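(* Let $\Omega\subset\mathbb{R}^3$ be a simply connected smooth bounded domain, let $\gamma>1$, $\mu>0$, $2\mu+3\lambda\ge 0$, and consider the initial-boundary value problem (MHD) for the compressible isentropic magnetohydrodynamic equations with slip boundary conditions described in the context. Assume that the initial data $(\rho_0,u_0,H_0)$, $\rho_0\ge 0$, satisfy $$\|\rho_0-\bar\rho_0\|_{L^2}+\|\sqrt{\rho_0}\,u_0\|_{L^2}+\|\nabla u_0\|_{H^1}+\|\nabla H_0\|_{H^1}<\infty ,$$ and let $(\rho,u,H)$ be a global strong solution of (MHD) such that $\sup_{t\ge 0}\|\rho(\cdot,t)\|_{L^\infty}\le\hat\rho$ for some positive constant $\hat\rho$. If additionally $\inf_{x\in\Omega}\rho_0(x)=0$, then for any $t\ge0$, $$\inf_{x\in\Omega}\rho(x,t)=0.$$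
   Context: Problem (MHD). The unknowns are the density $\rho\ge 0$, the velocity $u=(u^1,u^2,u^3)$ and the magnetic field $H=(H^1,H^2,H^3)$, functions of $(x,t)\in\Omega\times[0,\infty)$; the pressure is $P=\rho^\gamma$ (general pressure coefficient $a$ and resistivity $\nu$ are normalized to $a=\nu=1$ throughout). The equations are $$\rho_t+\operatorname{div}(\rho u)=0,$$ $$(\rho u)_t+\operatorname{div}(\rho u\otimes u)+\nabla P-\mu\Delta u-(\mu+\lambda)\nabla\operatorname{div}u=(\nabla\times H)\times H,$$ $$H_t-\nabla\times(u\times H)=-\nabla\times(\nabla\times H),\qquad \operatorname{div}H=0,$$ in $\Omega\times(0,\infty)$, with initial data $\rho(x,0)=\rho_0(x)$, $\rho u(x,0)=\rho_0u_0(x)$, $H(x,0)=H_0(x)$ for $x\in\Omega$, and boundary conditions $$u\cdot n=0,\quad \operatorname{curl}u\times n=0,\quad H\cdot n=0,\quad \operatorname{curl}H\times n=0\quad\text{on }\partial\Omega,\ t>0,$$ where $n$ is the unit outward normal to $\partial\Omega$. Notation: $\bar f=\frac1{|\Omega|}\int_\Omega f\,dx$; $L^p$, $W^{k,p}$, $H^k=W^{k,2}$ are the usual spaces on $\Omega$. Strong solution: for $T>0$, $(\rho,u,H)$ is a strong solution of (MHD) on $\Omega\times[0,T]$ if for some $q\in(3,6]$: $0\le\rho\in C([0,T];W^{1,q})$, $\rho_t\in C([0,T];L^q)$; $(u,H)\in C([0,T];H^2)\cap L^2(0,T;W^{2,q})$; $(\sqrt\rho\,u_t,H_t)\in L^\infty(0,T;L^2)$;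 $(u_t,H_t)\in L^2(0,T;H^1)$; and the equations hold a.e. in $\Omega\times[0,T]$ (together with the initial and boundary conditions). A global strong solution is one that is a strong solution on $\Omega\times[0,T]$ for every $T>0$. *)

theory Defs
  imports "HOL-Analysis.Analysis" "HOL-Probability.Essential_Supremum"
begin

section \<open>Smooth functions and weak derivatives\<close>

text \<open>
  A multi-index is written as a list of basis vectors, the directions of differentiation. For smooth
  functions, and hence for weak derivatives, the order of the list is immaterial.
\<close>

primrec iter_deriv ::
  "'a::euclidean_space list \<Rightarrow> ('a \<Rightarrow> real) \<Rightarrow> 'a \<Rightarrow> real" where
  "iter_deriv [] f = f"
| "iter_deriv (b # bs) f = (\<lambda>x. frechet_derivative (iter_deriv bs f) (at x) b)"

text \<open>To be used on open sets only.\<close>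

definition smooth_on :: "'a::euclidean_space set \<Rightarrow> ('a \<Rightarrow> real) \<Rightarrow> bool" where
  "smooth_on U f \<longleftrightarrow>
     (\<forall>bs. set bs \<subseteq> Basis \<longrightarrow> (\<forall>x\<in>U. iter_deriv bs f differentiable (at x)))"

definition test_function :: "'a::euclidean_space set \<Rightarrow> ('a \<Rightarrow> real) \<Rightarrow> bool" where
  "test_function U \<phi> \<longleftrightarrow>
     smooth_on UNIV \<phi> \<and> compact (closure {x. \<phi> x \<noteq> 0}) \<and> closure {x. \<phi> x \<noteq> 0} \<subseteq> U"

definition locally_integrable_on ::
  "'a::euclidean_space set \<Rightarrow> ('a \<Rightarrow> 'b::euclidean_space) \<Rightarrow> bool" where
  "locally_integrable_on U f \<longleftrightarrow>
     (\<forall>K. compact K \<and> K \<subseteq> U \<longrightarrow> set_integrable lebesgue K f)"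

definition has_weak_deriv ::
  "'a::euclidean_space set \<Rightarrow> 'a list \<Rightarrow> ('a \<Rightarrow> 'b::euclidean_space) \<Rightarrow> ('a \<Rightarrow> 'b) \<Rightarrow> bool" where
  "has_weak_deriv U bs f g \<longleftrightarrow>
     locally_integrable_on U f \<and> locally_integrable_on U g \<and>
     (\<forall>\<phi>. test_function U \<phi> \<longrightarrow>
        (LINT x:U|lebesgue. iter_deriv bs \<phi> x *\<^sub>R f x)
          = (- 1) ^ length bs *\<^sub>R (LINT x:U|lebesgue. \<phi> x *\<^sub>R g x))"

definition weakly_differentiable ::
  "'a::euclidean_space set \<Rightarrow> 'a list \<Rightarrow> ('a \<Rightarrow> 'b::euclidean_space) \<Rightarrow> bool" where
  "weakly_differentiable U bs f \<longleftrightarrow> (\<exists>g. has_weak_deriv U bs f g)"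

text \<open>
  A weak derivative is determined up to a null set of \<open>U\<close>; every use below is insensitive to the choice.
\<close>

definition wderiv ::
  "'a::euclidean_space set \<Rightarrow> 'a list \<Rightarrow> ('a \<Rightarrow> 'b::euclidean_space) \<Rightarrow> 'a \<Rightarrow> 'b" where
  "wderiv U bs f = (SOME g. has_weak_deriv U bs f g)"

text \<open>
  The differential operators in the three space variables. The argument \<open>e\<close> gives the three spatial
  directions, so that the same operators serve on \<open>\<Omega>\<close> (with \<open>e = spc\<close>) and on the space-time
  cylinder \<open>\<Omega> \<times> (0,T)\<close> (with \<open>e = spt\<close>).
\<close>

definition spc :: "3 \<Rightarrow> real^3" where
  "spc i = axis i 1"

definition spt :: "3 \<Rightarrow> (real^3) \<times> real" where
  "spt i = (axis i 1, 0)"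

definition wgrad ::
  "'a::euclidean_space set \<Rightarrow> (3 \<Rightarrow> 'a) \<Rightarrow> ('a \<Rightarrow> real) \<Rightarrow> 'a \<Rightarrow> real^3" where
  "wgrad U e f z = (\<chi> i. wderiv U [e i] f z)"

definition wdiv ::
  "'a::euclidean_space set \<Rightarrow> (3 \<Rightarrow> 'a) \<Rightarrow> ('a \<Rightarrow> real^3) \<Rightarrow> 'a \<Rightarrow> real" where
  "wdiv U e v z = (\<Sum>i\<in>UNIV. wderiv U [e i] v z $ i)"

definition wcurl ::
  "'a::euclidean_space set \<Rightarrow> (3 \<Rightarrow> 'a) \<Rightarrow> ('a \<Rightarrow> real^3) \<Rightarrow> 'a \<Rightarrow> real^3" where
  "wcurl U e v z = vector
     [wderiv U [e 2] v z $ 3 - wderiv U [e 3] v z $ 2,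
      wderiv U [e 3] v z $ 1 - wderiv U [e 1] v z $ 3,
      wderiv U [e 1] v z $ 2 - wderiv U [e 2] v z $ 1]"

definition wlaplace ::
  "'a::euclidean_space set \<Rightarrow> (3 \<Rightarrow> 'a) \<Rightarrow> ('a \<Rightarrow> real^3) \<Rightarrow> 'a \<Rightarrow> real^3" where
  "wlaplace U e v z = (\<Sum>i\<in>UNIV. wderiv U [e i, e i] v z)"

section \<open>Lebesgue and Sobolev spaces\<close>

definition Lp :: "'a::euclidean_space set \<Rightarrow> real \<Rightarrow> ('a \<Rightarrow> 'b::euclidean_space) set" where
  "Lp U p = {f. f \<in> borel_measurable (lebesgue_on U) \<and>
                integrable (lebesgue_on U) (\<lambda>x. norm (f x) powr p)}"

definition Lp_norm ::
  "'a::euclidean_space set \<Rightarrow> real \<Rightarrow> ('a \<Rightarrow> 'b::euclidean_space) \<Rightarrow> real" where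
  "Lp_norm U p f = (LINT x|lebesgue_on U. norm (f x) powr p) powr (1 / p)"

definition multi_indices :: "nat \<Rightarrow> 'a::euclidean_space list set" where
  "multi_indices k = {bs. set bs \<subseteq> Basis \<and> length bs \<le> k}"

definition Sobolev ::
  "'a::euclidean_space set \<Rightarrow> nat \<Rightarrow> real \<Rightarrow> ('a \<Rightarrow> 'b::euclidean_space) set" where
  "Sobolev U k p = {f. \<forall>bs \<in> multi_indices k. \<exists>g \<in> Lp U p. has_weak_deriv U bs f g}"

text \<open>
  Mixed derivatives are counted once for each order of differentiation, which gives a norm equivalent to
  the one summing over unordered multi-indices.
\<close>

definition Sobolev_norm ::
  "'a::euclidean_space set \<Rightarrow> nat \<Rightarrow> real \<Rightarrow> ('a \<Rightarrow> 'b::euclidean_space) \<Rightarrow> real" where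
  "Sobolev_norm U k p f =
     (\<Sum>bs \<in> multi_indices k. LINT x|lebesgue_on U. norm (wderiv U bs f x) powr p) powr (1 / p)"

definition mean :: "'a::euclidean_space set \<Rightarrow> ('a \<Rightarrow> real) \<Rightarrow> real" where
  "mean U f = (LINT x|lebesgue_on U. f x) / measure lebesgue U"

section \<open>Functions of time with values in a function space\<close>

text \<open>
  A function space is given by its carrier \<open>X\<close> and norm \<open>N\<close>. A function \<open>f\<close> of \<open>(x,t)\<close> is
  identified with the map sending \<open>t\<close> to \<open>at_time f t\<close>.
\<close>

definition at_time :: "('a \<times> real \<Rightarrow> 'b) \<Rightarrow> real \<Rightarrow> 'a \<Rightarrow> 'b" where
  "at_time f t = (\<lambda>x. f (x, t))"

definition C_time ::
  "real \<Rightarrow> ('a \<Rightarrow> 'b::euclidean_space) set \<Rightarrow> (('a \<Rightarrow> 'b) \<Rightarrow> real) \<Rightarrow> ('a \<times> real \<Rightarrow> 'b) set" where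
  "C_time T X N = {f. \<forall>t\<in>{0..T}. at_time f t \<in> X \<and>
     ((\<lambda>s. N (\<lambda>x. f (x, s) - f (x, t))) \<longlongrightarrow> 0) (at t within {0..T})}"

text \<open>Bochner measurability: a.e. limit of a sequence of measurable functions of finite range.\<close>

definition strongly_measurable ::
  "real \<Rightarrow> ('a \<Rightarrow> 'b::euclidean_space) set \<Rightarrow> (('a \<Rightarrow> 'b) \<Rightarrow> real) \<Rightarrow> ('a \<times> real \<Rightarrow> 'b) \<Rightarrow> bool" where
  "strongly_measurable T X N f \<longleftrightarrow>
     (\<exists>s :: nat \<Rightarrow> real \<Rightarrow> 'a \<Rightarrow> 'b.
        (\<forall>k. finite (range (s k)) \<and> range (s k) \<subseteq> X \<and> (\<forall>g. s k -` {g} \<in> sets lebesgue)) \<and>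
        (AE t in lebesgue_on {0<..<T}. at_time f t \<in> X \<and>
           (\<lambda>k. N (\<lambda>x. s k t x - f (x, t))) \<longlonglongrightarrow> 0))"

definition L2_time ::
  "real \<Rightarrow> ('a \<Rightarrow> 'b::euclidean_space) set \<Rightarrow> (('a \<Rightarrow> 'b) \<Rightarrow> real) \<Rightarrow> ('a \<times> real \<Rightarrow> 'b) set" where
  "L2_time T X N = {f. strongly_measurable T X N f \<and>
     integrable (lebesgue_on {0<..<T}) (\<lambda>t. (N (at_time f t))\<^sup>2)}"

definition Linf_time ::
  "real \<Rightarrow> ('a \<Rightarrow> 'b::euclidean_space) set \<Rightarrow> (('a \<Rightarrow> 'b) \<Rightarrow> real) \<Rightarrow> ('a \<times> real \<Rightarrow> 'b) set" where
  "Linf_time T X N = {f. strongly_measurable T X N f \<and>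
     (\<exists>C. AE t in lebesgue_on {0<..<T}. N (at_time f t) \<le> C)}"

section \<open>Smooth bounded domains\<close>

definition gradient :: "(real^3 \<Rightarrow> real) \<Rightarrow> real^3 \<Rightarrow> real^3" where
  "gradient h x = (\<chi> i. frechet_derivative h (at x) (axis i 1))"

definition local_defining_function ::
  "(real^3) set \<Rightarrow> real^3 \<Rightarrow> (real^3) set \<Rightarrow> (real^3 \<Rightarrow> real) \<Rightarrow> bool" where
  "local_defining_function \<Omega> p V h \<longleftrightarrow>
     open V \<and> p \<in> V \<and> smooth_on V h \<and> (\<forall>x\<in>V. gradient h x \<noteq> 0) \<and>
     \<Omega> \<inter> V = {x\<in>V. h x < 0}"

definition smooth_bounded_domain :: "(real^3) set \<Rightarrow> bool" where
  "smooth_bounded_domain \<Omega> \<longleftrightarrow>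
     open \<Omega> \<and> connected \<Omega> \<and> \<Omega> \<noteq> {} \<and> bounded \<Omega> \<and>
     (\<forall>p \<in> frontier \<Omega>. \<exists>V h. local_defining_function \<Omega> p V h)"

text \<open>Independent of the choice of the defining function.\<close>

definition outward_normal :: "(real^3) set \<Rightarrow> real^3 \<Rightarrow> real^3" where
  "outward_normal \<Omega> p =
     (SOME n. \<exists>V h. local_defining_function \<Omega> p V h \<and>
                    n = gradient h p /\<^sub>R norm (gradient h p))"

text \<open>
  Boundary values of a function of \<open>W\<^bsup>1,q\<^esup>\<close> with \<open>q > 3\<close>, or of \<open>H\<^sup>2\<close>: the restriction to the
  boundary of its representative that is continuous on the closure (Sobolev embedding). This is the
  trace of the function.
\<close>

definition continuous_up_to_boundary ::
  "(real^3) set \<Rightarrow> (real^3 \<Rightarrow> real^3) \<Rightarrow> (real^3 \<Rightarrow> real^3) \<Rightarrow> bool" where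
  "continuous_up_to_boundary \<Omega> f g \<longleftrightarrow>
     continuous_on (closure \<Omega>) g \<and> (AE x in lebesgue_on \<Omega>. g x = f x)"

definition normal_part_vanishes :: "(real^3) set \<Rightarrow> (real^3 \<Rightarrow> real^3) \<Rightarrow> bool" where
  "normal_part_vanishes \<Omega> f \<longleftrightarrow>
     (\<exists>g. continuous_up_to_boundary \<Omega> f g \<and> (\<forall>x\<in>frontier \<Omega>. g x \<bullet> outward_normal \<Omega> x = 0))"

definition tangential_part_vanishes :: "(real^3) set \<Rightarrow> (real^3 \<Rightarrow> real^3) \<Rightarrow> bool" where
  "tangential_part_vanishes \<Omega> f \<longleftrightarrow>
     (\<exists>g. continuous_up_to_boundary \<Omega> f g \<and> (\<forall>x\<in>frontier \<Omega>. cross3 (g x) (outward_normal \<Omega> x) = 0))"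

section \<open>The compressible isentropic MHD system\<close>

definition cylinder :: "(real^3) set \<Rightarrow> real \<Rightarrow> ((real^3) \<times> real) set" where
  "cylinder \<Omega> T = \<Omega> \<times> {0<..<T}"

definition wdt ::
  "((real^3) \<times> real) set \<Rightarrow> ((real^3) \<times> real \<Rightarrow> 'b::euclidean_space) \<Rightarrow> (real^3) \<times> real \<Rightarrow> 'b" where
  "wdt Q f = wderiv Q [(0, 1)] f"

text \<open>
  All derivatives are weak derivatives on the cylinder. That the equations hold almost everywhere
  includes that the derivatives occurring in them are locally integrable functions; for a strong
  solution this is also a consequence of its regularity.
\<close>

definition derivatives_exist ::
  "((real^3) \<times> real) set \<Rightarrow> real \<Rightarrow> ((real^3) \<times> real \<Rightarrow> real) \<Rightarrow> ((real^3) \<times> real \<Rightarrow> real^3) \<Rightarrow>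
   ((real^3) \<times> real \<Rightarrow> real^3) \<Rightarrow> bool" where
  "derivatives_exist Q \<gamma> \<rho> u H \<longleftrightarrow>
     weakly_differentiable Q [(0, 1)] \<rho> \<and>
     weakly_differentiable Q [(0, 1)] (\<lambda>z. \<rho> z *\<^sub>R u z) \<and>
     weakly_differentiable Q [(0, 1)] H \<and>
     (\<forall>i. weakly_differentiable Q [spt i] (\<lambda>z. \<rho> z *\<^sub>R u z) \<and>
          weakly_differentiable Q [spt i] (\<lambda>z. (\<rho> z * u z $ i) *\<^sub>R u z) \<and>
          weakly_differentiable Q [spt i] (\<lambda>z. \<rho> z powr \<gamma>) \<and>
          weakly_differentiable Q [spt i] (\<lambda>z. cross3 (u z) (H z)) \<and>
          weakly_differentiable Q [spt i] u \<and>
          weakly_differentiable Q [spt i] H \<and>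
          (\<forall>j. weakly_differentiable Q [spt i, spt j] u \<and>
               weakly_differentiable Q [spt i, spt j] H))"

definition MHD_equations ::
  "((real^3) \<times> real) set \<Rightarrow> real \<Rightarrow> real \<Rightarrow> real \<Rightarrow> ((real^3) \<times> real \<Rightarrow> real) \<Rightarrow>
   ((real^3) \<times> real \<Rightarrow> real^3) \<Rightarrow> ((real^3) \<times> real \<Rightarrow> real^3) \<Rightarrow> bool" where
  "MHD_equations Q \<gamma> \<mu> lam \<rho> u H \<longleftrightarrow>
     derivatives_exist Q \<gamma> \<rho> u H \<and>
     (AE z in lebesgue_on Q.
        wdt Q \<rho> z + wdiv Q spt (\<lambda>z. \<rho> z *\<^sub>R u z) z = 0 \<and>
        wdt Q (\<lambda>z. \<rho> z *\<^sub>R u z) z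
          + (\<Sum>j\<in>UNIV. wderiv Q [spt j] (\<lambda>z. (\<rho> z * u z $ j) *\<^sub>R u z) z)
          + wgrad Q spt (\<lambda>z. \<rho> z powr \<gamma>) z
          - \<mu> *\<^sub>R wlaplace Q spt u z
          - (\<mu> + lam) *\<^sub>R wgrad Q spt (wdiv Q spt u) z
          = cross3 (wcurl Q spt H z) (H z) \<and>
        wdt Q H z - wcurl Q spt (\<lambda>z. cross3 (u z) (H z)) z = - wcurl Q spt (wcurl Q spt H) z \<and>
        wdiv Q spt H z = 0)"

text \<open>
  Since the density belongs to \<open>C([0,T];W\<^bsup>1,q\<^esup>)\<close> with \<open>q > 3\<close>, at each time it has exactly
  one representative that is continuous on \<open>\<Omega>\<close>. Requiring \<open>\<rho>\<close> to be that representative gives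
  pointwise meaning to its values, in particular to the initial value and to infima over \<open>\<Omega>\<close>.
\<close>

definition strong_regularity ::
  "(real^3) set \<Rightarrow> real \<Rightarrow> real \<Rightarrow> ((real^3) \<times> real \<Rightarrow> real) \<Rightarrow>
   ((real^3) \<times> real \<Rightarrow> real^3) \<Rightarrow> ((real^3) \<times> real \<Rightarrow> real^3) \<Rightarrow> bool" where
  "strong_regularity \<Omega> T q \<rho> u H \<longleftrightarrow>
     (\<forall>t\<in>{0..T}. continuous_on \<Omega> (at_time \<rho> t) \<and> (\<forall>x\<in>\<Omega>. 0 \<le> \<rho> (x, t))) \<and>
     \<rho> \<in> C_time T (Sobolev \<Omega> 1 q) (Sobolev_norm \<Omega> 1 q) \<and>
     u \<in> C_time T (Sobolev \<Omega> 2 2) (Sobolev_norm \<Omega> 2 2) \<and>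
     H \<in> C_time T (Sobolev \<Omega> 2 2) (Sobolev_norm \<Omega> 2 2) \<and>
     u \<in> L2_time T (Sobolev \<Omega> 2 q) (Sobolev_norm \<Omega> 2 q) \<and>
     H \<in> L2_time T (Sobolev \<Omega> 2 q) (Sobolev_norm \<Omega> 2 q) \<and>
     (\<exists>\<rho>\<^sub>t u\<^sub>t H\<^sub>t.
        has_weak_deriv (cylinder \<Omega> T) [(0, 1)] \<rho> \<rho>\<^sub>t \<and>
        has_weak_deriv (cylinder \<Omega> T) [(0, 1)] u u\<^sub>t \<and>
        has_weak_deriv (cylinder \<Omega> T) [(0, 1)] H H\<^sub>t \<and>
        \<rho>\<^sub>t \<in> C_time T (Lp \<Omega> q) (Lp_norm \<Omega> q) \<and>
        (\<lambda>z. sqrt (\<rho> z) *\<^sub>R u\<^sub>t z) \<in> Linf_time T (Lp \<Omega> 2) (Lp_norm \<Omega> 2) \<and>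
        H\<^sub>t \<in> Linf_time T (Lp \<Omega> 2) (Lp_norm \<Omega> 2) \<and>
        u\<^sub>t \<in> L2_time T (Sobolev \<Omega> 1 2) (Sobolev_norm \<Omega> 1 2) \<and>
        H\<^sub>t \<in> L2_time T (Sobolev \<Omega> 1 2) (Sobolev_norm \<Omega> 1 2))"

definition initial_conditions ::
  "(real^3) set \<Rightarrow> (real^3 \<Rightarrow> real) \<Rightarrow> (real^3 \<Rightarrow> real^3) \<Rightarrow> (real^3 \<Rightarrow> real^3) \<Rightarrow>
   ((real^3) \<times> real \<Rightarrow> real) \<Rightarrow> ((real^3) \<times> real \<Rightarrow> real^3) \<Rightarrow> ((real^3) \<times> real \<Rightarrow> real^3) \<Rightarrow> bool" where
  "initial_conditions \<Omega> \<rho>\<^sub>0 u\<^sub>0 H\<^sub>0 \<rho> u H \<longleftrightarrow>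
     (\<forall>x\<in>\<Omega>. \<rho> (x, 0) = \<rho>\<^sub>0 x) \<and>
     (AE x in lebesgue_on \<Omega>. \<rho> (x, 0) *\<^sub>R u (x, 0) = \<rho>\<^sub>0 x *\<^sub>R u\<^sub>0 x) \<and>
     (AE x in lebesgue_on \<Omega>. H (x, 0) = H\<^sub>0 x)"

text \<open>
  At a general time the curls are only in \<open>H\<^sup>1\<close>; they are in \<open>W\<^bsup>1,q\<^esup>\<close> for almost every time, and
  the boundary conditions on them are imposed at those times. By continuity in time of the traces this
  amounts to imposing them at every time.
\<close>

definition boundary_conditions ::
  "(real^3) set \<Rightarrow> real \<Rightarrow> ((real^3) \<times> real \<Rightarrow> real^3) \<Rightarrow> ((real^3) \<times> real \<Rightarrow> real^3) \<Rightarrow> bool" where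
  "boundary_conditions \<Omega> T u H \<longleftrightarrow>
     (\<forall>t\<in>{0<..T}. normal_part_vanishes \<Omega> (at_time u t) \<and>
                    normal_part_vanishes \<Omega> (at_time H t)) \<and>
     (AE t in lebesgue_on {0<..<T}.
        tangential_part_vanishes \<Omega> (wcurl \<Omega> spc (at_time u t)) \<and>
        tangential_part_vanishes \<Omega> (wcurl \<Omega> spc (at_time H t)))"

definition strong_solution ::
  "(real^3) set \<Rightarrow> real \<Rightarrow> real \<Rightarrow> real \<Rightarrow>
   (real^3 \<Rightarrow> real) \<Rightarrow> (real^3 \<Rightarrow> real^3) \<Rightarrow> (real^3 \<Rightarrow> real^3) \<Rightarrow> real \<Rightarrow>
   ((real^3) \<times> real \<Rightarrow> real) \<Rightarrow> ((real^3) \<times> real \<Rightarrow> real^3) \<Rightarrow> ((real^3) \<times> real \<Rightarrow> real^3) \<Rightarrow> bool" where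
  "strong_solution \<Omega> \<gamma> \<mu> lam \<rho>\<^sub>0 u\<^sub>0 H\<^sub>0 T \<rho> u H \<longleftrightarrow>
     (\<exists>q. 3 < q \<and> q \<le> 6 \<and> strong_regularity \<Omega> T q \<rho> u H) \<and>
     MHD_equations (cylinder \<Omega> T) \<gamma> \<mu> lam \<rho> u H \<and>
     initial_conditions \<Omega> \<rho>\<^sub>0 u\<^sub>0 H\<^sub>0 \<rho> u H \<and>
     boundary_conditions \<Omega> T u H"

definition global_strong_solution ::
  "(real^3) set \<Rightarrow> real \<Rightarrow> real \<Rightarrow> real \<Rightarrow>
   (real^3 \<Rightarrow> real) \<Rightarrow> (real^3 \<Rightarrow> real^3) \<Rightarrow> (real^3 \<Rightarrow> real^3) \<Rightarrow>
   ((real^3) \<times> real \<Rightarrow> real) \<Rightarrow> ((real^3) \<times> real \<Rightarrow> real^3) \<Rightarrow> ((real^3) \<times> real \<Rightarrow> real^3) \<Rightarrow> bool" where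
  "global_strong_solution \<Omega> \<gamma> \<mu> lam \<rho>\<^sub>0 u\<^sub>0 H\<^sub>0 \<rho> u H \<longleftrightarrow>
     (\<forall>T>0. strong_solution \<Omega> \<gamma> \<mu> lam \<rho>\<^sub>0 u\<^sub>0 H\<^sub>0 T \<rho> u H)"

text \<open>Finiteness of the norms of the initial data; the gradients are taken direction by direction.\<close>

definition admissible_data ::
  "(real^3) set \<Rightarrow> (real^3 \<Rightarrow> real) \<Rightarrow> (real^3 \<Rightarrow> real^3) \<Rightarrow> (real^3 \<Rightarrow> real^3) \<Rightarrow> bool" where
  "admissible_data \<Omega> \<rho>\<^sub>0 u\<^sub>0 H\<^sub>0 \<longleftrightarrow>
     (\<lambda>x. \<rho>\<^sub>0 x - mean \<Omega> \<rho>\<^sub>0) \<in> Lp \<Omega> 2 \<and>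
     (\<lambda>x. sqrt (\<rho>\<^sub>0 x) *\<^sub>R u\<^sub>0 x) \<in> Lp \<Omega> 2 \<and>
     (\<forall>i. \<exists>g \<in> Sobolev \<Omega> 1 2. has_weak_deriv \<Omega> [spc i] u\<^sub>0 g) \<and>
     (\<forall>i. \<exists>g \<in> Sobolev \<Omega> 1 2. has_weak_deriv \<Omega> [spc i] H\<^sub>0 g)"

end

theory Submission
  imports Defs "HOL-Computational_Algebra.Polynomial" "HOL-Probability.Essential_Supremum"
begin

text \<open>If \<open>\<rho> \<ge> c > 0\<close> at time \<open>T\<close>, then \<open>\<rho>\<^sub>0\<close> is bounded below by a positive constant, so a density that
  vanishes somewhere initially keeps infimum zero. By Morrey's inequality \<open>u(t)\<close> is bounded and
  Lipschitz along segments with a constant \<open>L(t)\<close> that is integrable in time. Hence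
  \<open>m(t) = c exp (- \<integral>\<^sub>t\<^sup>T \<Lambda>)\<close> with \<open>\<Lambda>\<close> a multiple of \<open>L\<close> is a subsolution of the continuity equation
  with \<open>m(T) \<le> \<rho>(T)\<close>, and it is compared with \<open>\<rho>\<close> backwards in time: the integral of
  \<open>(m - \<rho>)\<^sub>+\<^sup>2\<close> is controlled after mollifying \<open>\<rho>\<close> in space, with a commutator that vanishes in the
  limit, and after cutting off near the boundary, where \<open>u \<bullet> n = 0\<close> makes the flux through the
  cutoff layer bounded by \<open>L\<close> and hence negligible by dominated convergence.\<close>

section \<open>Elementary smooth functions\<close>

text \<open>The velocity is Lipschitz in space only with a constant integrable in time, and the
  continuity equation is stated with weak derivatives on the cylinder. So no characteristics are
  followed and nothing is differentiated pointwise in time: increments of the mollified density are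
  integrals of a flux, and convexity turns them into increments of the squared positive part. The
  square makes that function differentiable with a continuous, nonnegative derivative. The rate is
  \<open>(C1 + 3) L\<close>: \<open>C1\<close> bounds the first moment of the gradient of the
  mollifier uniformly in its radius and pays for the commutator; 3 is the dimension and pays for the
  divergence of a field with Lipschitz constant \<open>L\<close>. The order of the limits matters.
  Mollification needs balls inside \<Omega>, so the radius tends to zero for a fixed cutoff, and the
  cutoff is removed afterwards. A cutoff with a layer of width \<epsilon> has a gradient of order
  1/\<epsilon>; its product with u stays bounded because |u . grad h| is at most of order |h| for a
  defining function h of the boundary, and |h| is of order \<epsilon> in the layer.\<close>

definition smooth_real :: "(real \<Rightarrow> real) \<Rightarrow> bool" where
  "smooth_real k \<longleftrightarrow> (\<forall>n x. ((deriv ^^ n) k) differentiable (at x))"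

text \<open>Smoothness is a greatest fixed point: a property that implies differentiability and
  survives \<open>deriv\<close> holds along all iterated derivatives. This suits families such as
  \<open>flat p\<close>, whose derivatives stay in the family without a closed form for the n-th
  one.\<close>

lemma smooth_real_coinduct:
  assumes "P k" and step: "\<And>k x. P k \<Longrightarrow> k differentiable (at x)" "\<And>k. P k \<Longrightarrow> P (deriv k)"
  shows "smooth_real k"
proof -
  have "P ((deriv ^^ n) k)" for n
    by (induction n) (use assms in auto)
  then show ?thesis
    using step(1) by (auto simp: smooth_real_def)
qed

lemma smooth_real_deriv: "smooth_real k \<Longrightarrow> smooth_real (deriv k)"
  unfolding smooth_real_def by (metis comp_apply funpow_Suc_right)

lemma smooth_real_DERIV: "smooth_real k \<Longrightarrow> (k has_real_derivative deriv k x) (at x)"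
  unfolding smooth_real_def
  by (metis DERIV_deriv_iff_real_differentiable funpow_0)

text \<open>Test functions must have all iterated Frechet derivatives. Instead of computing them,
  the functions in use are generated by rules under which directional derivatives stay in the class,
  so \<open>smooth_on\<close> follows by induction on the list of directions. The rule
  \<open>comp\<close> admits any smooth outer function of one variable, which is how cutoffs
  enter.\<close>

inductive_set elementary :: "('a::euclidean_space \<Rightarrow> real) set" where
  const: "(\<lambda>_. c) \<in> elementary"
| inner: "(\<lambda>x. x \<bullet> b) \<in> elementary"
| add: "f \<in> elementary \<Longrightarrow> g \<in> elementary \<Longrightarrow> (\<lambda>x. f x + g x) \<in> elementary"
| mult: "f \<in> elementary \<Longrightarrow> g \<in> elementary \<Longrightarrow> (\<lambda>x. f x * g x) \<in> elementary"
| comp: "smooth_real k \<Longrightarrow> f \<in> elementary \<Longrightarrow> (\<lambda>x. k (f x)) \<in> elementary"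

text \<open>Existence of the derivative and closure of the class are proved together: for products
  and compositions the new derivative mixes the old functions with their derivatives, and both must
  belong to the class.\<close>

lemma elementary_derivative:
  "f \<in> elementary \<Longrightarrow> \<exists>D. (\<forall>x. (f has_derivative D x) (at x)) \<and> (\<forall>b. (\<lambda>x. D x b) \<in> elementary)"
proof (induction rule: elementary.induct)
  case (const c)
  show ?case
    by (rule exI[of _ "\<lambda>_ _. 0"], intro conjI allI has_derivative_const elementary.const)
next
  case (inner b)
  show ?case
    by (rule exI[of _ "\<lambda>_ h. h \<bullet> b"], intro conjI allI elementary.const
      bounded_linear_imp_has_derivative bounded_linear_inner_left)
next
  case (add f g)
  then obtain D E where "\<forall>x. (f has_derivative D x) (at x)" "\<forall>b. (\<lambda>x. D x b) \<in> elementary"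
      "\<forall>x. (g has_derivative E x) (at x)" "\<forall>b. (\<lambda>x. E x b) \<in> elementary"
    by blast
  then show ?case
    by (intro exI[of _ "\<lambda>x h. D x h + E x h"] conjI allI has_derivative_add elementary.add) simp_all
next
  case (mult f g)
  then obtain D E where "\<forall>x. (f has_derivative D x) (at x)" "\<forall>b. (\<lambda>x. D x b) \<in> elementary"
      "\<forall>x. (g has_derivative E x) (at x)" "\<forall>b. (\<lambda>x. E x b) \<in> elementary"
    by blast
  with mult.hyps show ?case
    by (intro exI[of _ "\<lambda>x h. f x * E x h + D x h * g x"] conjI allI has_derivative_mult
        elementary.add elementary.mult) simp_all
next
  case (comp k f)
  then obtain D where D: "\<forall>x. (f has_derivative D x) (at x)" "\<forall>b. (\<lambda>x. D x b) \<in> elementary"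
    by blast
  have "((\<lambda>x. k (f x)) has_derivative (\<lambda>h. deriv k (f x) * D x h)) (at x)" for x
    by (rule has_derivative_compose[OF D(1)[rule_format]
          smooth_real_DERIV[OF comp.hyps(1), unfolded has_field_derivative_def]])
  then show ?case
    by (intro exI[of _ "\<lambda>x h. deriv k (f x) * D x h"] conjI allI elementary.mult
      elementary.comp[OF smooth_real_deriv[OF comp.hyps(1)] comp.hyps(2)] D(2)[rule_format])
qed

lemma elementary_differentiable:
  assumes "f \<in> elementary" shows "f differentiable (at x)"
proof -
  obtain D where "\<forall>x. (f has_derivative D x) (at x)"
    using elementary_derivative[OF assms] by blast
  then have "(f has_derivative D x) (at x)" ..
  then show ?thesis by (rule differentiableI)
qed

lemma elementary_has_derivative:
  "f \<in> elementary \<Longrightarrow> (f has_derivative frechet_derivative f (at x)) (at x)"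
  using elementary_differentiable by (simp add: frechet_derivative_works)

lemma elementary_frechet_derivative:
  assumes "f \<in> elementary"
  shows "(\<lambda>x. frechet_derivative f (at x) b) \<in> elementary"
proof -
  obtain D where D: "\<forall>x. (f has_derivative D x) (at x)" "\<forall>b. (\<lambda>x. D x b) \<in> elementary"
    using elementary_derivative[OF assms] by blast
  have "frechet_derivative f (at x) = D x" for x
    by (rule frechet_derivative_at[symmetric]) (simp add: D(1))
  then have *: "(\<lambda>x. frechet_derivative f (at x) b) = (\<lambda>x. D x b)" by simp
  show ?thesis unfolding * using D(2) by blast
qed

lemma iter_deriv_elementary: "f \<in> elementary \<Longrightarrow> iter_deriv bs f \<in> elementary"
  by (induction bs) (simp_all add: elementary_frechet_derivative)

lemma elementary_smooth_on: "f \<in> elementary \<Longrightarrow> smooth_on UNIV f"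
  unfolding smooth_on_def by (simp add: elementary_differentiable iter_deriv_elementary)

lemma elementary_continuous: "f \<in> elementary \<Longrightarrow> continuous_on S f"
  by (intro continuous_at_imp_continuous_on ballI differentiable_imp_continuous_within elementary_differentiable)

text \<open>In one variable the Frechet derivative applied to 1 is \<open>deriv\<close>, so the
  class is invariant under \<open>deriv\<close> and the coinduction applies. Functions assembled by
  the rules thereby become outer functions for \<open>comp\<close>, and cutoffs can be built in
  stages.\<close>

lemma elementary_smooth_real:
  assumes "f \<in> elementary" shows "smooth_real f"
proof (rule smooth_real_coinduct[where P="\<lambda>f. f \<in> elementary"])
  fix k :: "real \<Rightarrow> real" and x assume "k \<in> elementary"
  then show "k differentiable (at x)"
    by (rule elementary_differentiable)
next
  fix k :: "real \<Rightarrow> real" assume k: "k \<in> elementary"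
  have "(k has_real_derivative frechet_derivative k (at x) 1) (at x)" for x
  proof -
    have "linear (frechet_derivative k (at x))"
      using elementary_has_derivative[OF k] has_derivative_linear by blast
    then have *: "frechet_derivative k (at x) (h *\<^sub>R 1) = h *\<^sub>R frechet_derivative k (at x) 1" for h
      by (rule linear_scale)
    have "frechet_derivative k (at x) h = frechet_derivative k (at x) 1 * h" for h
      using *[of h] by (simp add: mult.commute)
    then have eq: "frechet_derivative k (at x) = (*) (frechet_derivative k (at x) 1)"
      by (rule ext)
    show ?thesis
      unfolding has_field_derivative_def
      by (rule subst[OF eq, where P="\<lambda>D. (k has_derivative D) (at x)"])
        (rule elementary_has_derivative[OF k])
  qed
  then have *: "deriv k = (\<lambda>x. frechet_derivative k (at x) 1)"
    by (intro ext DERIV_imp_deriv)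
  show "deriv k \<in> elementary"
    unfolding * by (rule elementary_frechet_derivative[OF k])
qed (fact assms)

section \<open>The flat function exp(-1/s) and its derivatives\<close>

definition flat :: "real poly \<Rightarrow> real \<Rightarrow> real" where
  "flat p s = (if s \<le> 0 then 0 else poly p (1 / s) * exp (- (1 / s)))"

lemma poly_times_exp_tendsto_0:
  "((\<lambda>x::real. x ^ k * poly p x * exp (- x)) \<longlongrightarrow> 0) at_top"
proof (induction p arbitrary: k)
  case (pCons a p)
  have "((\<lambda>x::real. a * (x ^ k / exp x)) \<longlongrightarrow> a * 0) at_top"
    by (intro tendsto_intros tendsto_power_div_exp_0)
  then have "((\<lambda>x::real. a * (x ^ k / exp x) + x ^ Suc k * poly p x * exp (- x)) \<longlongrightarrow> a * 0 + 0) at_top"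
    by (intro tendsto_add pCons)
  then show ?case
    by (simp add: algebra_simps exp_minus divide_inverse)
qed auto

text \<open>With x = 1/s, the chain rule turns p(x) exp(-x) into x^2 (p(x) - p'(x)) exp(-x), and
  \<open>[:0, 0, 1:]\<close> is the polynomial x^2. The polynomial parameter of \<open>flat\<close>
  is there to make the family closed under differentiation.\<close>

lemma flat_DERIV: "(flat p has_real_derivative flat ([:0, 0, 1:] * (p - pderiv p)) s) (at s)"
proof -
  consider "s < 0" | "s = 0" | "s > 0" by linarith
  then show ?thesis
  proof cases
    case 1
    have "((\<lambda>_. 0) has_real_derivative 0) (at s)" by simp
    then have "(flat p has_real_derivative 0) (at s)"
      by (rule has_field_derivative_transform_within_open[where S="{..<0}"]) (use 1 in \<open>auto simp: flat_def\<close>)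
    with 1 show ?thesis by (simp add: flat_def)
  next
    case 2
    have "((\<lambda>y. flat p y / y) \<longlongrightarrow> 0) (at_left 0)"
      by (rule tendsto_eventually) (auto simp: flat_def eventually_at_left_field intro: exI[of _ "-1"])
    moreover have "((\<lambda>y. flat p y / y) \<longlongrightarrow> 0) (at_right 0)"
    proof -
      \<comment> \<open>From the right, the difference quotient at 0 is x p(x) exp(-x) with x = 1/y,
        so exponential decay at infinity gives slope 0.\<close>
      have "((\<lambda>y::real. (inverse y) ^ 1 * poly p (inverse y) * exp (- inverse y)) \<longlongrightarrow> 0) (at_right 0)"
        by (rule filterlim_compose[OF poly_times_exp_tendsto_0 filterlim_inverse_at_top_right])
      then show ?thesis
        by (rule tendsto_cong[THEN iffD1, rotated])
          (auto simp: flat_def eventually_at_right_field divide_simps intro!: exI[of _ 1])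
    qed
    ultimately have "((\<lambda>y. flat p y / y) \<longlongrightarrow> 0) (at 0)"
      by (simp add: filterlim_split_at)
    with 2 show ?thesis
      by (simp add: has_field_derivative_iff flat_def)
  next
    case 3
    have i: "((\<lambda>s. 1 / s) has_real_derivative - 1 / s\<^sup>2) (at s)"
      using 3 by (auto intro!: derivative_eq_intros simp: power2_eq_square)
    have "((\<lambda>s. poly p (1 / s)) has_real_derivative poly (pderiv p) (1 / s) * (- 1 / s\<^sup>2)) (at s)"
      by (rule DERIV_chain2[OF poly_DERIV i])
    moreover have "((\<lambda>s. exp (- (1 / s))) has_real_derivative exp (- (1 / s)) * (1 / s\<^sup>2)) (at s)"
      using DERIV_chain2[OF DERIV_exp DERIV_minus[OF i]] by simp
    ultimately have "((\<lambda>s. poly p (1 / s) * exp (- (1 / s))) has_real_derivative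
       (poly (pderiv p) (1 / s) * (- 1 / s\<^sup>2)) * exp (- (1 / s)) + exp (- (1 / s)) * (1 / s\<^sup>2) * poly p (1 / s)) (at s)"
      by (rule DERIV_mult)
    then have "(flat p has_real_derivative
       (poly (pderiv p) (1 / s) * (- 1 / s\<^sup>2)) * exp (- (1 / s)) + exp (- (1 / s)) * (1 / s\<^sup>2) * poly p (1 / s)) (at s)"
      by (rule has_field_derivative_transform_within_open[where S="{0<..}"]) (use 3 in \<open>auto simp: flat_def\<close>)
    moreover have "(poly (pderiv p) (1 / s) * (- 1 / s\<^sup>2)) * exp (- (1 / s)) + exp (- (1 / s)) * (1 / s\<^sup>2) * poly p (1 / s)
       = flat ([:0, 0, 1:] * (p - pderiv p)) s"
      using 3 by (simp add: flat_def field_simps power2_eq_square)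
    ultimately show ?thesis by metis
  qed
qed

lemma smooth_real_flat: "smooth_real (flat p)"
proof (rule smooth_real_coinduct[where P="\<lambda>k. \<exists>p. k = flat p"])
  fix k assume "\<exists>p. k = flat p"
  then obtain p where p: "k = flat p" by blast
  then show "k differentiable (at x)" for x
    using flat_DERIV real_differentiable_def by blast
  show "\<exists>p. deriv k = flat p"
    using p flat_DERIV DERIV_imp_deriv by blast
qed auto

lemma continuous_on_flat: "continuous_on S (flat p)"
  using DERIV_continuous[OF flat_DERIV] continuous_at_imp_continuous_on by blast

lemma flat_1_pos [simp]: "0 < flat 1 s \<longleftrightarrow> 0 < s"
  and flat_1_nonneg [simp]: "0 \<le> flat 1 s"
  and flat_nonpos [simp]: "s \<le> 0 \<Longrightarrow> flat p s = 0"
  by (auto simp: flat_def)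

section \<open>A normalized bump on the unit interval and its primitive\<close>

definition pulse :: "real \<Rightarrow> real" where
  "pulse s = flat 1 s * flat 1 (1 - s) / integral {0..1} (\<lambda>s. flat 1 s * flat 1 (1 - s))"

text \<open>The primitive of \<open>pulse\<close> that is 0 left of 0 and 1 right of 1. Starting at
  -1 instead of 0 changes no value and makes every s \<ge> 0 interior to an interval of integration,
  so the fundamental theorem yields a two-sided derivative at 0 as well.\<close>

definition smooth_step :: "real \<Rightarrow> real" where
  "smooth_step s = integral {-1..s} pulse"

lemma continuous_on_pulse: "continuous_on S pulse"
  unfolding pulse_def divide_inverse
  by (intro continuous_intros continuous_on_flat continuous_on_compose2[OF continuous_on_flat[of UNIV]]) auto

lemma pulse_normalization: "integral {0..1} (\<lambda>s. flat 1 s * flat 1 (1 - s)) > 0"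
proof -
  let ?f = "\<lambda>s. flat 1 s * flat 1 (1 - s)"
  have c: "continuous_on {0..1} ?f"
    by (intro continuous_intros continuous_on_flat continuous_on_compose2[OF continuous_on_flat[of UNIV]]) auto
  have "integral {0..1} ?f \<ge> 0"
    by (intro integral_nonneg integrable_continuous_interval c) auto
  moreover have "integral {0..1} ?f \<noteq> 0"
  proof
    assume z: "integral {0..1} ?f = 0"
    have "0 \<le> ?f x" for x by (intro mult_nonneg_nonneg) simp_all
    then have "\<forall>x\<in>{0..1}. ?f x = 0"
      using integral_eq_0_iff[OF c] z by simp
    then have "?f (1/2) = 0" by (rule bspec) simp
    moreover have "?f (1/2) > 0" by (intro mult_pos_pos) simp_all
    ultimately show False by simp
  qed
  ultimately show ?thesis by simp
qed

lemma pulse_nonneg: "pulse s \<ge> 0"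
  using pulse_normalization by (auto simp: pulse_def intro!: divide_nonneg_pos)

lemma pulse_eq_0: "s \<le> 0 \<or> s \<ge> 1 \<Longrightarrow> pulse s = 0"
  by (auto simp: pulse_def)

lemma smooth_step_eq_0: "s \<le> 0 \<Longrightarrow> smooth_step s = 0"
  unfolding smooth_step_def by (subst integral_cong[where g="\<lambda>_. 0"]) (auto simp: pulse_eq_0)

lemma pulse_integrable: "pulse integrable_on {a..b}"
  by (intro integrable_continuous_interval continuous_on_pulse)

lemma smooth_step_DERIV: "(smooth_step has_real_derivative pulse s) (at s)"
proof (cases "s < 0")
  case True
  have "((\<lambda>_. 0) has_real_derivative 0) (at s)" by simp
  then have "(smooth_step has_real_derivative 0) (at s)"
    by (rule has_field_derivative_transform_within_open[where S="{..<0}"])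
      (use True in \<open>auto simp: smooth_step_eq_0\<close>)
  with True show ?thesis by (simp add: pulse_eq_0)
next
  case False
  have "(smooth_step has_real_derivative pulse s) (at s within {-1..s+1})"
    unfolding smooth_step_def
    by (rule integral_has_real_derivative) (use False in \<open>auto intro: continuous_on_pulse\<close>)
  moreover have "at s within {-1..s+1} = at s"
    by (rule at_within_interior) (use False in \<open>simp\<close>)
  ultimately show ?thesis by simp
qed

lemma smooth_step_eq_1: "s \<ge> 1 \<Longrightarrow> smooth_step s = 1"
proof -
  assume s: "s \<ge> 1"
  have "integral {-1..s} pulse = integral {-1..0} pulse + integral {0..1} pulse + integral {1..s} pulse"
    using s pulse_integrable by (simp add: Henstock_Kurzweil_Integration.integral_combine)
  moreover have "integral {-1..0} pulse = 0"
    using smooth_step_eq_0[of 0] by (simp add: smooth_step_def)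
  moreover have "integral {1..s} pulse = 0"
    by (subst integral_cong[where g="\<lambda>_. 0"]) (auto simp: pulse_eq_0)
  moreover have "integral {0..1} pulse = 1"
    unfolding pulse_def using pulse_normalization by simp
  ultimately show ?thesis by (simp add: smooth_step_def)
qed

lemma smooth_step_mono: "s \<le> t \<Longrightarrow> smooth_step s \<le> smooth_step t"
  by (rule DERIV_nonneg_imp_nondecreasing[of s t]) (auto intro: smooth_step_DERIV pulse_nonneg)

lemma smooth_step_nonneg: "0 \<le> smooth_step s" and smooth_step_le_1: "smooth_step s \<le> 1"
  using smooth_step_mono[of 0 s] smooth_step_mono[of s 1] smooth_step_eq_0 smooth_step_eq_1
  by (metis linear order_refl)+

lemma smooth_real_pulse: "smooth_real pulse"
proof (rule elementary_smooth_real)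
  have id: "(\<lambda>x::real. x) \<in> elementary" using elementary.inner[of "1::real"] by simp
  have "(\<lambda>s::real. 1 + (-1) * s) \<in> elementary"
    by (intro elementary.const elementary.add elementary.mult id)
  then have a: "(\<lambda>s::real. 1 - s) \<in> elementary" by simp
  have "(\<lambda>s::real. flat 1 s * flat 1 (1 - s) * (1 / integral {0..1} (\<lambda>s. flat 1 s * flat 1 (1 - s)))) \<in> elementary"
    by (intro elementary.const elementary.mult elementary.comp[OF smooth_real_flat] id a)
  then show "pulse \<in> elementary"
    unfolding pulse_def by simp
qed

text \<open>The coinduction invariant gets one extra member, \<open>smooth_step\<close> itself,
  whose derivative \<open>pulse\<close> is already known to be smooth.\<close>

lemma smooth_real_smooth_step: "smooth_real smooth_step"
proof (rule smooth_real_coinduct[where P="\<lambda>k. k = smooth_step \<or> smooth_real k"])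
  have *: "deriv smooth_step = pulse"
    using smooth_step_DERIV DERIV_imp_deriv by blast
  fix k assume k: "k = smooth_step \<or> smooth_real k"
  then show "k differentiable (at x)" for x
    using smooth_step_DERIV smooth_real_DERIV real_differentiable_def by blast
  from k * show "deriv k = smooth_step \<or> smooth_real (deriv k)"
    using smooth_real_pulse smooth_real_deriv by auto
qed auto

lemma continuous_on_smooth_step: "continuous_on S smooth_step"
  using DERIV_continuous[OF smooth_step_DERIV] continuous_at_imp_continuous_on by blast

section \<open>Further closure rules for elementary functions\<close>

lemma elementary_uminus: "f \<in> elementary \<Longrightarrow> (\<lambda>x. - f x) \<in> elementary"
  using elementary.mult[OF elementary.const[of "-1"]] by simp

lemma elementary_diff: "f \<in> elementary \<Longrightarrow> g \<in> elementary \<Longrightarrow> (\<lambda>x. f x - g x) \<in> elementary"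
  using elementary.add[OF _ elementary_uminus] by simp

lemma elementary_sum: "(\<And>i. i \<in> I \<Longrightarrow> f i \<in> elementary) \<Longrightarrow> (\<lambda>x. \<Sum>i\<in>I. f i x) \<in> elementary"
  by (induction I rule: infinite_finite_induct) (auto intro: elementary.const elementary.add elementary.mult)

lemma elementary_prod: "(\<And>i. i \<in> I \<Longrightarrow> f i \<in> elementary) \<Longrightarrow> (\<lambda>x. \<Prod>i\<in>I. f i x) \<in> elementary"
  by (induction I rule: infinite_finite_induct) (auto intro: elementary.const elementary.add elementary.mult)

lemma elementary_translate:
  "f \<in> elementary \<Longrightarrow> (\<lambda>x. f (a - x)) \<in> elementary"
proof (induction rule: elementary.induct)
  case (inner b)
  show ?case unfolding inner_diff_left by (intro elementary_diff elementary.const elementary.inner)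
qed (auto intro: elementary.const elementary.add elementary.mult elementary.comp[OF _ _])

lemma elementary_fst:
  "f \<in> elementary \<Longrightarrow> (\<lambda>z::'a::euclidean_space \<times> 'b::euclidean_space. f (fst z)) \<in> elementary"
proof (induction rule: elementary.induct)
  case (inner b)
  have "(\<lambda>z::'a\<times>'b. z \<bullet> (b, 0)) \<in> elementary" by (rule elementary.inner)
  then show ?case by (simp add: inner_prod_def)
qed (auto intro: elementary.const elementary.add elementary.mult elementary.comp)

lemma elementary_snd:
  "f \<in> elementary \<Longrightarrow> (\<lambda>z::'a::euclidean_space \<times> 'b::euclidean_space. f (snd z)) \<in> elementary"
proof (induction rule: elementary.induct)
  case (inner b)
  have "(\<lambda>z::'a\<times>'b. z \<bullet> (0, b)) \<in> elementary" by (rule elementary.inner)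
  then show ?case by (simp add: inner_prod_def)
qed (auto intro: elementary.const elementary.add elementary.mult elementary.comp)

lemma elementary_inner_self: "(\<lambda>x. x \<bullet> x) \<in> elementary"
  by (subst euclidean_inner) (intro elementary_sum elementary.mult elementary.inner)

section \<open>Mollification\<close>

text \<open>Writing the bump through |x|^2 keeps it smooth at the origin and makes it elementary;
  for e > 0 it is positive exactly on the open ball of radius e.\<close>

definition bump :: "real \<Rightarrow> 'a::euclidean_space \<Rightarrow> real" where
  "bump e x = flat 1 (1 - (x \<bullet> x) / e\<^sup>2)"

definition moll :: "real \<Rightarrow> 'a::euclidean_space \<Rightarrow> real" where
  "moll e x = bump e x / (LINT y|lborel. bump e (y :: 'a))"

text \<open>The gradient of \<open>moll e\<close> in closed form: \<open>[:0, 0, 1:]\<close> is what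
  \<open>flat_DERIV\<close> yields for the polynomial 1, and -2 x / e^2 is the gradient of 1 - |x|^2
  / e^2. An explicit formula gives continuity, support and the moment bound directly.\<close>

definition mgrad :: "real \<Rightarrow> 'a::euclidean_space \<Rightarrow> 'a" where
  "mgrad e x = (- 2 * flat [:0, 0, 1:] (1 - (x \<bullet> x) / e\<^sup>2) / (e\<^sup>2 * (LINT y|lborel. bump e (y :: 'a)))) *\<^sub>R x"

lemma bump_elementary: "bump e \<in> elementary"
proof -
  have "(\<lambda>x::'a. 1 - (x \<bullet> x) * (1 / e\<^sup>2)) \<in> elementary"
    by (intro elementary_diff elementary.const elementary.mult elementary_inner_self)
  then have "(\<lambda>x::'a. flat 1 (1 - (x \<bullet> x) * (1 / e\<^sup>2))) \<in> elementary"
    by (rule elementary.comp[OF smooth_real_flat])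
  then show ?thesis by (simp add: bump_def[abs_def])
qed

lemma moll_elementary: "moll e \<in> elementary"
  using elementary.mult[OF bump_elementary elementary.const[of "1 / (LINT y|lborel. bump e (y :: 'a))"]]
  by (simp add: moll_def[abs_def])

lemma continuous_on_bump: "continuous_on S (bump e)" and continuous_on_moll: "continuous_on S (moll e)"
  by (intro elementary_continuous bump_elementary moll_elementary)+

lemma bump_nonneg: "bump e x \<ge> 0"
  by (simp add: bump_def)

lemma norm_ge_imp_arg_nonpos:
  assumes "e > 0" "norm x \<ge> e" shows "1 - (x \<bullet> x) / e\<^sup>2 \<le> 0"
  using assms power_mono[of e "norm x" 2] by (simp add: power2_norm_eq_inner)

lemma bump_eq_0: "e > 0 \<Longrightarrow> norm x \<ge> e \<Longrightarrow> bump e x = 0"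
  unfolding bump_def by (intro flat_nonpos norm_ge_imp_arg_nonpos)

lemma integrable_continuous_bounded_support:
  fixes f :: "'a::euclidean_space \<Rightarrow> 'b::euclidean_space"
  assumes c: "continuous_on UNIV f" and z: "\<And>x. norm x \<ge> e \<Longrightarrow> f x = 0"
  shows "integrable lborel f"
proof -
  have "integrable lborel (\<lambda>x. indicator (cball 0 e) x *\<^sub>R f x)"
    by (intro borel_integrable_compact compact_cball continuous_on_subset[OF c]) auto
  moreover have "(\<lambda>x. indicator (cball 0 e) x *\<^sub>R f x) = f"
    using z by (auto simp: fun_eq_iff indicator_def)
  ultimately show ?thesis by simp
qed

lemma integrable_bump: "e > 0 \<Longrightarrow> integrable lborel (bump e)"
  by (rule integrable_continuous_bounded_support[where e=e]) (auto intro: continuous_on_bump bump_eq_0)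

lemma flat_1_mono: "s \<le> t \<Longrightarrow> flat 1 s \<le> flat 1 t"
  by (auto simp: flat_def frac_le)

text \<open>The scaling e^n comes from the ball of radius e/2, where |x|^2 / e^2 \<le> 1/4 and the
  bump is at least \<open>flat 1 (3/4)\<close>. The constant does not depend on e, and the moment
  bound for \<open>mgrad\<close> relies on that.\<close>

lemma integral_bump_lower:
  obtains c where "c > 0" "\<And>e. e > 0 \<Longrightarrow> c * e ^ DIM('a) \<le> (LINT y|lborel. bump e (y :: 'a::euclidean_space))"
proof
  let ?c = "flat 1 (3/4) * (unit_ball_vol DIM('a) * (1/2) ^ DIM('a))"
  show "?c > 0" by (intro mult_pos_pos) auto
  fix e :: real assume e: "e > 0"
  have int: "integrable lborel (\<lambda>y::'a. flat 1 (3/4) * indicator (cball 0 (e/2)) y)"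
    using emeasure_compact_finite[OF compact_cball, of "0::'a" "e/2"] by (intro integrable_mult_right) auto
  have "?c * e ^ DIM('a) = flat 1 (3/4) * measure lborel (cball (0::'a) (e/2))"
    using e by (simp add: content_cball power_divide)
  also have "\<dots> = (LINT y|lborel. flat 1 (3/4) * indicator (cball (0::'a) (e/2)) y)"
    by simp
  also have "\<dots> \<le> (LINT y|lborel. bump e (y :: 'a))"
  proof (rule integral_mono[OF int integrable_bump[OF e]])
    fix y :: 'a
    show "flat 1 (3/4) * indicator (cball 0 (e/2)) y \<le> bump e y"
    proof (cases "y \<in> cball 0 (e/2)")
      case True
      then have "(norm y)\<^sup>2 \<le> (e/2)\<^sup>2" by (intro power_mono) auto
      then have "(y \<bullet> y) / e\<^sup>2 \<le> 1/4"
        using e by (simp add: power2_norm_eq_inner power_divide divide_simps)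
      then have "flat 1 (3/4) \<le> bump e y"
        unfolding bump_def by (intro flat_1_mono) simp
      with True show ?thesis by simp
    qed (simp add: bump_nonneg)
  qed
  finally show "?c * e ^ DIM('a) \<le> (LINT y|lborel. bump e (y :: 'a))" .
qed

lemma integral_bump_pos:
  assumes "e > 0" shows "(LINT y|lborel. bump e (y :: 'a::euclidean_space)) > 0"
proof -
  obtain c where "c > 0" "\<And>e. e > 0 \<Longrightarrow> c * e ^ DIM('a) \<le> (LINT y|lborel. bump e (y :: 'a))"
    using integral_bump_lower by blast
  with assms show ?thesis by (smt (verit) mult_pos_pos zero_less_power)
qed

lemma moll_nonneg: "moll e x \<ge> 0"
  unfolding moll_def by (intro divide_nonneg_nonneg bump_nonneg Bochner_Integration.integral_nonneg)

lemma moll_eq_0: "e > 0 \<Longrightarrow> norm x \<ge> e \<Longrightarrow> moll e x = 0"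
  by (simp add: moll_def bump_eq_0)

lemma integrable_moll: "e > 0 \<Longrightarrow> integrable lborel (moll e)"
  by (rule integrable_continuous_bounded_support[where e=e]) (auto intro: continuous_on_moll moll_eq_0)

lemma integral_moll: "e > 0 \<Longrightarrow> (LINT x|lborel. moll e (x :: 'a::euclidean_space)) = 1"
  unfolding moll_def using integral_bump_pos[of e, where 'a='a] by simp

lemma moll_has_derivative:
  assumes "e > 0"
  shows "(moll e has_derivative (\<lambda>h. mgrad e x \<bullet> h)) (at x)"
proof -
  let ?I = "LINT y|lborel. bump e (y :: 'a)"
  have "((\<lambda>x. 1 - (x \<bullet> x) / e\<^sup>2) has_derivative (\<lambda>h. - (2 * (x \<bullet> h)) / e\<^sup>2)) (at x)"
    using assms by (auto intro!: derivative_eq_intros simp: inner_commute fun_eq_iff field_simps power2_eq_square power4_eq_xxxx)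
  from has_derivative_compose[OF this flat_DERIV[unfolded has_field_derivative_def, of 1]]
  have "(bump e has_derivative
      (\<lambda>h. flat ([:0, 0, 1:] * (1 - pderiv 1)) (1 - (x \<bullet> x) / e\<^sup>2) * (- (2 * (x \<bullet> h)) / e\<^sup>2))) (at x)"
    by (simp add: bump_def[abs_def])
  then have "(moll e has_derivative
      (\<lambda>h. flat ([:0, 0, 1:] * (1 - pderiv 1)) (1 - (x \<bullet> x) / e\<^sup>2) * (- (2 * (x \<bullet> h)) / e\<^sup>2) / ?I)) (at x)"
    unfolding moll_def[abs_def] divide_inverse by (rule has_derivative_mult_left)
  moreover have "(\<lambda>h. flat ([:0, 0, 1:] * (1 - pderiv 1)) (1 - (x \<bullet> x) / e\<^sup>2) * (- (2 * (x \<bullet> h)) / e\<^sup>2) / ?I)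
     = (\<lambda>h. mgrad e x \<bullet> h)"
    by (auto simp: mgrad_def)
  ultimately show ?thesis by simp
qed

lemma continuous_on_mgrad: "continuous_on S (mgrad e)"
  unfolding mgrad_def[abs_def] divide_inverse
  by (intro continuous_intros continuous_on_compose2[OF continuous_on_flat[of UNIV]]) auto

lemma mgrad_eq_0: "e > 0 \<Longrightarrow> norm x \<ge> e \<Longrightarrow> mgrad e x = 0"
  using norm_ge_imp_arg_nonpos[of e x] by (simp add: mgrad_def)

lemma borel_measurable_moll [measurable]: "moll e \<in> borel_measurable borel"
  and borel_measurable_mgrad [measurable]: "mgrad e \<in> borel_measurable borel"
  by (intro borel_measurable_continuous_onI continuous_on_moll continuous_on_mgrad)+

lemma flat_bounded_below_1:
  obtains M where "M > 0" "\<And>s. s \<le> 1 \<Longrightarrow> \<bar>flat p s\<bar> \<le> M"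
proof -
  have "compact (flat p ` {0..1})"
    by (intro compact_continuous_image continuous_on_flat) simp
  then obtain B where B: "B > 0" "\<forall>y\<in>flat p ` {0..1}. norm y \<le> B"
    using compact_imp_bounded bounded_pos by metis
  have "\<bar>flat p s\<bar> \<le> B" if "s \<le> 1" for s
    using B that by (cases "s \<le> 0") auto
  with B(1) show ?thesis by (rule that)
qed

text \<open>Scale invariance: |z| |mgrad e z| is at most 2 M / I on the ball of radius e, where I is
  the integral of the bump. The volume of the ball is of order e^n and I is at least of that order,
  so the bound survives e \<rightarrow> 0. This constant becomes \<open>C1\<close> in the growth
  rate of the lower barrier.\<close>

lemma mgrad_first_moment_bound:
  obtains C where "C > 0"
    "\<And>e. e > 0 \<Longrightarrow> integrable lborel (\<lambda>z::'a::euclidean_space. norm z * norm (mgrad e z))"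
    "\<And>e. e > 0 \<Longrightarrow> (LINT z|lborel. norm z * norm (mgrad e (z :: 'a))) \<le> C"
proof -
  obtain c where c: "c > 0" "\<And>e. e > 0 \<Longrightarrow> c * e ^ DIM('a) \<le> (LINT y|lborel. bump e (y :: 'a))"
    using integral_bump_lower by blast
  obtain M where M: "M > 0" "\<And>s. s \<le> 1 \<Longrightarrow> \<bar>flat [:0, 0, 1:] s\<bar> \<le> M"
    using flat_bounded_below_1 by blast
  let ?C = "2 * M / c * unit_ball_vol DIM('a)"
  have int: "integrable lborel (\<lambda>z::'a. norm z * norm (mgrad e z))" if "e > 0" for e
    by (rule integrable_continuous_bounded_support[where e=e])
      (use that in \<open>auto intro!: continuous_intros continuous_on_mgrad simp: mgrad_eq_0\<close>)
  have "(LINT z|lborel. norm z * norm (mgrad e (z :: 'a))) \<le> ?C" if e: "e > 0" for e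
  proof -
    let ?I = "LINT y|lborel. bump e (y :: 'a)"
    have I: "?I > 0" by (rule integral_bump_pos[OF e])
    have "(LINT z|lborel. norm z * norm (mgrad e (z :: 'a))) \<le> (LINT z|lborel. (2 * M / ?I) * indicator (cball (0::'a) e) z)"
    proof (rule integral_mono[OF int[OF e]])
      show "integrable lborel (\<lambda>z::'a. 2 * M / ?I * indicator (cball 0 e) z)"
        using emeasure_compact_finite[OF compact_cball, of "0::'a" e] by (intro integrable_mult_right) auto
      fix z :: 'a
      show "norm z * norm (mgrad e z) \<le> (2 * M / ?I) * indicator (cball 0 e) z"
      proof (cases "norm z \<le> e")
        case True
        let ?F = "\<bar>flat [:0, 0, 1:] (1 - (z \<bullet> z) / e\<^sup>2)\<bar>"
        have "norm (mgrad e z) = 2 * ?F / (e\<^sup>2 * ?I) * norm z"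
          using I e by (simp add: mgrad_def abs_mult)
        then have "norm z * norm (mgrad e z) = (2 * ?F / ?I) * ((norm z)\<^sup>2 / e\<^sup>2)"
          using I e by (simp add: power2_eq_square field_simps)
        also have "\<dots> \<le> (2 * M / ?I) * 1"
        proof (rule mult_mono)
          have "2 * ?F \<le> 2 * M" using e by (intro mult_left_mono M(2)) auto
          then show "2 * ?F / ?I \<le> 2 * M / ?I" using I by (intro divide_right_mono) auto
          show "(norm z)\<^sup>2 / e\<^sup>2 \<le> 1" using True e by (simp add: power_mono)
        qed (use I M in auto)
        finally show ?thesis using True by simp
      qed (use e in \<open>simp add: mgrad_eq_0\<close>)
    qed
    also have "\<dots> = 2 * M / ?I * (unit_ball_vol DIM('a) * e ^ DIM('a))"
      using e by (simp add: content_cball)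
    also have "\<dots> \<le> 2 * M / (c * e ^ DIM('a)) * (unit_ball_vol DIM('a) * e ^ DIM('a))"
      using c e M I by (intro mult_right_mono divide_left_mono mult_pos_pos) auto
    also have "\<dots> = ?C" using e by simp
    finally show ?thesis .
  qed
  moreover have "?C > 0" using M c by (intro mult_pos_pos divide_pos_pos) auto
  ultimately show ?thesis using int that by blast
qed

lemma support_moll_translate:
  assumes "e > 0"
  shows "closure {y. moll e (x - y) \<noteq> 0} \<subseteq> cball x e"
proof (rule closure_minimal)
  show "{y. moll e (x - y) \<noteq> 0} \<subseteq> cball x e"
    using moll_eq_0[OF assms] by (force simp: dist_norm)
qed simp

lemma test_functionI:
  assumes "f \<in> elementary" "closure {x. f x \<noteq> 0} \<subseteq> K" "compact K" "K \<subseteq> U"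
  shows "test_function U f"
proof -
  have "compact (closure {x. f x \<noteq> 0})"
    using assms by (meson bounded_subset closed_closure compact_eq_bounded_closed)
  then show ?thesis
    unfolding test_function_def using assms by (auto intro: elementary_smooth_on)
qed

lemma test_function_moll: "e > 0 \<Longrightarrow> cball x e \<subseteq> U \<Longrightarrow> test_function U (\<lambda>y. moll e (x - y))"
  by (rule test_functionI[OF elementary_translate[OF moll_elementary] support_moll_translate compact_cball])

lemma moll_translate_has_derivative:
  assumes "e > 0"
  shows "((\<lambda>y. moll e (x - y)) has_derivative (\<lambda>h. - (mgrad e (x - y) \<bullet> h))) (at y)"
proof -
  have "((\<lambda>y. x - y) has_derivative (\<lambda>h. - h)) (at y)"
    by (auto intro!: derivative_eq_intros)
  from has_derivative_compose[OF this moll_has_derivative[OF assms]]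
  show ?thesis by simp
qed

lemma iter_deriv_moll: "e > 0 \<Longrightarrow> iter_deriv [b] (\<lambda>y. moll e (x - y)) = (\<lambda>y. - (mgrad e (x - y) \<bullet> b))"
  using frechet_derivative_at[OF moll_translate_has_derivative, symmetric, of e x] by simp

text \<open>Uniform continuity on the compact ball of radius e + 1 is enough: if two points are at
  distance less than 1 and one of them leaves that ball, both are outside the ball of radius e,
  where the function is zero.\<close>

lemma uniformly_continuous_bounded_support:
  fixes f :: "'a::euclidean_space \<Rightarrow> 'b::real_normed_vector"
  assumes c: "continuous_on UNIV f" and z: "\<And>x. norm x \<ge> e \<Longrightarrow> f x = 0"
  shows "uniformly_continuous_on UNIV f"
  unfolding uniformly_continuous_on_def
proof (intro allI impI)
  fix \<epsilon> :: real assume "\<epsilon> > 0"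
  have "uniformly_continuous_on (cball 0 (e + 1)) f"
    by (intro compact_uniformly_continuous continuous_on_subset[OF c]) auto
  then obtain d where d: "d > 0"
      "\<And>x y. x \<in> cball 0 (e + 1) \<Longrightarrow> y \<in> cball 0 (e + 1) \<Longrightarrow> dist y x < d \<Longrightarrow> dist (f y) (f x) < \<epsilon>"
    using \<open>\<epsilon> > 0\<close> unfolding uniformly_continuous_on_def by meson
  have "dist (f y) (f x) < \<epsilon>" if xy: "dist y x < min d 1" for x y
  proof (cases "x \<in> cball 0 (e + 1) \<and> y \<in> cball 0 (e + 1)")
    case True
    with d(2) xy show ?thesis by simp
  next
    case False
    have "norm (x - y) < 1" using xy by (simp add: dist_norm norm_minus_commute)
    then have "norm x < norm y + 1" "norm y < norm x + 1"
      by (smt (verit) norm_triangle_ineq2 norm_minus_commute)+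
    with False have "norm x \<ge> e" "norm y \<ge> e" by auto
    with z \<open>\<epsilon> > 0\<close> show ?thesis by simp
  qed
  with d(1) show "\<exists>d>0. \<forall>x\<in>UNIV. \<forall>x'\<in>UNIV. dist x' x < d \<longrightarrow> dist (f x') (f x) < \<epsilon>"
    by (intro exI[of _ "min d 1"]) auto
qed

lemma moll_bounded: assumes "e > 0" obtains B where "B > 0" "\<And>x::'a::euclidean_space. \<bar>moll e x\<bar> \<le> B"
proof -
  have "bounded (moll e ` cball (0::'a) e)"
    by (intro compact_imp_bounded compact_continuous_image continuous_on_moll) auto
  then obtain B where B: "B > 0" "\<forall>y\<in>moll e ` cball (0::'a) e. norm y \<le> B"
    using bounded_pos by metis
  have "\<bar>moll e x\<bar> \<le> B" for x :: 'a
  proof (cases "norm x \<le> e")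
    case True
    then have "moll e x \<in> moll e ` cball (0::'a) e" by simp
    with B(2) show ?thesis by (metis real_norm_def)
  next
    case False
    with moll_eq_0[OF assms, of x] B(1) show ?thesis by simp
  qed
  with B(1) show ?thesis by (rule that)
qed

lemma mgrad_bounded: assumes "e > 0" obtains B where "B > 0" "\<And>x::'a::euclidean_space. norm (mgrad e x) \<le> B"
proof -
  have "bounded (mgrad e ` cball (0::'a) e)"
    by (intro compact_imp_bounded compact_continuous_image continuous_on_mgrad) auto
  then obtain B where B: "B > 0" "\<forall>y\<in>mgrad e ` cball (0::'a) e. norm y \<le> B"
    using bounded_pos by metis
  have "norm (mgrad e x) \<le> B" for x :: 'a
  proof (cases "norm x \<le> e")
    case True
    then have "mgrad e x \<in> mgrad e ` cball 0 e" by simp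
    with B(2) show ?thesis by blast
  next
    case False
    with mgrad_eq_0[OF assms, of x] B(1) show ?thesis by simp
  qed
  with B(1) show ?thesis by (rule that)
qed

text \<open>The remainder is controlled by the oscillation of \<open>mgrad\<close>, which is
  uniformly continuous. Uniformity in z is the point: the estimate can be integrated against any
  integrable function.\<close>

lemma moll_linearization:
  assumes "e > 0" "\<epsilon> > 0"
  obtains d where "d > 0" "\<And>z h. norm h < d \<Longrightarrow> \<bar>moll e (z + h) - moll e z - mgrad e z \<bullet> h\<bar> \<le> \<epsilon> * norm h"
proof -
  have "uniformly_continuous_on UNIV (mgrad e :: 'a \<Rightarrow> 'a)"
    by (rule uniformly_continuous_bounded_support[where e=e])
      (use assms in \<open>auto intro: continuous_on_mgrad mgrad_eq_0\<close>)
  then obtain d where d: "d > 0" "\<And>x y::'a. dist y x < d \<Longrightarrow> dist (mgrad e y) (mgrad e x) < \<epsilon>"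
    using \<open>\<epsilon> > 0\<close> unfolding uniformly_continuous_on_def by (meson UNIV_I)
  have "\<bar>moll e (z + h) - moll e z - mgrad e z \<bullet> h\<bar> \<le> \<epsilon> * norm h" if h: "norm h < d" for z h :: 'a
  proof -
    have D: "((\<lambda>t. moll e (z + t *\<^sub>R h)) has_real_derivative (mgrad e (z + t *\<^sub>R h) \<bullet> h)) (at t)" for t
    proof -
      have "((\<lambda>t. z + t *\<^sub>R h) has_derivative (\<lambda>s. s *\<^sub>R h)) (at t)"
        by (auto intro!: derivative_eq_intros)
      from has_derivative_compose[OF this moll_has_derivative[OF assms(1)]]
      show ?thesis by (simp add: has_field_derivative_def mult_commute_abs)
    qed
    obtain t where t: "0 < t" "t < 1" "moll e (z + h) - moll e z = mgrad e (z + t *\<^sub>R h) \<bullet> h"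
      using MVT2[of 0 1 "\<lambda>t. moll e (z + t *\<^sub>R h)" "\<lambda>t. mgrad e (z + t *\<^sub>R h) \<bullet> h", OF _ D] by auto
    have "norm (t *\<^sub>R h) \<le> norm h"
      using t by (simp add: mult_left_le_one_le)
    then have "dist (mgrad e (z + t *\<^sub>R h)) (mgrad e z) < \<epsilon>"
      using h by (intro d(2)) (simp add: dist_norm)
    then have "norm (mgrad e (z + t *\<^sub>R h) - mgrad e z) \<le> \<epsilon>" by (simp add: dist_norm)
    then have "\<bar>(mgrad e (z + t *\<^sub>R h) - mgrad e z) \<bullet> h\<bar> \<le> \<epsilon> * norm h"
      by (meson Cauchy_Schwarz_ineq2 mult_right_mono norm_ge_zero order_trans)
    then show ?thesis using t(3) by (simp add: inner_diff_left)
  qed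
  with d(1) show ?thesis by (rule that)
qed

section \<open>Convolution with the mollifier\<close>

lemma integrable_bounded_scaleR:
  fixes f :: "'a::euclidean_space \<Rightarrow> 'b::euclidean_space"
  assumes f: "integrable lborel f" and k: "k \<in> borel_measurable borel" and B: "\<And>x. \<bar>k x\<bar> \<le> B"
  shows "integrable lborel (\<lambda>x. k x *\<^sub>R f x)"
proof (rule Bochner_Integration.integrable_bound[where f="\<lambda>x. B * norm (f x)"])
  show "(\<lambda>x. k x *\<^sub>R f x) \<in> borel_measurable lborel"
    using k borel_measurable_integrable[OF f] by measurable
  have "B \<ge> 0" using B[of 0] by linarith
  then show "AE x in lborel. norm (k x *\<^sub>R f x) \<le> norm (B * norm (f x))"
    by (auto simp: abs_mult intro!: mult_right_mono B)
qed (use f in auto)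

definition conv :: "real \<Rightarrow> ('a::euclidean_space \<Rightarrow> 'b::euclidean_space) \<Rightarrow> 'a \<Rightarrow> 'b" where
  "conv e f x = (LINT y|lborel. moll e (x - y) *\<^sub>R f y)"

lemma integrable_conv:
  fixes f :: "'a::euclidean_space \<Rightarrow> 'b::euclidean_space"
  assumes "e > 0" "integrable lborel f"
  shows "integrable lborel (\<lambda>y. moll e (x - y) *\<^sub>R f y)"
    and "integrable lborel (\<lambda>y. (mgrad e (x - y) \<bullet> h) *\<^sub>R f y)"
proof -
  obtain B where B: "\<And>x::'a. \<bar>moll e x\<bar> \<le> B" using moll_bounded[OF assms(1)] by metis
  show "integrable lborel (\<lambda>y. moll e (x - y) *\<^sub>R f y)"
    by (rule integrable_bounded_scaleR[OF assms(2) _ B]) measurable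
  obtain B' where B': "\<And>x::'a. norm (mgrad e x) \<le> B'" using mgrad_bounded[OF assms(1)] by metis
  show "integrable lborel (\<lambda>y. (mgrad e (x - y) \<bullet> h) *\<^sub>R f y)"
  proof (rule integrable_bounded_scaleR[OF assms(2)])
    show "\<bar>mgrad e (x - y) \<bullet> h\<bar> \<le> B' * norm h" for y
      by (meson B' Cauchy_Schwarz_ineq2 mult_right_mono norm_ge_zero order_trans)
  qed measurable
qed

text \<open>All regularity sits in the kernel, f is merely integrable. The uniform linearization of
  \<open>moll\<close> is multiplied by |f| and integrated, which bounds the remainder without a
  dominated convergence argument.\<close>

lemma conv_has_derivative:
  fixes f :: "'a::euclidean_space \<Rightarrow> 'b::euclidean_space"
  assumes e: "e > 0" and f: "integrable lborel f"
  shows "(conv e f has_derivative (\<lambda>h. LINT y|lborel. (mgrad e (x - y) \<bullet> h) *\<^sub>R f y)) (at x)"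
  unfolding has_derivative_at_alt
proof (intro conjI allI impI)
  let ?D = "\<lambda>h. LINT y|lborel. (mgrad e (x - y) \<bullet> h) *\<^sub>R f y"
  obtain B where B: "\<And>x::'a. norm (mgrad e x) \<le> B" using mgrad_bounded[OF e] by metis
  note int = integrable_conv[OF e f]
  show "bounded_linear ?D"
  proof (rule bounded_linear_intro)
    show "?D (h + k) = ?D h + ?D k" for h k
      by (simp add: inner_add_right scaleR_add_left int)
    show "?D (r *\<^sub>R h) = r *\<^sub>R ?D h" for r h
      by (simp flip: scaleR_scaleR)
    show "norm (?D h) \<le> norm h * (B * (LINT y|lborel. norm (f y)))" for h
    proof -
      have "norm (?D h) \<le> (LINT y|lborel. (norm h * B) * norm (f y))"
      proof (rule Bochner_Integration.integral_norm_bound_integral[OF int(2)])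
        show "norm ((mgrad e (x - y) \<bullet> h) *\<^sub>R f y) \<le> norm h * B * norm (f y)" for y
        proof -
          have "\<bar>mgrad e (x - y) \<bullet> h\<bar> \<le> B * norm h"
            by (meson B Cauchy_Schwarz_ineq2 mult_right_mono norm_ge_zero order_trans)
          then have "\<bar>mgrad e (x - y) \<bullet> h\<bar> * norm (f y) \<le> (B * norm h) * norm (f y)"
            by (rule mult_right_mono) simp
          then show ?thesis by (simp add: mult.commute)
        qed
      qed (use f in auto)
      then show ?thesis by (simp add: mult.assoc)
    qed
  qed
  fix \<epsilon> :: real assume "\<epsilon> > 0"
  \<comment> \<open>The summand 1 keeps the divisor positive when f vanishes almost
    everywhere.\<close>
  let ?N = "(LINT y|lborel. norm (f y)) + 1"
  have "(LINT y|lborel. norm (f y)) \<ge> 0" by (rule Bochner_Integration.integral_nonneg) simp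
  then have N: "?N > 0" by linarith
  obtain d where d: "d > 0"
      "\<And>z h::'a. norm h < d \<Longrightarrow> \<bar>moll e (z + h) - moll e z - mgrad e z \<bullet> h\<bar> \<le> (\<epsilon> / ?N) * norm h"
    using moll_linearization[OF e, of "\<epsilon> / ?N"] \<open>\<epsilon> > 0\<close> N by (metis divide_pos_pos)
  have "norm (conv e f y - conv e f x - ?D (y - x)) \<le> \<epsilon> * norm (y - x)" if y: "norm (y - x) < d" for y
  proof -
    have "conv e f y - conv e f x - ?D (y - x)
      = (LINT z|lborel. (moll e (y - z) - moll e (x - z) - mgrad e (x - z) \<bullet> (y - x)) *\<^sub>R f z)"
      unfolding conv_def by (simp add: scaleR_diff_left int)
    also have "norm \<dots> \<le> (LINT z|lborel. (\<epsilon> / ?N * norm (y - x)) * norm (f z))"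
    proof (rule Bochner_Integration.integral_norm_bound_integral)
      show "integrable lborel (\<lambda>z. (moll e (y - z) - moll e (x - z) - mgrad e (x - z) \<bullet> (y - x)) *\<^sub>R f z)"
        by (simp add: scaleR_diff_left int)
      show "norm ((moll e (y - z) - moll e (x - z) - mgrad e (x - z) \<bullet> (y - x)) *\<^sub>R f z)
        \<le> \<epsilon> / ?N * norm (y - x) * norm (f z)" for z
        using mult_right_mono[OF d(2)[OF y, of "x - z"], of "norm (f z)"] by simp
    qed (use f in auto)
    also have "\<dots> = \<epsilon> * norm (y - x) * ((LINT z|lborel. norm (f z)) / ?N)" by simp
    also have "\<dots> \<le> \<epsilon> * norm (y - x) * 1"
      using \<open>\<epsilon> > 0\<close> N by (intro mult_left_mono) auto
    finally show ?thesis by simp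
  qed
  with d(1) show "\<exists>d>0. \<forall>y. norm (y - x) < d \<longrightarrow>
      norm (conv e f y - conv e f x - ?D (y - x)) \<le> \<epsilon> * norm (y - x)" by blast
qed

lemma lborel_reflect: "distr lborel borel (\<lambda>y. x - y) = (lborel :: 'a::euclidean_space measure)"
  using lborel_affine[of "-1" x] by (simp add: density_1)

lemma integral_reflect:
  fixes f :: "'a::euclidean_space \<Rightarrow> 'b::euclidean_space"
  assumes [measurable]: "f \<in> borel_measurable borel"
  shows "(LINT y|lborel. f (x - y)) = (LINT y|lborel. f y)"
    and "integrable lborel (\<lambda>y. f (x - y)) \<longleftrightarrow> integrable lborel f"
proof -
  have "(LINT y|lborel. f y) = (LINT y|distr lborel borel (\<lambda>y. x - y). f y)"
    by (simp add: lborel_reflect)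
  then show "(LINT y|lborel. f (x - y)) = (LINT y|lborel. f y)"
    by (simp add: integral_distr)
  have "integrable lborel f \<longleftrightarrow> integrable (distr lborel borel (\<lambda>y. x - y)) f"
    by (simp add: lborel_reflect)
  then show "integrable lborel (\<lambda>y. f (x - y)) \<longleftrightarrow> integrable lborel f"
    by (simp add: integrable_distr_eq)
qed

text \<open>The kernel has mass one and lives in the ball of radius e, so the convolution is an
  average of nearby values. Closeness is assumed only almost everywhere, since f will be a
  representative of another function.\<close>

lemma conv_approx:
  fixes f :: "'a::euclidean_space \<Rightarrow> 'b::euclidean_space"
  assumes e: "e > 0" and f: "integrable lborel f"
    and close: "AE y in lborel. y \<in> cball x e \<longrightarrow> norm (f y - v) \<le> d"
  shows "norm (conv e f x - v) \<le> d"
proof -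
  have im: "integrable lborel (\<lambda>y. moll e (x - y))" and m1: "(LINT y|lborel. moll e (x - y)) = 1"
    using integrable_moll[OF e, where 'a='a] integral_moll[OF e, where 'a='a]
    by (simp_all add: integral_reflect)
  have "conv e f x - v = (LINT y|lborel. moll e (x - y) *\<^sub>R (f y - v))"
    unfolding conv_def by (simp add: scaleR_diff_right integrable_conv[OF e f] im m1)
  also have "norm \<dots> \<le> (LINT y|lborel. norm (moll e (x - y) *\<^sub>R (f y - v)))"
    by (rule integral_norm_bound)
  also have "\<dots> \<le> (LINT y|lborel. moll e (x - y) * d)"
  proof (rule integral_mono_AE)
    show "integrable lborel (\<lambda>y. norm (moll e (x - y) *\<^sub>R (f y - v)))"
      unfolding scaleR_diff_right
      by (intro integrable_norm Bochner_Integration.integrable_diff integrable_conv[OF e f]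
          integrable_scaleR_left im)
    show "AE y in lborel. norm (moll e (x - y) *\<^sub>R (f y - v)) \<le> moll e (x - y) * d"
      using close
    proof eventually_elim
      case (elim y)
      show ?case
      proof (cases "y \<in> cball x e")
        case True
        with elim show ?thesis by (simp add: moll_nonneg mult_left_mono)
      next
        case False
        then have "moll e (x - y) = 0" by (intro moll_eq_0[OF e]) (simp add: dist_norm)
        then show ?thesis by simp
      qed
    qed
  qed (use im in simp)
  also have "\<dots> = d" using m1 by simp
  finally show ?thesis .
qed

section \<open>The fundamental lemma of the calculus of variations\<close>

lemma borel_measurable_lebesgueI: "f \<in> borel_measurable borel \<Longrightarrow> f \<in> borel_measurable lebesgue"
  by (rule measurable_completion) simp

lemma elementary_borel: "f \<in> elementary \<Longrightarrow> f \<in> borel_measurable borel"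
  by (intro borel_measurable_continuous_onI elementary_continuous)

text \<open>The product is positive exactly inside the open box; the growing factor pushes it past 1
  there, where \<open>smooth_step\<close> saturates. So these functions lie between 0 and 1 and
  converge pointwise to the indicator of the open box.\<close>

definition box_bump :: "'a::euclidean_space \<Rightarrow> 'a \<Rightarrow> nat \<Rightarrow> 'a \<Rightarrow> real" where
  "box_bump a c n x = smooth_step (real (Suc n) * (\<Prod>b\<in>Basis. flat 1 (x \<bullet> b - a \<bullet> b) * flat 1 (c \<bullet> b - x \<bullet> b)))"

lemma box_bump_elementary: "box_bump a c n \<in> elementary"
proof -
  have 1: "(\<lambda>x. flat 1 (x \<bullet> b - a \<bullet> b)) \<in> elementary" for b
    by (rule elementary.comp[OF smooth_real_flat elementary_diff[OF elementary.inner elementary.const]])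
  have 2: "(\<lambda>x. flat 1 (c \<bullet> b - x \<bullet> b)) \<in> elementary" for b
    by (rule elementary.comp[OF smooth_real_flat elementary_diff[OF elementary.const elementary.inner]])
  have "(\<lambda>x. \<Prod>b\<in>Basis. flat 1 (x \<bullet> b - a \<bullet> b) * flat 1 (c \<bullet> b - x \<bullet> b)) \<in> elementary"
    by (rule elementary_prod[OF elementary.mult[OF 1 2]])
  from elementary.comp[OF smooth_real_smooth_step elementary.mult[OF elementary.const this]]
  show ?thesis unfolding box_bump_def[abs_def] .
qed

lemma box_bump_eq_0: assumes "x \<notin> box a c" shows "box_bump a c n x = 0"
proof -
  obtain b where b: "b \<in> Basis" "\<not> (a \<bullet> b < x \<bullet> b \<and> x \<bullet> b < c \<bullet> b)"
    using assms by (auto simp: box_def)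
  then have "flat 1 (x \<bullet> b - a \<bullet> b) * flat 1 (c \<bullet> b - x \<bullet> b) = 0" by (auto simp: not_less)
  then have "(\<Prod>b\<in>Basis. flat 1 (x \<bullet> b - a \<bullet> b) * flat 1 (c \<bullet> b - x \<bullet> b)) = 0"
    using b(1) by (intro prod_zero) auto
  then show ?thesis by (simp only: box_bump_def mult_zero_right smooth_step_eq_0[OF order_refl])
qed

lemma box_bump_tendsto: "(\<lambda>n. box_bump a c n x) \<longlonglongrightarrow> indicator (box a c) x"
proof (cases "x \<in> box a c")
  case True
  define G where "G = (\<Prod>b\<in>Basis. flat 1 (x \<bullet> b - a \<bullet> b) * flat 1 (c \<bullet> b - x \<bullet> b))"
  have "G > 0"
    unfolding G_def using True by (intro prod_pos mult_pos_pos) (auto simp: box_def)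
  then obtain N where N: "1 < real N * G" using ex_less_of_nat_mult by blast
  have "box_bump a c n x = 1" if "n \<ge> N" for n
  proof -
    have "real N * G \<le> real (Suc n) * G" using that \<open>G > 0\<close> by (intro mult_right_mono) auto
    with N show ?thesis by (simp only: box_bump_def G_def[symmetric] smooth_step_eq_1)
  qed
  then have "eventually (\<lambda>n. box_bump a c n x = 1) sequentially"
    unfolding eventually_sequentially by blast
  then show ?thesis using True by (simp add: tendsto_eventually)
next
  case False
  then show ?thesis by (simp add: box_bump_eq_0)
qed

lemma test_function_box_bump: "cbox a c \<subseteq> U \<Longrightarrow> test_function U (box_bump a c n)"
proof (rule test_functionI[OF box_bump_elementary _ compact_cbox])
  have "{x. box_bump a c n x \<noteq> 0} \<subseteq> cbox a c"
    using box_bump_eq_0 box_subset_cbox by blast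
  then show "closure {x. box_bump a c n x \<noteq> 0} \<subseteq> cbox a c"
    by (rule closure_minimal) (rule closed_cbox)
qed

text \<open>Box bumps converge to indicators, so the integral of f vanishes over every box inside U,
  and the Lebesgue differentiation theorem then gives f = 0 at almost every point.\<close>

lemma fundamental_lemma:
  fixes f :: "'a::euclidean_space \<Rightarrow> 'b::euclidean_space"
  assumes U: "open U" and f: "locally_integrable_on U f"
    and zero: "\<And>\<phi>. test_function U \<phi> \<Longrightarrow> (LINT x:U|lebesgue. \<phi> x *\<^sub>R f x) = 0"
  shows "AE x in lebesgue. x \<in> U \<longrightarrow> f x = 0"
proof -
  have box: "AE x in lebesgue. x \<in> box a c \<longrightarrow> f x = 0" if ac: "cbox a c \<subseteq> U" for a c
  proof -
    \<comment> \<open>Cutting f off to one compact box turns local integrability into integrability,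
      as dominated convergence and the differentiation theorem require.\<close>
    define g where "g x = indicator (cbox a c) x *\<^sub>R f x" for x
    have g: "integrable lebesgue g"
    proof -
      have "set_integrable lebesgue (cbox a c) f"
        using f ac unfolding locally_integrable_on_def by simp
      then show ?thesis by (simp add: set_integrable_def g_def[abs_def])
    qed
    have zero_box: "integral (cbox p q) g = 0" if pq: "cbox p q \<subseteq> cbox a c" for p q
    proof -
      have eq: "(LINT x|lebesgue. box_bump p q n x *\<^sub>R g x) = 0" for n
      proof -
        have "(LINT x:U|lebesgue. box_bump p q n x *\<^sub>R f x) = 0"
          using pq ac by (intro zero test_function_box_bump) auto
        moreover have "indicator U x *\<^sub>R (box_bump p q n x *\<^sub>R f x) = box_bump p q n x *\<^sub>R g x" for x
        proof (cases "x \<in> box p q")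
          case True
          then have "x \<in> cbox a c" "x \<in> U" using pq ac box_subset_cbox by blast+
          then show ?thesis by (simp add: g_def)
        qed (simp add: box_bump_eq_0)
        ultimately show ?thesis by (simp add: set_lebesgue_integral_def)
      qed
      have "(\<lambda>n. LINT x|lebesgue. box_bump p q n x *\<^sub>R g x) \<longlonglongrightarrow> (LINT x|lebesgue. indicator (box p q) x *\<^sub>R g x)"
      proof (rule integral_dominated_convergence[where w="\<lambda>x. norm (g x)"])
        show "(\<lambda>x. indicator (box p q) x *\<^sub>R g x) \<in> borel_measurable lebesgue"
          using g by (intro borel_measurable_scaleR borel_measurable_indicator) auto
        have "box_bump p q n \<in> borel_measurable lebesgue" for n
          by (intro borel_measurable_lebesgueI elementary_borel box_bump_elementary)
        then show "(\<lambda>x. box_bump p q n x *\<^sub>R g x) \<in> borel_measurable lebesgue" for n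
          using g by (intro borel_measurable_scaleR) auto
        show "AE x in lebesgue. norm (box_bump p q n x *\<^sub>R g x) \<le> norm (g x)" for n
          by (auto intro!: AE_I2 mult_left_le_one_le simp: box_bump_def smooth_step_nonneg smooth_step_le_1)
        show "AE x in lebesgue. (\<lambda>n. box_bump p q n x *\<^sub>R g x) \<longlonglongrightarrow> indicator (box p q) x *\<^sub>R g x"
          by (intro AE_I2 tendsto_scaleR box_bump_tendsto tendsto_const)
      qed (use g in auto)
      then have "(LINT x:box p q|lebesgue. g x) = 0"
        unfolding eq set_lebesgue_integral_def by (simp add: LIMSEQ_const_iff)
      moreover have "set_integrable lebesgue (box p q) g"
        unfolding set_integrable_def using g by (intro integrable_mult_indicator) auto
      ultimately show ?thesis
        using set_lebesgue_integral_eq_integral(2) integral_open_interval by metis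
    qed
    have "g integrable_on cbox p q" for p q
    proof -
      have "set_integrable lebesgue (cbox p q) g"
        unfolding set_integrable_def using g by (intro integrable_mult_indicator) auto
      then show ?thesis by (rule set_lebesgue_integral_eq_integral)
    qed
    \<comment> \<open>The Lebesgue differentiation theorem, for cubes whose lower corner is
      x.\<close>
    then obtain N where N: "negligible N" and
      diff: "\<And>x e. x \<notin> N \<Longrightarrow> 0 < e \<Longrightarrow> \<exists>d>0. \<forall>h. 0 < h \<and> h < d \<longrightarrow>
                norm (integral (cbox x (x + h *\<^sub>R One)) g /\<^sub>R h ^ DIM('a) - g x) < e"
      using integrable_ccontinuous_explicit by metis
    have "f x = 0" if x: "x \<in> box a c" "x \<notin> N" for x
    proof (rule ccontr)
      assume "f x \<noteq> 0"
      moreover have gx: "g x = f x"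
        using subsetD[OF box_subset_cbox x(1)] by (simp add: g_def)
      ultimately obtain d where d: "d > 0" "\<And>h. 0 < h \<Longrightarrow> h < d \<Longrightarrow>
          norm (integral (cbox x (x + h *\<^sub>R One)) g /\<^sub>R h ^ DIM('a) - g x) < norm (g x)"
        using diff[OF x(2), of "norm (g x)"] by auto
      obtain r where r: "r > 0" "ball x r \<subseteq> box a c"
        using x(1) open_box open_contains_ball by metis
      \<comment> \<open>The cube with corner x and side h lies in the ball of radius r because the
        Euclidean norm is at most the sum of the n absolute coordinates; dividing by twice the
        dimension makes the inclusion strict.\<close>
      define h where "h = min (d / 2) (r / (2 * DIM('a)))"
      have h: "0 < h" "h < d" "DIM('a) * h < r"
      proof -
        show "0 < h" "h < d" using d(1) r(1) by (auto simp: h_def)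
        have "DIM('a) * h \<le> DIM('a) * (r / (2 * DIM('a)))"
          unfolding h_def by (intro mult_left_mono) auto
        also have "\<dots> < r" using r(1) by simp
        finally show "DIM('a) * h < r" .
      qed
      have "cbox x (x + h *\<^sub>R One) \<subseteq> ball x r"
      proof
        fix y assume y: "y \<in> cbox x (x + h *\<^sub>R One)"
        have "norm (y - x) \<le> (\<Sum>b\<in>Basis. \<bar>(y - x) \<bullet> b\<bar>)" by (rule norm_le_l1)
        also have "\<dots> \<le> (\<Sum>b\<in>(Basis::'a set). h)"
          using y by (intro sum_mono) (auto simp: mem_box inner_diff_left inner_add_left)
        also have "\<dots> = DIM('a) * h" by simp
        also have "\<dots> < r" by (rule h)
        finally show "y \<in> ball x r" by (simp add: dist_norm norm_minus_commute)
      qed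
      with r(2) have "cbox x (x + h *\<^sub>R One) \<subseteq> cbox a c"
        using box_subset_cbox by blast
      from zero_box[OF this] d(2)[OF h(1,2)] show False by simp
    qed
    then have "{x \<in> box a c. f x \<noteq> 0} \<subseteq> N" by auto
    moreover have "N \<in> null_sets lebesgue" using N by (simp add: negligible_iff_null_sets)
    ultimately show ?thesis
      by (intro AE_I'[of N]) auto
  qed
  \<comment> \<open>The argument so far is local to a box. Countably many closed boxes exhaust U,
    and passing from an open to a closed box costs a null set each time.\<close>
  obtain D where D: "countable D" "D \<subseteq> Pow U" "\<And>X. X \<in> D \<Longrightarrow> \<exists>a c. X = cbox a c" "\<Union>D = U"
    using open_countable_Union_open_cbox[OF U] by metis
  have "AE x in lebesgue. x \<in> X \<longrightarrow> f x = 0" if X: "X \<in> D" for X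
  proof -
    obtain a c where ac: "X = cbox a c" using D(3)[OF X] by blast
    have sub: "cbox a c \<subseteq> U" using D(2) X ac by blast
    have "negligible (cbox a c - box a c)" by (rule negligible_frontier_interval)
    then have "AE x in lebesgue. x \<notin> cbox a c - box a c"
      by (intro AE_not_in) (simp add: negligible_iff_null_sets)
    with box[OF sub] show ?thesis unfolding ac by eventually_elim auto
  qed
  then have "AE x in lebesgue. \<forall>X\<in>D. x \<in> X \<longrightarrow> f x = 0"
    unfolding AE_ball_countable[OF D(1)] by blast
  then show ?thesis unfolding D(4)[symmetric] by eventually_elim blast
qed

section \<open>Borel representatives and test functions\<close>

lemma test_function_iter_deriv:
  assumes "test_function U \<phi>" "b \<in> Basis"
  shows "test_function U (iter_deriv [b] \<phi>)"
proof -
  define S where "S = closure {x. \<phi> x \<noteq> 0}"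
  have s: "smooth_on UNIV \<phi>" "compact S" "S \<subseteq> U"
    using assms by (auto simp: test_function_def S_def)
  have "iter_deriv bs (iter_deriv [b] \<phi>) = iter_deriv (bs @ [b]) \<phi>" for bs
    by (induction bs) auto
  with s(1) assms(2) have "smooth_on UNIV (iter_deriv [b] \<phi>)"
    by (simp add: smooth_on_def del: iter_deriv.simps)
  moreover have "iter_deriv [b] \<phi> x = 0" if x: "x \<notin> S" for x
  proof -
    have z: "\<phi> y = 0" if "y \<in> - S" for y using that closure_subset[of "{x. \<phi> x \<noteq> 0}"] unfolding S_def by auto
    have "((\<lambda>_. 0) has_derivative (\<lambda>_. 0)) (at x)" by simp
    then have "(\<phi> has_derivative (\<lambda>_. 0)) (at x)"
    proof (rule has_derivative_transform_within_open[where s="- S"])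
      show "x \<in> - S" using x by blast
      show "0 = \<phi> y" if "y \<in> - S" for y using z[OF that] by (rule sym)
    qed (auto simp: S_def)
    from frechet_derivative_at[OF this, symmetric] show ?thesis by simp
  qed
  then have "closure {x. iter_deriv [b] \<phi> x \<noteq> 0} \<subseteq> S"
    unfolding S_def by (intro closure_minimal closed_closure) blast
  ultimately show ?thesis
    using s unfolding test_function_def
    by (meson bounded_subset closed_closure compact_eq_bounded_closed order_trans)
qed

lemma test_function_continuous:
  assumes "test_function U \<phi>" shows "continuous_on S \<phi>"
proof -
  have "\<forall>x. iter_deriv [] \<phi> differentiable (at x)"
    using assms unfolding test_function_def smooth_on_def by (metis UNIV_I empty_iff empty_set subsetI)
  then have "\<phi> differentiable (at x)" for x by simp
  then show ?thesis
    by (intro continuous_at_imp_continuous_on ballI differentiable_imp_continuous_within)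
qed

lemma test_function_borel: "test_function U \<phi> \<Longrightarrow> \<phi> \<in> borel_measurable borel"
  by (intro borel_measurable_continuous_onI test_function_continuous)

lemma test_function_bounded:
  assumes "test_function U \<phi>" obtains B where "B > 0" "\<And>x. \<bar>\<phi> x\<bar> \<le> B"
proof -
  let ?S = "closure {x. \<phi> x \<noteq> 0}"
  have "bounded (\<phi> ` ?S)"
    using assms by (intro compact_imp_bounded compact_continuous_image test_function_continuous)
      (auto simp: test_function_def)
  then obtain B where B: "B > 0" "\<forall>y\<in>\<phi> ` ?S. norm y \<le> B"
    using bounded_pos by metis
  have "\<bar>\<phi> x\<bar> \<le> B" for x
  proof (cases "\<phi> x = 0")
    case False
    then have "x \<in> ?S" using closure_subset[of "{x. \<phi> x \<noteq> 0}"] by auto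
    then have "\<phi> x \<in> \<phi> ` ?S" by (rule imageI)
    with B(2) show ?thesis by (metis real_norm_def)
  qed (use B in simp)
  with B(1) show ?thesis by (rule that)
qed

lemma test_function_set_integrable:
  fixes f :: "'a::euclidean_space \<Rightarrow> 'b::euclidean_space"
  assumes \<phi>: "test_function U \<phi>" and f: "locally_integrable_on U f"
  shows "set_integrable lebesgue U (\<lambda>x. \<phi> x *\<^sub>R f x)"
proof -
  let ?S = "closure {x. \<phi> x \<noteq> 0}"
  obtain B where B: "\<And>x. \<bar>\<phi> x\<bar> \<le> B" using test_function_bounded[OF \<phi>] by metis
  have S: "compact ?S" "?S \<subseteq> U" using \<phi> by (auto simp: test_function_def)
  then have i: "integrable lebesgue (\<lambda>x. indicator ?S x *\<^sub>R f x)"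
    using f unfolding locally_integrable_on_def set_integrable_def by simp
  have "integrable lebesgue (\<lambda>x. \<phi> x *\<^sub>R (indicator ?S x *\<^sub>R f x))"
  proof (rule Bochner_Integration.integrable_bound[where f="\<lambda>x. B * norm (indicator ?S x *\<^sub>R f x)"])
    show "(\<lambda>x. \<phi> x *\<^sub>R indicator ?S x *\<^sub>R f x) \<in> borel_measurable lebesgue"
    proof (rule borel_measurable_scaleR[OF _ borel_measurable_integrable[OF i]])
      show "\<phi> \<in> borel_measurable lebesgue"
        by (rule measurable_completion) (use test_function_borel[OF \<phi>] in simp)
    qed
    have "B \<ge> 0" using B[of 0] by linarith
    then show "AE x in lebesgue. norm (\<phi> x *\<^sub>R (indicator ?S x *\<^sub>R f x)) \<le> norm (B * norm (indicator ?S x *\<^sub>R f x))"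
      by (intro AE_I2) (simp add: abs_mult mult.assoc mult_right_mono B)
  qed (rule integrable_mult_right[OF integrable_norm[OF i]])
  moreover have "\<phi> x *\<^sub>R (indicator ?S x *\<^sub>R f x) = indicator U x *\<^sub>R (\<phi> x *\<^sub>R f x)" for x
  proof (cases "\<phi> x = 0")
    case False
    then have "x \<in> ?S" using closure_subset[of "{x. \<phi> x \<noteq> 0}"] by auto
    with S(2) show ?thesis by auto
  qed simp
  ultimately show ?thesis unfolding set_integrable_def by (simp only:)
qed

text \<open>Functions on U are only Lebesgue measurable on U, whereas Fubini's theorem, translations
  and parameter integrals are applied to Borel functions on the whole space. So each function is
  replaced by a Borel one that agrees with it almost everywhere on U and is literally zero
  outside.\<close>

definition borel_rep :: "'a::euclidean_space set \<Rightarrow> ('a \<Rightarrow> 'b::euclidean_space) \<Rightarrow> ('a \<Rightarrow> 'b) \<Rightarrow> bool" where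
  "borel_rep U f f' \<longleftrightarrow> f \<in> borel_measurable (lebesgue_on U) \<and> f' \<in> borel_measurable borel \<and>
     (AE x in lborel. x \<in> U \<longrightarrow> f' x = f x) \<and> (\<forall>x. x \<notin> U \<longrightarrow> f' x = 0)"

text \<open>A Borel representative is found for each real coordinate and the coordinates are
  reassembled; multiplying by the indicator of the open set U makes the extension by zero exact and
  not just almost everywhere.\<close>

lemma borel_rep_exists:
  fixes f :: "'a::euclidean_space \<Rightarrow> 'b::euclidean_space"
  assumes U: "open U" and f: "f \<in> borel_measurable (lebesgue_on U)"
  obtains f' where "borel_rep U f f'"
proof -
  let ?F = "\<lambda>x. indicator U x *\<^sub>R f x"
  have F: "?F \<in> borel_measurable lebesgue"
    using f U borel_measurable_restrict_space_iff[of U lebesgue f] by simp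
  have "\<exists>g\<in>borel_measurable lborel. AE x in lborel. ?F x \<bullet> b = g x" for b :: 'b
  proof (rule completion_ex_borel_measurable_real)
    show "(\<lambda>x. ?F x \<bullet> b) \<in> borel_measurable lebesgue"
      by (rule borel_measurable_inner[OF F borel_measurable_const])
  qed
  then have "\<forall>b::'b. \<exists>g. g \<in> borel_measurable lborel \<and> (AE x in lborel. ?F x \<bullet> b = g x)" by blast
  from choice[OF this] obtain g
    where g: "\<And>b::'b. g b \<in> borel_measurable lborel" "\<And>b. AE x in lborel. ?F x \<bullet> b = g b x"
    by blast
  define f' where "f' x = indicator U x *\<^sub>R (\<Sum>b\<in>Basis. g b x *\<^sub>R b)" for x
  have "f' \<in> borel_measurable borel"
    unfolding f'_def using g(1) U by (auto intro!: borel_measurable_scaleR borel_measurable_sum borel_measurable_indicator)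
  moreover have "AE x in lborel. \<forall>b\<in>Basis. ?F x \<bullet> b = g b x"
    using g(2) by (simp add: AE_finite_allI)
  then have "AE x in lborel. x \<in> U \<longrightarrow> f' x = f x"
  proof eventually_elim
    case (elim x)
    show ?case
    proof
      assume x: "x \<in> U"
      have "f' x = (\<Sum>b\<in>Basis. (f x \<bullet> b) *\<^sub>R b)"
        unfolding f'_def using elim x by simp
      then show "f' x = f x" by (simp add: euclidean_representation)
    qed
  qed
  moreover have "\<forall>x. x \<notin> U \<longrightarrow> f' x = 0" by (simp add: f'_def)
  ultimately show ?thesis using that f unfolding borel_rep_def by blast
qed

lemma borel_rep_AE:
  fixes f :: "'a::euclidean_space \<Rightarrow> 'b::euclidean_space"
  assumes "borel_rep U f f'"
  shows "AE x in lebesgue. indicator U x *\<^sub>R f x = f' x"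
proof -
  have "AE x in lborel. indicator U x *\<^sub>R f x = f' x"
    using assms unfolding borel_rep_def by (auto elim!: eventually_mono simp: indicator_def)
  then show ?thesis by (rule AE_completion)
qed

lemma borel_rep_set_integral:
  fixes f :: "'a::euclidean_space \<Rightarrow> 'b::euclidean_space"
  assumes r: "borel_rep U f f'" and U: "open U" and k: "k \<in> borel_measurable borel"
  shows "(LINT x:U|lebesgue. k x *\<^sub>R f x) = (LINT x|lborel. k x *\<^sub>R f' x)"
    and "set_integrable lebesgue U (\<lambda>x. k x *\<^sub>R f x) \<longleftrightarrow> integrable lborel (\<lambda>x. k x *\<^sub>R f' x)"
proof -
  have F: "(\<lambda>x. indicator U x *\<^sub>R f x) \<in> borel_measurable lebesgue"
    using r U borel_measurable_restrict_space_iff[of U lebesgue f] by (simp add: borel_rep_def)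
  have f': "f' \<in> borel_measurable borel" using r by (simp add: borel_rep_def)
  have k': "k \<in> borel_measurable lebesgue" by (rule measurable_completion) (use k in simp)
  have eq: "indicator U x *\<^sub>R (k x *\<^sub>R f x) = k x *\<^sub>R (indicator U x *\<^sub>R f x)" for x by simp
  have m1: "(\<lambda>x. indicator U x *\<^sub>R (k x *\<^sub>R f x)) \<in> borel_measurable lebesgue"
    unfolding eq by (intro borel_measurable_scaleR F k')
  have m2: "(\<lambda>x. k x *\<^sub>R f' x) \<in> borel_measurable lborel"
    using k f' by simp
  have m3: "(\<lambda>x. k x *\<^sub>R f' x) \<in> borel_measurable lebesgue"
    by (rule measurable_completion[OF m2])
  have ae: "AE x in lebesgue. indicator U x *\<^sub>R (k x *\<^sub>R f x) = k x *\<^sub>R f' x"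
    using borel_rep_AE[OF r] unfolding eq by eventually_elim simp
  show "(LINT x:U|lebesgue. k x *\<^sub>R f x) = (LINT x|lborel. k x *\<^sub>R f' x)"
    unfolding set_lebesgue_integral_def integral_cong_AE[OF m1 m3 ae] by (rule integral_completion[OF m2])
  show "set_integrable lebesgue U (\<lambda>x. k x *\<^sub>R f x) \<longleftrightarrow> integrable lborel (\<lambda>x. k x *\<^sub>R f' x)"
    unfolding set_integrable_def integrable_cong_AE[OF m1 m3 ae] by (rule integrable_completion[OF m2])
qed

lemma borel_rep_powr:
  fixes f :: "'a::euclidean_space \<Rightarrow> 'b::euclidean_space"
  assumes r: "borel_rep U f f'" and U: "open U" and p: "p > 0" and f: "f \<in> Lp U p"
  shows "integrable lborel (\<lambda>x. norm (f' x) powr p)"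
    and "(LINT x|lborel. norm (f' x) powr p) = (LINT x|lebesgue_on U. norm (f x) powr p)"
proof -
  have F: "(\<lambda>x. indicator U x *\<^sub>R f x) \<in> borel_measurable lebesgue"
    using r U borel_measurable_restrict_space_iff[of U lebesgue f] by (simp add: borel_rep_def)
  have f': "f' \<in> borel_measurable borel" using r by (simp add: borel_rep_def)
  have m2: "(\<lambda>x. norm (f' x) powr p) \<in> borel_measurable lborel" using f' by measurable
  have eq: "indicator U x *\<^sub>R (norm (f x) powr p) = norm (indicator U x *\<^sub>R f x) powr p" for x
    using p by (auto simp: indicator_def)
  have m1: "(\<lambda>x. indicator U x *\<^sub>R (norm (f x) powr p)) \<in> borel_measurable lebesgue"
    unfolding eq using F by measurable
  have ae: "AE x in lebesgue. indicator U x *\<^sub>R (norm (f x) powr p) = norm (f' x) powr p"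
    using borel_rep_AE[OF r] unfolding eq by eventually_elim simp
  have i: "integrable lebesgue (\<lambda>x. indicator U x *\<^sub>R (norm (f x) powr p))"
    using f U integrable_restrict_space[of U lebesgue "\<lambda>x. norm (f x) powr p"] by (simp add: Lp_def)
  show "integrable lborel (\<lambda>x. norm (f' x) powr p)"
    using i integrable_cong_AE[OF m1 measurable_completion[OF m2] ae] integrable_completion[OF m2] by blast
  have "(LINT x|lebesgue_on U. norm (f x) powr p) = (LINT x|lebesgue. indicator U x *\<^sub>R (norm (f x) powr p))"
    using U by (intro integral_restrict_space) simp
  also have "\<dots> = (LINT x|lborel. norm (f' x) powr p)"
    unfolding integral_cong_AE[OF m1 measurable_completion[OF m2] ae] by (rule integral_completion[OF m2])
  finally show "(LINT x|lborel. norm (f' x) powr p) = (LINT x|lebesgue_on U. norm (f x) powr p)" by simp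
qed

text \<open>Local integrability speaks of compact sets only, so U is exhausted by finite unions of
  compact boxes and f is the pointwise limit of its restrictions to them.\<close>

lemma locally_integrable_measurable:
  fixes f :: "'a::euclidean_space \<Rightarrow> 'b::euclidean_space"
  assumes U: "open U" and f: "locally_integrable_on U f"
  shows "f \<in> borel_measurable (lebesgue_on U)"
proof (cases "U = {}")
  case True
  then show ?thesis by (simp add: measurable_def)
next
  case False
  obtain D where D: "countable D" "D \<subseteq> Pow U" "\<And>X. X \<in> D \<Longrightarrow> \<exists>a c. X = cbox a c" "\<Union>D = U"
    using open_countable_Union_open_cbox[OF U] by metis
  with False have ne: "D \<noteq> {}" by auto
  define K where "K n = (\<Union>k\<le>n. from_nat_into D k)" for n
  have mem: "from_nat_into D k \<in> D" for k using ne by (rule from_nat_into)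
  have K: "compact (K n)" "K n \<subseteq> U" for n
  proof -
    have "compact (from_nat_into D k)" for k using D(3)[OF mem[of k]] by auto
    then show "compact (K n)" unfolding K_def by (intro compact_UN) auto
    show "K n \<subseteq> U" unfolding K_def using D(2) mem by blast
  qed
  have "(\<lambda>x. indicator U x *\<^sub>R f x) \<in> borel_measurable lebesgue"
  proof (rule borel_measurable_LIMSEQ_metric)
    fix n
    show "(\<lambda>x. indicator (K n) x *\<^sub>R f x) \<in> borel_measurable lebesgue"
    proof -
      have "set_integrable lebesgue (K n) f"
        using f K unfolding locally_integrable_on_def by simp
      then show ?thesis unfolding set_integrable_def by (rule borel_measurable_integrable)
    qed
  next
    fix x
    show "(\<lambda>n. indicator (K n) x *\<^sub>R f x) \<longlonglongrightarrow> indicator U x *\<^sub>R f x"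
    proof (cases "x \<in> U")
      case True
      then obtain X where "X \<in> D" "x \<in> X" using D(4) by blast
      then obtain k where "x \<in> from_nat_into D k"
        using D(1) by (metis from_nat_into_surj)
      then have "x \<in> K n" if "n \<ge> k" for n using that by (auto simp: K_def)
      then have "eventually (\<lambda>n. indicator (K n) x *\<^sub>R f x = indicator U x *\<^sub>R f x) sequentially"
        unfolding eventually_sequentially using True by (intro exI[of _ k]) auto
      then show ?thesis by (rule tendsto_eventually)
    next
      case False
      with K(2) have "x \<notin> K n" for n by blast
      with False show ?thesis by simp
    qed
  qed
  then show ?thesis
    using U borel_measurable_restrict_space_iff[of U lebesgue f] by simp
qed

section \<open>Weak derivatives\<close>

lemma wderiv_has_weak_deriv: "weakly_differentiable U bs f \<Longrightarrow> has_weak_deriv U bs f (wderiv U bs f)"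
  unfolding weakly_differentiable_def wderiv_def by (erule someI_ex)

text \<open>The fundamental lemma applied to the difference. Since \<open>wderiv\<close> is a
  choice, what is known about some weak derivative is transported to it by this uniqueness.\<close>

lemma has_weak_deriv_unique:
  fixes f :: "'a::euclidean_space \<Rightarrow> 'b::euclidean_space"
  assumes U: "open U" and g: "has_weak_deriv U bs f g" and h: "has_weak_deriv U bs f h"
  shows "AE x in lebesgue. x \<in> U \<longrightarrow> g x = h x"
proof -
  have lg: "locally_integrable_on U g" and lh: "locally_integrable_on U h"
    using g h by (auto simp: has_weak_deriv_def)
  have "AE x in lebesgue. x \<in> U \<longrightarrow> g x - h x = 0"
  proof (rule fundamental_lemma[OF U])
    show "locally_integrable_on U (\<lambda>x. g x - h x)"
      using lg lh unfolding locally_integrable_on_def by auto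
    fix \<phi> assume t: "test_function U \<phi>"
    have "(- 1) ^ length bs *\<^sub>R (LINT x:U|lebesgue. \<phi> x *\<^sub>R g x) = (- 1) ^ length bs *\<^sub>R (LINT x:U|lebesgue. \<phi> x *\<^sub>R h x)"
      using g h t unfolding has_weak_deriv_def by metis
    then have "(LINT x:U|lebesgue. \<phi> x *\<^sub>R g x) = (LINT x:U|lebesgue. \<phi> x *\<^sub>R h x)" by simp
    then show "(LINT x:U|lebesgue. \<phi> x *\<^sub>R (g x - h x)) = 0"
      using set_integral_diff(2)[OF test_function_set_integrable[OF t lg] test_function_set_integrable[OF t lh]]
      by (simp add: scaleR_diff_right)
  qed
  then show ?thesis by simp
qed

text \<open>The head of the list is the outermost derivative of the test function:
  \<open>iter_deriv [c, b] \<phi>\<close> is the c-derivative of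
  \<open>iter_deriv [b] \<phi>\<close>, itself a test function. Testing the c-derivative of f with
  it turns a second derivative of f into a first derivative of g, and one of the two signs is used
  up.\<close>

lemma has_weak_deriv_Cons:
  assumes f: "has_weak_deriv U [c] f g" "has_weak_deriv U [c, b] f h" and b: "b \<in> Basis"
  shows "has_weak_deriv U [b] g h"
  unfolding has_weak_deriv_def
proof (intro conjI allI impI)
  show "locally_integrable_on U g" "locally_integrable_on U h"
    using f by (auto simp: has_weak_deriv_def)
  fix \<phi> assume t: "test_function U \<phi>"
  have "(LINT x:U|lebesgue. iter_deriv [c] (iter_deriv [b] \<phi>) x *\<^sub>R f x)
      = (-1) ^ length [c] *\<^sub>R (LINT x:U|lebesgue. iter_deriv [b] \<phi> x *\<^sub>R g x)"
    using f(1) test_function_iter_deriv[OF t b] unfolding has_weak_deriv_def by blast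
  moreover have "(LINT x:U|lebesgue. iter_deriv [c, b] \<phi> x *\<^sub>R f x)
      = (-1) ^ length [c, b] *\<^sub>R (LINT x:U|lebesgue. \<phi> x *\<^sub>R h x)"
    using f(2) t unfolding has_weak_deriv_def by blast
  ultimately show "(LINT x:U|lebesgue. iter_deriv [b] \<phi> x *\<^sub>R g x)
      = (-1) ^ length [b] *\<^sub>R (LINT x:U|lebesgue. \<phi> x *\<^sub>R h x)"
    by (simp add: minus_equation_iff)
qed

text \<open>Membership in the space provides some weak derivative in Lp; uniqueness carries its
  integrability over to the chosen one.\<close>

lemma Sobolev_wderiv:
  fixes f :: "'a::euclidean_space \<Rightarrow> 'b::euclidean_space"
  assumes U: "open U" and f: "f \<in> Sobolev U k p" and bs: "bs \<in> multi_indices k" and p: "p > 0"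
  shows "has_weak_deriv U bs f (wderiv U bs f)" and "wderiv U bs f \<in> Lp U p"
proof -
  obtain g where g: "g \<in> Lp U p" "has_weak_deriv U bs f g"
    using f bs by (auto simp: Sobolev_def)
  then show w: "has_weak_deriv U bs f (wderiv U bs f)"
    by (intro wderiv_has_weak_deriv) (auto simp: weakly_differentiable_def)
  have "AE x in lebesgue. x \<in> U \<longrightarrow> g x = wderiv U bs f x"
    by (rule has_weak_deriv_unique[OF U g(2) w])
  then have ae: "AE x in lebesgue_on U. g x = wderiv U bs f x"
    using U by (simp add: AE_restrict_space_iff)
  have m: "wderiv U bs f \<in> borel_measurable (lebesgue_on U)"
    using w by (intro locally_integrable_measurable[OF U]) (simp add: has_weak_deriv_def)
  have "integrable (lebesgue_on U) (\<lambda>x. norm (wderiv U bs f x) powr p)"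
  proof (rule integrable_cong_AE_imp)
    show "integrable (lebesgue_on U) (\<lambda>x. norm (g x) powr p)" using g(1) by (simp add: Lp_def)
    show "(\<lambda>x. norm (wderiv U bs f x) powr p) \<in> borel_measurable (lebesgue_on U)" using m by measurable
    show "AE x in lebesgue_on U. norm (g x) powr p = norm (wderiv U bs f x) powr p"
      using ae by eventually_elim simp
  qed
  with m show "wderiv U bs f \<in> Lp U p" by (simp add: Lp_def)
qed

lemma finite_multi_indices: "finite (multi_indices k :: 'a::euclidean_space list set)"
  unfolding multi_indices_def by (rule finite_lists_length_le) simp

lemma Sobolev_norm_ge:
  assumes "bs \<in> multi_indices k" "p > 0"
  shows "(LINT x|lebesgue_on U. norm (wderiv U bs f x) powr p) \<le> Sobolev_norm U k p f powr p"
proof -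
  let ?S = "\<Sum>bs\<in>multi_indices k. LINT x|lebesgue_on U. norm (wderiv U bs f x) powr p"
  have "?S \<ge> 0" by (intro sum_nonneg Bochner_Integration.integral_nonneg) simp
  then have "Sobolev_norm U k p f powr p = ?S"
    using assms(2) by (simp add: Sobolev_norm_def powr_powr)
  moreover have "(LINT x|lebesgue_on U. norm (wderiv U bs f x) powr p) \<le> ?S"
    using assms(1) finite_multi_indices by (intro member_le_sum Bochner_Integration.integral_nonneg) auto
  ultimately show ?thesis by simp
qed

section \<open>Morrey's inequality\<close>

lemma nn_integral_affine:
  fixes h :: "'a::euclidean_space \<Rightarrow> ennreal"
  assumes [measurable]: "h \<in> borel_measurable borel" and s: "s > 0"
  shows "(\<integral>\<^sup>+z. h (x + s *\<^sub>R z) \<partial>lborel) = ennreal (1 / s ^ DIM('a)) * (\<integral>\<^sup>+y. h y \<partial>lborel)"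
proof -
  have "(\<integral>\<^sup>+y. h y \<partial>lborel) = (\<integral>\<^sup>+y. h y \<partial>density (distr lborel borel (\<lambda>z. x + s *\<^sub>R z)) (\<lambda>_. ennreal (\<bar>s\<bar> ^ DIM('a))))"
    using lborel_affine[of s x] s by simp
  also have "\<dots> = ennreal (s ^ DIM('a)) * (\<integral>\<^sup>+z. h (x + s *\<^sub>R z) \<partial>lborel)"
    using s by (simp add: nn_integral_density nn_integral_distr nn_integral_cmult)
  finally have "ennreal (1 / s ^ DIM('a)) * (\<integral>\<^sup>+y. h y \<partial>lborel)
      = ennreal (1 / s ^ DIM('a)) * ennreal (s ^ DIM('a)) * (\<integral>\<^sup>+z. h (x + s *\<^sub>R z) \<partial>lborel)"
    by (simp add: mult.assoc)
  also have "ennreal (1 / s ^ DIM('a)) * ennreal (s ^ DIM('a)) = 1"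
    using s by (simp flip: ennreal_mult)
  finally show ?thesis by simp
qed

lemma cball_borel [measurable]: "cball a r \<in> sets borel" "Measurable.pred borel (\<lambda>x. x \<in> cball a r)"
  using borel_closed[OF closed_cball, of a r] by (simp_all add: pred_def del: mem_cball)

text \<open>Below the level l the bound is trivial; above it t^(1-q) \<le> l^(1-q), since 1 - q is
  negative. With the level left free this does the work of Hoelder's inequality: the level is fixed
  afterwards so as to balance the two terms.\<close>

lemma powr_Young:
  fixes t l q :: real
  assumes "t \<ge> 0" "l > 0" "q > 1"
  shows "t \<le> l + l powr (1 - q) * t powr q"
proof (cases "t \<le> l")
  case True
  then show ?thesis using assms by (smt (verit) mult_nonneg_nonneg powr_ge_zero)
next
  case False
  then have t: "t > 0" "t > l" using assms by auto
  have "t = t powr (1 - q) * t powr q" using t by (simp flip: powr_add)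
  also have "\<dots> \<le> l powr (1 - q) * t powr q"
    using t assms by (intro mult_right_mono powr_mono2') auto
  finally show ?thesis using assms by simp
qed

text \<open>A Hoelder bound for |G| over balls scaled by s. The factor s^(-n/q) is what makes
  Morrey's inequality work, being integrable near 0 for q > n.\<close>

lemma average_bound:
  fixes G :: "'a::euclidean_space \<Rightarrow> 'b::euclidean_space"
  assumes G[measurable]: "G \<in> borel_measurable borel" and i: "integrable lborel (\<lambda>x. norm (G x) powr q)"
    and A: "(LINT x|lborel. norm (G x) powr q) \<le> A powr q" "A > 0" and q: "q > 1" and s: "s > 0"
  shows "(\<integral>\<^sup>+z. ennreal (norm (G (x + s *\<^sub>R z))) * indicator (cball a r) z \<partial>lborel)
     \<le> ennreal (s powr (- (DIM('a) / q)) * (A * (measure lborel (cball a r) + 1)))"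
proof -
  \<comment> \<open>The balancing level: the integral of |G(x + s z)|^q in z is at most s^(-n) A^q,
    and with this l the second term of Young's bound equals l again. The total is l times the volume
    plus 1.\<close>
  define l where "l = s powr (- (DIM('a) / q)) * A"
  have l: "l > 0" using s A by (simp add: l_def)
  let ?B = "cball a r" and ?I = "LINT x|lborel. norm (G x) powr q"
  have fin: "emeasure lborel ?B = ennreal (measure lborel ?B)"
    by (intro emeasure_eq_ennreal_measure) (metis emeasure_compact_finite compact_cball infinity_ennreal_def less_irrefl)
  have "(\<integral>\<^sup>+z. ennreal (norm (G (x + s *\<^sub>R z))) * indicator ?B z \<partial>lborel)
     \<le> (\<integral>\<^sup>+z. ennreal l * indicator ?B z + ennreal (l powr (1 - q)) * ennreal (norm (G (x + s *\<^sub>R z)) powr q) \<partial>lborel)"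
  proof (intro nn_integral_mono)
    fix z
    have "norm (G (x + s *\<^sub>R z)) \<le> l + l powr (1 - q) * norm (G (x + s *\<^sub>R z)) powr q"
      using powr_Young[OF _ l q] by simp
    then have "ennreal (norm (G (x + s *\<^sub>R z))) \<le> ennreal l + ennreal (l powr (1 - q)) * ennreal (norm (G (x + s *\<^sub>R z)) powr q)"
      using l by (simp flip: ennreal_mult ennreal_plus)
    then show "ennreal (norm (G (x + s *\<^sub>R z))) * indicator ?B z
        \<le> ennreal l * indicator ?B z + ennreal (l powr (1 - q)) * ennreal (norm (G (x + s *\<^sub>R z)) powr q)"
      by (auto simp: indicator_def)
  qed
  also have "\<dots> = ennreal l * emeasure lborel ?B
      + ennreal (l powr (1 - q)) * (\<integral>\<^sup>+z. ennreal (norm (G (x + s *\<^sub>R z)) powr q) \<partial>lborel)"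
  proof -
    have m: "(\<lambda>z. ennreal (norm (G (x + s *\<^sub>R z)) powr q)) \<in> borel_measurable lborel" by measurable
    have "(\<integral>\<^sup>+z. ennreal l * indicator ?B z + ennreal (l powr (1 - q)) * ennreal (norm (G (x + s *\<^sub>R z)) powr q) \<partial>lborel)
       = (\<integral>\<^sup>+z. ennreal l * indicator ?B z \<partial>lborel) + (\<integral>\<^sup>+z. ennreal (l powr (1 - q)) * ennreal (norm (G (x + s *\<^sub>R z)) powr q) \<partial>lborel)"
      by (intro nn_integral_add) (measurable, measurable)
    then show ?thesis by (simp add: nn_integral_cmult[OF m] nn_integral_cmult_indicator)
  qed
  also have "(\<integral>\<^sup>+z. ennreal (norm (G (x + s *\<^sub>R z)) powr q) \<partial>lborel) = ennreal (1 / s ^ DIM('a)) * ennreal ?I"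
    using nn_integral_affine[of "\<lambda>y. ennreal (norm (G y) powr q)" s x] s
      nn_integral_eq_integral[OF i] by simp
  also have "ennreal l * emeasure lborel ?B + ennreal (l powr (1 - q)) * (ennreal (1 / s ^ DIM('a)) * ennreal ?I)
     = ennreal (l * measure lborel ?B + l powr (1 - q) * (1 / s ^ DIM('a) * ?I))"
  proof -
    have "?I \<ge> 0" by (rule Bochner_Integration.integral_nonneg) simp
    with l s show ?thesis
      unfolding fin by (simp flip: ennreal_mult ennreal_plus)
  qed
  also have "\<dots> \<le> ennreal (s powr (- (DIM('a) / q)) * (A * (measure lborel ?B + 1)))"
  proof (rule ennreal_leI)
    have "l powr (1 - q) * (1 / s ^ DIM('a) * ?I) \<le> l powr (1 - q) * (1 / s ^ DIM('a) * A powr q)"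
      using s by (intro mult_left_mono A) auto
    also have "\<dots> = s powr (- (DIM('a) / q) * (1 - q)) * A powr (1 - q) * (s powr (- DIM('a)) * A powr q)"
    proof -
      have "l powr (1 - q) = s powr (- (DIM('a) / q) * (1 - q)) * A powr (1 - q)"
        unfolding l_def using s A by (simp only: powr_mult powr_powr)
      moreover have "1 / s ^ DIM('a) = s powr (- real DIM('a))"
        using s by (simp add: powr_minus powr_realpow divide_inverse)
      ultimately show ?thesis by (simp only: of_int_minus of_int_of_nat_eq)
    qed
    also have "\<dots> = (s powr (- (DIM('a) / q) * (1 - q)) * s powr (- DIM('a))) * (A powr (1 - q) * A powr q)"
      by (simp only: mult_ac)
    also have "\<dots> = s powr (- (DIM('a) / q) * (1 - q) + - DIM('a)) * A powr (1 - q + q)"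
      by (simp only: powr_add)
    also have "\<dots> = l"
    proof -
      have "- (DIM('a) / q) * (1 - q) + - real DIM('a) = - (DIM('a) / q)"
        using q by (simp add: field_simps)
      then show ?thesis using A by (simp only: l_def) simp
    qed
    finally have "l powr (1 - q) * (1 / s ^ DIM('a) * ?I) \<le> l" .
    then show "l * measure lborel ?B + l powr (1 - q) * (1 / s ^ DIM('a) * ?I)
       \<le> s powr (- (DIM('a) / q)) * (A * (measure lborel ?B + 1))"
      by (simp add: l_def algebra_simps)
  qed
  finally show ?thesis .
qed

lemma conv_reflect:
  fixes G :: "'a::euclidean_space \<Rightarrow> 'b::euclidean_space"
  assumes [measurable]: "G \<in> borel_measurable borel"
  shows "conv e G y = (LINT w|lborel. moll e w *\<^sub>R G (y - w))"
proof -
  have "(\<lambda>w. moll e w *\<^sub>R G (y - w)) \<in> borel_measurable borel" by measurable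
  from integral_reflect(1)[OF this, of y] show ?thesis by (simp add: conv_def)
qed

text \<open>A mollification is an average of translates of G, and the right-hand side of
  \<open>average_bound\<close> does not depend on the centre x. Tonelli's theorem lets the
  mollifier, of mass one, be integrated last.\<close>

lemma conv_average_bound:
  fixes G :: "'a::euclidean_space \<Rightarrow> 'b::euclidean_space"
  assumes G[measurable]: "G \<in> borel_measurable borel" and i: "integrable lborel (\<lambda>x. norm (G x) powr q)"
    and A: "(LINT x|lborel. norm (G x) powr q) \<le> A powr q" "A > 0" and q: "q > 1" and s: "s > 0" and e: "e > 0"
  shows "(\<integral>\<^sup>+z. ennreal (norm (conv e G (x + s *\<^sub>R z))) * indicator (cball a r) z \<partial>lborel)
     \<le> ennreal (s powr (- (DIM('a) / q)) * (A * (measure lborel (cball a r) + 1)))" (is "_ \<le> ?R")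
proof -
  have "(\<integral>\<^sup>+z. ennreal (norm (conv e G (x + s *\<^sub>R z))) * indicator (cball a r) z \<partial>lborel)
     \<le> (\<integral>\<^sup>+z. (\<integral>\<^sup>+w. ennreal (moll e w) * (ennreal (norm (G ((x - w) + s *\<^sub>R z))) * indicator (cball a r) z) \<partial>lborel) \<partial>lborel)"
  proof (intro nn_integral_mono)
    fix z
    have eq: "conv e G (x + s *\<^sub>R z) = (LINT w|lborel. moll e w *\<^sub>R G ((x - w) + s *\<^sub>R z))"
      unfolding conv_reflect[OF G] by (intro Bochner_Integration.integral_cong refl) (simp add: algebra_simps)
    have "ennreal (norm (conv e G (x + s *\<^sub>R z))) \<le> (\<integral>\<^sup>+w. ennreal (norm (moll e w *\<^sub>R G ((x - w) + s *\<^sub>R z))) \<partial>lborel)"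
    proof (cases "integrable lborel (\<lambda>w. moll e w *\<^sub>R G ((x - w) + s *\<^sub>R z))")
      case True
      have "ennreal (norm (conv e G (x + s *\<^sub>R z))) \<le> ennreal (LINT w|lborel. norm (moll e w *\<^sub>R G ((x - w) + s *\<^sub>R z)))"
        unfolding eq by (intro ennreal_leI integral_norm_bound)
      also have "\<dots> = (\<integral>\<^sup>+w. ennreal (norm (moll e w *\<^sub>R G ((x - w) + s *\<^sub>R z))) \<partial>lborel)"
        by (intro nn_integral_eq_integral[symmetric] integrable_norm True AE_I2 norm_ge_zero)
      finally show ?thesis .
    next
      \<comment> \<open>The integral of a non-integrable function is 0 by convention, so the
        inequality is trivial here.\<close>
      case False
      then have "conv e G (x + s *\<^sub>R z) = 0"
        unfolding eq by (rule not_integrable_integral_eq)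
      then show ?thesis by simp
    qed
    also have "\<dots> = (\<integral>\<^sup>+w. ennreal (moll e w) * ennreal (norm (G ((x - w) + s *\<^sub>R z))) \<partial>lborel)"
      by (simp add: moll_nonneg ennreal_mult)
    finally have "ennreal (norm (conv e G (x + s *\<^sub>R z))) * indicator (cball a r) z \<le>
        (\<integral>\<^sup>+w. ennreal (moll e w) * ennreal (norm (G ((x - w) + s *\<^sub>R z))) \<partial>lborel) * indicator (cball a r) z"
      by (rule mult_right_mono) simp
    also have "\<dots> = (\<integral>\<^sup>+w. ennreal (moll e w) * (ennreal (norm (G ((x - w) + s *\<^sub>R z))) * indicator (cball a r) z) \<partial>lborel)"
      by (auto simp: indicator_def)
    finally show "ennreal (norm (conv e G (x + s *\<^sub>R z))) * indicator (cball a r) z \<le>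
        (\<integral>\<^sup>+w. ennreal (moll e w) * (ennreal (norm (G ((x - w) + s *\<^sub>R z))) * indicator (cball a r) z) \<partial>lborel)" .
  qed
  also have "\<dots> = (\<integral>\<^sup>+w. (\<integral>\<^sup>+z. ennreal (moll e w) * (ennreal (norm (G ((x - w) + s *\<^sub>R z))) * indicator (cball a r) z) \<partial>lborel) \<partial>lborel)"
    by (intro lborel_pair.Fubini'[symmetric]) measurable
  also have "\<dots> = (\<integral>\<^sup>+w. ennreal (moll e w) * (\<integral>\<^sup>+z. ennreal (norm (G ((x - w) + s *\<^sub>R z))) * indicator (cball a r) z \<partial>lborel) \<partial>lborel)"
    by (intro nn_integral_cong nn_integral_cmult) measurable
  also have "\<dots> \<le> (\<integral>\<^sup>+w. ennreal (moll e (w::'a)) * ?R \<partial>lborel)"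
    by (intro nn_integral_mono mult_left_mono average_bound G i A q s) simp
  also have "\<dots> = (\<integral>\<^sup>+w. ennreal (moll e (w::'a)) \<partial>lborel) * ?R"
    by (rule nn_integral_multc) measurable
  also have "(\<integral>\<^sup>+w. ennreal (moll e (w::'a)) \<partial>lborel) = 1"
    using nn_integral_eq_integral[OF integrable_moll[OF e, where 'a='a]] integral_moll[OF e, where 'a='a]
    by (simp add: moll_nonneg)
  finally show ?thesis by simp
qed

text \<open>Used with p = n/q, for which p < 1 says q > n.\<close>

lemma nn_integral_powr_unit_interval:
  fixes p :: real
  assumes "p < 1"
  obtains K where "K \<ge> 0" "(\<integral>\<^sup>+s. ennreal (s powr (- p)) * indicator {0<..1} s \<partial>lborel) = ennreal K"
proof -
  have "((\<lambda>s. s powr (- p)) has_integral (1 powr (- p + 1) / (- p + 1))) {0..1}"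
    using assms by (intro has_integral_powr_from_0) auto
  then have "((\<lambda>s. if s \<in> {0..1} then s powr (- p) else 0) has_integral (1 / (1 - p))) UNIV"
    by (subst has_integral_restrict_UNIV) simp
  then have "(\<integral>\<^sup>+s. ennreal (if s \<in> {0..1} then s powr (- p) else 0) \<partial>lborel) = ennreal (1 / (1 - p))"
    by (intro nn_integral_has_integral_lborel) auto
  moreover have "ennreal (if s \<in> {0..1} then s powr (- p) else 0) = ennreal (s powr (- p)) * indicator {0<..1} s" for s
    by (auto simp: indicator_def)
  ultimately show ?thesis using assms by (intro that[of "1 / (1 - p)"]) auto
qed

text \<open>The fundamental theorem of calculus, phrased with an extended nonnegative integral so
  that Tonelli's theorem can follow without integrability conditions. The end point 0 is removed
  because the averages are estimated only for s > 0.\<close>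

lemma norm_diff_le_nn_integral:
  fixes F :: "real \<Rightarrow> 'b::euclidean_space"
  assumes d: "\<And>s. s \<in> {0..1} \<Longrightarrow> (F has_vector_derivative F' s) (at s within {0..1})"
    and c: "continuous_on {0..1} F'" and k: "\<And>s. s \<in> {0..1} \<Longrightarrow> norm (F' s) \<le> k s"
    and kc: "continuous_on {0..1} k"
  shows "ennreal (norm (F 1 - F 0)) \<le> (\<integral>\<^sup>+s. ennreal (k s) * indicator {0<..1} s \<partial>lborel)"
proof -
  have "(F' has_integral (F 1 - F 0)) {0..1}"
    by (rule fundamental_theorem_of_calculus) (use d in auto)
  then have "norm (F 1 - F 0) \<le> integral {0..1} k"
    using integral_norm_bound_integral[of F' "{0..1}" k] k integrable_continuous_interval[OF kc]
    by (metis has_integral_integrable integral_unique)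
  also have "integral {0..1} k = (LINT s:{0..1}|lborel. k s)"
    using borel_integrable_compact[OF compact_Icc kc]
    by (intro set_borel_integral_eq_integral(2)[symmetric]) (simp add: set_integrable_def)
  finally have "ennreal (norm (F 1 - F 0)) \<le> ennreal (LINT s:{0..1}|lborel. k s)" by (rule ennreal_leI)
  also have "\<dots> = (\<integral>\<^sup>+s. ennreal (indicator {0..1} s *\<^sub>R k s) \<partial>lborel)"
  proof -
    have "0 \<le> indicator {0..1} s *\<^sub>R k s" for s
      using k[of s] by (auto simp: indicator_def) (meson norm_ge_zero order_trans)
    then show ?thesis
      unfolding set_lebesgue_integral_def
      by (intro nn_integral_eq_integral[symmetric] borel_integrable_compact[OF compact_Icc kc]) auto
  qed
  also have "\<dots> = (\<integral>\<^sup>+s. ennreal (k s) * indicator {0<..1} s \<partial>lborel)"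
  proof (rule nn_integral_cong_AE)
    have "AE s in lborel. s \<noteq> (0::real)" by (rule AE_lborel_singleton)
    then show "AE s in lborel. ennreal (indicator {0..1} s *\<^sub>R k s) = ennreal (k s) * indicator {0<..1} s"
      by eventually_elim (auto simp: indicator_def)
  qed
  finally show ?thesis .
qed

text \<open>What remains after mollification of g b being the weak derivative of f in direction b: a
  classical derivative wherever the kernel stays inside U. Morrey's inequality is proved from this
  alone and so applies equally to a function and to its derivatives.\<close>

definition regularized_deriv ::
  "'a::euclidean_space set \<Rightarrow> ('a \<Rightarrow> 'b::euclidean_space) \<Rightarrow> ('a \<Rightarrow> 'a \<Rightarrow> 'b) \<Rightarrow> bool" where
  "regularized_deriv U f g \<longleftrightarrow>
     (\<forall>e>0. \<forall>x. cball x e \<subseteq> U \<longrightarrow>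
       (conv e f has_derivative (\<lambda>h. \<Sum>b\<in>Basis. (h \<bullet> b) *\<^sub>R conv e (g b) x)) (at x))"

lemma weak_deriv_regularized:
  fixes f :: "'a::euclidean_space \<Rightarrow> 'b::euclidean_space"
  assumes U: "open U" and f: "borel_rep U f f'" and i: "integrable lborel f'"
    and g: "\<And>b. b \<in> Basis \<Longrightarrow> has_weak_deriv U [b] f (g b) \<and> borel_rep U (g b) (g' b)"
  shows "regularized_deriv U f' g'"
  unfolding regularized_deriv_def
proof (intro allI impI)
  fix e x assume e: "(e::real) > 0" and x: "cball x e \<subseteq> U"
  have 1: "(LINT y|lborel. (mgrad e (x - y) \<bullet> b) *\<^sub>R f' y) = conv e (g' b) x" if b: "b \<in> Basis" for b
  proof -
    \<comment> \<open>The test function is the mollifier centred at x; the minus sign from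
      differentiating \<open>moll e (x - y)\<close> in y cancels the one in the definition of the
      weak derivative.\<close>
    have "(LINT y:U|lebesgue. iter_deriv [b] (\<lambda>y. moll e (x - y)) y *\<^sub>R f y)
        = (-1) ^ length [b] *\<^sub>R (LINT y:U|lebesgue. moll e (x - y) *\<^sub>R g b y)"
      using g[OF b] test_function_moll[OF e x] unfolding has_weak_deriv_def by blast
    then have "(LINT y|lborel. (- (mgrad e (x - y) \<bullet> b)) *\<^sub>R f' y) = - (LINT y|lborel. moll e (x - y) *\<^sub>R g' b y)"
      unfolding iter_deriv_moll[OF e]
      using borel_rep_set_integral(1)[OF f U, of "\<lambda>y. - (mgrad e (x - y) \<bullet> b)"]
        borel_rep_set_integral(1)[OF conjunct2[OF g[OF b]] U, of "\<lambda>y. moll e (x - y)"]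
      by simp
    then show ?thesis by (simp add: conv_def)
  qed
  have "(LINT y|lborel. (mgrad e (x - y) \<bullet> h) *\<^sub>R f' y) = (\<Sum>b\<in>Basis. (h \<bullet> b) *\<^sub>R conv e (g' b) x)" for h
  proof -
    have "(mgrad e (x - y) \<bullet> h) *\<^sub>R f' y = (\<Sum>b\<in>Basis. (h \<bullet> b) *\<^sub>R ((mgrad e (x - y) \<bullet> b) *\<^sub>R f' y))" for y
      by (subst euclidean_inner) (simp add: scaleR_sum_left mult.commute)
    then have "(LINT y|lborel. (mgrad e (x - y) \<bullet> h) *\<^sub>R f' y)
        = (\<Sum>b\<in>Basis. LINT y|lborel. (h \<bullet> b) *\<^sub>R ((mgrad e (x - y) \<bullet> b) *\<^sub>R f' y))"
      by (simp only:) (intro Bochner_Integration.integral_sum integrable_scaleR_right integrable_conv(2)[OF e i])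
    also have "\<dots> = (\<Sum>b\<in>Basis. (h \<bullet> b) *\<^sub>R conv e (g' b) x)"
      by (intro sum.cong refl) (simp only: integral_scaleR_right 1)
    finally show ?thesis .
  qed
  with conv_has_derivative[OF e i, of x]
  show "(conv e f' has_derivative (\<lambda>h. \<Sum>b\<in>Basis. (h \<bullet> b) *\<^sub>R conv e (g' b) x)) (at x)" by simp
qed

lemma continuous_on_conv:
  fixes f :: "'a::euclidean_space \<Rightarrow> 'b::euclidean_space"
  assumes "e > 0" "integrable lborel f" shows "continuous_on S (conv e f)"
  by (intro continuous_at_imp_continuous_on ballI has_derivative_continuous[OF conv_has_derivative[OF assms]])

text \<open>For z in the base ball of the cone, |f(x)| is at most |f(x + z)| plus the integral over
  s of |z . grad f(x + s z)|. Averaging over z and exchanging the integrals leaves averages of the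
  gradient over balls scaled by s, of size s^(-n/q) A, and q > n makes them integrable in s. The
  estimate concerns mollifications, so that f may be differentiated along the cone, and C depends
  neither on U nor on x and e.\<close>

lemma Morrey_pointwise:
  fixes q :: real
  assumes q: "q > DIM('a::euclidean_space)" and r: "r > 0"
  obtains C where "C > 0"
    "\<And>(U :: 'a set) (f :: 'a \<Rightarrow> 'b::euclidean_space) g A x e.
       \<lbrakk>integrable lborel f; \<And>b. b \<in> Basis \<Longrightarrow> integrable lborel (g b); regularized_deriv U f g;
        integrable lborel (\<lambda>x. norm (f x) powr q); (LINT x|lborel. norm (f x) powr q) \<le> A powr q;
        \<And>b. b \<in> Basis \<Longrightarrow> integrable lborel (\<lambda>x. norm (g b x) powr q);
        \<And>b. b \<in> Basis \<Longrightarrow> (LINT x|lborel. norm (g b x) powr q) \<le> A powr q;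
        A > 0; e > 0; \<And>z s. z \<in> cball a r \<Longrightarrow> s \<in> {0..1} \<Longrightarrow> cball (x + s *\<^sub>R z) e \<subseteq> U\<rbrakk>
       \<Longrightarrow> norm (conv e f x) \<le> C * A"
proof -
  let ?B = "cball a r" and ?n = "real DIM('a)"
  define V where "V = measure lborel ?B"
  have V: "V > 0" unfolding V_def using r by simp
  define M where "M = norm a + r"
  have M: "M > 0" using r by (simp add: M_def add_nonneg_pos)
  have q1: "q > 1" using q DIM_positive[where 'a='a] by linarith
  have "?n / q < 1" using q q1 by simp
  then obtain K where K: "K \<ge> 0" "(\<integral>\<^sup>+s. ennreal (s powr (- (?n / q))) * indicator {0<..1} s \<partial>lborel) = ennreal K"
    using nn_integral_powr_unit_interval by metis
  have fin: "emeasure lborel ?B = ennreal V"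
    unfolding V_def by (intro emeasure_eq_ennreal_measure) (metis emeasure_compact_finite compact_cball infinity_ennreal_def less_irrefl)
  \<comment> \<open>V + 1 comes from each use of \<open>conv_average_bound\<close>, M bounds |z| on
    the ball, K is the integral of s^(-n/q) over the unit interval, n counts the components of the
    gradient, and division by V turns the integral over the ball into a mean.\<close>
  define C where "C = ((V + 1) + ?n * (M * (K * (V + 1)))) / V"
  have "C > 0" unfolding C_def using V M K by (intro divide_pos_pos add_pos_nonneg mult_nonneg_nonneg) auto
  moreover have "norm (conv e f x) \<le> C * A"
    if f: "integrable lborel f" and g: "\<And>b. b \<in> Basis \<Longrightarrow> integrable lborel (g b)"
      and d: "regularized_deriv U f g"
      and fq: "integrable lborel (\<lambda>x. norm (f x) powr q)" "(LINT x|lborel. norm (f x) powr q) \<le> A powr q"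
      and gq: "\<And>b. b \<in> Basis \<Longrightarrow> integrable lborel (\<lambda>x. norm (g b x) powr q)"
        "\<And>b. b \<in> Basis \<Longrightarrow> (LINT x|lborel. norm (g b x) powr q) \<le> A powr q"
      and A: "A > 0" and e: "e > 0" and cone: "\<And>z s. z \<in> ?B \<Longrightarrow> s \<in> {0..1} \<Longrightarrow> cball (x + s *\<^sub>R z) e \<subseteq> U"
    for U :: "'a set" and f :: "'a \<Rightarrow> 'b" and g A x e
  proof -
    have fm[measurable]: "f \<in> borel_measurable borel" using borel_measurable_integrable[OF f] by simp
    have gm: "g b \<in> borel_measurable borel" if "b \<in> Basis" for b
      using borel_measurable_integrable[OF g[OF that]] by simp
    have cf[measurable]: "conv e f \<in> borel_measurable borel"
      by (intro borel_measurable_continuous_onI continuous_on_conv e f)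
    have cg[measurable]: "conv e (g b) \<in> borel_measurable borel" if "b \<in> Basis" for b
      by (intro borel_measurable_continuous_onI continuous_on_conv e g that)
    define k where "k z s = (\<Sum>b\<in>Basis. M * norm (conv e (g b) (x + s *\<^sub>R z)))" for z s
    have kmeas[measurable]: "case_prod k \<in> borel_measurable (borel \<Otimes>\<^sub>M borel)"
    proof -
      have "(\<lambda>p. M * norm (conv e (g b) (x + snd p *\<^sub>R fst p))) \<in> borel_measurable (borel \<Otimes>\<^sub>M borel)" if "b \<in> Basis" for b
        using cg[OF that] by measurable
      then have "(\<lambda>p. \<Sum>b\<in>Basis. M * norm (conv e (g b) (x + snd p *\<^sub>R fst p))) \<in> borel_measurable (borel \<Otimes>\<^sub>M borel)"
        by (intro borel_measurable_sum) auto
      then show ?thesis by (simp add: k_def case_prod_beta')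
    qed
    have point: "ennreal (norm (conv e f x)) \<le> ennreal (norm (conv e f (x + 1 *\<^sub>R z)))
        + (\<integral>\<^sup>+s. ennreal (k z s) * indicator {0<..1} s \<partial>lborel)" if z: "z \<in> ?B" for z
    proof -
      have nz: "norm z \<le> M"
      proof -
        have "norm z \<le> norm a + norm (z - a)" by (rule norm_triangle_sub)
        with z show ?thesis by (simp add: M_def dist_norm norm_minus_commute)
      qed
      have "ennreal (norm (conv e f (x + 1 *\<^sub>R z) - conv e f (x + 0 *\<^sub>R z)))
          \<le> (\<integral>\<^sup>+s. ennreal (k z s) * indicator {0<..1} s \<partial>lborel)"
      proof (rule norm_diff_le_nn_integral[where F="\<lambda>s. conv e f (x + s *\<^sub>R z)"
            and F'="\<lambda>s. \<Sum>b\<in>Basis. (z \<bullet> b) *\<^sub>R conv e (g b) (x + s *\<^sub>R z)"])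
        fix s :: real assume s: "s \<in> {0..1}"
        have 1: "((\<lambda>s. x + s *\<^sub>R z) has_derivative (\<lambda>t. t *\<^sub>R z)) (at s within {0..1})"
          by (auto intro!: derivative_eq_intros)
        have 2: "(conv e f has_derivative (\<lambda>h. \<Sum>b\<in>Basis. (h \<bullet> b) *\<^sub>R conv e (g b) (x + s *\<^sub>R z))) (at (x + s *\<^sub>R z))"
          using d cone[OF z s] e unfolding regularized_deriv_def by blast
        from has_derivative_compose[OF 1 2]
        show "((\<lambda>s. conv e f (x + s *\<^sub>R z)) has_vector_derivative
            (\<Sum>b\<in>Basis. (z \<bullet> b) *\<^sub>R conv e (g b) (x + s *\<^sub>R z))) (at s within {0..1})"
          by (simp add: has_vector_derivative_def scaleR_sum_right)
        show "norm (\<Sum>b\<in>Basis. (z \<bullet> b) *\<^sub>R conv e (g b) (x + s *\<^sub>R z)) \<le> k z s"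
          unfolding k_def
        proof (rule sum_norm_le)
          fix b :: 'a assume b: "b \<in> Basis"
          have "\<bar>z \<bullet> b\<bar> \<le> M" using Basis_le_norm[OF b, of z] nz by linarith
          then show "norm ((z \<bullet> b) *\<^sub>R conv e (g b) (x + s *\<^sub>R z)) \<le> M * norm (conv e (g b) (x + s *\<^sub>R z))"
            by (simp add: mult_right_mono)
        qed
      next
        have c: "continuous_on {0..1} (\<lambda>s. conv e (g b) (x + s *\<^sub>R z))" if b: "b \<in> Basis" for b
          by (rule continuous_on_compose2[OF continuous_on_conv[OF e g[OF b], of UNIV]]) (auto intro!: continuous_intros)
        show "continuous_on {0..1} (\<lambda>s. \<Sum>b\<in>Basis. (z \<bullet> b) *\<^sub>R conv e (g b) (x + s *\<^sub>R z))"
          by (intro continuous_intros c)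
        show "continuous_on {0..1} (k z)"
          unfolding k_def by (intro continuous_intros c)
      qed
      moreover have "norm (conv e f x) \<le> norm (conv e f (x + 1 *\<^sub>R z)) + norm (conv e f (x + 1 *\<^sub>R z) - conv e f (x + 0 *\<^sub>R z))"
        using norm_triangle_sub[of "conv e f x" "conv e f (x + z)"] by (simp add: norm_minus_commute)
      then have "ennreal (norm (conv e f x)) \<le> ennreal (norm (conv e f (x + 1 *\<^sub>R z)))
          + ennreal (norm (conv e f (x + 1 *\<^sub>R z) - conv e f (x + 0 *\<^sub>R z)))"
        by (simp flip: ennreal_plus)
      ultimately show ?thesis by (meson add_left_mono order_trans)
    qed
    have "ennreal (norm (conv e f x) * V) = (\<integral>\<^sup>+z. ennreal (norm (conv e f x)) * indicator ?B z \<partial>lborel)"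
      using V by (simp add: nn_integral_cmult_indicator fin ennreal_mult)
    also have "\<dots> \<le> (\<integral>\<^sup>+z. ennreal (norm (conv e f (x + 1 *\<^sub>R z))) * indicator ?B z
        + (\<integral>\<^sup>+s. ennreal (k z s) * indicator {0<..1} s \<partial>lborel) * indicator ?B z \<partial>lborel)"
    proof (intro nn_integral_mono)
      fix z
      show "ennreal (norm (conv e f x)) * indicator ?B z \<le> ennreal (norm (conv e f (x + 1 *\<^sub>R z))) * indicator ?B z
        + (\<integral>\<^sup>+s. ennreal (k z s) * indicator {0<..1} s \<partial>lborel) * indicator ?B z"
        using point[of z] by (cases "z \<in> ?B") simp_all
    qed
    also have "\<dots> = (\<integral>\<^sup>+z. ennreal (norm (conv e f (x + 1 *\<^sub>R z))) * indicator ?B z \<partial>lborel)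
        + (\<integral>\<^sup>+z. (\<integral>\<^sup>+s. ennreal (k z s) * indicator {0<..1} s \<partial>lborel) * indicator ?B z \<partial>lborel)"
      by (intro nn_integral_add) (measurable, measurable)
    finally have main: "ennreal (norm (conv e f x) * V) \<le> (\<integral>\<^sup>+z. ennreal (norm (conv e f (x + 1 *\<^sub>R z))) * indicator ?B z \<partial>lborel)
        + (\<integral>\<^sup>+z. (\<integral>\<^sup>+s. ennreal (k z s) * indicator {0<..1} s \<partial>lborel) * indicator ?B z \<partial>lborel)" .
    have "(\<integral>\<^sup>+z. (\<integral>\<^sup>+s. ennreal (k z s) * indicator {0<..1} s \<partial>lborel) * indicator ?B z \<partial>lborel)
        = (\<integral>\<^sup>+z. (\<integral>\<^sup>+s. ennreal (k z s) * indicator ?B z * indicator {0<..1} s \<partial>lborel) \<partial>lborel)"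
      by (intro nn_integral_cong) (auto simp: indicator_def)
    also have "\<dots> = (\<integral>\<^sup>+s. (\<integral>\<^sup>+z. ennreal (k z s) * indicator ?B z * indicator {0<..1} s \<partial>lborel) \<partial>lborel)"
      by (intro lborel_pair.Fubini'[symmetric]) measurable
    also have "\<dots> \<le> (\<integral>\<^sup>+s. ennreal (?n * (M * (A * (V + 1)))) * (ennreal (s powr (- (?n / q))) * indicator {0<..1} s) \<partial>lborel)"
    proof (intro nn_integral_mono)
      fix s :: real
      show "(\<integral>\<^sup>+z. ennreal (k z s) * indicator ?B z * indicator {0<..1} s \<partial>lborel)
          \<le> ennreal (?n * (M * (A * (V + 1)))) * (ennreal (s powr (- (?n / q))) * indicator {0<..1} s)"
      proof (cases "s \<in> {0<..1}")
        case True
        then have s: "s > 0" by simp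
        have "(\<integral>\<^sup>+z. ennreal (k z s) * indicator ?B z \<partial>lborel)
            = (\<integral>\<^sup>+z. (\<Sum>b\<in>Basis. ennreal M * (ennreal (norm (conv e (g b) (x + s *\<^sub>R z))) * indicator ?B z)) \<partial>lborel)"
          using M by (intro nn_integral_cong) (simp add: k_def ennreal_mult sum_distrib_right mult.assoc flip: sum_ennreal)
        also have "\<dots> = (\<Sum>b\<in>Basis. ennreal M * (\<integral>\<^sup>+z. ennreal (norm (conv e (g b) (x + s *\<^sub>R z))) * indicator ?B z \<partial>lborel))"
          by (subst nn_integral_sum) (auto intro!: sum.cong nn_integral_cmult)
        also have "\<dots> \<le> (\<Sum>b\<in>(Basis::'a set). ennreal M * ennreal (s powr (- (?n / q)) * (A * (V + 1))))"
          unfolding V_def by (intro sum_mono mult_left_mono conv_average_bound gm gq A q1 s e) auto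
        also have "\<dots> = ennreal (?n * (M * (s powr (- (?n / q)) * (A * (V + 1)))))"
          using M A V by (simp add: ennreal_mult ennreal_of_nat_eq_real_of_nat)
        also have "?n * (M * (s powr (- (?n / q)) * (A * (V + 1)))) = (?n * (M * (A * (V + 1)))) * s powr (- (?n / q))"
          by (simp only: mult_ac)
        also have "ennreal \<dots> = ennreal (?n * (M * (A * (V + 1)))) * ennreal (s powr (- (?n / q)))"
          using M A V by (intro ennreal_mult mult_nonneg_nonneg) auto
        finally show ?thesis using True by simp
      qed simp
    qed
    also have "\<dots> = ennreal (?n * (M * (A * (V + 1)))) * ennreal K"
      unfolding K(2)[symmetric] by (intro nn_integral_cmult) measurable
    also have "\<dots> = ennreal (?n * (M * (A * (V + 1))) * K)"
      using M A V K by (intro ennreal_mult[symmetric] mult_nonneg_nonneg) auto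
    finally have h2: "(\<integral>\<^sup>+z. (\<integral>\<^sup>+s. ennreal (k z s) * indicator {0<..1} s \<partial>lborel) * indicator ?B z \<partial>lborel)
        \<le> ennreal (?n * (M * (A * (V + 1))) * K)" .
    have h1: "(\<integral>\<^sup>+z. ennreal (norm (conv e f (x + 1 *\<^sub>R z))) * indicator ?B z \<partial>lborel) \<le> ennreal (A * (V + 1))"
      using conv_average_bound[OF fm fq A q1 _ e, of 1 x a r] by (simp add: V_def)
    have "ennreal (norm (conv e f x) * V) \<le> ennreal (A * (V + 1)) + ennreal (?n * (M * (A * (V + 1))) * K)"
      by (rule order_trans[OF main add_mono[OF h1 h2]])
    also have "ennreal (A * (V + 1)) + ennreal (?n * (M * (A * (V + 1))) * K)
        = ennreal (A * (V + 1) + ?n * (M * (A * (V + 1))) * K)"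
      using M A V K by (intro ennreal_plus[symmetric] mult_nonneg_nonneg) auto
    finally have "norm (conv e f x) * V \<le> A * (V + 1) + ?n * (M * (A * (V + 1))) * K"
      using M A V K(1) by (subst (asm) ennreal_le_iff) (auto intro!: add_nonneg_nonneg mult_nonneg_nonneg)
    also have "\<dots> = A * (C * V)"
    proof -
      have "C * V = (V + 1) + ?n * (M * (K * (V + 1)))" using V by (simp add: C_def)
      then show ?thesis by (simp only:) (simp add: algebra_simps)
    qed
    also have "\<dots> = C * A * V" by simp
    finally show ?thesis using V by simp
  qed
  ultimately show ?thesis by (rule that)
qed

section \<open>Cone condition and Lipschitz embedding of W^{2,q}\<close>

definition cone_condition :: "'a::euclidean_space set \<Rightarrow> bool" where
  "cone_condition U \<longleftrightarrow> (\<exists>P :: ('a \<times> real) set. finite P \<and> (\<forall>(a, r)\<in>P. r > 0) \<and>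
     (\<forall>x\<in>U. \<exists>(a, r)\<in>P. \<forall>z\<in>cball a r. \<forall>s\<in>{0..1}. x + s *\<^sub>R z \<in> U))"

text \<open>The cone with vertex x is compact, hence it has a margin inside the open set U. Half of
  the margin goes to moving the vertex, half to the mollification radius.\<close>

lemma cone_neighbourhood:
  fixes U :: "'a::euclidean_space set"
  assumes U: "open U" and cone: "\<And>z s. z \<in> cball a r \<Longrightarrow> s \<in> {0..1::real} \<Longrightarrow> x + s *\<^sub>R z \<in> U"
  obtains d where "d > 0" "\<And>y e z s. y \<in> ball x d \<Longrightarrow> e \<le> d \<Longrightarrow> z \<in> cball a r \<Longrightarrow> s \<in> {0..1::real} \<Longrightarrow> cball (y + s *\<^sub>R z) e \<subseteq> U"
proof -
  define H where "H = (\<lambda>(s, z). x + s *\<^sub>R z) ` ({0..1::real} \<times> cball a r)"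
  have "compact H"
    unfolding H_def by (intro compact_continuous_image compact_Times compact_Icc compact_cball)
      (auto intro!: continuous_intros simp: case_prod_beta')
  moreover have "H \<subseteq> U" unfolding H_def using cone by auto
  ultimately obtain d where d: "d > 0" "(\<Union>h\<in>H. cball h d) \<subseteq> U"
    using compact_subset_open_imp_cball_epsilon_subset[OF _ U] by metis
  have "cball (y + s *\<^sub>R z) e \<subseteq> U" if y: "y \<in> ball x (d/2)" "e \<le> d/2" "z \<in> cball a r" "s \<in> {0..1}" for y e z and s :: real
  proof -
    have "x + s *\<^sub>R z \<in> H" unfolding H_def using y(3,4) by (intro image_eqI[of _ _ "(s, z)"]) auto
    moreover have "cball (y + s *\<^sub>R z) e \<subseteq> cball (x + s *\<^sub>R z) d"
      using y(1,2) by (intro cball_subset_cball_iff[THEN iffD2]) (auto simp: dist_norm norm_minus_commute)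
    ultimately show ?thesis using d(2) by blast
  qed
  with d(1) show ?thesis by (intro that[of "d/2"]) auto
qed

text \<open>The domain need not be convex, so Lipschitz bounds are claimed along segments only.
  Local bounds with a common constant add up along the segment; the bisection principle
  \<open>Bolzano\<close> takes the place of an explicit subdivision.\<close>

lemma lipschitz_along_segment:
  fixes v :: "'a::real_normed_vector \<Rightarrow> 'b::real_normed_vector"
  assumes local: "\<And>z. z \<in> closed_segment x y \<Longrightarrow>
      \<exists>d>0. \<forall>y1\<in>ball z d. \<forall>y2\<in>ball z d. norm (v y1 - v y2) \<le> L * norm (y1 - y2)"
  shows "norm (v x - v y) \<le> L * norm (x - y)"
proof -
  define p where "p t = x + t *\<^sub>R (y - x)" for t :: real
  have "norm (v (p 0) - v (p 1)) \<le> L * norm (x - y) * (1 - 0)"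
  proof (rule Bolzano[of 0 "1::real" "\<lambda>a b. norm (v (p a) - v (p b)) \<le> L * norm (x - y) * (b - a)"])
    fix a b c :: real
    assume "norm (v (p a) - v (p b)) \<le> L * norm (x - y) * (b - a)"
      "norm (v (p b) - v (p c)) \<le> L * norm (x - y) * (c - b)"
    then show "norm (v (p a) - v (p c)) \<le> L * norm (x - y) * (c - a)"
      using norm_triangle_ineq[of "v (p a) - v (p b)" "v (p b) - v (p c)"] by (simp add: algebra_simps)
  next
    fix t :: real assume t: "0 \<le> t" "t \<le> 1"
    have "p t \<in> closed_segment x y"
      unfolding closed_segment_def p_def using t by (auto intro!: exI[of _ t] simp: algebra_simps)
    from local[OF this] obtain d where d: "d > 0"
      "\<And>y1 y2. y1 \<in> ball (p t) d \<Longrightarrow> y2 \<in> ball (p t) d \<Longrightarrow> norm (v y1 - v y2) \<le> L * norm (y1 - y2)" by blast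
    define \<delta> where "\<delta> = d / (norm (y - x) + 1)"
    have np: "norm (y - x) + 1 > 0" by (simp add: add_nonneg_pos)
    have "\<delta> > 0" using d(1) np by (simp add: \<delta>_def)
    moreover have "norm (v (p a) - v (p b)) \<le> L * norm (x - y) * (b - a)"
      if ab: "a \<le> t" "t \<le> b" "b - a < \<delta>" for a b
    proof -
      have "p c \<in> ball (p t) d" if c: "a \<le> c" "c \<le> b" for c
      proof -
        have "norm (p c - p t) = \<bar>c - t\<bar> * norm (y - x)"
        proof -
          have "p c - p t = (c - t) *\<^sub>R (y - x)" by (simp add: p_def algebra_simps)
          then show ?thesis by (simp only: norm_scaleR)
        qed
        also have "\<dots> \<le> \<bar>c - t\<bar> * (norm (y - x) + 1)" by (intro mult_left_mono) auto
        also have "\<dots> < \<delta> * (norm (y - x) + 1)" using c ab np by (intro mult_strict_right_mono) auto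
        also have "\<dots> = d" using np by (simp add: \<delta>_def)
        finally show ?thesis by (simp add: dist_norm norm_minus_commute)
      qed
      then have "norm (v (p a) - v (p b)) \<le> L * norm (p a - p b)"
        using d(2) ab by simp
      also have "norm (p a - p b) = norm ((a - b) *\<^sub>R (y - x))"
        unfolding p_def by (simp add: scaleR_diff_left)
      also have "\<dots> = norm (x - y) * (b - a)" using ab by (simp add: norm_minus_commute)
      finally show ?thesis by (simp add: mult.assoc)
    qed
    ultimately show "\<exists>d>0. \<forall>a b. a \<le> t \<and> t \<le> b \<and> b - a < d \<longrightarrow> norm (v (p a) - v (p b)) \<le> L * norm (x - y) * (b - a)"
      by blast
  qed simp
  then show ?thesis by (simp add: p_def)
qed

lemma Lp_cong_AE:
  fixes f :: "'a::euclidean_space \<Rightarrow> 'b::euclidean_space"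
  assumes f: "f \<in> Lp U p" and g: "g \<in> borel_measurable (lebesgue_on U)" and ae: "AE x in lebesgue_on U. f x = g x"
  shows "g \<in> Lp U p" and "(LINT x|lebesgue_on U. norm (g x) powr p) = (LINT x|lebesgue_on U. norm (f x) powr p)"
proof -
  have m: "(\<lambda>x. norm (f x) powr p) \<in> borel_measurable (lebesgue_on U)" "(\<lambda>x. norm (g x) powr p) \<in> borel_measurable (lebesgue_on U)"
    using f g by (auto simp: Lp_def)
  have ae': "AE x in lebesgue_on U. norm (f x) powr p = norm (g x) powr p"
    using ae by eventually_elim simp
  show "g \<in> Lp U p" using f g integrable_cong_AE[OF m ae'] by (simp add: Lp_def)
  show "(LINT x|lebesgue_on U. norm (g x) powr p) = (LINT x|lebesgue_on U. norm (f x) powr p)"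
    by (rule integral_cong_AE[OF m ae', symmetric])
qed

text \<open>The empty list of directions gives a weak derivative of order zero, so one of the terms
  in the Sobolev norm is the L^p norm of f itself.\<close>

lemma Sobolev_self:
  fixes f :: "'a::euclidean_space \<Rightarrow> 'b::euclidean_space"
  assumes U: "open U" and f: "f \<in> Sobolev U k p" and p: "p > 0"
  shows "f \<in> Lp U p" and "(LINT x|lebesgue_on U. norm (f x) powr p) \<le> Sobolev_norm U k p f powr p"
    and "locally_integrable_on U f" and "AE x in lebesgue_on U. wderiv U [] f x = f x"
proof -
  have nil: "[] \<in> multi_indices k" by (simp add: multi_indices_def)
  note w = Sobolev_wderiv[OF U f nil p]
  show l: "locally_integrable_on U f" using w(1) by (simp add: has_weak_deriv_def)
  then have "has_weak_deriv U [] f f" by (simp add: has_weak_deriv_def)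
  from has_weak_deriv_unique[OF U w(1) this]
  show ae: "AE x in lebesgue_on U. wderiv U [] f x = f x"
    using U by (simp add: AE_restrict_space_iff)
  note c = Lp_cong_AE[OF w(2) locally_integrable_measurable[OF U l] ae]
  show "f \<in> Lp U p" by (rule c)
  show "(LINT x|lebesgue_on U. norm (f x) powr p) \<le> Sobolev_norm U k p f powr p"
    using c(2) Sobolev_norm_ge[OF nil p] by metis
qed

text \<open>On a bounded set |f| \<le> 1 + |f|^q suffices.\<close>

lemma integrable_of_powr:
  fixes f :: "'a::euclidean_space \<Rightarrow> 'b::euclidean_space"
  assumes U: "open U" "bounded U" and f: "f \<in> borel_measurable borel" "\<And>x. x \<notin> U \<Longrightarrow> f x = 0"
    and i: "integrable lborel (\<lambda>x. norm (f x) powr q)" and q: "q > 1"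
  shows "integrable lborel f"
proof (rule Bochner_Integration.integrable_bound[where f="\<lambda>x. indicator U x + norm (f x) powr q"])
  have "emeasure lborel U < \<infinity>" using U(2) by (rule emeasure_bounded_finite)
  then have "integrable lborel (indicator U :: 'a \<Rightarrow> real)" using U(1) by simp
  then show "integrable lborel (\<lambda>x. indicator U x + norm (f x) powr q)" using i by simp
  show "AE x in lborel. norm (f x) \<le> norm (indicator U x + norm (f x) powr q)"
  proof (intro AE_I2)
    fix x show "norm (f x) \<le> norm (indicator U x + norm (f x) powr q)"
    proof (cases "x \<in> U")
      case True
      then show ?thesis using powr_Young[of "norm (f x)" 1 q] q by simp
    qed (simp add: f(2))
  qed
qed (use f in simp)

text \<open>Morrey's inequality is applied to u for the sup bound and to each first derivative for
  the Lipschitz bound; both pass from the mollifications to the continuous representative v as the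
  radius tends to zero. The cone condition offers finitely many shapes, so a single constant serves
  all points. The summand 1 beside the norm keeps the bound positive, as Morrey's inequality asks
  for A > 0.\<close>

lemma Sobolev_embedding_Lipschitz:
  fixes U :: "'a::euclidean_space set" and q :: real
  assumes U: "open U" "bounded U" and cone: "cone_condition U" and q: "q > DIM('a)"
  obtains C where "C > 0"
    "\<And>(u :: 'a \<Rightarrow> 'b::euclidean_space) v. u \<in> Sobolev U 2 q \<Longrightarrow> continuous_on U v \<Longrightarrow> AE x in lebesgue_on U. v x = u x \<Longrightarrow>
       (\<forall>x\<in>U. norm (v x) \<le> C * (Sobolev_norm U 2 q u + 1)) \<and>
       (\<forall>x y. closed_segment x y \<subseteq> U \<longrightarrow> norm (v x - v y) \<le> C * (Sobolev_norm U 2 q u + 1) * norm (x - y))"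
proof -
  obtain P :: "('a \<times> real) set" where P: "finite P" "\<And>a r. (a, r) \<in> P \<Longrightarrow> r > 0"
    "\<And>x. x \<in> U \<Longrightarrow> \<exists>(a, r)\<in>P. \<forall>z\<in>cball a r. \<forall>s\<in>{0..1}. x + s *\<^sub>R z \<in> U"
    using cone unfolding cone_condition_def by blast
  have q1: "q > 1" using q DIM_positive[where 'a='a] by linarith
  \<comment> \<open>Morrey's inequality is restated as an object-level formula so that a constant
    can be chosen for every cone shape.\<close>
  define Mor where "Mor C a r \<longleftrightarrow> C > 0 \<and> (\<forall>(U :: 'a set) (f :: 'a \<Rightarrow> 'b) g A x e.
       integrable lborel f \<longrightarrow> (\<forall>b\<in>Basis. integrable lborel (g b)) \<longrightarrow> regularized_deriv U f g \<longrightarrow>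
        integrable lborel (\<lambda>x. norm (f x) powr q) \<longrightarrow> (LINT x|lborel. norm (f x) powr q) \<le> A powr q \<longrightarrow>
        (\<forall>b\<in>Basis. integrable lborel (\<lambda>x. norm (g b x) powr q)) \<longrightarrow>
        (\<forall>b\<in>Basis. (LINT x|lborel. norm (g b x) powr q) \<le> A powr q) \<longrightarrow>
        A > 0 \<longrightarrow> e > 0 \<longrightarrow> (\<forall>z s. z \<in> cball a r \<longrightarrow> s \<in> {0..1} \<longrightarrow> cball (x + s *\<^sub>R z) e \<subseteq> U)
       \<longrightarrow> norm (conv e f x) \<le> C * A)" for C a r
  have "\<exists>C. Mor C a r" if ar: "(a, r) \<in> P" for a r
  proof -
    obtain C where C: "C > 0"
      "\<And>(U :: 'a set) (f :: 'a \<Rightarrow> 'b::euclidean_space) g A x e.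
       \<lbrakk>integrable lborel f; \<And>b. b \<in> Basis \<Longrightarrow> integrable lborel (g b); regularized_deriv U f g;
        integrable lborel (\<lambda>x. norm (f x) powr q); (LINT x|lborel. norm (f x) powr q) \<le> A powr q;
        \<And>b. b \<in> Basis \<Longrightarrow> integrable lborel (\<lambda>x. norm (g b x) powr q);
        \<And>b. b \<in> Basis \<Longrightarrow> (LINT x|lborel. norm (g b x) powr q) \<le> A powr q;
        A > 0; e > 0; \<And>z s. z \<in> cball a r \<Longrightarrow> s \<in> {0..1} \<Longrightarrow> cball (x + s *\<^sub>R z) e \<subseteq> U\<rbrakk>
       \<Longrightarrow> norm (conv e f x) \<le> C * A"
      using Morrey_pointwise[OF q P(2)[OF ar], where a=a and 'b='b] by blast
    have "Mor C a r"
      unfolding Mor_def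
    proof (intro conjI allI impI C(1))
      fix U :: "'a set" and f :: "'a \<Rightarrow> 'b" and g A x e
      assume h: "integrable lborel f" "\<forall>b\<in>Basis. integrable lborel (g b)" "regularized_deriv U f g"
        "integrable lborel (\<lambda>x. norm (f x) powr q)" "(LINT x|lborel. norm (f x) powr q) \<le> A powr q"
        "\<forall>b\<in>Basis. integrable lborel (\<lambda>x. norm (g b x) powr q)"
        "\<forall>b\<in>Basis. (LINT x|lborel. norm (g b x) powr q) \<le> A powr q"
        "A > 0" "e > 0" "\<forall>z s. z \<in> cball a r \<longrightarrow> s \<in> {0..1} \<longrightarrow> cball (x + s *\<^sub>R z) e \<subseteq> U"
      show "norm (conv e f x) \<le> C * A"
      proof (rule C(2)[where U=U and f=f and g=g and A=A and x=x and e=e])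
        show "cball (x + s *\<^sub>R z) e \<subseteq> U" if "z \<in> cball a r" "s \<in> {0..1}" for z s
          using h(10) that by blast
      qed (use h(1-9) in auto)
    qed
    then show ?thesis by blast
  qed
  then have "\<forall>p. \<exists>C. p \<in> P \<longrightarrow> Mor C (fst p) (snd p)" by (metis prod.collapse)
  from choice[OF this] obtain Cp where Cp: "\<And>a r. (a, r) \<in> P \<Longrightarrow> Mor (Cp (a, r)) a r" by fastforce
  \<comment> \<open>One constant above the finitely many cone constants; the 1 keeps it
    positive.\<close>
  define C0 where "C0 = 1 + (\<Sum>p\<in>P. Cp p)"
  have Cp_pos: "Cp p > 0" if "p \<in> P" for p using Cp[of "fst p" "snd p"] that by (simp add: Mor_def)
  have C0: "C0 > 0" unfolding C0_def using Cp_pos by (intro add_pos_nonneg sum_nonneg) (auto intro: less_imp_le)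
  have Cp_le: "Cp p \<le> C0" if "p \<in> P" for p
    unfolding C0_def using member_le_sum[OF that, of Cp] P(1) Cp_pos by (simp add: less_imp_le add_increasing)
  let ?n = "real DIM('a)"
  \<comment> \<open>The mollified gradient has n components, each bounded by C0 A, so its operator
    norm is at most n C0 A.\<close>
  define C where "C = ?n * C0"
  have n1: "?n \<ge> 1" using DIM_positive[where 'a='a] by (metis One_nat_def Suc_leI of_nat_1 of_nat_mono)
  have C: "C > 0" "C0 \<le> C" using C0 n1 by (auto simp: C_def)
  have "(\<forall>x\<in>U. norm (v x) \<le> C * (Sobolev_norm U 2 q u + 1)) \<and>
       (\<forall>x y. closed_segment x y \<subseteq> U \<longrightarrow> norm (v x - v y) \<le> C * (Sobolev_norm U 2 q u + 1) * norm (x - y))"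
    if u: "u \<in> Sobolev U 2 q" and v: "continuous_on U v" and vu: "AE x in lebesgue_on U. v x = u x" for u v :: "'a \<Rightarrow> 'b"
  proof -
    define A where "A = Sobolev_norm U 2 q u + 1"
    have N0: "Sobolev_norm U 2 q u \<ge> 0" by (simp add: Sobolev_norm_def)
    then have A: "A > 0" by (simp add: A_def)
    have NA: "Sobolev_norm U 2 q u powr q \<le> A powr q"
      using N0 q1 by (intro powr_mono2) (auto simp: A_def)
    have q0: "q > 0" using q1 by simp
    note su = Sobolev_self[OF U(1) u q0]
    have um: "u \<in> borel_measurable (lebesgue_on U)" using su(1) by (simp add: Lp_def)
    obtain u' where u': "borel_rep U u u'" using borel_rep_exists[OF U(1) um] by blast
    have u'z: "u' \<in> borel_measurable borel" "\<And>x. x \<notin> U \<Longrightarrow> u' x = 0" using u' by (auto simp: borel_rep_def)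
    have u'q: "integrable lborel (\<lambda>x. norm (u' x) powr q)" "(LINT x|lborel. norm (u' x) powr q) \<le> A powr q"
      using borel_rep_powr[OF u' U(1) q0 su(1)] su(2) NA by auto
    have u'i: "integrable lborel u'" by (rule integrable_of_powr[OF U u'z u'q(1) q1])
    define w where "w bs = wderiv U bs u" for bs
    have rep: "\<exists>g. borel_rep U (w bs) g \<and> integrable lborel g \<and> integrable lborel (\<lambda>x. norm (g x) powr q) \<and>
        (LINT x|lborel. norm (g x) powr q) \<le> A powr q" if bs: "bs \<in> multi_indices 2" for bs
    proof -
      have wLp: "w bs \<in> Lp U q" unfolding w_def by (rule Sobolev_wderiv(2)[OF U(1) u bs q0])
      then obtain g where g: "borel_rep U (w bs) g"
        using borel_rep_exists[OF U(1), of "w bs"] by (auto simp: Lp_def)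
      have gq: "integrable lborel (\<lambda>x. norm (g x) powr q)" "(LINT x|lborel. norm (g x) powr q) \<le> A powr q"
        using borel_rep_powr[OF g U(1) q0 wLp] Sobolev_norm_ge[OF bs q0, of U u] NA by (auto simp: w_def)
      have "integrable lborel g"
        using g by (intro integrable_of_powr[OF U _ _ gq(1) q1]) (auto simp: borel_rep_def)
      with g gq show ?thesis by blast
    qed
    then have "\<forall>bs. \<exists>g. bs \<in> multi_indices 2 \<longrightarrow> borel_rep U (w bs) g \<and> integrable lborel g \<and> integrable lborel (\<lambda>x. norm (g x) powr q) \<and>
        (LINT x|lborel. norm (g x) powr q) \<le> A powr q" by blast
    from choice[OF this] obtain G where G: "\<And>bs. bs \<in> multi_indices 2 \<Longrightarrow> borel_rep U (w bs) (G bs) \<and> integrable lborel (G bs) \<and>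
        integrable lborel (\<lambda>x. norm (G bs x) powr q) \<and> (LINT x|lborel. norm (G bs x) powr q) \<le> A powr q" by blast
    have mi: "[b] \<in> multi_indices 2" "[b, c] \<in> multi_indices 2" if "b \<in> Basis" "c \<in> Basis" for b c :: 'a
      using that by (auto simp: multi_indices_def)
    have wd: "has_weak_deriv U bs u (w bs)" if "bs \<in> multi_indices 2" for bs
      unfolding w_def by (rule Sobolev_wderiv(1)[OF U(1) u that q0])
    have reg1: "regularized_deriv U u' (\<lambda>b. G [b])"
      by (rule weak_deriv_regularized[OF U(1) u' u'i]) (use mi wd G in blast)
    have reg2: "regularized_deriv U (G [c]) (\<lambda>b. G [c, b])" if c: "c \<in> Basis" for c
    proof (rule weak_deriv_regularized[OF U(1)])
      show "borel_rep U (w [c]) (G [c])" "integrable lborel (G [c])" using G mi c by blast+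
      show "has_weak_deriv U [b] (w [c]) (w [c, b]) \<and> borel_rep U (w [c, b]) (G [c, b])" if b: "b \<in> Basis" for b
        using has_weak_deriv_Cons[OF wd wd b] G mi c b by blast
    qed
    \<comment> \<open>The cone may change from point to point, but its shape is one of finitely
      many, and near x the same shape serves all vertices y and all small radii.\<close>
    have near: "\<exists>d>0. ball x d \<subseteq> U \<and> (\<forall>y\<in>ball x d. \<forall>e. 0 < e \<longrightarrow> e \<le> d \<longrightarrow>
        cball y e \<subseteq> U \<and> norm (conv e u' y) \<le> C0 * A \<and> (\<forall>b\<in>Basis. norm (conv e (G [b]) y) \<le> C0 * A))" if x: "x \<in> U" for x
    proof -
      obtain a r where ar: "(a, r) \<in> P" "\<And>z s. z \<in> cball a r \<Longrightarrow> s \<in> {0..1} \<Longrightarrow> x + s *\<^sub>R z \<in> U"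
        using P(3)[OF x] by blast
      obtain d where d: "d > 0" "\<And>y e z s. y \<in> ball x d \<Longrightarrow> e \<le> d \<Longrightarrow> z \<in> cball a r \<Longrightarrow> s \<in> {0..1} \<Longrightarrow> cball (y + s *\<^sub>R z) e \<subseteq> U"
        using cone_neighbourhood[OF U(1) ar(2)] by metis
      have aB: "a \<in> cball a r" using P(2)[OF ar(1)] by simp
      have cb: "cball y e \<subseteq> U" if "y \<in> ball x d" "e \<le> d" for y e
        using d(2)[OF that aB, of 0] by simp
      have M: "Mor (Cp (a, r)) a r" by (rule Cp[OF ar(1)])
      have le: "Cp (a, r) * A \<le> C0 * A" using Cp_le[OF ar(1)] A by simp
      have c1: "norm (conv e u' y) \<le> C0 * A" if y: "y \<in> ball x d" "0 < e" "e \<le> d" for y e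
      proof -
        have "norm (conv e u' y) \<le> Cp (a, r) * A"
          using M[unfolded Mor_def, THEN conjunct2, rule_format, of u' "\<lambda>b. G [b]" U A e y]
            u'i u'q reg1 G mi A y d(2) by blast
        with le show ?thesis by linarith
      qed
      have c2: "norm (conv e (G [b]) y) \<le> C0 * A" if y: "y \<in> ball x d" "0 < e" "e \<le> d" and b: "b \<in> Basis" for y e b
      proof -
        have "norm (conv e (G [b]) y) \<le> Cp (a, r) * A"
          using M[unfolded Mor_def, THEN conjunct2, rule_format, of "G [b]" "\<lambda>c. G [b, c]" U A e y]
            reg2[OF b] G mi A y b d(2) by blast
        with le show ?thesis by linarith
      qed
      have "ball x d \<subseteq> U" using cb[of _ 0] d(1) by auto
      with cb c1 c2 d(1) show ?thesis by blast
    qed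
    have u'v: "AE y in lborel. y \<in> U \<longrightarrow> u' y = v y"
    proof -
      have "AE y in lebesgue. y \<in> U \<longrightarrow> v y = u y" using vu U(1) by (simp add: AE_restrict_space_iff)
      then have "AE y in lborel. y \<in> U \<longrightarrow> v y = u y" by (simp add: AE_completion_iff)
      moreover have "AE y in lborel. y \<in> U \<longrightarrow> u' y = u y" using u' by (simp add: borel_rep_def)
      ultimately show ?thesis by eventually_elim simp
    qed
    have approx: "\<exists>\<delta>>0. \<forall>e. 0 < e \<longrightarrow> e \<le> \<delta> \<longrightarrow> norm (conv e u' x - v x) \<le> \<epsilon>" if x: "x \<in> U" and \<epsilon>: "\<epsilon> > 0" for x \<epsilon>
    proof -
      have "continuous (at x) v" using v x U(1) by (simp add: continuous_on_eq_continuous_at)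
      then obtain d1 where d1: "d1 > 0" "\<And>y. dist y x < d1 \<Longrightarrow> dist (v y) (v x) < \<epsilon>"
        using \<epsilon> unfolding continuous_at_eps_delta by blast
      obtain d2 where d2: "d2 > 0" "cball x d2 \<subseteq> U" using U(1) x open_contains_cball by metis
      have "norm (conv e u' x - v x) \<le> \<epsilon>" if e: "0 < e" "e \<le> min (d1/2) d2" for e
      proof (rule conv_approx[OF e(1) u'i])
        show "AE y in lborel. y \<in> cball x e \<longrightarrow> norm (u' y - v x) \<le> \<epsilon>"
          using u'v
        proof eventually_elim
          case (elim y)
          show ?case
          proof
            assume y: "y \<in> cball x e"
            then have "y \<in> U" using d2(2) e(2) by auto
            moreover have "dist y x < d1" using y e d1(1) by (simp add: dist_commute)
            ultimately show "norm (u' y - v x) \<le> \<epsilon>" using elim d1(2)[of y] by (simp add: dist_norm)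
          qed
        qed
      qed
      then show ?thesis using d1(1) d2(1) by (intro exI[of _ "min (d1/2) d2"]) auto
    qed
    have bound: "norm (v x) \<le> C * A" if x: "x \<in> U" for x
    proof -
      obtain d where d: "d > 0" "\<And>e. 0 < e \<Longrightarrow> e \<le> d \<Longrightarrow> norm (conv e u' x) \<le> C0 * A"
        using near[OF x] by (metis centre_in_ball)
      have "norm (v x) \<le> C0 * A + \<epsilon>" if \<epsilon>: "\<epsilon> > 0" for \<epsilon>
      proof -
        obtain \<delta> where \<delta>: "\<delta> > 0" "\<And>e. 0 < e \<Longrightarrow> e \<le> \<delta> \<Longrightarrow> norm (conv e u' x - v x) \<le> \<epsilon>"
          using approx[OF x \<epsilon>] by blast
        have "norm (conv (min d \<delta>) u' x) \<le> C0 * A" "norm (conv (min d \<delta>) u' x - v x) \<le> \<epsilon>"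
          using d \<delta> by auto
        then show ?thesis using norm_triangle_sub[of "v x" "conv (min d \<delta>) u' x"] by (simp add: norm_minus_commute)
      qed
      then have "norm (v x) \<le> C0 * A" by (rule field_le_epsilon)
      also have "\<dots> \<le> C * A" using C A by simp
      finally show ?thesis .
    qed
    have local: "\<exists>d>0. \<forall>y1\<in>ball x d. \<forall>y2\<in>ball x d. norm (v y1 - v y2) \<le> C * A * norm (y1 - y2)" if x: "x \<in> U" for x
    proof -
      obtain d where d: "d > 0" "ball x d \<subseteq> U" "\<And>y e. y \<in> ball x d \<Longrightarrow> 0 < e \<Longrightarrow> e \<le> d \<Longrightarrow> cball y e \<subseteq> U"
          "\<And>y e b. y \<in> ball x d \<Longrightarrow> 0 < e \<Longrightarrow> e \<le> d \<Longrightarrow> b \<in> Basis \<Longrightarrow> norm (conv e (G [b]) y) \<le> C0 * A"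
        using near[OF x] by blast
      have lip: "norm (conv e u' y1 - conv e u' y2) \<le> C * A * norm (y1 - y2)"
        if e: "0 < e" "e \<le> d" and y: "y1 \<in> ball x d" "y2 \<in> ball x d" for e y1 y2
      proof (rule differentiable_bound[OF convex_ball _ _ y(1) y(2)])
        fix y assume y: "y \<in> ball x d"
        show "(conv e u' has_derivative (\<lambda>h. \<Sum>b\<in>Basis. (h \<bullet> b) *\<^sub>R conv e (G [b]) y)) (at y within ball x d)"
          using reg1 e(1) d(3)[OF y e] unfolding regularized_deriv_def by (blast intro: has_derivative_at_withinI)
        show "onorm (\<lambda>h. \<Sum>b\<in>Basis. (h \<bullet> b) *\<^sub>R conv e (G [b]) y) \<le> C * A"
        proof (rule onorm_le)
          fix h :: 'a
          have "norm (\<Sum>b\<in>Basis. (h \<bullet> b) *\<^sub>R conv e (G [b]) y) \<le> (\<Sum>b\<in>(Basis::'a set). norm h * (C0 * A))"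
          proof (rule sum_norm_le)
            fix b :: 'a assume b: "b \<in> Basis"
            show "norm ((h \<bullet> b) *\<^sub>R conv e (G [b]) y) \<le> norm h * (C0 * A)"
              using mult_mono[OF Basis_le_norm[OF b, of h] d(4)[OF y e b]] by simp
          qed
          then show "norm (\<Sum>b\<in>Basis. (h \<bullet> b) *\<^sub>R conv e (G [b]) y) \<le> C * A * norm h"
            by (simp add: C_def mult_ac)
        qed
      qed
      have "norm (v y1 - v y2) \<le> C * A * norm (y1 - y2)" if y: "y1 \<in> ball x d" "y2 \<in> ball x d" for y1 y2
      proof (rule field_le_epsilon)
        fix \<epsilon> :: real assume \<epsilon>: "\<epsilon> > 0"
        have yU: "y1 \<in> U" "y2 \<in> U" using y d(2) by auto
        obtain \<delta>1 where 1: "\<delta>1 > 0" "\<And>e. 0 < e \<Longrightarrow> e \<le> \<delta>1 \<Longrightarrow> norm (conv e u' y1 - v y1) \<le> \<epsilon>/2"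
          using approx[OF yU(1), of "\<epsilon>/2"] \<epsilon> by auto
        obtain \<delta>2 where 2: "\<delta>2 > 0" "\<And>e. 0 < e \<Longrightarrow> e \<le> \<delta>2 \<Longrightarrow> norm (conv e u' y2 - v y2) \<le> \<epsilon>/2"
          using approx[OF yU(2), of "\<epsilon>/2"] \<epsilon> by auto
        define e where "e = min d (min \<delta>1 \<delta>2)"
        have e: "0 < e" "e \<le> d" "e \<le> \<delta>1" "e \<le> \<delta>2" using d(1) 1(1) 2(1) by (auto simp: e_def)
        have "v y1 - v y2 = (conv e u' y1 - conv e u' y2) - (conv e u' y1 - v y1) + (conv e u' y2 - v y2)" by simp
        also have "norm \<dots> \<le> norm (conv e u' y1 - conv e u' y2) + norm (conv e u' y1 - v y1) + norm (conv e u' y2 - v y2)"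
          by (intro norm_triangle_le add_right_mono norm_triangle_ineq4)
        also have "\<dots> \<le> C * A * norm (y1 - y2) + \<epsilon>/2 + \<epsilon>/2"
          by (intro add_mono lip e y 1(2) 2(2))
        finally show "norm (v y1 - v y2) \<le> C * A * norm (y1 - y2) + \<epsilon>" by simp
      qed
      with d(1) show ?thesis by blast
    qed
    show ?thesis
      unfolding A_def[symmetric]
    proof (intro conjI ballI allI impI bound)
      fix x y assume "closed_segment x y \<subseteq> U"
      then show "norm (v x - v y) \<le> C * A * norm (x - y)"
        by (intro lipschitz_along_segment local) blast
    qed
  qed
  with C(1) show ?thesis by (rule that)
qed

section \<open>Geometry of smooth domains\<close>

lemma smooth_on_iter_deriv: "smooth_on V f \<Longrightarrow> b \<in> Basis \<Longrightarrow> smooth_on V (iter_deriv [b] f)"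
proof -
  assume s: "smooth_on V f" and b: "b \<in> Basis"
  have "iter_deriv bs (iter_deriv [b] f) = iter_deriv (bs @ [b]) f" for bs
    by (induction bs) auto
  with s b show ?thesis by (simp add: smooth_on_def del: iter_deriv.simps)
qed

lemma smooth_on_differentiable: "smooth_on V f \<Longrightarrow> x \<in> V \<Longrightarrow> f differentiable (at x)"
  unfolding smooth_on_def by (drule spec[of _ "[]"]) simp

lemma smooth_on_has_derivative:
  fixes f :: "'a::euclidean_space \<Rightarrow> real"
  assumes "smooth_on V f" "x \<in> V"
  shows "(f has_derivative (\<lambda>v. \<Sum>b\<in>Basis. (v \<bullet> b) * iter_deriv [b] f x)) (at x)"
proof -
  let ?D = "frechet_derivative f (at x)"
  have D: "(f has_derivative ?D) (at x)"
    using smooth_on_differentiable[OF assms] by (simp add: frechet_derivative_works)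
  then interpret bounded_linear ?D by (rule has_derivative_bounded_linear)
  have "?D v = (\<Sum>b\<in>Basis. (v \<bullet> b) * iter_deriv [b] f x)" for v
  proof -
    have "?D v = ?D (\<Sum>b\<in>Basis. (v \<bullet> b) *\<^sub>R b)" by (simp add: euclidean_representation)
    also have "\<dots> = (\<Sum>b\<in>Basis. (v \<bullet> b) * iter_deriv [b] f x)" by (simp add: sum scaleR)
    finally show ?thesis .
  qed
  then have eq: "?D = (\<lambda>v. \<Sum>b\<in>Basis. (v \<bullet> b) * iter_deriv [b] f x)" by (rule ext)
  show ?thesis by (rule subst[OF eq, where P="\<lambda>D. (f has_derivative D) (at x)"]) (rule D)
qed

lemma smooth_on_continuous_on: "smooth_on V f \<Longrightarrow> continuous_on V f"
  by (intro continuous_at_imp_continuous_on ballI differentiable_imp_continuous_within smooth_on_differentiable)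

lemma smooth_on_Lipschitz_cball:
  fixes f :: "'a::euclidean_space \<Rightarrow> real"
  assumes s: "smooth_on V f" and V: "cball p r \<subseteq> V"
  obtains L where "L \<ge> 0" "\<And>x y. x \<in> cball p r \<Longrightarrow> y \<in> cball p r \<Longrightarrow> \<bar>f x - f y\<bar> \<le> L * norm (x - y)"
proof -
  define N where "N x = (\<Sum>b\<in>Basis. \<bar>iter_deriv [b] f x\<bar>)" for x
  have "continuous_on (cball p r) N"
    unfolding N_def
    by (intro continuous_intros continuous_on_subset[OF smooth_on_continuous_on[OF smooth_on_iter_deriv[OF s]] V])
  then have "bounded (N ` cball p r)"
    by (intro compact_imp_bounded compact_continuous_image compact_cball)
  then obtain L where "L > 0" and L': "\<forall>y\<in>N ` cball p r. norm y \<le> L" unfolding bounded_pos by blast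
  have L: "N x \<le> L" if "x \<in> cball p r" for x
  proof -
    have "N x \<in> N ` cball p r" using that by (rule imageI)
    with L' have "norm (N x) \<le> L" by (rule bspec)
    then show ?thesis by simp
  qed
  have "\<bar>f x - f y\<bar> \<le> L * norm (x - y)" if x: "x \<in> cball p r" and y: "y \<in> cball p r" for x y
  proof -
    have "norm (f x - f y) \<le> L * norm (x - y)"
    proof (rule differentiable_bound[where f=f and f'="\<lambda>z v. \<Sum>b\<in>Basis. (v \<bullet> b) * iter_deriv [b] f z" and B=L, OF convex_cball _ _ x y])
      fix z assume z: "z \<in> cball p r"
      show "(f has_derivative (\<lambda>v. \<Sum>b\<in>Basis. (v \<bullet> b) * iter_deriv [b] f z)) (at z within cball p r)"
        by (rule has_derivative_at_withinI[OF smooth_on_has_derivative[OF s subsetD[OF V z]]])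
      show "onorm (\<lambda>v. \<Sum>b\<in>Basis. (v \<bullet> b) * iter_deriv [b] f z) \<le> L"
      proof (rule onorm_le)
        fix v :: 'a
        have "norm (\<Sum>b\<in>Basis. (v \<bullet> b) * iter_deriv [b] f z) \<le> (\<Sum>b\<in>Basis. norm v * \<bar>iter_deriv [b] f z\<bar>)"
        proof (rule sum_norm_le)
          fix b :: 'a assume b: "b \<in> Basis"
          show "norm ((v \<bullet> b) * iter_deriv [b] f z) \<le> norm v * \<bar>iter_deriv [b] f z\<bar>"
            unfolding real_norm_def abs_mult by (intro mult_right_mono Basis_le_norm b abs_ge_zero)
        qed
        also have "\<dots> = norm v * N z" unfolding N_def by (rule sum_distrib_left[symmetric])
        also have "\<dots> \<le> norm v * L" by (intro mult_left_mono L z norm_ge_zero)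
        finally show "norm (\<Sum>b\<in>Basis. (v \<bullet> b) * iter_deriv [b] f z) \<le> L * norm v"
          by (simp only: mult.commute)
      qed
    qed
    then show ?thesis by (simp only: real_norm_def)
  qed
  moreover have "L \<ge> 0" using \<open>L > 0\<close> by simp
  ultimately show ?thesis using that by blast
qed

lemma gradient_inner_Basis: "b \<in> Basis \<Longrightarrow> gradient h x \<bullet> b = iter_deriv [b] h x"
  by (auto simp: gradient_def Basis_vec_def inner_axis)

lemma gradient_has_derivative:
  assumes "smooth_on V h" "x \<in> V"
  shows "(h has_derivative (\<lambda>v. gradient h x \<bullet> v)) (at x)"
proof -
  have "(\<Sum>b\<in>Basis. (v \<bullet> b) * iter_deriv [b] h x) = gradient h x \<bullet> v" for v
    by (subst euclidean_inner) (auto intro!: sum.cong simp: gradient_inner_Basis mult.commute simp del: iter_deriv.simps)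
  with smooth_on_has_derivative[OF assms] show ?thesis by (simp only:)
qed

lemma gradient_continuous_on:
  assumes "smooth_on V h" shows "continuous_on V (gradient h)"
proof -
  have "continuous_on V (\<lambda>x. gradient h x \<bullet> b)" if b: "b \<in> Basis" for b
    unfolding gradient_inner_Basis[OF b] by (intro smooth_on_continuous_on smooth_on_iter_deriv assms b)
  then show ?thesis by (rule continuous_on_componentwise[THEN iffD2, rule_format])
qed

lemma gradient_Lipschitz_cball:
  assumes s: "smooth_on V h" and V: "cball p r \<subseteq> V"
  obtains L where "L \<ge> 0" "\<And>x y. x \<in> cball p r \<Longrightarrow> y \<in> cball p r \<Longrightarrow> norm (gradient h x - gradient h y) \<le> L * norm (x - y)"
proof -
  define Lip where "Lip b l \<longleftrightarrow> l \<ge> 0 \<and> (\<forall>x\<in>cball p r. \<forall>y\<in>cball p r. \<bar>iter_deriv [b] h x - iter_deriv [b] h y\<bar> \<le> l * norm (x - y))" for b l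
  define L where "L b = (SOME l. Lip b l)" for b
  have Lip: "Lip b (L b)" if b: "b \<in> Basis" for b
  proof -
    obtain l where "l \<ge> 0" "\<And>x y. x \<in> cball p r \<Longrightarrow> y \<in> cball p r \<Longrightarrow> \<bar>iter_deriv [b] h x - iter_deriv [b] h y\<bar> \<le> l * norm (x - y)"
      by (rule smooth_on_Lipschitz_cball[OF smooth_on_iter_deriv[OF s b] V]) (rule that)
    then have "Lip b l" unfolding Lip_def by (intro conjI ballI)
    then show ?thesis unfolding L_def by (rule someI)
  qed
  have L: "L b \<ge> 0" if "b \<in> Basis" for b
    using Lip[OF that] unfolding Lip_def by (rule conjunct1)
  have L2: "\<bar>iter_deriv [b] h x - iter_deriv [b] h y\<bar> \<le> L b * norm (x - y)"
    if "b \<in> Basis" "x \<in> cball p r" "y \<in> cball p r" for b x y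
    by (rule Lip[OF that(1), unfolded Lip_def, THEN conjunct2, THEN bspec, THEN bspec, OF that(2,3)])
  have "norm (gradient h x - gradient h y) \<le> (\<Sum>b\<in>Basis. L b) * norm (x - y)" if xy: "x \<in> cball p r" "y \<in> cball p r" for x y
  proof -
    have "norm (gradient h x - gradient h y) \<le> (\<Sum>b\<in>Basis. \<bar>(gradient h x - gradient h y) \<bullet> b\<bar>)" by (rule norm_le_l1)
    also have "\<dots> \<le> (\<Sum>b\<in>Basis. L b * norm (x - y))"
    proof (rule sum_mono)
      fix b :: "real^3" assume b: "b \<in> Basis"
      show "\<bar>(gradient h x - gradient h y) \<bullet> b\<bar> \<le> L b * norm (x - y)"
        unfolding inner_diff_left gradient_inner_Basis[OF b] by (rule L2[OF b xy])
    qed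
    finally show ?thesis by (simp add: sum_distrib_right)
  qed
  moreover have "(\<Sum>b\<in>Basis. L b) \<ge> 0" by (intro sum_nonneg L)
  ultimately show ?thesis using that by blast
qed

lemma defining_function_mean_value:
  assumes s: "smooth_on V h" and seg: "\<And>t. 0 \<le> t \<Longrightarrow> t \<le> 1 \<Longrightarrow> x + t *\<^sub>R w \<in> V"
  obtains t where "0 < t" "t < 1" "h (x + w) - h x = gradient h (x + t *\<^sub>R w) \<bullet> w"
proof -
  have D: "((\<lambda>t. h (x + t *\<^sub>R w)) has_real_derivative (gradient h (x + t *\<^sub>R w) \<bullet> w)) (at t)" if "0 \<le> t" "t \<le> 1" for t
  proof -
    have "((\<lambda>t. x + t *\<^sub>R w) has_derivative (\<lambda>s. s *\<^sub>R w)) (at t)"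
      by (auto intro!: derivative_eq_intros)
    from has_derivative_compose[OF this gradient_has_derivative[OF s seg[OF that]]]
    show ?thesis by (simp add: has_field_derivative_def mult_commute_abs)
  qed
  show ?thesis
    using MVT2[of 0 1 "\<lambda>t. h (x + t *\<^sub>R w)" "\<lambda>t. gradient h (x + t *\<^sub>R w) \<bullet> w", OF _ D] that by auto
qed

text \<open>A boundary point is not in the open set, so h \<ge> 0 there. If h were positive, it
  would be so in a neighbourhood, which would then miss \<Omega>, against membership in the
  closure.\<close>

lemma defining_function_zero:
  assumes l: "local_defining_function \<Omega> p V h" and y: "y \<in> frontier \<Omega>" "y \<in> V" and "open \<Omega>"
  shows "h y = 0"
proof -
  have V: "open V" "smooth_on V h" "\<Omega> \<inter> V = {x\<in>V. h x < 0}" using l by (auto simp: local_defining_function_def)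
  have "y \<notin> \<Omega>" using y(1) \<open>open \<Omega>\<close> by (simp add: frontier_def interior_open)
  then have "h y \<ge> 0" using V(3) y(2) by force
  moreover have "h y \<le> 0"
  proof (rule ccontr)
    assume "\<not> h y \<le> 0"
    have "open {x\<in>V. 0 < h x}"
    proof -
      have "continuous_on V h" by (rule smooth_on_continuous_on[OF V(2)])
      then have "open (V \<inter> h -` {0<..})" using V(1) by (simp add: continuous_on_open_vimage Int_commute)
      moreover have "V \<inter> h -` {0<..} = {x\<in>V. 0 < h x}" by auto
      ultimately show ?thesis by simp
    qed
    moreover have "y \<in> {x\<in>V. 0 < h x}" using y(2) \<open>\<not> h y \<le> 0\<close> by simp
    moreover have "y \<in> closure \<Omega>" using y(1) by (simp add: frontier_def)
    ultimately have "\<Omega> \<inter> {x\<in>V. 0 < h x} \<noteq> {}" using open_Int_closure_eq_empty by (metis Int_commute disjoint_iff)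
    then show False using V(3) by force
  qed
  ultimately show ?thesis by simp
qed

text \<open>Gradients of two defining functions at a boundary point are positive multiples of each other:
  otherwise some direction would lead into \<open>\<Omega>\<close> according to one and out of it according to the other.\<close>

lemma gradient_parallel_outward_normal:
  assumes l: "local_defining_function \<Omega> p V h" and y: "y \<in> frontier \<Omega>" "y \<in> V" and "open \<Omega>"
  shows "gradient h y = norm (gradient h y) *\<^sub>R outward_normal \<Omega> y"
proof -
  have V: "open V" "smooth_on V h" "\<forall>x\<in>V. gradient h x \<noteq> 0" "\<Omega> \<inter> V = {x\<in>V. h x < 0}"
    using l by (auto simp: local_defining_function_def)
  have ly: "local_defining_function \<Omega> y V h" using l y(2) by (simp add: local_defining_function_def)
  have "\<exists>V' h'. local_defining_function \<Omega> y V' h' \<and> outward_normal \<Omega> y = gradient h' y /\<^sub>R norm (gradient h' y)"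
    unfolding outward_normal_def by (rule someI_ex) (use ly in blast)
  then obtain V' h' where l': "local_defining_function \<Omega> y V' h'"
    and n: "outward_normal \<Omega> y = gradient h' y /\<^sub>R norm (gradient h' y)" by blast
  have V': "open V'" "y \<in> V'" "smooth_on V' h'" "\<forall>x\<in>V'. gradient h' x \<noteq> 0" "\<Omega> \<inter> V' = {x\<in>V'. h' x < 0}"
    using l' by (auto simp: local_defining_function_def)
  define a where "a = gradient h y" define b where "b = gradient h' y"
  have ab: "a \<noteq> 0" "b \<noteq> 0" using V(3) V'(4) y(2) V'(2) by (auto simp: a_def b_def)
  have h0: "h y = 0" "h' y = 0"
    using defining_function_zero[OF l y \<open>open \<Omega>\<close>] defining_function_zero[OF l' y(1) V'(2) \<open>open \<Omega>\<close>] by auto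
  have along: "((\<lambda>t. k (y + t *\<^sub>R v)) has_real_derivative (gradient k y \<bullet> v)) (at 0)"
    if "smooth_on W k" "y \<in> W" for k W v
  proof -
    have 1: "((\<lambda>t. y + t *\<^sub>R v) has_derivative (\<lambda>s. s *\<^sub>R v)) (at 0)"
      by (auto intro!: derivative_eq_intros)
    have "(k has_derivative (\<lambda>v. gradient k y \<bullet> v)) (at (y + 0 *\<^sub>R v))"
      using gradient_has_derivative[OF that] by simp
    from has_derivative_compose[OF 1 this]
    show ?thesis by (simp add: has_field_derivative_def mult_commute_abs)
  qed
  have "a /\<^sub>R norm a = b /\<^sub>R norm b"
  proof (rule ccontr)
    assume ne: "a /\<^sub>R norm a \<noteq> b /\<^sub>R norm b"
    define a' where "a' = a /\<^sub>R norm a" define b' where "b' = b /\<^sub>R norm b"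
    have u: "norm a' = 1" "norm b' = 1" using ab by (auto simp: a'_def b'_def)
    \<comment> \<open>For distinct unit vectors a' . b' < 1, so this direction decreases h and
      increases h' to first order.\<close>
    define v where "v = b' - a'"
    have "v \<noteq> 0" using ne by (simp add: v_def a'_def b'_def)
    then have "v \<bullet> v > 0" by simp
    moreover have "v \<bullet> v = 2 - 2 * (a' \<bullet> b')"
      using u by (simp add: v_def inner_diff_left inner_diff_right inner_commute norm_eq_1)
    ultimately have "a' \<bullet> b' < 1" by simp
    moreover have "a' \<bullet> a' = 1" "b' \<bullet> b' = 1" using u by (auto simp: norm_eq_1)
    ultimately have "a' \<bullet> v < 0" "b' \<bullet> v > 0" by (auto simp: v_def inner_diff_right inner_commute)
    then have av: "a \<bullet> v < 0" "b \<bullet> v > 0"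
      using ab by (auto simp: a'_def b'_def mult_less_0_iff zero_less_mult_iff)
    obtain d1 where d1: "d1 > 0" "\<And>t. 0 < t \<Longrightarrow> t < d1 \<Longrightarrow> h (y + t *\<^sub>R v) < h y"
      using DERIV_neg_dec_right[OF along[OF V(2) y(2), of v]] av(1) by (auto simp: a_def)
    obtain d2 where d2: "d2 > 0" "\<And>t. 0 < t \<Longrightarrow> t < d2 \<Longrightarrow> h' (y + t *\<^sub>R v) > h' y"
      using DERIV_pos_inc_right[OF along[OF V'(3) V'(2), of v]] av(2) by (auto simp: b_def)
    have "open (V \<inter> V')" using V(1) V'(1) by (rule open_Int)
    then obtain r where r: "r > 0" "ball y r \<subseteq> V \<inter> V'"
      using y(2) V'(2) open_contains_ball by blast
    define t where "t = min (min d1 d2) (r / norm v) / 2"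
    have t: "0 < t" "t < d1" "t < d2" "t * norm v < r"
    proof -
      have nv: "norm v > 0" using \<open>v \<noteq> 0\<close> by simp
      show "0 < t" "t < d1" "t < d2" using d1(1) d2(1) r(1) nv by (auto simp: t_def)
      have "t \<le> (r / norm v) / 2" by (simp add: t_def)
      then have "t * norm v \<le> (r / norm v) / 2 * norm v" using nv by (intro mult_right_mono) auto
      also have "\<dots> < r" using nv r(1) by simp
      finally show "t * norm v < r" .
    qed
    have "y + t *\<^sub>R v \<in> ball y r" using t by (simp add: dist_norm)
    then have m: "y + t *\<^sub>R v \<in> V" "y + t *\<^sub>R v \<in> V'" using r(2) by auto
    have "y + t *\<^sub>R v \<in> \<Omega>" using d1(2)[OF t(1,2)] h0 V(4) m by auto
    moreover have "y + t *\<^sub>R v \<notin> \<Omega>" using d2(2)[OF t(1,3)] h0 V'(5) m by force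
    ultimately show False by simp
  qed
  then have "outward_normal \<Omega> y = a /\<^sub>R norm a" using n by (simp add: b_def)
  then show ?thesis using ab by (simp add: a_def)
qed

section \<open>Charts, cones and tangential fields at the boundary\<close>

definition tangential_Lipschitz_field :: "(real^3) set \<Rightarrow> real \<Rightarrow> (real^3 \<Rightarrow> real^3) \<Rightarrow> bool" where
  "tangential_Lipschitz_field \<Omega> K v \<longleftrightarrow>
     K \<ge> 0 \<and> continuous_on (closure \<Omega>) v \<and> (\<forall>x\<in>\<Omega>. norm (v x) \<le> K) \<and>
     (\<forall>x y. closed_segment x y \<subseteq> \<Omega> \<longrightarrow> norm (v x - v y) \<le> K * norm (x - y)) \<and>
     (\<forall>y\<in>frontier \<Omega>. v y \<bullet> outward_normal \<Omega> y = 0)"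

text \<open>On a small ball the gradient stays within |G|/4 of its value G at p. With d = G/|G| and
  c = 3/4 |G| this gives the slope bound c in direction d, and |grad h| \<le> 5/4 |G| \<le> 2
  c.\<close>

lemma boundary_chart:
  assumes l: "local_defining_function \<Omega> p V h" and "open \<Omega>"
  obtains R c L d where "R > 0" "c > 0" "L \<ge> 0" "cball p R \<subseteq> V" "norm d = 1"
    "\<And>x. x \<in> cball p R \<Longrightarrow> gradient h x \<bullet> d \<ge> c"
    "\<And>x. x \<in> cball p R \<Longrightarrow> norm (gradient h x) \<le> 2 * c"
    "\<And>x y. x \<in> cball p R \<Longrightarrow> y \<in> cball p R \<Longrightarrow> norm (gradient h x - gradient h y) \<le> L * norm (x - y)"
proof -
  have V: "open V" "p \<in> V" "smooth_on V h" "\<forall>x\<in>V. gradient h x \<noteq> 0"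
    using l by (auto simp: local_defining_function_def)
  define G where "G = gradient h p"
  have G: "norm G > 0" using V by (simp add: G_def)
  have "continuous_on V (gradient h)" by (rule gradient_continuous_on[OF V(3)])
  then have "continuous (at p) (gradient h)" using V by (simp add: continuous_on_eq_continuous_at)
  moreover have "norm G / 4 > 0" using G by simp
  ultimately obtain r1 where r1: "r1 > 0" "\<And>x. dist x p < r1 \<Longrightarrow> dist (gradient h x) (gradient h p) < norm G / 4"
    unfolding continuous_at_eps_delta by blast
  obtain r2 where r2: "r2 > 0" "cball p r2 \<subseteq> V" using V(1,2) open_contains_cball by blast
  define R where "R = min (r1/2) r2"
  have R: "R > 0" "cball p R \<subseteq> V" using r1(1) r2 by (auto simp: R_def)
  have close: "norm (gradient h x - G) \<le> norm G / 4" if "x \<in> cball p R" for x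
  proof -
    have "dist x p < r1" using that r1(1) by (auto simp: R_def dist_commute)
    from r1(2)[OF this] show ?thesis by (simp add: dist_norm G_def)
  qed
  obtain L where L: "L \<ge> 0" "\<And>x y. x \<in> cball p R \<Longrightarrow> y \<in> cball p R \<Longrightarrow> norm (gradient h x - gradient h y) \<le> L * norm (x - y)"
    using gradient_Lipschitz_cball[OF V(3) R(2)] by metis
  define d where "d = G /\<^sub>R norm G"
  have d: "norm d = 1" using G by (simp add: d_def)
  have "gradient h x \<bullet> d \<ge> 3/4 * norm G" if x: "x \<in> cball p R" for x
  proof -
    have "G \<bullet> d = norm G"
      using G by (simp add: d_def power2_norm_eq_inner[symmetric] power2_eq_square)
    moreover have "\<bar>(gradient h x - G) \<bullet> d\<bar> \<le> norm G / 4"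
      using Cauchy_Schwarz_ineq2[of "gradient h x - G" d] close[OF x] d by simp
    ultimately show ?thesis unfolding inner_diff_left by linarith
  qed
  moreover have "norm (gradient h x) \<le> 2 * (3/4 * norm G)" if x: "x \<in> cball p R" for x
    using norm_triangle_sub[of "gradient h x" G] close[OF x] G by linarith
  ultimately show ?thesis
    using that[of R "3/4 * norm G" L d] R G L d by simp
qed

text \<open>Along a vector z within \<sigma>/4 of -\<sigma> d, the slope of h is at most 2 c
  \<sigma>/4 - \<sigma> c < 0, so h stays negative and the path stays in \<Omega>. The choice
  \<sigma> = R/4 keeps the path, of length at most 5/4 \<sigma>, inside the ball where the gradient
  bounds hold.\<close>

lemma boundary_cone:
  assumes l: "local_defining_function \<Omega> p V h" and "open \<Omega>"
  obtains R a r where "R > 0" "r > 0"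
    "\<And>x z s. x \<in> \<Omega> \<inter> ball p R \<Longrightarrow> z \<in> cball a r \<Longrightarrow> s \<in> {0..1::real} \<Longrightarrow> x + s *\<^sub>R z \<in> \<Omega>"
proof -
  have V: "smooth_on V h" "\<Omega> \<inter> V = {x\<in>V. h x < 0}"
    using l by (auto simp: local_defining_function_def)
  obtain R c L d where R: "R > 0" "c > 0" "cball p R \<subseteq> V" "norm d = 1"
    "\<And>x. x \<in> cball p R \<Longrightarrow> gradient h x \<bullet> d \<ge> c"
    "\<And>x. x \<in> cball p R \<Longrightarrow> norm (gradient h x) \<le> 2 * c"
    using boundary_chart[OF assms] by metis
  define \<sigma> where "\<sigma> = R / 4"
  have \<sigma>: "\<sigma> > 0" using R by (simp add: \<sigma>_def)
  have "x + s *\<^sub>R z \<in> \<Omega>" if x: "x \<in> \<Omega> \<inter> ball p (R/2)" and z: "z \<in> cball (- \<sigma> *\<^sub>R d) (\<sigma>/4)" and s: "s \<in> {0..1::real}" for x z s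
  proof -
    have zz: "norm (z + \<sigma> *\<^sub>R d) \<le> \<sigma> / 4"
    proof -
      have "- \<sigma> *\<^sub>R d - z = - (z + \<sigma> *\<^sub>R d)" by simp
      then have "dist (- \<sigma> *\<^sub>R d) z = norm (- (z + \<sigma> *\<^sub>R d))" by (simp only: dist_norm)
      with z show ?thesis by (simp only: norm_minus_cancel mem_cball)
    qed
    have nz: "norm z \<le> R/2"
    proof -
      have "norm z \<le> norm (z + \<sigma> *\<^sub>R d) + norm (\<sigma> *\<^sub>R d)" using norm_triangle_ineq4[of "z + \<sigma> *\<^sub>R d" "\<sigma> *\<^sub>R d"] by simp
      also have "\<dots> \<le> \<sigma> / 4 + \<sigma>" using zz R(4) \<sigma> by simp
      also have "\<dots> \<le> R/2" using R(1) by (simp add: \<sigma>_def)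
      finally show ?thesis .
    qed
    have inR: "x + t *\<^sub>R z \<in> cball p R" if t: "0 \<le> t" "t \<le> 1" for t
    proof -
      have "norm (t *\<^sub>R z) \<le> R/2" using nz t mult_left_le_one_le[of "norm z" t] by simp
      moreover have "dist p x < R/2" using x by simp
      moreover have "dist p (x + t *\<^sub>R z) \<le> dist p x + norm (t *\<^sub>R z)"
        using dist_triangle[of p "x + t *\<^sub>R z" x] by (simp add: dist_norm)
      ultimately show ?thesis by simp
    qed
    have hx: "h x < 0" "x \<in> V" using x V(2) inR[of 0] R(3) by auto
    have "h (x + s *\<^sub>R z) \<le> h x"
    proof -
      have "x + t *\<^sub>R (s *\<^sub>R z) \<in> V" if "0 \<le> t" "t \<le> 1" for t
        using inR[of "t * s"] R(3) s that by (auto simp: mult_le_one)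
      from defining_function_mean_value[OF V(1) this]
      obtain t where t: "0 < t" "t < 1" "h (x + s *\<^sub>R z) - h x = gradient h (x + t *\<^sub>R (s *\<^sub>R z)) \<bullet> (s *\<^sub>R z)" by blast
      define g where "g = gradient h (x + t *\<^sub>R (s *\<^sub>R z))"
      have xin: "x + t *\<^sub>R (s *\<^sub>R z) \<in> cball p R" using inR[of "t * s"] s t by (auto simp: mult_le_one)
      have "g \<bullet> z = g \<bullet> (z + \<sigma> *\<^sub>R d) - \<sigma> * (g \<bullet> d)" by (simp add: inner_add_right)
      also have "g \<bullet> (z + \<sigma> *\<^sub>R d) \<le> norm g * norm (z + \<sigma> *\<^sub>R d)" by (rule norm_cauchy_schwarz)
      also have "\<dots> \<le> (2 * c) * (\<sigma> / 4)" using R(6)[OF xin] zz R(2) by (intro mult_mono) (auto simp: g_def)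
      also have "(2 * c) * (\<sigma> / 4) - \<sigma> * (g \<bullet> d) \<le> (2 * c) * (\<sigma> / 4) - \<sigma> * c"
        using R(5)[OF xin] \<sigma> by (simp add: g_def)
      also have "\<dots> \<le> 0" using \<sigma> R(2) by simp
      finally have "g \<bullet> z \<le> 0" by simp
      then have "s * (g \<bullet> z) \<le> 0" using s by (simp add: mult_nonneg_nonpos)
      then show ?thesis using t(3) by (simp add: g_def)
    qed
    then have "h (x + s *\<^sub>R z) < 0" using hx by simp
    moreover have "x + s *\<^sub>R z \<in> V" using inR[of s] s R(3) by auto
    ultimately show ?thesis using V(2) by blast
  qed
  then show ?thesis using that[of "R/2" "\<sigma>/4" "- \<sigma> *\<^sub>R d"] R(1) \<sigma> by simp
qed

text \<open>Small balls serve at interior points and the cones above at boundary points; compactness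
  of the closure leaves finitely many shapes.\<close>

lemma smooth_bounded_domain_cone:
  assumes "smooth_bounded_domain \<Omega>"
  shows "cone_condition \<Omega>"
proof -
  have \<Omega>: "open \<Omega>" "bounded \<Omega>" "\<And>p. p \<in> frontier \<Omega> \<Longrightarrow> \<exists>V h. local_defining_function \<Omega> p V h"
    using assms by (auto simp: smooth_bounded_domain_def)
  define Q where "Q p R a r \<longleftrightarrow> R > 0 \<and> r > 0 \<and>
    (\<forall>x z s. x \<in> \<Omega> \<inter> ball p R \<longrightarrow> z \<in> cball a r \<longrightarrow> s \<in> {0..1::real} \<longrightarrow> x + s *\<^sub>R z \<in> \<Omega>)" for p a :: "real^3" and R r
  have "\<exists>R a r. Q p R a r" if p: "p \<in> closure \<Omega>" for p
  proof (cases "p \<in> \<Omega>")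
    case True
    then obtain r where r: "r > 0" "ball p r \<subseteq> \<Omega>" using \<Omega>(1) open_contains_ball by blast
    have "x + s *\<^sub>R z \<in> \<Omega>" if x: "x \<in> ball p (r/2)" and z: "z \<in> cball 0 (r/2)" and s: "s \<in> {0..1}" for x z s
    proof -
      have "norm (s *\<^sub>R z) \<le> r/2" using z s mult_left_le_one_le[of "norm z" s] by simp
      moreover have "dist p (x + s *\<^sub>R z) \<le> dist p x + norm (s *\<^sub>R z)"
        using dist_triangle[of p "x + s *\<^sub>R z" x] by (simp add: dist_norm)
      ultimately have "x + s *\<^sub>R z \<in> ball p r" using x by simp
      with r(2) show ?thesis by (rule subsetD)
    qed
    then have "Q p (r/2) 0 (r/2)" using r(1) unfolding Q_def by (intro conjI allI impI) simp_all
    then show ?thesis by (intro exI)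
  next
    case False
    then have "p \<in> frontier \<Omega>" using p \<Omega>(1) by (simp add: frontier_def interior_open)
    then obtain V h where l: "local_defining_function \<Omega> p V h" using \<Omega>(3) by blast
    show ?thesis
    proof (rule boundary_cone[OF l \<Omega>(1)])
      fix R a r
      assume h: "R > 0" "r > 0" "\<And>x z s. x \<in> \<Omega> \<inter> ball p R \<Longrightarrow> z \<in> cball a r \<Longrightarrow> s \<in> {0..1::real} \<Longrightarrow> x + s *\<^sub>R z \<in> \<Omega>"
      have "Q p R a r" unfolding Q_def by (intro conjI allI impI h(1,2)) (rule h(3))
      then show "\<exists>R a r. Q p R a r" by (intro exI)
    qed
  qed
  then have "\<forall>p. \<exists>t. p \<in> closure \<Omega> \<longrightarrow> Q p (fst t) (fst (snd t)) (snd (snd t))"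
    unfolding split_paired_Ex fst_conv snd_conv by blast
  from choice[OF this] obtain t where Qt: "\<forall>p. p \<in> closure \<Omega> \<longrightarrow> Q p (fst (t p)) (fst (snd (t p))) (snd (snd (t p)))" ..
  have t: "fst (t p) > 0" "snd (snd (t p)) > 0"
      "\<And>x z s. x \<in> \<Omega> \<inter> ball p (fst (t p)) \<Longrightarrow> z \<in> cball (fst (snd (t p))) (snd (snd (t p))) \<Longrightarrow> s \<in> {0..1::real} \<Longrightarrow> x + s *\<^sub>R z \<in> \<Omega>"
    if "p \<in> closure \<Omega>" for p
    using Qt[rule_format, OF that] unfolding Q_def by blast+
  have cpt: "compact (closure \<Omega>)" using \<Omega>(2) by (simp add: compact_closure)
  have cov: "closure \<Omega> \<subseteq> (\<Union>p\<in>closure \<Omega>. ball p (fst (t p)))" using t(1) centre_in_ball by blast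
  obtain F where F: "F \<subseteq> closure \<Omega>" "finite F" "closure \<Omega> \<subseteq> (\<Union>p\<in>F. ball p (fst (t p)))"
    by (rule compactE_image[OF cpt open_ball cov])
  show ?thesis
    unfolding cone_condition_def
  proof (intro exI[of _ "(\<lambda>p. snd (t p)) ` F"] conjI ballI)
    show "finite ((\<lambda>p. snd (t p)) ` F)" using F(2) by simp
    fix y assume "y \<in> (\<lambda>p. snd (t p)) ` F"
    then show "case y of (a, r) \<Rightarrow> r > 0" using t(2) F(1) by (auto simp: case_prod_beta')
  next
    fix x assume x: "x \<in> \<Omega>"
    then have "x \<in> closure \<Omega>" using closure_subset by blast
    then obtain p where p: "p \<in> F" "x \<in> ball p (fst (t p))" using F(3) by blast
    have "\<forall>z\<in>cball (fst (snd (t p))) (snd (snd (t p))). \<forall>s\<in>{0..1}. x + s *\<^sub>R z \<in> \<Omega>"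
      by (intro ballI t(3)[OF subsetD[OF F(1) p(1)]] IntI x p(2))
    with p(1) show "\<exists>y\<in>(\<lambda>p. snd (t p)) ` F. case y of (a, r) \<Rightarrow> \<forall>z\<in>cball a r. \<forall>s\<in>{0..1}. x + s *\<^sub>R z \<in> \<Omega>"
      by (auto simp: case_prod_beta')
  qed
qed

text \<open>From x one walks in direction d, along which h grows at least at rate c, and meets the
  boundary at y after a distance s0 \<le> |h x| / c. At y the gradient of h is parallel to the
  normal, so v y is orthogonal to it; the Lipschitz bounds of v and of grad h carry this back to x
  at a cost proportional to s0.\<close>

lemma tangential_near_boundary:
  assumes l: "local_defining_function \<Omega> p V h" and \<Omega>: "open \<Omega>"
  obtains R C \<eta> where "R > 0" "C \<ge> 0" "\<eta> > 0" "cball p R \<subseteq> V"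
    "\<And>x K v. x \<in> \<Omega> \<inter> cball p R \<Longrightarrow> - \<eta> < h x \<Longrightarrow> tangential_Lipschitz_field \<Omega> K v \<Longrightarrow>
        \<bar>v x \<bullet> gradient h x\<bar> \<le> C * K * \<bar>h x\<bar>"
proof -
  have V: "smooth_on V h" "\<Omega> \<inter> V = {x\<in>V. h x < 0}"
    using l by (auto simp: local_defining_function_def)
  obtain R c L d where R: "R > 0" "c > 0" "L \<ge> 0" "cball p R \<subseteq> V" "norm d = 1"
    "\<And>x. x \<in> cball p R \<Longrightarrow> gradient h x \<bullet> d \<ge> c"
    "\<And>x. x \<in> cball p R \<Longrightarrow> norm (gradient h x) \<le> 2 * c"
    "\<And>x y. x \<in> cball p R \<Longrightarrow> y \<in> cball p R \<Longrightarrow> norm (gradient h x - gradient h y) \<le> L * norm (x - y)"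
    by (rule boundary_chart[OF l \<Omega>]) (rule that)
  \<comment> \<open>With |h x| < c R/4 the walk is shorter than R/4, hence stays in the
    chart.\<close>
  define \<eta> where "\<eta> = c * (R / 4)"
  define C where "C = (2 * c + (1 + R) * L) / c"
  have main: "\<bar>v x \<bullet> gradient h x\<bar> \<le> C * K * \<bar>h x\<bar>"
    if x: "x \<in> \<Omega> \<inter> cball p (R/2)" and hx: "- \<eta> < h x" and v: "tangential_Lipschitz_field \<Omega> K v" for x K v
  proof -
    have K: "K \<ge> 0" "continuous_on (closure \<Omega>) v" "\<And>x. x \<in> \<Omega> \<Longrightarrow> norm (v x) \<le> K"
      "\<And>x y. closed_segment x y \<subseteq> \<Omega> \<Longrightarrow> norm (v x - v y) \<le> K * norm (x - y)"
      "\<And>y. y \<in> frontier \<Omega> \<Longrightarrow> v y \<bullet> outward_normal \<Omega> y = 0"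
      using v unfolding tangential_Lipschitz_field_def by blast+
    have xV: "x \<in> V" using x R(1,4) by auto
    have neg: "h x < 0" using x xV V(2) by blast
    define S where "S = - h x / c"
    have S: "0 < S" "S < R/4" using neg hx R(2) by (auto simp: S_def \<eta>_def field_simps)
    have inR: "x + s *\<^sub>R d \<in> cball p R" if s: "0 \<le> s" "s \<le> R/2" for s
    proof -
      have "dist p (x + s *\<^sub>R d) \<le> dist p x + norm (s *\<^sub>R d)"
        using dist_triangle[of p "x + s *\<^sub>R d" x] by (simp add: dist_norm)
      also have "\<dots> \<le> R" using x s R(5) by simp
      finally show ?thesis by simp
    qed
    have grow: "h (x + t *\<^sub>R d) - h (x + s *\<^sub>R d) \<ge> c * (t - s)" if st: "0 \<le> s" "s \<le> t" "t \<le> R/2" for s t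
    proof -
      have "(x + s *\<^sub>R d) + r *\<^sub>R ((t - s) *\<^sub>R d) \<in> V" if r: "0 \<le> r" "r \<le> 1" for r
      proof -
        have "r * (t - s) \<le> t - s" using r st mult_left_le_one_le[of "t - s" r] by simp
        then have "x + (s + r * (t - s)) *\<^sub>R d \<in> cball p R" using r st by (intro inR) auto
        then show ?thesis using R(4) by (auto simp: scaleR_add_left add.assoc)
      qed
      from defining_function_mean_value[OF V(1) this]
      obtain r where r: "0 < r" "r < 1"
        "h ((x + s *\<^sub>R d) + (t - s) *\<^sub>R d) - h (x + s *\<^sub>R d) = gradient h ((x + s *\<^sub>R d) + r *\<^sub>R ((t - s) *\<^sub>R d)) \<bullet> ((t - s) *\<^sub>R d)"
        by blast
      have "r * (t - s) \<le> t - s" using r st mult_left_le_one_le[of "t - s" r] by simp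
      then have "x + (s + r * (t - s)) *\<^sub>R d \<in> cball p R" using r st by (intro inR) auto
      then have "(x + s *\<^sub>R d) + r *\<^sub>R ((t - s) *\<^sub>R d) \<in> cball p R" by (simp add: scaleR_add_left add.assoc)
      from mult_left_mono[OF R(6)[OF this], of "t - s"] st
      have "c * (t - s) \<le> gradient h ((x + s *\<^sub>R d) + r *\<^sub>R ((t - s) *\<^sub>R d)) \<bullet> ((t - s) *\<^sub>R d)"
        by (simp add: mult.commute)
      moreover have e: "(x + s *\<^sub>R d) + (t - s) *\<^sub>R d = x + t *\<^sub>R d" by (simp add: scaleR_diff_left)
      ultimately show ?thesis using r(3) unfolding e by linarith
    qed
    have "continuous_on {0..S} (\<lambda>s. h (x + s *\<^sub>R d))"
      by (rule continuous_on_compose2[OF smooth_on_continuous_on[OF V(1)]])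
        (use inR S R(1,4) in \<open>auto intro!: continuous_intros\<close>)
    moreover have "h (x + 0 *\<^sub>R d) \<le> 0" using neg by simp
    moreover have "0 \<le> h (x + S *\<^sub>R d)"
    proof -
      have "c * S = - h x" using R(2) by (simp add: S_def)
      moreover have "c * (S - 0) \<le> h (x + S *\<^sub>R d) - h (x + 0 *\<^sub>R d)"
        by (rule grow) (use S R(1) in linarith)+
      ultimately show ?thesis by simp
    qed
    ultimately obtain s0 where s0: "0 \<le> s0" "s0 \<le> S" "h (x + s0 *\<^sub>R d) = 0"
      using IVT'[of "\<lambda>s. h (x + s *\<^sub>R d)" 0 0 S] S by auto
    have s0_pos: "s0 > 0" using s0 neg by (cases "s0 = 0") auto
    have s0R: "s0 \<le> R/2" using s0 S R(1) by simp
    have inside: "x + s *\<^sub>R d \<in> \<Omega>" if s: "0 \<le> s" "s < s0" for s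
    proof -
      have "c * (s0 - s) > 0" using s R(2) by simp
      with grow[of s s0] s s0 s0R have "h (x + s *\<^sub>R d) < 0" by simp
      moreover have "x + s *\<^sub>R d \<in> V" using inR[of s] s s0R R(4) by auto
      ultimately show ?thesis using V(2) by blast
    qed
    define y where "y = x + s0 *\<^sub>R d"
    have yR: "y \<in> cball p R" unfolding y_def by (rule inR[OF s0(1) s0R])
    have xR: "x \<in> cball p R" using inR[of 0] R(1) by simp
    have yV: "y \<in> V" using yR R(4) by blast
    have "y \<notin> \<Omega>"
    proof
      assume "y \<in> \<Omega>"
      then have "h y < 0" using yV V(2) by blast
      then show False using s0(3) by (simp add: y_def)
    qed
    have path: "((\<lambda>s. x + s *\<^sub>R d) \<longlongrightarrow> y) (at_left s0)"
      unfolding y_def by (intro tendsto_intros)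
    have ev: "eventually (\<lambda>s. 0 \<le> s \<and> s < s0) (at_left s0)"
      using s0_pos by (auto simp: eventually_at_left_field intro!: exI[of _ 0])
    have ycl: "y \<in> closure \<Omega>"
    proof (rule Lim_in_closed_set[OF closed_closure _ _ path])
      show "\<forall>\<^sub>F s in at_left s0. x + s *\<^sub>R d \<in> closure \<Omega>"
        using ev by eventually_elim (use inside closure_subset in blast)
    qed simp
    then have yfr: "y \<in> frontier \<Omega>" using \<open>y \<notin> \<Omega>\<close> \<Omega> by (simp add: frontier_def interior_open)
    have vlim: "((\<lambda>s. v (x + s *\<^sub>R d)) \<longlongrightarrow> v y) (at_left s0)"
    proof (rule continuous_on_tendsto_compose[OF K(2) path ycl])
      show "\<forall>\<^sub>F s in at_left s0. x + s *\<^sub>R d \<in> closure \<Omega>"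
        using ev by eventually_elim (use inside closure_subset in blast)
    qed
    \<comment> \<open>The segment from x to y leaves \<Omega> at its end point, so the Lipschitz
      bound is used up to x + s d with s < s0, and y is reached by continuity of v on the
      closure.\<close>
    have vxy: "norm (v x - v y) \<le> K * s0"
    proof (rule tendsto_upperbound[where F="at_left s0" and f="\<lambda>s. norm (v x - v (x + s *\<^sub>R d))"])
      show "((\<lambda>s. norm (v x - v (x + s *\<^sub>R d))) \<longlongrightarrow> norm (v x - v y)) (at_left s0)"
        by (intro tendsto_intros vlim)
      show "\<forall>\<^sub>F s in at_left s0. norm (v x - v (x + s *\<^sub>R d)) \<le> K * s0"
        using ev
      proof eventually_elim
        case (elim s)
        have "closed_segment x (x + s *\<^sub>R d) \<subseteq> \<Omega>"
        proof
          fix z assume "z \<in> closed_segment x (x + s *\<^sub>R d)"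
          then obtain r where r: "0 \<le> r" "r \<le> 1" "z = (1 - r) *\<^sub>R x + r *\<^sub>R (x + s *\<^sub>R d)"
            unfolding closed_segment_def by blast
          then have "z = x + (r * s) *\<^sub>R d" by (simp add: algebra_simps)
          moreover have "r * s \<le> s" using r elim mult_left_le_one_le[of s r] by simp
          ultimately show "z \<in> \<Omega>" using inside[of "r * s"] r elim by simp
        qed
        from K(4)[OF this] have "norm (v x - v (x + s *\<^sub>R d)) \<le> K * s" using R(5) elim by simp
        also have "\<dots> \<le> K * s0" using K(1) elim by (intro mult_left_mono) auto
        finally show ?case .
      qed
    qed simp
    have "v y \<bullet> gradient h y = norm (gradient h y) * (v y \<bullet> outward_normal \<Omega> y)"
      by (subst gradient_parallel_outward_normal[OF l yfr yV \<Omega>]) simp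
    then have vy0: "v y \<bullet> gradient h y = 0" using K(5)[OF yfr] by simp
    have nxy: "norm (x - y) = s0" using s0(1) R(5) by (simp add: y_def)
    have vy: "norm (v y) \<le> K * (1 + R)"
    proof -
      have "norm (v y) \<le> norm (v x) + norm (v x - v y)" using norm_triangle_sub[of "v y" "v x"] by (simp add: norm_minus_commute)
      also have "\<dots> \<le> K + K * R" using K(3)[of x] x vxy mult_left_mono[of s0 R K] K(1) s0R R(1) by (intro add_mono) auto
      finally show ?thesis by (simp add: algebra_simps)
    qed
    have "v x \<bullet> gradient h x = (v x - v y) \<bullet> gradient h x + v y \<bullet> (gradient h x - gradient h y)"
      using vy0 by (simp add: inner_diff_left inner_diff_right)
    also have "\<bar>\<dots>\<bar> \<le> norm (v x - v y) * norm (gradient h x) + norm (v y) * norm (gradient h x - gradient h y)"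
      by (intro order_trans[OF abs_triangle_ineq] add_mono Cauchy_Schwarz_ineq2)
    also have "\<dots> \<le> (K * s0) * (2 * c) + (K * (1 + R)) * (L * s0)"
    proof (intro add_mono mult_mono)
      show "norm (gradient h x - gradient h y) \<le> L * s0" using R(8)[OF xR yR] nxy by simp
    qed (use vxy vy R(7)[OF xR] K(1) s0(1) R(1,3) in auto)
    also have "\<dots> = K * (2 * c + (1 + R) * L) * s0" by (simp add: algebra_simps)
    also have "\<dots> \<le> K * (2 * c + (1 + R) * L) * S"
      using K(1) R(1,2,3) s0(2) by (intro mult_left_mono mult_nonneg_nonneg) auto
    also have "\<dots> = C * K * \<bar>h x\<bar>" using neg R(2) by (simp add: C_def S_def)
    finally show ?thesis .
  qed
  have "C \<ge> 0" using R by (simp add: C_def)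
  moreover have "\<eta> > 0" using R by (simp add: \<eta>_def)
  moreover have "cball p (R/2) \<subseteq> V" using R(1,4) by auto
  ultimately show ?thesis using that[of "R/2" C \<eta>] R(1) main by simp
qed

section \<open>Cutoffs adapted to tangential fields\<close>

definition cutoff_sequence :: "(real^3) set \<Rightarrow> (nat \<Rightarrow> real^3 \<Rightarrow> real) \<Rightarrow> (nat \<Rightarrow> real^3 \<Rightarrow> real^3) \<Rightarrow> real \<Rightarrow> bool" where
  "cutoff_sequence \<Omega> \<kappa> g C \<longleftrightarrow> C \<ge> 0 \<and>
     (\<forall>n x. 0 \<le> \<kappa> n x \<and> \<kappa> n x \<le> 1 \<and> (\<kappa> n has_derivative (\<lambda>v. g n x \<bullet> v)) (at x)) \<and>
     (\<forall>n. continuous_on UNIV (g n) \<and> (\<exists>K. compact K \<and> K \<subseteq> \<Omega> \<and> (\<forall>x. x \<notin> K \<longrightarrow> \<kappa> n x = 0 \<and> g n x = 0))) \<and>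
     (\<forall>n K v x. tangential_Lipschitz_field \<Omega> K v \<longrightarrow> x \<in> \<Omega> \<longrightarrow> \<bar>v x \<bullet> g n x\<bar> \<le> C * K) \<and>
     (\<forall>x\<in>\<Omega>. eventually (\<lambda>n. \<kappa> n x = 1 \<and> g n x = 0) sequentially)"

lemma pulse_bounded: obtains M where "M > 0" "\<And>s. pulse s \<le> M"
proof -
  have "bounded (pulse ` {0..1})"
    by (intro compact_imp_bounded compact_continuous_image continuous_on_pulse compact_Icc)
  then obtain M where M: "M > 0" "\<And>y. y \<in> pulse ` {0..1} \<Longrightarrow> norm y \<le> M" unfolding bounded_pos by blast
  have "pulse s \<le> M" for s
  proof (cases "s \<in> {0..1}")
    case True
    then show ?thesis using M(2)[of "pulse s"] by simp
  next
    case False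
    then show ?thesis using pulse_eq_0[of s] M(1) by auto
  qed
  with M(1) show ?thesis by (rule that)
qed

text \<open>The gradient of a cutoff with a layer of width \<epsilon> is of order 1/\<epsilon>, but
  up to the bounded gradients of localizing functions it points along grad h. A tangential field
  satisfies |v . grad h| \<le> C K |h| with |h| \<le> 2 \<epsilon> in the layer, so v . g n is
  bounded independently of n. No partition of unity is formed: it is enough that the localized
  layers sum to at least 1 near the boundary, because \<open>smooth_step\<close> saturates.\<close>

lemma cutoff_sequence_exists:
  assumes "smooth_bounded_domain \<Omega>"
  obtains \<kappa> g C where "cutoff_sequence \<Omega> \<kappa> g C"
proof -
  have \<Omega>: "open \<Omega>" "bounded \<Omega>" "\<And>p. p \<in> frontier \<Omega> \<Longrightarrow> \<exists>V h. local_defining_function \<Omega> p V h"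
    using assms by (auto simp: smooth_bounded_domain_def)
  define Q where "Q p V h R C \<eta> \<longleftrightarrow> local_defining_function \<Omega> p V h \<and> R > 0 \<and> C \<ge> 0 \<and> \<eta> > 0 \<and> cball p R \<subseteq> V \<and>
    (\<forall>x K v. x \<in> \<Omega> \<inter> cball p R \<longrightarrow> - \<eta> < h x \<longrightarrow> tangential_Lipschitz_field \<Omega> K v \<longrightarrow>
        \<bar>v x \<bullet> gradient h x\<bar> \<le> C * K * \<bar>h x\<bar>)" for p V h and R C \<eta> :: real
  have "\<exists>V h R C \<eta>. Q p V h R C \<eta>" if p: "p \<in> frontier \<Omega>" for p
  proof -
    obtain V h where l: "local_defining_function \<Omega> p V h" using \<Omega>(3)[OF p] by blast
    show ?thesis
    proof (rule tangential_near_boundary[OF l \<Omega>(1)])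
      fix R C \<eta>
      assume a: "R > 0" "C \<ge> 0" "\<eta> > 0" "cball p R \<subseteq> V"
        "\<And>x K v. x \<in> \<Omega> \<inter> cball p R \<Longrightarrow> - \<eta> < h x \<Longrightarrow> tangential_Lipschitz_field \<Omega> K v \<Longrightarrow>
        \<bar>v x \<bullet> gradient h x\<bar> \<le> C * K * \<bar>h x\<bar>"
      have "Q p V h R C \<eta>" unfolding Q_def by (intro conjI allI impI l a(1-4)) (rule a(5))
      then show ?thesis by (intro exI)
    qed
  qed
  then have "\<forall>p. \<exists>t. p \<in> frontier \<Omega> \<longrightarrow> Q p (fst t) (fst (snd t)) (fst (snd (snd t))) (fst (snd (snd (snd t)))) (snd (snd (snd (snd t))))"
    unfolding split_paired_Ex fst_conv snd_conv by blast
  from choice[OF this] obtain t where t: "\<forall>p. p \<in> frontier \<Omega> \<longrightarrow>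
    Q p (fst (t p)) (fst (snd (t p))) (fst (snd (snd (t p)))) (fst (snd (snd (snd (t p))))) (snd (snd (snd (snd (t p)))))" ..
  define V h R Cp \<eta> where "V p = fst (t p)" and "h p = fst (snd (t p))" and "R p = fst (snd (snd (t p)))"
    and "Cp p = fst (snd (snd (snd (t p))))" and "\<eta> p = snd (snd (snd (snd (t p))))" for p
  have Q: "Q p (V p) (h p) (R p) (Cp p) (\<eta> p)" if "p \<in> frontier \<Omega>" for p
    using t that unfolding V_def h_def R_def Cp_def \<eta>_def by blast
  have cpt: "compact (frontier \<Omega>)" using \<Omega>(2) by (simp add: compact_frontier_bounded)
  have cov: "frontier \<Omega> \<subseteq> (\<Union>p\<in>frontier \<Omega>. ball p (R p / 2))"
  proof
    fix p assume "p \<in> frontier \<Omega>"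
    then show "p \<in> (\<Union>p\<in>frontier \<Omega>. ball p (R p / 2))"
      using Q[of p] unfolding Q_def by (intro UN_I[of p]) auto
  qed
  obtain F where F: "F \<subseteq> frontier \<Omega>" "finite F" "frontier \<Omega> \<subseteq> (\<Union>p\<in>F. ball p (R p / 2))"
    by (rule compactE_image[OF cpt open_ball cov])
  have q: "local_defining_function \<Omega> p (V p) (h p)" "R p > 0" "Cp p \<ge> 0" "\<eta> p > 0" "cball p (R p) \<subseteq> V p"
    "\<And>x K v. x \<in> \<Omega> \<inter> cball p (R p) \<Longrightarrow> - \<eta> p < h p x \<Longrightarrow> tangential_Lipschitz_field \<Omega> K v \<Longrightarrow>
        \<bar>v x \<bullet> gradient (h p) x\<bar> \<le> Cp p * K * \<bar>h p x\<bar>" if "p \<in> F" for p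
    using Q[OF subsetD[OF F(1) that]] unfolding Q_def by blast+
  have sm: "smooth_on (V p) (h p)" "open (V p)" "\<Omega> \<inter> V p = {x\<in>V p. h p x < 0}" if "p \<in> F" for p
    using q(1)[OF that] by (auto simp: local_defining_function_def)
  obtain M where M: "M > 0" "\<And>s. pulse s \<le> M" using pulse_bounded by blast
  have pa: "\<bar>pulse s\<bar> \<le> M" for s using M(2)[of s] pulse_nonneg[of s] by simp
  \<comment> \<open>Normalized so that k times 3/4 (R p)^2 is 1: the argument \<open>a p x\<close>
    is at least 1 for |x - p| \<le> R p / 2 and at most 0 for |x - p| \<ge> R p.\<close>
  define k where "k p = 4 / (3 * (R p)\<^sup>2)" for p
  define a where "a p x = k p * ((R p)\<^sup>2 - (x - p) \<bullet> (x - p))" for p x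
  define \<zeta> where "\<zeta> p x = smooth_step (a p x)" for p x
  define g\<zeta> where "g\<zeta> p x = (- 2 * k p * pulse (a p x)) *\<^sub>R (x - p)" for p x
  have kpos: "k p > 0" if "p \<in> F" for p using q(2)[OF that] by (simp add: k_def)
  have \<zeta>d: "(\<zeta> p has_derivative (\<lambda>v. g\<zeta> p x \<bullet> v)) (at x)" for p x
  proof -
    have "(a p has_derivative (\<lambda>v. k p * (- (2 * ((x - p) \<bullet> v))))) (at x)"
      unfolding a_def[abs_def] by (auto intro!: derivative_eq_intros simp: inner_commute algebra_simps)
    from has_derivative_compose[OF this smooth_step_DERIV[unfolded has_field_derivative_def]]
    have "(\<zeta> p has_derivative (\<lambda>v. pulse (a p x) * (k p * (- (2 * ((x - p) \<bullet> v)))))) (at x)"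
      by (simp only: \<zeta>_def[abs_def])
    moreover have "(\<lambda>v. pulse (a p x) * (k p * (- (2 * ((x - p) \<bullet> v))))) = (\<lambda>v. g\<zeta> p x \<bullet> v)"
      by (simp add: g\<zeta>_def fun_eq_iff)
    ultimately show ?thesis by simp
  qed
  have g\<zeta>c: "continuous_on UNIV (g\<zeta> p)" for p
    unfolding g\<zeta>_def[abs_def] a_def
    by (intro continuous_intros continuous_on_compose2[OF continuous_on_pulse[of UNIV]]) auto
  have \<zeta>out: "\<zeta> p x = 0" "g\<zeta> p x = 0" if p: "p \<in> F" and x: "norm (x - p) \<ge> R p" for p x
  proof -
    have "(R p)\<^sup>2 \<le> (norm (x - p))\<^sup>2" using q(2)[OF p] x by (intro power_mono) auto
    then have "a p x \<le> 0" using kpos[OF p] by (simp add: a_def power2_norm_eq_inner mult_nonneg_nonpos)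
    then show "\<zeta> p x = 0" "g\<zeta> p x = 0" by (simp_all add: \<zeta>_def g\<zeta>_def smooth_step_eq_0 pulse_eq_0)
  qed
  have \<zeta>in: "\<zeta> p x = 1" if p: "p \<in> F" and x: "norm (x - p) \<le> R p / 2" for p x
  proof -
    have "(norm (x - p))\<^sup>2 \<le> (R p / 2)\<^sup>2" using x by (intro power_mono) auto
    then have "(x - p) \<bullet> (x - p) \<le> (R p)\<^sup>2 / 4" by (simp add: power2_norm_eq_inner power_divide)
    then have "k p * (3/4 * (R p)\<^sup>2) \<le> a p x" unfolding a_def using kpos[OF p] by (intro mult_left_mono) auto
    moreover have "k p * (3/4 * (R p)\<^sup>2) = 1" using q(2)[OF p] by (simp add: k_def)
    ultimately show ?thesis by (simp add: \<zeta>_def smooth_step_eq_1)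
  qed
  have \<zeta>01: "0 \<le> \<zeta> p x" "\<zeta> p x \<le> 1" for p x by (simp_all add: \<zeta>_def smooth_step_nonneg smooth_step_le_1)
  define B\<zeta> where "B\<zeta> p = 2 * k p * M * R p" for p
  have g\<zeta>b: "norm (g\<zeta> p x) \<le> B\<zeta> p" if p: "p \<in> F" for p x
  proof (cases "norm (x - p) \<ge> R p")
    case True
    then show ?thesis using \<zeta>out(2)[OF p True] kpos[OF p] M(1) q(2)[OF p] by (simp add: B\<zeta>_def)
  next
    case False
    have "norm (g\<zeta> p x) = 2 * k p * pulse (a p x) * norm (x - p)"
      using kpos[OF p] pulse_nonneg[of "a p x"] by (simp add: g\<zeta>_def abs_mult)
    also have "\<dots> \<le> 2 * k p * M * R p"
      using kpos[OF p] M False pulse_nonneg[of "a p x"] q(2)[OF p] by (intro mult_mono) auto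
    finally show ?thesis by (simp add: B\<zeta>_def)
  qed
  \<comment> \<open>Half the smallest width on which the tangential estimates hold, so that h > -2
    \<epsilon>0 implies h > -\<eta> p; the inserted 1 covers an empty F.\<close>
  define \<epsilon>0 where "\<epsilon>0 = Min (insert 1 (\<eta> ` F)) / 2"
  have \<epsilon>0: "\<epsilon>0 > 0" "\<And>p. p \<in> F \<Longrightarrow> 2 * \<epsilon>0 \<le> \<eta> p"
  proof -
    have "Min (insert 1 (\<eta> ` F)) > 0" using F(2) q(4) by (subst Min_gr_iff) auto
    then show "\<epsilon>0 > 0" by (simp add: \<epsilon>0_def)
    show "2 * \<epsilon>0 \<le> \<eta> p" if "p \<in> F" for p unfolding \<epsilon>0_def using F(2) that by (simp add: Min_le)
  qed
  define \<epsilon> where "\<epsilon> n = \<epsilon>0 / real (Suc n)" for n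
  have \<epsilon>pos: "\<epsilon> n > 0" for n using \<epsilon>0 by (simp add: \<epsilon>_def)
  have \<epsilon>le: "\<epsilon> n \<le> \<epsilon>0" for n
    unfolding \<epsilon>_def using \<epsilon>0(1) by (simp add: divide_le_eq mult_le_cancel_left1)
  \<comment> \<open>The second factor is 0 where h \<le> -2 \<epsilon> n and 1 where h \<ge>
    -\<epsilon> n, so it varies only in the layer between. The first factor confines the product to
    the chart, outside of which h is not known to be smooth.\<close>
  define T where "T n p x = \<zeta> p x * smooth_step (2 + h p x / \<epsilon> n)" for n p x
  define gT where "gT n p x = (if x \<in> cball p (R p) then smooth_step (2 + h p x / \<epsilon> n) *\<^sub>R g\<zeta> p x
      + (\<zeta> p x * pulse (2 + h p x / \<epsilon> n) / \<epsilon> n) *\<^sub>R gradient (h p) x else 0)" for n p x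
  have Td: "(T n p has_derivative (\<lambda>v. gT n p x \<bullet> v)) (at x)" if p: "p \<in> F" for n p x
  proof (cases "x \<in> cball p (R p)")
    case True
    then have xV: "x \<in> V p" using q(5)[OF p] by blast
    have "((\<lambda>x. 2 + h p x / \<epsilon> n) has_derivative (\<lambda>v. (gradient (h p) x \<bullet> v) / \<epsilon> n)) (at x)"
      using \<epsilon>pos[of n] by (auto intro!: derivative_eq_intros gradient_has_derivative[OF sm(1)[OF p] xV])
    from has_derivative_compose[OF this smooth_step_DERIV[unfolded has_field_derivative_def]]
    have "((\<lambda>x. smooth_step (2 + h p x / \<epsilon> n)) has_derivative (\<lambda>v. pulse (2 + h p x / \<epsilon> n) * ((gradient (h p) x \<bullet> v) / \<epsilon> n))) (at x)" .
    from has_derivative_mult[OF \<zeta>d[of p x] this]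
    have "(T n p has_derivative (\<lambda>v. \<zeta> p x * (pulse (2 + h p x / \<epsilon> n) * ((gradient (h p) x \<bullet> v) / \<epsilon> n)) + (g\<zeta> p x \<bullet> v) * smooth_step (2 + h p x / \<epsilon> n))) (at x)"
      by (simp only: T_def[abs_def])
    moreover have "(\<lambda>v. \<zeta> p x * (pulse (2 + h p x / \<epsilon> n) * ((gradient (h p) x \<bullet> v) / \<epsilon> n)) + (g\<zeta> p x \<bullet> v) * smooth_step (2 + h p x / \<epsilon> n)) = (\<lambda>v. gT n p x \<bullet> v)"
      using True by (simp add: gT_def fun_eq_iff inner_add_left)
    ultimately show ?thesis by simp
  next
    case False
    have "((\<lambda>_. 0) has_derivative (\<lambda>_. 0)) (at x)" by simp
    then have "(T n p has_derivative (\<lambda>_. 0)) (at x)"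
    proof (rule has_derivative_transform_within_open[where s="- cball p (R p)"])
      show "0 = T n p y" if "y \<in> - cball p (R p)" for y
        using that \<zeta>out(1)[OF p, of y] by (simp add: T_def dist_norm norm_minus_commute)
    qed (use False in auto)
    with False show ?thesis by (simp add: gT_def)
  qed
  have gTc: "continuous_on (V p) (gT n p)" if p: "p \<in> F" for n p
  proof -
    have hc: "continuous_on (V p) (h p)" by (rule smooth_on_continuous_on[OF sm(1)[OF p]])
    have ac: "continuous_on (V p) (\<lambda>x. 2 + h p x / \<epsilon> n)" by (intro continuous_intros hc) (use \<epsilon>pos[of n] in auto)
    have zc: "continuous_on (V p) (\<zeta> p)"
      by (intro continuous_at_imp_continuous_on ballI has_derivative_continuous[OF \<zeta>d])
    have "continuous_on (V p) (\<lambda>x. smooth_step (2 + h p x / \<epsilon> n) *\<^sub>R g\<zeta> p x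
      + (\<zeta> p x * pulse (2 + h p x / \<epsilon> n) / \<epsilon> n) *\<^sub>R gradient (h p) x)"
      by (intro continuous_intros continuous_on_compose2[OF continuous_on_smooth_step[of UNIV] ac]
          continuous_on_compose2[OF continuous_on_pulse[of UNIV] ac] zc gradient_continuous_on[OF sm(1)[OF p]]
          continuous_on_subset[OF g\<zeta>c]) (use \<epsilon>pos[of n] in auto)
    \<comment> \<open>Outside the ball both \<zeta> p and its gradient vanish, so the formula
      without case distinction is valid everywhere and continuity on V p is read off from
      it.\<close>
    moreover have "gT n p x = smooth_step (2 + h p x / \<epsilon> n) *\<^sub>R g\<zeta> p x
      + (\<zeta> p x * pulse (2 + h p x / \<epsilon> n) / \<epsilon> n) *\<^sub>R gradient (h p) x" for x
      using \<zeta>out[OF p, of x] by (auto simp: gT_def dist_norm norm_minus_commute)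
    ultimately show ?thesis by simp
  qed
  have gTc': "continuous_on UNIV (gT n p)" if p: "p \<in> F" for n p
  proof -
    have "continuous_on (V p \<union> - cball p (R p)) (gT n p)"
    proof (rule continuous_on_open_Un)
      show "open (V p)" by (rule sm(2)[OF p])
      show "continuous_on (- cball p (R p)) (gT n p)"
        by (rule continuous_on_cong[THEN iffD2, OF refl _ continuous_on_const[of _ 0]]) (auto simp: gT_def)
    qed (auto intro: gTc[OF p])
    moreover have "V p \<union> - cball p (R p) = UNIV" using q(5)[OF p] by blast
    ultimately show ?thesis by simp
  qed
  define B where "B n x = (\<Sum>p\<in>F. T n p x)" for n x
  define gB where "gB n x = (\<Sum>p\<in>F. gT n p x)" for n x
  have Bd: "(B n has_derivative (\<lambda>v. gB n x \<bullet> v)) (at x)" for n x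
    unfolding B_def[abs_def] gB_def inner_sum_left by (rule has_derivative_sum) (rule Td)
  \<comment> \<open>Near the boundary B \<ge> 1, so the formula gives 0 there and fits the extension
    by zero; at a fixed interior point B is 0 for large n and the value is 1.\<close>
  define \<kappa> where "\<kappa> n x = (if x \<in> \<Omega> then 1 - smooth_step (B n x) else 0)" for n x
  define g where "g n x = (if x \<in> \<Omega> then (- pulse (B n x)) *\<^sub>R gB n x else 0)" for n x
  have Tnn: "T n p x \<ge> 0" for n p x unfolding T_def by (intro mult_nonneg_nonneg \<zeta>01 smooth_step_nonneg)
  \<comment> \<open>An open neighbourhood of the boundary on which one of the summands of B equals
    1; removing it from the closure leaves the compact support K n.\<close>
  define W where "W n = (\<Union>p\<in>F. {x \<in> V p \<inter> ball p (R p / 2). - \<epsilon> n < h p x})" for n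
  have Wo: "open (W n)" for n
  proof -
    have "open {x \<in> V p \<inter> ball p (R p / 2). - \<epsilon> n < h p x}" if p: "p \<in> F" for p
    proof -
      have o: "open (V p \<inter> ball p (R p / 2))" using sm(2)[OF p] by (intro open_Int open_ball)
      have "continuous_on (V p \<inter> ball p (R p / 2)) (h p)"
        by (rule continuous_on_subset[OF smooth_on_continuous_on[OF sm(1)[OF p]]]) auto
      then have "open ((V p \<inter> ball p (R p / 2)) \<inter> h p -` {- \<epsilon> n<..})"
        using o by (simp add: continuous_on_open_vimage Int_commute)
      moreover have "(V p \<inter> ball p (R p / 2)) \<inter> h p -` {- \<epsilon> n<..} = {x \<in> V p \<inter> ball p (R p / 2). - \<epsilon> n < h p x}" by auto
      ultimately show ?thesis by simp
    qed
    then show ?thesis unfolding W_def by (intro open_UN ballI)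
  qed
  have WB: "B n x \<ge> 1" if x: "x \<in> W n" for n x
  proof -
    obtain p where p: "p \<in> F" "x \<in> ball p (R p / 2)" "- \<epsilon> n < h p x" using x unfolding W_def by blast
    have "\<zeta> p x = 1" using p(2) by (intro \<zeta>in p(1)) (simp add: dist_norm norm_minus_commute)
    moreover have "smooth_step (2 + h p x / \<epsilon> n) = 1"
    proof (rule smooth_step_eq_1)
      have "- 1 < h p x / \<epsilon> n" using p(3) \<epsilon>pos[of n] by (simp add: pos_less_divide_eq)
      then show "1 \<le> 2 + h p x / \<epsilon> n" by simp
    qed
    ultimately have "T n p x = 1" by (simp add: T_def)
    moreover have "T n p x \<le> B n x" unfolding B_def by (rule member_le_sum[OF p(1)]) (use Tnn F(2) in auto)
    ultimately show ?thesis by simp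
  qed
  have Wf: "frontier \<Omega> \<subseteq> W n" for n
  proof
    fix y assume y: "y \<in> frontier \<Omega>"
    then obtain p where p: "p \<in> F" "y \<in> ball p (R p / 2)" using F(3) by blast
    have "y \<in> cball p (R p)" using p(2) q(2)[OF p(1)] by auto
    then have yV: "y \<in> V p" using q(5)[OF p(1)] by blast
    have "h p y = 0" by (rule defining_function_zero[OF q(1)[OF p(1)] y yV \<Omega>(1)])
    then show "y \<in> W n" unfolding W_def using p yV \<epsilon>pos[of n] by auto
  qed
  have Wz: "\<kappa> n x = 0" "g n x = 0" if "x \<in> W n" for n x
    using WB[OF that] by (simp_all add: \<kappa>_def g_def smooth_step_eq_1 pulse_eq_0)
  define K where "K n = closure \<Omega> - W n" for n
  have K: "compact (K n)" "K n \<subseteq> \<Omega>" for n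
  proof -
    show "compact (K n)" unfolding K_def using \<Omega>(2) Wo by (intro compact_diff) (auto simp: compact_closure)
    show "K n \<subseteq> \<Omega>" unfolding K_def using Wf[of n] \<Omega>(1) by (auto simp: frontier_def interior_open)
  qed
  have Kz: "\<kappa> n x = 0" "g n x = 0" if "x \<notin> K n" for n x
    using that Wz[of x n] closure_subset[of \<Omega>] by (auto simp: K_def \<kappa>_def g_def)
  have \<kappa>d: "(\<kappa> n has_derivative (\<lambda>v. g n x \<bullet> v)) (at x)" for n x
  proof (cases "x \<in> \<Omega>")
    case True
    have "((\<lambda>x. 1 - smooth_step (B n x)) has_derivative (\<lambda>v. 0 - pulse (B n x) * (gB n x \<bullet> v))) (at x)"
      by (intro has_derivative_diff has_derivative_const
          has_derivative_compose[OF Bd smooth_step_DERIV[unfolded has_field_derivative_def]])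
    then have "(\<kappa> n has_derivative (\<lambda>v. 0 - pulse (B n x) * (gB n x \<bullet> v))) (at x)"
      by (rule has_derivative_transform_within_open[OF _ \<Omega>(1) True]) (simp add: \<kappa>_def)
    with True show ?thesis by (simp add: g_def)
  next
    case False
    have "((\<lambda>_. 0) has_derivative (\<lambda>_. 0)) (at x)" by simp
    then have "(\<kappa> n has_derivative (\<lambda>_. 0)) (at x)"
    proof (rule has_derivative_transform_within_open[where s="- K n"])
      show "open (- K n)" using K(1) by (intro open_Compl compact_imp_closed)
      show "x \<in> - K n" using False K(2)[of n] by blast
      show "0 = \<kappa> n y" if "y \<in> - K n" for y using Kz(1)[of y n] that by simp
    qed
    with False show ?thesis by (simp add: g_def)
  qed
  have gc: "continuous_on UNIV (g n)" for n
  proof -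
    have Bc: "continuous_on \<Omega> (B n)"
      by (intro continuous_at_imp_continuous_on ballI has_derivative_continuous[OF Bd])
    have "continuous_on (\<Omega> \<union> - K n) (g n)"
    proof (rule continuous_on_open_Un)
      show "open (- K n)" using K(1) by (intro open_Compl compact_imp_closed)
      show "continuous_on (- K n) (g n)"
        by (rule continuous_on_cong[THEN iffD2, OF refl _ continuous_on_const[of _ 0]]) (use Kz(2) in auto)
      have "continuous_on \<Omega> (\<lambda>x. (- pulse (B n x)) *\<^sub>R gB n x)"
        unfolding gB_def
        by (intro continuous_intros continuous_on_compose2[OF continuous_on_pulse[of UNIV] Bc]
            continuous_on_subset[OF gTc']) auto
      then show "continuous_on \<Omega> (g n)"
        by (rule continuous_on_cong[THEN iffD1, OF refl _, rotated]) (simp add: g_def)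
    qed (rule \<Omega>(1))
    moreover have "\<Omega> \<union> - K n = UNIV" using K(2)[of n] by blast
    ultimately show ?thesis by simp
  qed
  \<comment> \<open>The outer M bounds \<open>pulse (B n x)\<close>, B\<zeta> the gradient of the
    localization, and 2 M Cp is the inner pulse times the tangential constant times the ratio of the
    layer width 2 \<epsilon> n to \<epsilon> n.\<close>
  define C where "C = M * (\<Sum>p\<in>F. B\<zeta> p + 2 * M * Cp p)"
  have B\<zeta>nn: "B\<zeta> p \<ge> 0" if "p \<in> F" for p
    unfolding B\<zeta>_def using kpos[OF that] M(1) q(2)[OF that] by simp
  have Cnn: "C \<ge> 0" unfolding C_def using M(1) B\<zeta>nn q(3) by (intro mult_nonneg_nonneg sum_nonneg add_nonneg_nonneg) auto
  have gbound: "\<bar>v x \<bullet> g n x\<bar> \<le> C * L" if v: "tangential_Lipschitz_field \<Omega> L v" and x: "x \<in> \<Omega>" for n L v x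
  proof -
    have L: "L \<ge> 0" "norm (v x) \<le> L" using v x unfolding tangential_Lipschitz_field_def by blast+
    have Tb: "\<bar>v x \<bullet> gT n p x\<bar> \<le> (B\<zeta> p + 2 * M * Cp p) * L" if p: "p \<in> F" for p
    proof (cases "x \<in> cball p (R p)")
      case True
      have "\<bar>smooth_step (2 + h p x / \<epsilon> n) * (v x \<bullet> g\<zeta> p x)\<bar> \<le> 1 * (L * B\<zeta> p)"
      proof -
        have "\<bar>v x \<bullet> g\<zeta> p x\<bar> \<le> L * B\<zeta> p"
          using Cauchy_Schwarz_ineq2[of "v x" "g\<zeta> p x"] mult_mono[OF L(2) g\<zeta>b[OF p, of x] L(1) norm_ge_zero] by linarith
        then show ?thesis unfolding abs_mult
          using smooth_step_nonneg smooth_step_le_1 L(1) B\<zeta>nn[OF p] by (intro mult_mono) auto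
      qed
      moreover have "\<bar>(\<zeta> p x * pulse (2 + h p x / \<epsilon> n) / \<epsilon> n) * (v x \<bullet> gradient (h p) x)\<bar> \<le> 2 * M * Cp p * L"
      proof (cases "pulse (2 + h p x / \<epsilon> n) = 0")
        case pz: False
        then have "0 < 2 + h p x / \<epsilon> n" using pulse_eq_0 not_le by blast
        \<comment> \<open>The pulse is nonzero only where h > -2 \<epsilon> n, and there the factor
          |h| \<le> 2 \<epsilon> n of the tangential estimate cancels the 1 / \<epsilon> n.\<close>
        then have hb: "- (2 * \<epsilon> n) < h p x" using \<epsilon>pos[of n] by (simp add: field_simps)
        have "h p x < 0" using x True q(5)[OF p] sm(3)[OF p] by blast
        then have habs: "\<bar>h p x\<bar> \<le> 2 * \<epsilon> n" using hb by simp
        have "- \<eta> p < h p x" using hb \<epsilon>le[of n] \<epsilon>0(2)[OF p] by linarith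
        then have "\<bar>v x \<bullet> gradient (h p) x\<bar> \<le> Cp p * L * \<bar>h p x\<bar>" using x True by (intro q(6)[OF p] v) auto
        also have "\<dots> \<le> Cp p * L * (2 * \<epsilon> n)" using habs q(3)[OF p] L(1) by (intro mult_left_mono mult_nonneg_nonneg) auto
        finally have 1: "\<bar>v x \<bullet> gradient (h p) x\<bar> \<le> Cp p * L * (2 * \<epsilon> n)" .
        have "\<bar>\<zeta> p x * pulse (2 + h p x / \<epsilon> n)\<bar> \<le> 1 * M"
          unfolding abs_mult using \<zeta>01[of p x] pa M(1) by (intro mult_mono) auto
        then have 2: "\<bar>\<zeta> p x * pulse (2 + h p x / \<epsilon> n) / \<epsilon> n\<bar> \<le> M / \<epsilon> n"
          using \<epsilon>pos[of n] by (simp add: divide_right_mono)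
        have "\<bar>(\<zeta> p x * pulse (2 + h p x / \<epsilon> n) / \<epsilon> n) * (v x \<bullet> gradient (h p) x)\<bar> \<le> (M / \<epsilon> n) * (Cp p * L * (2 * \<epsilon> n))"
          unfolding abs_mult[of _ "v x \<bullet> gradient (h p) x"] using M(1) \<epsilon>pos[of n] by (intro mult_mono 1 2) auto
        also have "\<dots> = 2 * M * Cp p * L" using \<epsilon>pos[of n] by simp
        finally show ?thesis .
      qed (use M(1) q(3)[OF p] L(1) in simp)
      moreover have "v x \<bullet> gT n p x = smooth_step (2 + h p x / \<epsilon> n) * (v x \<bullet> g\<zeta> p x)
          + (\<zeta> p x * pulse (2 + h p x / \<epsilon> n) / \<epsilon> n) * (v x \<bullet> gradient (h p) x)"
        using True by (simp add: gT_def inner_add_right)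
      ultimately have "\<bar>v x \<bullet> gT n p x\<bar> \<le> 1 * (L * B\<zeta> p) + 2 * M * Cp p * L" by linarith
      then show ?thesis by (simp add: algebra_simps)
    next
      case False
      then show ?thesis using B\<zeta>nn[OF p] M(1) q(3)[OF p] L(1) by (simp add: gT_def)
    qed
    have "\<bar>v x \<bullet> gB n x\<bar> \<le> (\<Sum>p\<in>F. (B\<zeta> p + 2 * M * Cp p) * L)"
      unfolding gB_def inner_sum_right by (rule order_trans[OF sum_abs sum_mono]) (rule Tb)
    then have "M * \<bar>v x \<bullet> gB n x\<bar> \<le> C * L"
      unfolding C_def mult.assoc sum_distrib_right using M(1) by (intro mult_left_mono) auto
    moreover have "\<bar>v x \<bullet> g n x\<bar> = \<bar>pulse (B n x)\<bar> * \<bar>v x \<bullet> gB n x\<bar>" using x by (simp add: g_def abs_mult)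
    moreover have "\<dots> \<le> M * \<bar>v x \<bullet> gB n x\<bar>" by (intro mult_right_mono pa) simp
    ultimately show ?thesis by linarith
  qed
  have conv1: "eventually (\<lambda>n. \<kappa> n x = 1 \<and> g n x = 0) sequentially" if x: "x \<in> \<Omega>" for x
  proof -
    have "eventually (\<lambda>n. T n p x = 0) sequentially" if p: "p \<in> F" for p
    proof (cases "x \<in> cball p (R p)")
      case True
      then have neg: "h p x < 0" using x q(5)[OF p] sm(3)[OF p] by blast
      obtain N where N: "2 * \<epsilon>0 / (- h p x) < real N" using reals_Archimedean2 by blast
      have "T n p x = 0" if n: "n \<ge> N" for n
      proof -
        have "2 * \<epsilon>0 / (- h p x) < real (Suc n)" using N n by linarith
        then have "2 * \<epsilon>0 < real (Suc n) * (- h p x)" using neg by (simp only: pos_divide_less_eq[of "- h p x"] neg_0_less_iff_less)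
        then have "2 * \<epsilon> n \<le> - h p x" unfolding \<epsilon>_def by (simp add: pos_divide_le_eq mult.commute del: of_nat_Suc)
        then have "2 + h p x / \<epsilon> n \<le> 0" using \<epsilon>pos[of n] by (simp add: field_simps)
        then show ?thesis by (simp add: T_def smooth_step_eq_0)
      qed
      then show ?thesis unfolding eventually_sequentially by blast
    next
      case False
      then have "\<zeta> p x = 0" by (intro \<zeta>out(1)[OF p]) (simp add: dist_norm norm_minus_commute)
      then show ?thesis by (simp add: T_def)
    qed
    then have "eventually (\<lambda>n. \<forall>p\<in>F. T n p x = 0) sequentially"
      using F(2) by (simp add: eventually_ball_finite)
    then show ?thesis
    proof eventually_elim
      case (elim n)
      then have "B n x = 0" by (simp add: B_def)
      then show ?case using x by (simp add: \<kappa>_def g_def smooth_step_eq_0 pulse_eq_0)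
    qed
  qed
  have \<kappa>01: "0 \<le> \<kappa> n x" "\<kappa> n x \<le> 1" for n x
    by (auto simp: \<kappa>_def smooth_step_nonneg smooth_step_le_1)
  have "cutoff_sequence \<Omega> \<kappa> g C"
    unfolding cutoff_sequence_def
  proof (intro conjI allI impI ballI)
    show "\<exists>K. compact K \<and> K \<subseteq> \<Omega> \<and> (\<forall>x. x \<notin> K \<longrightarrow> \<kappa> n x = 0 \<and> g n x = 0)" for n
      using K[of n] Kz[of _ n] by (intro exI[of _ "K n"]) simp
  qed (simp_all add: Cnn \<kappa>01 \<kappa>d gc gbound conv1)
  then show ?thesis by (rule that)
qed

section \<open>Integral inequalities\<close>

lemma absolutely_integrable_continuous_mult:
  fixes k g :: "real \<Rightarrow> real"
  assumes k: "continuous_on {a..b} k" and g: "g absolutely_integrable_on {a..b}"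
  shows "(\<lambda>x. k x * g x) absolutely_integrable_on {a..b}"
proof (rule absolutely_integrable_bounded_measurable_product_real[OF _ _ _ g])
  show "k \<in> borel_measurable (lebesgue_on {a..b})"
    by (rule continuous_imp_measurable_on_sets_lebesgue[OF k]) simp
  show "bounded (k ` {a..b})"
    by (intro compact_imp_bounded compact_continuous_image k compact_Icc)
qed simp

text \<open>A chain rule inequality that replaces the theory of absolutely continuous functions:
  convexity gives it on short intervals up to an error, and the inequality is additive.\<close>

lemma convex_chain_inequality:
  fixes w g F F' :: "real \<Rightarrow> real"
  assumes ab: "a \<le> b" and w: "continuous_on {a..b} w" and g: "g absolutely_integrable_on {a..b}"
    and incr: "\<And>s t. a \<le> s \<Longrightarrow> s \<le> t \<Longrightarrow> t \<le> b \<Longrightarrow> integral {s..t} g \<le> w t - w s"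
    and F: "\<And>x y. F' x * (y - x) \<le> F y - F x" and F': "continuous_on UNIV F'" "\<And>x. F' x \<ge> 0"
  shows "integral {a..b} (\<lambda>\<tau>. F' (w \<tau>) * g \<tau>) \<le> F (w b) - F (w a)"
proof (rule field_le_epsilon)
  define k where "k \<tau> = F' (w \<tau>)" for \<tau>
  have kc: "continuous_on {a..b} k"
    unfolding k_def by (rule continuous_on_compose2[OF F'(1) w]) simp
  have ki: "(\<lambda>\<tau>. k \<tau> * g \<tau>) absolutely_integrable_on {a..b}"
    by (rule absolutely_integrable_continuous_mult[OF kc g])
  have sub: "f integrable_on {s..t}" if "f integrable_on {a..b}" "a \<le> s" "t \<le> b" for f :: "real \<Rightarrow> real" and s t
    using that by (meson atLeastatMost_subset_iff integrable_on_subinterval)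
  have gi: "g integrable_on {a..b}" "(\<lambda>\<tau>. \<bar>g \<tau>\<bar>) integrable_on {a..b}" "(\<lambda>\<tau>. k \<tau> * g \<tau>) integrable_on {a..b}"
    using g ki by (auto simp: absolutely_integrable_on_def)
  fix \<epsilon> :: real assume \<epsilon>: "\<epsilon> > 0"
  define A where "A = integral {a..b} (\<lambda>\<tau>. \<bar>g \<tau>\<bar>)"
  have A: "A \<ge> 0" unfolding A_def by (intro integral_nonneg gi) auto
  define e where "e = \<epsilon> / (A + 1)"
  have e: "e > 0" "e * A \<le> \<epsilon>" using \<epsilon> A by (auto simp: e_def divide_simps)
  \<comment> \<open>Subtracting e |g| absorbs the oscillation of k on short intervals, so the
    inequality for f holds there without error and is preserved when intervals are joined; the total
    loss e A is at most \<epsilon>.\<close>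
  define f where "f \<tau> = k \<tau> * g \<tau> - e * \<bar>g \<tau>\<bar>" for \<tau>
  have fi: "f integrable_on {a..b}"
    unfolding f_def by (intro integrable_diff gi integrable_on_mult_right)
  have "a \<le> a \<and> b \<le> b \<longrightarrow> integral {a..b} f \<le> F (w b) - F (w a)"
  proof (rule Bolzano[OF ab, where P="\<lambda>s t. a \<le> s \<and> t \<le> b \<longrightarrow> integral {s..t} f \<le> F (w t) - F (w s)"])
    fix s t r :: real
    assume h: "a \<le> s \<and> t \<le> b \<longrightarrow> integral {s..t} f \<le> F (w t) - F (w s)"
      "a \<le> t \<and> r \<le> b \<longrightarrow> integral {t..r} f \<le> F (w r) - F (w t)" "s \<le> t" "t \<le> r"
    show "a \<le> s \<and> r \<le> b \<longrightarrow> integral {s..r} f \<le> F (w r) - F (w s)"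
    proof
      assume b: "a \<le> s \<and> r \<le> b"
      have "integral {s..t} f + integral {t..r} f = integral {s..r} f"
        by (intro Henstock_Kurzweil_Integration.integral_combine h(3,4) sub[OF fi]) (use b in auto)
      with h b show "integral {s..r} f \<le> F (w r) - F (w s)" by linarith
    qed
  next
    fix x assume x: "a \<le> x" "x \<le> b"
    have "\<exists>d>0. \<forall>y\<in>{a..b}. dist y x < d \<longrightarrow> dist (k y) (k x) < e / 2"
      using kc x e(1) unfolding continuous_on_iff by (meson atLeastAtMost_iff half_gt_zero)
    then obtain d where d: "d > 0" "\<And>y. y \<in> {a..b} \<Longrightarrow> dist y x < d \<Longrightarrow> dist (k y) (k x) < e / 2" by blast
    show "\<exists>d>0. \<forall>s t. s \<le> x \<and> x \<le> t \<and> t - s < d \<longrightarrow> a \<le> s \<and> t \<le> b \<longrightarrow> integral {s..t} f \<le> F (w t) - F (w s)"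
    proof (intro exI[of _ d] conjI allI impI d(1))
      fix s t assume st: "s \<le> x \<and> x \<le> t \<and> t - s < d" "a \<le> s \<and> t \<le> b"
      have "integral {s..t} f \<le> integral {s..t} (\<lambda>\<tau>. k s * g \<tau>)"
      proof (rule integral_le)
        show "f integrable_on {s..t}" by (rule sub[OF fi]) (use st in auto)
        show "(\<lambda>\<tau>. k s * g \<tau>) integrable_on {s..t}"
          by (intro integrable_on_mult_right sub[OF gi(1)]) (use st in auto)
        fix \<tau> assume \<tau>: "\<tau> \<in> {s..t}"
        have "dist (k \<tau>) (k x) < e / 2" "dist (k s) (k x) < e / 2"
          by (rule d(2); use \<tau> st in \<open>auto simp: dist_real_def\<close>)+
        then have "\<bar>k \<tau> - k s\<bar> \<le> e" unfolding dist_real_def by linarith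
        then have "\<bar>k \<tau> - k s\<bar> * \<bar>g \<tau>\<bar> \<le> e * \<bar>g \<tau>\<bar>" by (rule mult_right_mono) simp
        moreover have "(k \<tau> - k s) * g \<tau> \<le> \<bar>k \<tau> - k s\<bar> * \<bar>g \<tau>\<bar>" by (metis abs_ge_self abs_mult)
        ultimately show "f \<tau> \<le> k s * g \<tau>" by (simp add: f_def algebra_simps)
      qed
      also have "\<dots> = k s * integral {s..t} g" by simp
      also have "\<dots> \<le> k s * (w t - w s)"
        using incr[of s t] st F'(2) by (intro mult_left_mono) (auto simp: k_def)
      also have "\<dots> \<le> F (w t) - F (w s)" unfolding k_def by (rule F)
      finally show "integral {s..t} f \<le> F (w t) - F (w s)" .
    qed
  qed
  then have "integral {a..b} f \<le> F (w b) - F (w a)" by simp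
  moreover have "integral {a..b} f = integral {a..b} (\<lambda>\<tau>. k \<tau> * g \<tau>) - e * A"
    unfolding f_def A_def using gi by (simp add: integral_diff integrable_on_mult_right)
  ultimately show "integral {a..b} (\<lambda>\<tau>. F' (w \<tau>) * g \<tau>) \<le> F (w b) - F (w a) + \<epsilon>"
    using e(2) unfolding k_def by linarith
qed

lemma integral_translate:
  fixes f :: "'a::euclidean_space \<Rightarrow> 'b::euclidean_space"
  assumes [measurable]: "f \<in> borel_measurable borel"
  shows "(LINT x|lborel. f (c + x)) = (LINT x|lborel. f x)"
    and "integrable lborel (\<lambda>x. f (c + x)) \<longleftrightarrow> integrable lborel f"
proof -
  have "(LINT y|lborel. f y) = (LINT y|distr lborel borel ((+) c). f y)"
    by (simp add: lborel_distr_plus)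
  then show "(LINT y|lborel. f (c + y)) = (LINT y|lborel. f y)"
    by (simp add: integral_distr)
  have "integrable lborel f \<longleftrightarrow> integrable (distr lborel borel ((+) c)) f"
    by (simp add: lborel_distr_plus)
  then show "integrable lborel (\<lambda>y. f (c + y)) \<longleftrightarrow> integrable lborel f"
    by (simp add: integrable_distr_eq)
qed

lemma integrable_bounded_compact_support:
  fixes f :: "'a::euclidean_space \<Rightarrow> 'b::euclidean_space"
  assumes f: "f \<in> borel_measurable borel" and K: "bounded K" "K \<in> sets borel"
    and B: "\<And>x. norm (f x) \<le> B" and z: "\<And>x. x \<notin> K \<Longrightarrow> f x = 0"
  shows "integrable lborel f"
proof (rule Bochner_Integration.integrable_bound[where f="\<lambda>x. B * indicator K x"])
  have "emeasure lborel K < \<infinity>" using K(1) by (rule emeasure_bounded_finite)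
  then show "integrable lborel (\<lambda>x. B * indicator K x)" using K(2) by simp
  show "AE x in lborel. norm (f x) \<le> norm (B * indicator K x)"
  proof (intro AE_I2)
    fix x show "norm (f x) \<le> norm (B * indicator K x)"
      using B[of x] z[of x] by (cases "x \<in> K") auto
  qed
qed (use f in simp)

text \<open>For a Lipschitz field this is integration by parts with the bound \<open>\<bar>div V\<bar> \<le> n L\<close>; difference
  quotients avoid the weak divergence.\<close>

lemma integral_field_gradient_le:
  fixes U :: "'a::euclidean_space set" and V :: "'a \<Rightarrow> 'a" and L :: real
  assumes U: "open U" and V: "V \<in> borel_measurable borel" "\<And>x. norm (V x) \<le> L"
    and lip: "\<And>x y. closed_segment x y \<subseteq> U \<Longrightarrow> norm (V x - V y) \<le> L * norm (x - y)"
    and \<psi>: "\<And>x. \<psi> x \<ge> 0" "\<And>x. (\<psi> has_derivative (\<lambda>h. G x \<bullet> h)) (at x)" "continuous_on UNIV G"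
    and K: "compact K" "K \<subseteq> U" "\<And>x. x \<notin> K \<Longrightarrow> \<psi> x = 0" "\<And>x. x \<notin> K \<Longrightarrow> G x = 0"
  shows "integrable lborel (\<lambda>x. V x \<bullet> G x)"
    and "(LINT x|lborel. V x \<bullet> G x) \<le> DIM('a) * L * (LINT x|lborel. \<psi> x)"
proof -
  have L: "L \<ge> 0" using V(2)[of 0] norm_ge_zero order_trans by blast
  have \<psi>c: "continuous_on UNIV \<psi>"
    by (intro continuous_at_imp_continuous_on ballI has_derivative_continuous[OF \<psi>(2)])
  have \<psi>m[measurable]: "\<psi> \<in> borel_measurable borel" by (rule borel_measurable_continuous_onI[OF \<psi>c])
  have Gm[measurable]: "G \<in> borel_measurable borel" by (rule borel_measurable_continuous_onI[OF \<psi>(3)])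
  note V(1)[measurable]
  have Kb: "bounded K" "K \<in> sets borel" using K(1) by (auto intro: compact_imp_bounded borel_compact)
  have "bounded (G ` K)" by (intro compact_imp_bounded compact_continuous_image K(1) continuous_on_subset[OF \<psi>(3)]) auto
  then obtain M where M: "M > 0" "\<And>y. y \<in> G ` K \<Longrightarrow> norm y \<le> M" unfolding bounded_pos by blast
  have GM: "norm (G x) \<le> M" for x
  proof (cases "x \<in> K")
    case True
    then show ?thesis by (intro M(2) imageI)
  next
    case False
    then show ?thesis using K(4) M(1) by simp
  qed
  have VG: "norm (V x \<bullet> G x) \<le> L * M" for x
    using Cauchy_Schwarz_ineq2[of "V x" "G x"] mult_mono[OF V(2) GM L norm_ge_zero, of x x] by simp
  show iVG: "integrable lborel (\<lambda>x. V x \<bullet> G x)"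
    by (rule integrable_bounded_compact_support[OF _ Kb VG]) (auto simp: K(4))
  have i\<psi>: "integrable lborel \<psi>"
  proof -
    obtain e where "\<forall>x\<in>K. norm x \<le> e" using Kb(1) unfolding bounded_iff by blast
    then have "x \<notin> K" if "norm x \<ge> e + 1" for x using that by force
    then show ?thesis by (intro integrable_continuous_bounded_support[where e="e + 1"] \<psi>c K(3)) auto
  qed
  obtain \<delta> where \<delta>: "\<delta> > 0" "(\<Union>x\<in>K. cball x \<delta>) \<subseteq> U"
    using compact_subset_open_imp_cball_epsilon_subset[OF K(1) U K(2)] by blast
  define \<eta> where "\<eta> n = min 1 \<delta> / real (Suc n)" for n
  have \<eta>: "\<eta> n > 0" "\<eta> n \<le> \<delta>" "\<eta> n \<le> 1" for n
  proof -
    have "min 1 \<delta> / real (Suc n) \<le> min 1 \<delta> / 1" using \<delta>(1) by (intro divide_left_mono) auto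
    then show "\<eta> n > 0" "\<eta> n \<le> \<delta>" "\<eta> n \<le> 1" using \<delta>(1) by (auto simp: \<eta>_def)
  qed
  have \<eta>0: "\<eta> \<longlonglongrightarrow> 0" unfolding \<eta>_def by (rule real_tendsto_divide_at_top tendsto_const filterlim_compose[OF filterlim_real_sequentially filterlim_Suc])+
  \<comment> \<open>The steps \<eta> n are at most 1, so the closed unit neighbourhood of K contains
    the supports of all difference quotients and supplies one dominating function.\<close>
  define K' where "K' = {x + y |x y. x \<in> K \<and> y \<in> cball (0::'a) 1}"
  have K': "compact K'" unfolding K'_def by (intro compact_sums K(1) compact_cball)
  have part: "(LINT x|lborel. (V x \<bullet> b) * (G x \<bullet> b)) \<le> L * (LINT x|lborel. \<psi> x)" if b: "b \<in> Basis" for b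
  proof -
    have nb: "norm b = 1" using b by simp
    define q where "q n x = (V x \<bullet> b) * ((\<psi> (\<eta> n *\<^sub>R b + x) - \<psi> x) / \<eta> n)" for n x
    have qm: "q n \<in> borel_measurable borel" for n unfolding q_def by measurable
    have mv: "\<bar>\<psi> (\<eta> n *\<^sub>R b + x) - \<psi> x\<bar> \<le> M * \<eta> n" for n x
    proof -
      have "norm (\<psi> (\<eta> n *\<^sub>R b + x) - \<psi> x) \<le> M * norm (\<eta> n *\<^sub>R b + x - x)"
      proof (rule differentiable_bound[where f=\<psi> and S=UNIV and f'="\<lambda>x h. G x \<bullet> h" and B=M])
        show "onorm (\<lambda>h. G x \<bullet> h) \<le> M" for x
        proof (rule onorm_le)
          fix h
          have "norm (G x \<bullet> h) \<le> norm (G x) * norm h" using Cauchy_Schwarz_ineq2[of "G x" h] by simp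
          also have "\<dots> \<le> M * norm h" by (intro mult_right_mono GM norm_ge_zero)
          finally show "norm (G x \<bullet> h) \<le> M * norm h" .
        qed
      qed (auto intro: \<psi>(2))
      then show ?thesis using nb \<eta>(1)[of n] by simp
    qed
    have Vb: "\<bar>V x \<bullet> b\<bar> \<le> L" for x using Basis_le_norm[OF b, of "V x"] V(2)[of x] by linarith
    have qb: "norm (q n x) \<le> L * M * indicator K' x" for n x
    proof (cases "x \<in> K'")
      case True
      have "\<bar>(\<psi> (\<eta> n *\<^sub>R b + x) - \<psi> x) / \<eta> n\<bar> \<le> M"
        using mv[of n x] \<eta>(1)[of n] by (simp add: pos_divide_le_eq)
      then have "\<bar>q n x\<bar> \<le> L * M" unfolding q_def abs_mult by (intro mult_mono Vb L) auto
      with True show ?thesis by simp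
    next
      case False
      have "x \<notin> K" using False unfolding K'_def by force
      moreover have "\<eta> n *\<^sub>R b + x \<notin> K"
      proof
        assume "\<eta> n *\<^sub>R b + x \<in> K"
        moreover have "- (\<eta> n *\<^sub>R b) \<in> cball 0 1" using nb \<eta>[of n] by simp
        moreover have "x = (\<eta> n *\<^sub>R b + x) + - (\<eta> n *\<^sub>R b)" by simp
        ultimately have "x \<in> K'" unfolding K'_def by blast
        with False show False ..
      qed
      ultimately show ?thesis using K(3) False by (simp add: q_def)
    qed
    have iK': "integrable lborel (\<lambda>x. L * M * indicator K' x)"
    proof -
      have "emeasure lborel K' < \<infinity>" using K' by (intro emeasure_bounded_finite compact_imp_bounded)
      moreover have "K' \<in> sets borel" using K' by (rule borel_compact)
      ultimately show ?thesis by simp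
    qed
    have lim: "(\<lambda>n. q n x) \<longlonglongrightarrow> (V x \<bullet> b) * (G x \<bullet> b)" for x
    proof -
      have 1: "((\<lambda>t. x + t *\<^sub>R b) has_derivative (\<lambda>s. s *\<^sub>R b)) (at 0)"
        by (auto intro!: derivative_eq_intros)
      have "(\<psi> has_derivative (\<lambda>h. G x \<bullet> h)) (at (x + 0 *\<^sub>R b))" using \<psi>(2) by simp
      from has_derivative_compose[OF 1 this]
      have "((\<lambda>t. \<psi> (x + t *\<^sub>R b)) has_real_derivative (G x \<bullet> b)) (at 0)"
        by (simp add: has_field_derivative_def mult_commute_abs)
      then have "((\<lambda>t. (\<psi> (x + t *\<^sub>R b) - \<psi> x) / t) \<longlongrightarrow> G x \<bullet> b) (at 0)"
        by (simp add: has_field_derivative_iff)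
      moreover have "filterlim \<eta> (at 0) sequentially"
        using \<eta>0 \<eta>(1) by (auto simp: filterlim_at less_imp_neq[symmetric] intro!: always_eventually)
      ultimately have "(\<lambda>n. (\<psi> (x + \<eta> n *\<^sub>R b) - \<psi> x) / \<eta> n) \<longlonglongrightarrow> G x \<bullet> b"
        by (rule filterlim_compose)
      then show ?thesis unfolding q_def by (intro tendsto_mult tendsto_const) (simp add: add.commute)
    qed
    have "(\<lambda>n. LINT x|lborel. q n x) \<longlonglongrightarrow> (LINT x|lborel. (V x \<bullet> b) * (G x \<bullet> b))"
    proof (rule integral_dominated_convergence[where w="\<lambda>x. L * M * indicator K' x"])
      show "(\<lambda>x. (V x \<bullet> b) * (G x \<bullet> b)) \<in> borel_measurable lborel" by measurable
      show "q n \<in> borel_measurable lborel" for n using qm by simp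
    qed (use lim qb iK' in auto)
    moreover have "(LINT x|lborel. q n x) \<le> L * (LINT x|lborel. \<psi> x)" for n
    proof -
      define s1 where "s1 x = (V (x - \<eta> n *\<^sub>R b) \<bullet> b) * \<psi> x" for x
      define s2 where "s2 x = (V x \<bullet> b) * \<psi> x" for x
      have sm: "s1 \<in> borel_measurable borel" "s2 \<in> borel_measurable borel"
        unfolding s1_def s2_def by measurable
      have si: "integrable lborel s1" "integrable lborel s2"
        unfolding s1_def s2_def
        using integrable_bounded_scaleR[OF i\<psi>, of "\<lambda>x. V (x - \<eta> n *\<^sub>R b) \<bullet> b" L]
          integrable_bounded_scaleR[OF i\<psi>, of "\<lambda>x. V x \<bullet> b" L] Vb by simp_all
      have si1: "integrable lborel (\<lambda>x. s1 (\<eta> n *\<^sub>R b + x))" using integral_translate(2)[OF sm(1)] si(1) by simp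
      \<comment> \<open>Integration by parts for difference quotients: translation invariance moves
        the difference from \<psi> to V, where it is at most L times the step on the support of
        \<psi>.\<close>
      have "q n = (\<lambda>x. (1 / \<eta> n) * (s1 (\<eta> n *\<^sub>R b + x) - s2 x))"
        by (auto simp: q_def s1_def s2_def fun_eq_iff algebra_simps diff_divide_distrib)
      then have "(LINT x|lborel. q n x) = (1 / \<eta> n) * ((LINT x|lborel. s1 (\<eta> n *\<^sub>R b + x)) - (LINT x|lborel. s2 x))"
        using si1 si(2) by simp
      also have "\<dots> = (1 / \<eta> n) * (LINT x|lborel. s1 x - s2 x)"
        using si integral_translate(1)[OF sm(1)] by simp
      also have "(LINT x|lborel. s1 x - s2 x) \<le> (LINT x|lborel. (L * \<eta> n) * \<psi> x)"
      proof (rule integral_mono)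
        fix x
        show "s1 x - s2 x \<le> (L * \<eta> n) * \<psi> x"
        proof (cases "x \<in> K")
          case True
          have "closed_segment (x - \<eta> n *\<^sub>R b) x \<subseteq> cball x \<delta>"
            using \<eta>[of n] nb \<delta>(1) by (intro closed_segment_subset convex_cball) (auto simp: dist_norm)
          also have "\<dots> \<subseteq> U" using \<delta>(2) True by blast
          finally have "norm (V (x - \<eta> n *\<^sub>R b) - V x) \<le> L * \<eta> n"
            using lip[of "x - \<eta> n *\<^sub>R b" x] nb \<eta>(1)[of n] by simp
          then have "(V (x - \<eta> n *\<^sub>R b) - V x) \<bullet> b \<le> L * \<eta> n"
            using Basis_le_norm[OF b, of "V (x - \<eta> n *\<^sub>R b) - V x"] by linarith
          then have "((V (x - \<eta> n *\<^sub>R b) - V x) \<bullet> b) * \<psi> x \<le> (L * \<eta> n) * \<psi> x"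
            by (intro mult_right_mono \<psi>(1))
          then show ?thesis by (simp add: s1_def s2_def inner_diff_left algebra_simps)
        qed (simp add: s1_def s2_def K(3))
      qed (use si i\<psi> in auto)
      then have "(1 / \<eta> n) * (LINT x|lborel. s1 x - s2 x) \<le> (1 / \<eta> n) * (LINT x|lborel. (L * \<eta> n) * \<psi> x)"
        using \<eta>(1)[of n] by (intro mult_left_mono) auto
      also have "\<dots> = L * (LINT x|lborel. \<psi> x)" using \<eta>(1)[of n] by simp
      finally show ?thesis .
    qed
    ultimately show ?thesis by (intro LIMSEQ_le_const2) auto
  qed
  have "(LINT x|lborel. V x \<bullet> G x) = (LINT x|lborel. (\<Sum>b\<in>Basis. (V x \<bullet> b) * (G x \<bullet> b)))"
    by (intro Bochner_Integration.integral_cong refl euclidean_inner)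
  also have "\<dots> = (\<Sum>b\<in>Basis. LINT x|lborel. (V x \<bullet> b) * (G x \<bullet> b))"
  proof (rule Bochner_Integration.integral_sum)
    fix b :: 'a assume b: "b \<in> Basis"
    have "norm ((V x \<bullet> b) * (G x \<bullet> b)) \<le> L * M" for x
      unfolding real_norm_def abs_mult
      using Basis_le_norm[OF b, of "V x"] Basis_le_norm[OF b, of "G x"] V(2)[of x] GM[of x] L
      by (intro mult_mono) auto
    then show "integrable lborel (\<lambda>x. (V x \<bullet> b) * (G x \<bullet> b))"
      by (intro integrable_bounded_compact_support[OF _ Kb]) (auto simp: K(4))
  qed
  also have "\<dots> \<le> (\<Sum>b\<in>(Basis::'a set). L * (LINT x|lborel. \<psi> x))" by (intro sum_mono part)
  finally show "(LINT x|lborel. V x \<bullet> G x) \<le> DIM('a) * L * (LINT x|lborel. \<psi> x)" by simp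
qed

section \<open>The squared positive part\<close>

lemma max_0_power2_DERIV: "((\<lambda>s::real. (max 0 s)\<^sup>2) has_real_derivative 2 * max 0 s) (at s)"
proof -
  consider "s < 0" | "s = 0" | "s > 0" by linarith
  then show ?thesis
  proof cases
    case 1
    have "((\<lambda>_. 0) has_real_derivative 0) (at s)" by simp
    then have "((\<lambda>s::real. (max 0 s)\<^sup>2) has_real_derivative 0) (at s)"
      by (rule has_field_derivative_transform_within_open[where S="{..<0}"]) (use 1 in auto)
    with 1 show ?thesis by simp
  next
    case 2
    have "((\<lambda>y::real. (max 0 y)\<^sup>2 / y) \<longlongrightarrow> 0) (at 0)"
    proof (rule tendsto_rabs_zero_cancel, rule tendsto_sandwich[OF _ _ tendsto_const])
      show "((\<lambda>y::real. \<bar>y\<bar>) \<longlongrightarrow> 0) (at 0)" by (intro tendsto_rabs_zero tendsto_ident_at)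
      show "\<forall>\<^sub>F y in at (0::real). \<bar>(max 0 y)\<^sup>2 / y\<bar> \<le> \<bar>y\<bar>"
        by (intro always_eventually) (auto simp: max_def power2_eq_square)
    qed auto
    with 2 show ?thesis by (simp add: has_field_derivative_iff)
  next
    case 3
    have "((\<lambda>s::real. s\<^sup>2) has_real_derivative 2 * s) (at s)" by (auto intro!: derivative_eq_intros)
    then have "((\<lambda>s::real. (max 0 s)\<^sup>2) has_real_derivative 2 * s) (at s)"
      by (rule has_field_derivative_transform_within_open[where S="{0<..}"]) (use 3 in auto)
    with 3 show ?thesis by simp
  qed
qed

text \<open>Convexity in the tangent-line form required by \<open>convex_chain_inequality\<close>;
  it reduces to a square being nonnegative.\<close>

lemma max_0_power2_convex: "2 * max 0 x * (y - x) \<le> (max 0 y)\<^sup>2 - (max 0 (x::real))\<^sup>2"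
proof -
  have "max 0 x * y \<le> max 0 x * max 0 y" by (intro mult_left_mono) auto
  moreover have "max 0 x * x = (max 0 x)\<^sup>2" by (auto simp: max_def power2_eq_square)
  moreover have "0 \<le> (max 0 y - max 0 x)\<^sup>2" by simp
  ultimately show ?thesis by (simp add: power2_diff algebra_simps)
qed

section \<open>The estimate at a fixed time\<close>

definition extend_by_zero :: "'a set \<Rightarrow> ('a \<Rightarrow> 'b::zero) \<Rightarrow> 'a \<Rightarrow> 'b" where
  "extend_by_zero \<Omega> f x = (if x \<in> \<Omega> then f x else 0)"

lemma borel_measurable_extend_by_zero:
  fixes f :: "'a::euclidean_space \<Rightarrow> 'b::euclidean_space"
  assumes "open \<Omega>" "continuous_on \<Omega> f"
  shows "extend_by_zero \<Omega> f \<in> borel_measurable borel"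
proof -
  have "(\<lambda>x. indicator \<Omega> x *\<^sub>R f x) \<in> borel_measurable borel"
    using assms by (intro borel_measurable_continuous_on_indicator) auto
  moreover have "extend_by_zero \<Omega> f = (\<lambda>x. indicator \<Omega> x *\<^sub>R f x)"
    by (auto simp: extend_by_zero_def fun_eq_iff)
  ultimately show ?thesis by simp
qed

lemma integrable_dominated:
  fixes f :: "'a::euclidean_space \<Rightarrow> 'b::euclidean_space"
  assumes w: "integrable lborel w" and f: "f \<in> borel_measurable borel" and b: "\<And>x. norm (f x) \<le> w x"
  shows "integrable lborel f" and "norm (LINT x|lborel. f x) \<le> (LINT x|lborel. w x)"
proof -
  show i: "integrable lborel f"
  proof (rule Bochner_Integration.integrable_bound[OF w])
    show "AE x in lborel. norm (f x) \<le> norm (w x)"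
      using b by (intro AE_I2) (smt (verit) real_norm_def)
  qed (use f in simp)
  show "norm (LINT x|lborel. f x) \<le> (LINT x|lborel. w x)"
    by (rule Bochner_Integration.integral_norm_bound_integral[OF i w b])
qed

text \<open>The divergence at x of the mollification of r V, with the derivative placed on the
  kernel. Under the continuity equation it is minus the time derivative of the mollified
  density.\<close>

definition flux :: "real \<Rightarrow> ('a::euclidean_space \<Rightarrow> real) \<Rightarrow> ('a \<Rightarrow> 'a) \<Rightarrow> 'a \<Rightarrow> real" where
  "flux e r V x = (LINT y|lborel. r y * (V y \<bullet> mgrad e (x - y)))"

text \<open>If m' = \<Lambda> m and the mollified density has minus the flux as its time derivative,
  this is the time derivative of the integral of \<kappa> times the squared positive part of m minus
  the mollified density.\<close>

definition defect ::
  "real \<Rightarrow> ('a::euclidean_space \<Rightarrow> real) \<Rightarrow> ('a \<Rightarrow> 'a) \<Rightarrow> ('a \<Rightarrow> real) \<Rightarrow> real \<Rightarrow> real \<Rightarrow> real" where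
  "defect e r V \<kappa> m \<Lambda> = (LINT x|lborel. \<kappa> x * (2 * max 0 (m - conv e r x) * (\<Lambda> * m + flux e r V x)))"

text \<open>The commutator form of the flux: freezing \<open>V\<close> at \<open>x\<close> produces the transport term, freezing
  \<open>r\<close> at its mean value a term controlled by the divergence, and the rest is small because it
  carries the oscillation of \<open>r\<close>.\<close>

lemma slice_estimate:
  fixes \<Omega> :: "'a::euclidean_space set" and L :: real
  assumes \<Omega>: "open \<Omega>" "bounded \<Omega>"
    and \<rho>: "continuous_on \<Omega> \<rho>" "\<And>x. x \<in> \<Omega> \<Longrightarrow> 0 \<le> \<rho> x" "\<And>x. x \<in> \<Omega> \<Longrightarrow> \<rho> x \<le> M" and M: "M \<ge> 0"
    and v: "continuous_on \<Omega> v" "\<And>x. x \<in> \<Omega> \<Longrightarrow> norm (v x) \<le> L"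
      "\<And>x y. closed_segment x y \<subseteq> \<Omega> \<Longrightarrow> norm (v x - v y) \<le> L * norm (x - y)" and L: "L \<ge> 0"
    and \<kappa>: "\<And>x. 0 \<le> \<kappa> x" "\<And>x. \<kappa> x \<le> 1" "\<And>x. (\<kappa> has_derivative (\<lambda>h. g x \<bullet> h)) (at x)" "continuous_on UNIV g"
    and K: "compact K" "K \<subseteq> \<Omega>" "\<And>x. x \<notin> K \<Longrightarrow> \<kappa> x = 0 \<and> g x = 0"
    and e: "e > 0" "\<And>x. x \<in> K \<Longrightarrow> cball x e \<subseteq> \<Omega>"
    and C1: "integrable lborel (\<lambda>z::'a. norm z * norm (mgrad e z))" "(LINT z|lborel. norm z * norm (mgrad e (z::'a))) \<le> C1"
    and m: "m \<ge> 0" and osc: "\<And>x y. x \<in> K \<Longrightarrow> y \<in> cball x e \<Longrightarrow> \<bar>\<rho> y - conv e (extend_by_zero \<Omega> \<rho>) x\<bar> \<le> \<omega>" "\<omega> \<ge> 0"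
  shows "- defect e (extend_by_zero \<Omega> \<rho>) (extend_by_zero \<Omega> v) \<kappa> m ((C1 + DIM('a)) * L)
    \<le> 2 * m * (C1 * L * \<omega>) * measure lborel K + m\<^sup>2 * (LINT x|lborel. \<bar>extend_by_zero \<Omega> v x \<bullet> g x\<bar>)"
proof -
  define r where "r = extend_by_zero \<Omega> \<rho>"
  define V where "V = extend_by_zero \<Omega> v"
  define n where "n = real DIM('a)"
  \<comment> \<open>C1 L pays for the commutator with the mollifier, n L for the divergence of the
    field.\<close>
  define \<Lambda> where "\<Lambda> = (C1 + n) * L"
  define c where "c = conv e r"
  have rm[measurable]: "r \<in> borel_measurable borel" unfolding r_def by (rule borel_measurable_extend_by_zero[OF \<Omega>(1) \<rho>(1)])
  have Vm[measurable]: "V \<in> borel_measurable borel" unfolding V_def by (rule borel_measurable_extend_by_zero[OF \<Omega>(1) v(1)])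
  have rb: "0 \<le> r x" "r x \<le> M" for x using \<rho>(2,3) M by (auto simp: r_def extend_by_zero_def)
  have ra: "norm (r x) \<le> M" for x using rb[of x] by simp
  have Vb: "norm (V x) \<le> L" for x using v(2) L by (simp add: V_def extend_by_zero_def)
  have \<Omega>b: "\<Omega> \<in> sets borel" using \<Omega>(1) by simp
  have ri: "integrable lborel r"
    by (rule integrable_bounded_compact_support[OF rm \<Omega>(2) \<Omega>b ra]) (simp add: r_def extend_by_zero_def)
  obtain B where B: "B > 0" "\<And>x::'a. norm (mgrad e x) \<le> B" using mgrad_bounded[OF e(1), where 'a='a] by blast
  have C1nn: "C1 \<ge> 0"
    using C1(2) by (rule order_trans[rotated]) (intro Bochner_Integration.integral_nonneg mult_nonneg_nonneg norm_ge_zero)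
  define G where "G x = (LINT y|lborel. r y *\<^sub>R mgrad e (x - y))" for x
  have Gi: "integrable lborel (\<lambda>y. r y *\<^sub>R mgrad e (x - y))" for x
  proof (rule integrable_bounded_compact_support[OF _ \<Omega>(2) \<Omega>b])
    show "(\<lambda>y. r y *\<^sub>R mgrad e (x - y)) \<in> borel_measurable borel" by measurable
    show "norm (r y *\<^sub>R mgrad e (x - y)) \<le> M * B" for y
      unfolding norm_scaleR using ra[of y] B M by (intro mult_mono) auto
  qed (simp add: r_def extend_by_zero_def)
  have cd: "(c has_derivative (\<lambda>h. G x \<bullet> h)) (at x)" for x
  proof -
    have "(LINT y|lborel. (mgrad e (x - y) \<bullet> h) *\<^sub>R r y) = G x \<bullet> h" for h
      unfolding G_def integral_inner_left[OF Gi, symmetric] by (simp add: mult.commute)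
    with conv_has_derivative[OF e(1) ri, of x] show ?thesis by (simp only: c_def)
  qed
  have cc: "continuous_on UNIV c"
    by (intro continuous_at_imp_continuous_on ballI has_derivative_continuous[OF cd])
  \<comment> \<open>The kernel gradient is uniformly continuous and r is integrable, so G is even
    uniformly continuous.\<close>
  have Gc: "continuous_on UNIV G"
  proof (rule uniformly_continuous_imp_continuous)
    have u: "uniformly_continuous_on UNIV (mgrad e :: 'a \<Rightarrow> 'a)"
      by (rule uniformly_continuous_bounded_support[where e=e]) (auto intro: continuous_on_mgrad mgrad_eq_0 e(1))
    let ?I = "(LINT y|lborel. r y) + 1"
    have I0: "(LINT y|lborel. r y) \<ge> 0" using rb by (intro Bochner_Integration.integral_nonneg)
    show "uniformly_continuous_on UNIV G"
      unfolding uniformly_continuous_on_def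
    proof (intro allI impI)
      fix \<epsilon> :: real assume \<epsilon>: "\<epsilon> > 0"
      have "\<epsilon> / ?I > 0" using \<epsilon> I0 by simp
      then obtain d where d: "d > 0" "\<And>x y::'a. dist y x < d \<Longrightarrow> dist (mgrad e y) (mgrad e x) < \<epsilon> / ?I"
        using u unfolding uniformly_continuous_on_def by (meson UNIV_I)
      have "dist (G x') (G x) < \<epsilon>" if xx: "dist x' x < d" for x x'
      proof -
        have "norm (G x' - G x) = norm (LINT y|lborel. r y *\<^sub>R mgrad e (x' - y) - r y *\<^sub>R mgrad e (x - y))"
          unfolding G_def by (simp add: Gi)
        also have "\<dots> \<le> (LINT y|lborel. (\<epsilon> / ?I) * r y)"
        proof (rule Bochner_Integration.integral_norm_bound_integral)
          show "integrable lborel (\<lambda>y. r y *\<^sub>R mgrad e (x' - y) - r y *\<^sub>R mgrad e (x - y))"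
            by (intro Bochner_Integration.integrable_diff Gi)
          fix y
          have "dist (x' - y) (x - y) < d" using xx by (simp add: dist_norm)
          from d(2)[OF this] have "norm (mgrad e (x' - y) - mgrad e (x - y)) \<le> \<epsilon> / ?I" by (simp add: dist_norm)
          then have "r y * norm (mgrad e (x' - y) - mgrad e (x - y)) \<le> r y * (\<epsilon> / ?I)" by (rule mult_left_mono[OF _ rb(1)])
          then show "norm (r y *\<^sub>R mgrad e (x' - y) - r y *\<^sub>R mgrad e (x - y)) \<le> (\<epsilon> / ?I) * r y"
            using rb(1)[of y] by (simp add: scaleR_diff_right[symmetric] mult.commute)
        qed (use ri in simp)
        also have "\<dots> = \<epsilon> * ((LINT y|lborel. r y) / ?I)" by simp
        also have "\<dots> < \<epsilon> * 1" using \<epsilon> I0 by (intro mult_strict_left_mono) auto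
        finally show ?thesis by (simp add: dist_norm)
      qed
      with d(1) show "\<exists>d>0. \<forall>x\<in>UNIV. \<forall>x'\<in>UNIV. dist x' x < d \<longrightarrow> dist (G x') (G x) < \<epsilon>" by blast
    qed
  qed
  have c0: "c x \<ge> 0" for x
    unfolding c_def conv_def real_scaleR_def
    by (intro Bochner_Integration.integral_nonneg mult_nonneg_nonneg moll_nonneg rb(1))
  define \<phi> where "\<phi> x = max 0 (m - c x)" for x
  have \<phi>b: "0 \<le> \<phi> x" "\<phi> x \<le> m" for x using c0[of x] m by (auto simp: \<phi>_def)
  have \<phi>c: "continuous_on UNIV \<phi>" unfolding \<phi>_def by (intro continuous_intros cc)
  have \<phi>d: "((\<lambda>x. (\<phi> x)\<^sup>2) has_derivative (\<lambda>h. 2 * \<phi> x * (0 - G x \<bullet> h))) (at x)" for x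
  proof -
    have "((\<lambda>x. m - c x) has_derivative (\<lambda>h. 0 - G x \<bullet> h)) (at x)"
      by (intro has_derivative_diff has_derivative_const cd)
    from has_derivative_compose[OF this max_0_power2_DERIV[unfolded has_field_derivative_def]]
    show ?thesis unfolding \<phi>_def .
  qed
  \<comment> \<open>Up to sign and the derivative of the cutoff, the transport term in the weighted
    integrand is V . grad \<psi>, which puts it in the form of
    \<open>integral_field_gradient_le\<close>.\<close>
  define \<psi> where "\<psi> x = \<kappa> x * (\<phi> x)\<^sup>2" for x
  define G\<psi> where "G\<psi> x = (\<phi> x)\<^sup>2 *\<^sub>R g x - (2 * \<kappa> x * \<phi> x) *\<^sub>R G x" for x
  have \<psi>d: "(\<psi> has_derivative (\<lambda>h. G\<psi> x \<bullet> h)) (at x)" for x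
  proof -
    have "(\<psi> has_derivative (\<lambda>h. \<kappa> x * (2 * \<phi> x * (0 - G x \<bullet> h)) + (g x \<bullet> h) * (\<phi> x)\<^sup>2)) (at x)"
      unfolding \<psi>_def[abs_def] by (rule has_derivative_mult[OF \<kappa>(3) \<phi>d])
    moreover have "(\<lambda>h. \<kappa> x * (2 * \<phi> x * (0 - G x \<bullet> h)) + (g x \<bullet> h) * (\<phi> x)\<^sup>2) = (\<lambda>h. G\<psi> x \<bullet> h)"
      by (simp add: G\<psi>_def fun_eq_iff inner_diff_left algebra_simps)
    ultimately show ?thesis by simp
  qed
  have \<kappa>c: "continuous_on UNIV \<kappa>"
    by (intro continuous_at_imp_continuous_on ballI has_derivative_continuous[OF \<kappa>(3)])
  have G\<psi>c: "continuous_on UNIV G\<psi>" unfolding G\<psi>_def by (intro continuous_intros \<phi>c \<kappa>c Gc \<kappa>(4))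
  have lipV: "norm (V x - V y) \<le> L * norm (x - y)" if "closed_segment x y \<subseteq> \<Omega>" for x y
    using v(3)[OF that] that by (auto simp: V_def extend_by_zero_def)
  have field: "integrable lborel (\<lambda>x. V x \<bullet> G\<psi> x)" "(LINT x|lborel. V x \<bullet> G\<psi> x) \<le> n * L * (LINT x|lborel. \<psi> x)"
    unfolding n_def
    by (rule integral_field_gradient_le[OF \<Omega>(1) Vm Vb lipV _ \<psi>d G\<psi>c K(1,2)];
        use \<kappa>(1) K(3) in \<open>simp add: \<psi>_def G\<psi>_def\<close>)+
  have Kb: "bounded K" "K \<in> sets borel" using K(1) by (auto intro: compact_imp_bounded borel_compact)
  have \<kappa>a: "\<bar>\<kappa> x\<bar> \<le> 1" for x using \<kappa>(1,2)[of x] by simp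
  have [measurable]: "\<kappa> \<in> borel_measurable borel" "\<phi> \<in> borel_measurable borel" "g \<in> borel_measurable borel"
    by (intro borel_measurable_continuous_onI \<kappa>c \<phi>c \<kappa>(4))+
  have \<psi>i: "integrable lborel \<psi>"
  proof (rule integrable_bounded_compact_support[OF _ Kb])
    show "\<psi> \<in> borel_measurable borel" unfolding \<psi>_def by measurable
    show "norm (\<psi> x) \<le> 1 * m\<^sup>2" for x
      unfolding \<psi>_def norm_mult using \<phi>b[of x] \<kappa>a[of x] by (intro mult_mono) (auto intro: power_mono)
  qed (simp add: \<psi>_def K(3))
  have Vgi: "integrable lborel (\<lambda>x. \<bar>V x \<bullet> g x\<bar>)"
  proof -
    have "bounded (g ` K)" by (intro compact_imp_bounded compact_continuous_image K(1) continuous_on_subset[OF \<kappa>(4)]) auto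
    then obtain b where b: "b > 0" "\<And>y. y \<in> g ` K \<Longrightarrow> norm y \<le> b" unfolding bounded_pos by blast
    have gb: "norm (g x) \<le> b" for x
    proof (cases "x \<in> K")
      case True
      then show ?thesis by (intro b(2) imageI)
    qed (use K(3) b(1) in simp)
    show ?thesis
    proof (rule integrable_bounded_compact_support[OF _ Kb])
      show "norm \<bar>V x \<bullet> g x\<bar> \<le> L * b" for x
        using Cauchy_Schwarz_ineq2[of "V x" "g x"] mult_mono[OF Vb[of x] gb[of x] L norm_ge_zero] by simp
    qed (auto simp: K(3))
  qed
  define Q where "Q x = flux e r V x" for x
  have Qm: "Q \<in> borel_measurable borel" unfolding Q_def flux_def by measurable
  have Vr: "norm (r y * (V y \<bullet> mgrad e (x - y))) \<le> (M * (L * B)) * indicator \<Omega> y" for x y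
  proof (cases "y \<in> \<Omega>")
    case True
    have "\<bar>V y \<bullet> mgrad e (x - y)\<bar> \<le> L * B"
      using Cauchy_Schwarz_ineq2[of "V y" "mgrad e (x - y)"] mult_mono[OF Vb[of y] B(2)[of "x - y"] L norm_ge_zero] by linarith
    then have "\<bar>r y\<bar> * \<bar>V y \<bullet> mgrad e (x - y)\<bar> \<le> M * (L * B)" using ra[of y] M by (intro mult_mono) auto
    with True show ?thesis by (simp add: abs_mult)
  qed (simp add: r_def extend_by_zero_def)
  have \<Omega>i: "integrable lborel (\<lambda>y. (M * (L * B)) * indicator \<Omega> y)"
    using emeasure_bounded_finite[OF \<Omega>(2)] \<Omega>b by simp
  have Qb: "\<bar>Q x\<bar> \<le> (LINT y|lborel. (M * (L * B)) * indicator \<Omega> y)" for x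
  proof -
    have "norm (Q x) \<le> (LINT y|lborel. (M * (L * B)) * indicator \<Omega> y)"
      unfolding Q_def flux_def by (rule integrable_dominated(2)[OF \<Omega>i _ Vr]) measurable
    then show ?thesis by simp
  qed
  define BQ where "BQ = (LINT y|lborel. (M * (L * B)) * indicator \<Omega> y)"
  define J where "J x = \<kappa> x * (2 * \<phi> x * (\<Lambda> * m + Q x))" for x
  have Ji: "integrable lborel J"
  proof (rule integrable_bounded_compact_support[OF _ Kb])
    show "J \<in> borel_measurable borel" unfolding J_def using Qm by measurable
    show "norm (J x) \<le> 1 * (2 * m * (\<bar>\<Lambda> * m\<bar> + BQ))" for x
    proof -
      have "\<bar>\<Lambda> * m + Q x\<bar> \<le> \<bar>\<Lambda> * m\<bar> + BQ" using Qb[of x] unfolding BQ_def by linarith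
      then show ?thesis unfolding J_def real_norm_def abs_mult using \<kappa>a[of x] \<phi>b[of x] by (intro mult_mono) auto
    qed
  qed (simp add: J_def K(3))
  have point: "n * L * \<psi> x - V x \<bullet> G\<psi> x - 2 * m * (C1 * L * \<omega>) * indicator K x - m\<^sup>2 * \<bar>V x \<bullet> g x\<bar> \<le> J x" for x
  proof (cases "x \<in> K")
    case False
    then show ?thesis by (simp add: \<psi>_def G\<psi>_def J_def K(3))
  next
    case True
    let ?k = "\<lambda>y. mgrad e (x - y)"
    have kz: "?k y = 0" if "y \<notin> cball x e" for y
      using that e(1) by (intro mgrad_eq_0) (auto simp: dist_norm)
    have inc: "cball x e \<subseteq> \<Omega>" by (rule e(2)[OF True])
    have Vlip: "norm (V y - V x) \<le> L * norm (x - y)" if y: "y \<in> cball x e" for y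
    proof -
      have "closed_segment y x \<subseteq> cball x e" using y e(1) by (intro closed_segment_subset convex_cball) auto
      then show ?thesis using lipV[of y x] inc by (simp add: norm_minus_commute)
    qed
    define D where "D y = (V y - V x) \<bullet> ?k y" for y
    have Dm[measurable]: "D \<in> borel_measurable borel" unfolding D_def by measurable
    have Db: "\<bar>D y\<bar> \<le> L * (norm (x - y) * norm (?k y))" for y
    proof (cases "y \<in> cball x e")
      case True
      have "\<bar>D y\<bar> \<le> norm (V y - V x) * norm (?k y)" unfolding D_def by (rule Cauchy_Schwarz_ineq2)
      also have "\<dots> \<le> (L * norm (x - y)) * norm (?k y)" by (intro mult_right_mono Vlip True norm_ge_zero)
      finally show ?thesis by (simp add: mult.assoc)
    qed (simp add: D_def kz)
    have mom: "integrable lborel (\<lambda>y. norm (x - y) * norm (?k y))" "(LINT y|lborel. norm (x - y) * norm (?k y)) \<le> C1"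
    proof -
      have "(\<lambda>z::'a. norm z * norm (mgrad e z)) \<in> borel_measurable borel" by measurable
      from integral_reflect[OF this, of x] C1 show "integrable lborel (\<lambda>y. norm (x - y) * norm (?k y))"
        "(LINT y|lborel. norm (x - y) * norm (?k y)) \<le> C1" by simp_all
    qed
    have Di: "integrable lborel D"
      by (rule integrable_dominated(1)[OF integrable_mult_right[OF mom(1), of L] Dm]) (use Db in simp)
    have Dint: "\<bar>LINT y|lborel. D y\<bar> \<le> C1 * L"
    proof -
      have "norm (LINT y|lborel. D y) \<le> (LINT y|lborel. L * (norm (x - y) * norm (?k y)))"
        by (rule Bochner_Integration.integral_norm_bound_integral[OF Di integrable_mult_right[OF mom(1)]]) (use Db in simp)
      also have "\<dots> \<le> L * C1" using mult_left_mono[OF mom(2) L] by simp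
      finally show ?thesis by (simp add: mult.commute)
    qed
    \<comment> \<open>This remainder alone carries the oscillation of the density, hence the factor
      \<omega>, which is made small later by shrinking the radius.\<close>
    have Rb: "\<bar>(r y - c x) * D y\<bar> \<le> \<omega> * (L * (norm (x - y) * norm (?k y)))" for y
    proof (cases "y \<in> cball x e")
      case y: True
      have "\<bar>r y - c x\<bar> \<le> \<omega>" using osc(1)[OF True y] inc y by (auto simp: c_def r_def extend_by_zero_def)
      then show ?thesis unfolding abs_mult using Db[of y] osc(2) by (intro mult_mono) auto
    qed (simp add: D_def kz)
    have Ri: "integrable lborel (\<lambda>y. (r y - c x) * D y)"
    proof (rule integrable_dominated(1)[OF integrable_mult_right[OF integrable_mult_right[OF mom(1), of L], of \<omega>]])
      show "(\<lambda>y. (r y - c x) * D y) \<in> borel_measurable borel" by measurable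
    qed (use Rb in simp)
    define Rr where "Rr = (LINT y|lborel. (r y - c x) * D y)"
    have Rint: "\<bar>Rr\<bar> \<le> C1 * L * \<omega>"
    proof -
      have "norm Rr \<le> (LINT y|lborel. \<omega> * (L * (norm (x - y) * norm (?k y))))"
        unfolding Rr_def
        by (rule Bochner_Integration.integral_norm_bound_integral[OF Ri integrable_mult_right[OF integrable_mult_right[OF mom(1)]]]) (use Rb in simp)
      also have "\<dots> \<le> \<omega> * (L * C1)" using mult_left_mono[OF mult_left_mono[OF mom(2) L] osc(2)] by simp
      finally show ?thesis by (simp add: mult_ac)
    qed
    have Gx: "V x \<bullet> G x = (LINT y|lborel. V x \<bullet> (r y *\<^sub>R ?k y))"
      unfolding G_def by (rule integral_inner_right[OF Gi, symmetric])
    have "Q x = (LINT y|lborel. V x \<bullet> (r y *\<^sub>R ?k y) + (c x * D y + (r y - c x) * D y))"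
      unfolding Q_def flux_def
      by (intro Bochner_Integration.integral_cong refl) (simp add: D_def inner_diff_left algebra_simps)
    also have "\<dots> = V x \<bullet> G x + (c x * (LINT y|lborel. D y) + Rr)"
    proof -
      have vi: "integrable lborel (\<lambda>y. V x \<bullet> (r y *\<^sub>R ?k y))" by (rule integrable_inner_right) (rule Gi)
      have di: "integrable lborel (\<lambda>y. c x * D y)" by (rule integrable_mult_right) (rule Di)
      show ?thesis
        unfolding Gx Rr_def Bochner_Integration.integral_add[OF vi Bochner_Integration.integrable_add[OF di Ri]]
          Bochner_Integration.integral_add[OF di Ri] by simp
    qed
    finally have Qx: "Q x = V x \<bullet> G x + (c x * (LINT y|lborel. D y) + Rr)" .
    let ?a = "2 * \<kappa> x * \<phi> x"
    have a0: "0 \<le> ?a" "?a \<le> 2 * m"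
    proof -
      show "0 \<le> ?a" using \<kappa>(1) \<phi>b by simp
      have "\<kappa> x * \<phi> x \<le> 1 * m" using \<kappa>(1,2) \<phi>b by (intro mult_mono) auto
      then show "?a \<le> 2 * m" by simp
    qed
    \<comment> \<open>Both sides vanish where m \<le> c x, so m - c x may be exchanged for its
      positive part; after multiplication by the weight it becomes 2 \<psi>.\<close>
    have "\<phi> x * (m - c x) = (\<phi> x)\<^sup>2" by (auto simp: \<phi>_def max_def power2_eq_square)
    then have s: "?a * (m - c x) = 2 * \<psi> x" by (simp add: \<psi>_def)
    have "- (c x * (C1 * L)) \<le> c x * (LINT y|lborel. D y)"
      using mult_left_mono[of "- (C1 * L)" "LINT y|lborel. D y" "c x"] Dint c0[of x] by simp
    \<comment> \<open>The commutator integral is at least -C1 L and c x \<ge> 0, so giving up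
      \<Lambda> c x in the growth term pays for it; the remaining 2 \<Lambda> \<psi> covers n L
      \<psi> from the divergence.\<close>
    then have "\<Lambda> * (m - c x) \<le> \<Lambda> * m + c x * (LINT y|lborel. D y)"
    proof -
      assume h: "- (c x * (C1 * L)) \<le> c x * (LINT y|lborel. D y)"
      have "0 \<le> n * L * c x" using L c0[of x] by (simp add: n_def)
      moreover have "\<Lambda> * (m - c x) = \<Lambda> * m - c x * (C1 * L) - n * L * c x" by (simp add: \<Lambda>_def algebra_simps)
      ultimately show ?thesis using h by linarith
    qed
    from mult_left_mono[OF this a0(1)]
    have 1: "\<Lambda> * (2 * \<psi> x) \<le> ?a * (\<Lambda> * m + c x * (LINT y|lborel. D y))"
      using s by (metis mult.left_commute)
    have "\<psi> x \<ge> 0" using \<kappa>(1) by (simp add: \<psi>_def)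
    then have "n * L * \<psi> x \<le> \<Lambda> * (2 * \<psi> x)"
    proof -
      assume p: "\<psi> x \<ge> 0"
      have "0 \<le> C1 * L * \<psi> x" "0 \<le> n * L * \<psi> x" using C1nn L p by (simp_all add: n_def)
      then show ?thesis by (simp add: \<Lambda>_def algebra_simps)
    qed
    with 1 have 1: "n * L * \<psi> x \<le> ?a * (\<Lambda> * m + c x * (LINT y|lborel. D y))" by linarith
    have 2: "- (2 * m * (C1 * L * \<omega>)) \<le> ?a * Rr"
    proof -
      have "\<bar>?a * Rr\<bar> \<le> 2 * m * (C1 * L * \<omega>)"
        unfolding abs_mult[of ?a] using a0 Rint by (intro mult_mono) auto
      then show ?thesis by linarith
    qed
    have 3: "- (m\<^sup>2 * \<bar>V x \<bullet> g x\<bar>) - V x \<bullet> G\<psi> x \<le> ?a * (V x \<bullet> G x)"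
    proof -
      have "V x \<bullet> G\<psi> x = (\<phi> x)\<^sup>2 * (V x \<bullet> g x) - ?a * (V x \<bullet> G x)" by (simp add: G\<psi>_def inner_diff_right)
      moreover have "\<bar>(\<phi> x)\<^sup>2 * (V x \<bullet> g x)\<bar> \<le> m\<^sup>2 * \<bar>V x \<bullet> g x\<bar>"
        unfolding abs_mult using \<phi>b[of x] by (intro mult_right_mono) (auto intro: power_mono)
      ultimately show ?thesis by linarith
    qed
    have "J x = ?a * (\<Lambda> * m + c x * (LINT y|lborel. D y)) + ?a * Rr + ?a * (V x \<bullet> G x)"
      unfolding J_def Qx by (simp add: algebra_simps)
    moreover have "indicator K x = (1::real)" using True by simp
    ultimately show ?thesis using 1 2 3 by (simp only: mult_1_right)
  qed
  have Ki: "integrable lborel (\<lambda>x. 2 * m * (C1 * L * \<omega>) * indicator K x)"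
    using emeasure_bounded_finite[OF Kb(1)] Kb(2) by simp
  have "(LINT x|lborel. n * L * \<psi> x - V x \<bullet> G\<psi> x - 2 * m * (C1 * L * \<omega>) * indicator K x - m\<^sup>2 * \<bar>V x \<bullet> g x\<bar>) \<le> (LINT x|lborel. J x)"
  proof (rule integral_mono[OF _ Ji point])
    show "integrable lborel (\<lambda>x. n * L * \<psi> x - V x \<bullet> G\<psi> x - 2 * m * (C1 * L * \<omega>) * indicator K x - m\<^sup>2 * \<bar>V x \<bullet> g x\<bar>)"
      by (intro Bochner_Integration.integrable_diff integrable_mult_right \<psi>i field(1) Ki Vgi)
  qed
  moreover have "(LINT x|lborel. n * L * \<psi> x - V x \<bullet> G\<psi> x - 2 * m * (C1 * L * \<omega>) * indicator K x - m\<^sup>2 * \<bar>V x \<bullet> g x\<bar>)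
      = n * L * (LINT x|lborel. \<psi> x) - (LINT x|lborel. V x \<bullet> G\<psi> x) - (LINT x|lborel. 2 * m * (C1 * L * \<omega>) * indicator K x)
        - (LINT x|lborel. m\<^sup>2 * \<bar>V x \<bullet> g x\<bar>)"
    using \<psi>i field(1) Ki Vgi
    by (simp only: Bochner_Integration.integral_diff Bochner_Integration.integrable_diff integrable_mult_right integral_mult_right_zero)
  moreover have "(LINT x|lborel. 2 * m * (C1 * L * \<omega>) * indicator K x) = 2 * m * (C1 * L * \<omega>) * measure lborel K"
    using Kb(2) by simp
  moreover have "(LINT x|lborel. m\<^sup>2 * \<bar>V x \<bullet> g x\<bar>) = m\<^sup>2 * (LINT x|lborel. \<bar>V x \<bullet> g x\<bar>)" by simp
  moreover have "(LINT x|lborel. J x) = defect e r V \<kappa> m \<Lambda>"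
    unfolding defect_def J_def Q_def \<phi>_def c_def ..
  ultimately have "- defect e r V \<kappa> m \<Lambda> \<le> 2 * m * (C1 * L * \<omega>) * measure lborel K + m\<^sup>2 * (LINT x|lborel. \<bar>V x \<bullet> g x\<bar>)"
    using field(2) by linarith
  then show ?thesis unfolding r_def V_def \<Lambda>_def n_def .
qed

section \<open>The weak form of the continuity equation in time\<close>

lemma open_cylinder: "open \<Omega> \<Longrightarrow> open (cylinder \<Omega> T)"
  unfolding cylinder_def by (intro open_Times open_greaterThanLessThan)

lemma spt_Basis: "spt i \<in> Basis" and time_Basis: "(0::real^3, 1::real) \<in> Basis"
  by (auto simp: spt_def Basis_prod_def Basis_vec_def)

lemma set_integral_vec_nth:
  fixes f :: "'a::euclidean_space \<Rightarrow> real^3"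
  assumes "set_integrable M U f"
  shows "(LINT x:U|M. f x $ i) = (LINT x:U|M. f x) $ i" and "set_integrable M U (\<lambda>x. f x $ i)"
proof -
  have i: "integrable M (\<lambda>x. indicator U x *\<^sub>R f x)" using assms by (simp add: set_integrable_def)
  have eq: "indicator U x *\<^sub>R (f x $ i) = (indicator U x *\<^sub>R f x) \<bullet> axis i 1" for x
    by (simp add: inner_axis)
  have "(LINT x|M. (indicator U x *\<^sub>R f x) \<bullet> axis i 1) = (LINT x|M. indicator U x *\<^sub>R f x) \<bullet> axis i 1"
    by (rule integral_inner_left) (rule i)
  then show "(LINT x:U|M. f x $ i) = (LINT x:U|M. f x) $ i"
    unfolding set_lebesgue_integral_def eq by (simp add: inner_axis)
  show "set_integrable M U (\<lambda>x. f x $ i)"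
    unfolding set_integrable_def eq by (rule integrable_inner_left) (rule i)
qed

text \<open>The equation holds almost everywhere with weak derivatives as functions; multiplying by
  a test function and moving the derivatives onto it gives the distributional form, which involves
  only \<rho> and \<rho> u themselves.\<close>

lemma continuity_equation_test:
  assumes Q: "open Q" and eq: "MHD_equations Q \<gamma> \<mu> lam \<rho> u H" and t: "test_function Q \<Phi>"
  shows "(LINT z:Q|lebesgue. iter_deriv [(0, 1)] \<Phi> z *\<^sub>R \<rho> z)
     + (\<Sum>i\<in>UNIV. LINT z:Q|lebesgue. iter_deriv [spt i] \<Phi> z *\<^sub>R ((\<rho> z *\<^sub>R u z) $ i)) = 0"
proof -
  define p where "p z = \<rho> z *\<^sub>R u z" for z
  define w0 where "w0 = wderiv Q [(0, 1)] \<rho>"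
  define w where "w i = wderiv Q [spt i] p" for i
  have "weakly_differentiable Q [(0, 1)] \<rho>"
    using eq unfolding MHD_equations_def derivatives_exist_def by blast
  then have d0: "has_weak_deriv Q [(0, 1)] \<rho> w0"
    unfolding w0_def by (rule wderiv_has_weak_deriv)
  have d: "has_weak_deriv Q [spt i] p (w i)" for i
  proof -
    have "weakly_differentiable Q [spt i] p"
      using eq unfolding MHD_equations_def derivatives_exist_def p_def[abs_def] by blast
    then show ?thesis unfolding w_def by (rule wderiv_has_weak_deriv)
  qed
  have ae: "AE z in lebesgue. z \<in> Q \<longrightarrow> w0 z + (\<Sum>i\<in>UNIV. w i z $ i) = 0"
  proof -
    have "AE z in lebesgue_on Q. wdt Q \<rho> z + wdiv Q spt (\<lambda>z. \<rho> z *\<^sub>R u z) z = 0"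
      using eq unfolding MHD_equations_def by (auto elim: eventually_mono)
    then show ?thesis
      using Q by (simp add: AE_restrict_space_iff wdt_def wdiv_def w0_def w_def p_def[abs_def])
  qed
  have l0: "locally_integrable_on Q w0" and l: "locally_integrable_on Q (w i)" and lp: "locally_integrable_on Q p" for i
    using d0 d by (auto simp: has_weak_deriv_def)
  have s0: "set_integrable lebesgue Q (\<lambda>z. \<Phi> z *\<^sub>R w0 z)" and s: "set_integrable lebesgue Q (\<lambda>z. \<Phi> z *\<^sub>R w i z)" for i
    by (intro test_function_set_integrable[OF t] l0 l)+
  have e0: "(LINT z:Q|lebesgue. iter_deriv [(0, 1)] \<Phi> z *\<^sub>R \<rho> z) = - (LINT z:Q|lebesgue. \<Phi> z *\<^sub>R w0 z)"
  proof -
    have "(LINT z:Q|lebesgue. iter_deriv [(0, 1)] \<Phi> z *\<^sub>R \<rho> z) = (- 1) ^ length [(0::real^3, 1::real)] *\<^sub>R (LINT z:Q|lebesgue. \<Phi> z *\<^sub>R w0 z)"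
      using d0 t unfolding has_weak_deriv_def by blast
    then show ?thesis by simp
  qed
  have e: "(LINT z:Q|lebesgue. iter_deriv [spt i] \<Phi> z *\<^sub>R (p z $ i)) = - (LINT z:Q|lebesgue. \<Phi> z *\<^sub>R (w i z $ i))" for i
  proof -
    have "(LINT z:Q|lebesgue. iter_deriv [spt i] \<Phi> z *\<^sub>R p z) = (- 1) ^ length [spt i] *\<^sub>R (LINT z:Q|lebesgue. \<Phi> z *\<^sub>R w i z)"
      using d[of i] t unfolding has_weak_deriv_def by blast
    then have "(LINT z:Q|lebesgue. iter_deriv [spt i] \<Phi> z *\<^sub>R p z) $ i = - ((LINT z:Q|lebesgue. \<Phi> z *\<^sub>R w i z) $ i)" by simp
    moreover have "set_integrable lebesgue Q (\<lambda>z. iter_deriv [spt i] \<Phi> z *\<^sub>R p z)"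
      by (rule test_function_set_integrable[OF test_function_iter_deriv[OF t spt_Basis] lp])
    ultimately show ?thesis
      using set_integral_vec_nth(1)[of lebesgue Q "\<lambda>z. iter_deriv [spt i] \<Phi> z *\<^sub>R p z" i] set_integral_vec_nth(1)[OF s[of i], of i]
      by (simp del: iter_deriv.simps)
  qed
  have sw: "set_integrable lebesgue Q (\<lambda>z. \<Phi> z *\<^sub>R (w i z $ i))" for i
    using set_integral_vec_nth(2)[OF s[of i], of i] by simp
  have "(LINT z:Q|lebesgue. \<Phi> z *\<^sub>R w0 z) + (\<Sum>i\<in>UNIV. LINT z:Q|lebesgue. \<Phi> z *\<^sub>R (w i z $ i))
      = (LINT z|lebesgue. indicator Q z *\<^sub>R (\<Phi> z *\<^sub>R w0 z) + (\<Sum>i\<in>UNIV. indicator Q z *\<^sub>R (\<Phi> z *\<^sub>R (w i z $ i))))"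
  proof -
    have i0: "integrable lebesgue (\<lambda>z. indicator Q z *\<^sub>R (\<Phi> z *\<^sub>R w0 z))"
      using s0 by (simp only: set_integrable_def)
    have i1: "integrable lebesgue (\<lambda>z. indicator Q z *\<^sub>R (\<Phi> z *\<^sub>R (w i z $ i)))" for i
      using sw[of i] by (simp only: set_integrable_def)
    have "(LINT z|lebesgue. (\<Sum>i\<in>UNIV. indicator Q z *\<^sub>R (\<Phi> z *\<^sub>R (w i z $ i))))
        = (\<Sum>i\<in>UNIV. LINT z|lebesgue. indicator Q z *\<^sub>R (\<Phi> z *\<^sub>R (w i z $ i)))"
      by (rule Bochner_Integration.integral_sum) (rule i1)
    moreover have "integrable lebesgue (\<lambda>z. \<Sum>i\<in>UNIV. indicator Q z *\<^sub>R (\<Phi> z *\<^sub>R (w i z $ i)))"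
      by (rule Bochner_Integration.integrable_sum) (rule i1)
    ultimately show ?thesis
      unfolding set_lebesgue_integral_def by (simp only: Bochner_Integration.integral_add[OF i0])
  qed
  also have "\<dots> = 0"
  proof (rule integral_eq_zero_AE)
    show "AE z in lebesgue. indicator Q z *\<^sub>R (\<Phi> z *\<^sub>R w0 z) + (\<Sum>i\<in>UNIV. indicator Q z *\<^sub>R (\<Phi> z *\<^sub>R (w i z $ i))) = 0"
      using ae
    proof eventually_elim
      case (elim z)
      show ?case
      proof (cases "z \<in> Q")
        case True
        then have "indicator Q z *\<^sub>R (\<Phi> z *\<^sub>R w0 z) + (\<Sum>i\<in>UNIV. indicator Q z *\<^sub>R (\<Phi> z *\<^sub>R (w i z $ i)))
            = \<Phi> z * (w0 z + (\<Sum>i\<in>UNIV. w i z $ i))" by (simp add: sum_distrib_left distrib_left)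
        with elim True show ?thesis by simp
      qed simp
    qed
  qed
  finally have "(LINT z:Q|lebesgue. \<Phi> z *\<^sub>R w0 z) + (\<Sum>i\<in>UNIV. LINT z:Q|lebesgue. \<Phi> z *\<^sub>R (w i z $ i)) = 0" .
  then show ?thesis
    unfolding e0 p_def[symmetric] e sum_negf by simp
qed

section \<open>Cutoffs in time and integration of a weak time derivative\<close>

definition hat :: "real \<Rightarrow> real \<Rightarrow> nat \<Rightarrow> real \<Rightarrow> real" where
  "hat s t n \<tau> = smooth_step (real (Suc n) * (\<tau> - s)) - smooth_step (real (Suc n) * (\<tau> - t))"

lemma hat_elementary: "hat s t n \<in> elementary"
proof -
  have id: "(\<lambda>x::real. x) \<in> elementary" using elementary.inner[of "1::real"] by simp
  have "(\<lambda>\<tau>. real (Suc n) * (\<tau> - a)) \<in> elementary" for a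
    by (rule elementary.mult[OF elementary.const elementary_diff[OF id elementary.const]])
  from elementary_diff[OF elementary.comp[OF smooth_real_smooth_step this[of s]] elementary.comp[OF smooth_real_smooth_step this[of t]]]
  show ?thesis unfolding hat_def[abs_def] .
qed

lemma hat_DERIV: "(hat s t n has_real_derivative real (Suc n) * pulse (real (Suc n) * (\<tau> - s)) - real (Suc n) * pulse (real (Suc n) * (\<tau> - t))) (at \<tau>)"
proof -
  have "((\<lambda>\<tau>. smooth_step (real (Suc n) * (\<tau> - a))) has_real_derivative pulse (real (Suc n) * (\<tau> - a)) * real (Suc n)) (at \<tau>)" for a
    by (rule DERIV_chain2[OF smooth_step_DERIV]) (auto intro!: derivative_eq_intros)
  from DERIV_diff[OF this[of s] this[of t]] show ?thesis
    unfolding hat_def[abs_def] by (simp only: mult.commute)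
qed

text \<open>Both ramps lie to the right of their base points, so the support extends 1/(n+1) beyond
  t. This is why admissible times satisfy t + 1/(n+1) < T.\<close>

lemma hat_support: assumes "s \<le> t" "\<tau> < s \<or> \<tau> > t + 1 / real (Suc n)" shows "hat s t n \<tau> = 0"
proof (cases "\<tau> < s")
  case True
  then have "real (Suc n) * (\<tau> - s) \<le> 0" "real (Suc n) * (\<tau> - t) \<le> 0"
    using assms(1) by (auto intro!: mult_nonneg_nonpos simp del: of_nat_Suc)
  then show ?thesis by (simp only: hat_def smooth_step_eq_0)
next
  case False
  with assms have h: "\<tau> > t + 1 / real (Suc n)" by simp
  have "1 = real (Suc n) * (1 / real (Suc n))" by simp
  also have "\<dots> \<le> real (Suc n) * (\<tau> - t)" using h by (intro mult_left_mono) auto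
  finally have 1: "1 \<le> real (Suc n) * (\<tau> - t)" .
  also have "\<dots> \<le> real (Suc n) * (\<tau> - s)" using assms(1) by (intro mult_left_mono) auto
  finally show ?thesis using 1 by (simp only: hat_def smooth_step_eq_1)
qed

lemma hat_abs_le: "\<bar>hat s t n \<tau>\<bar> \<le> 1"
  unfolding hat_def
  using smooth_step_nonneg[of "real (Suc n) * (\<tau> - s)"] smooth_step_le_1[of "real (Suc n) * (\<tau> - s)"]
    smooth_step_nonneg[of "real (Suc n) * (\<tau> - t)"] smooth_step_le_1[of "real (Suc n) * (\<tau> - t)"]
  by linarith

lemma smooth_step_scaled_tendsto: "(\<lambda>n. smooth_step (real (Suc n) * (\<tau> - a))) \<longlonglongrightarrow> indicator {a<..} \<tau>"
proof (cases "\<tau> > a")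
  case True
  then obtain N where N: "1 < real N * (\<tau> - a)" using ex_less_of_nat_mult[of "\<tau> - a" 1] by auto
  have "smooth_step (real (Suc n) * (\<tau> - a)) = 1" if "n \<ge> N" for n
  proof (rule smooth_step_eq_1)
    have "real N * (\<tau> - a) \<le> real (Suc n) * (\<tau> - a)" using that True by (intro mult_right_mono) auto
    with N show "1 \<le> real (Suc n) * (\<tau> - a)" by linarith
  qed
  then have "eventually (\<lambda>n. smooth_step (real (Suc n) * (\<tau> - a)) = 1) sequentially"
    unfolding eventually_sequentially by blast
  with True show ?thesis by (simp add: tendsto_eventually del: of_nat_Suc)
next
  case False
  then have "real (Suc n) * (\<tau> - a) \<le> 0" for n by (intro mult_nonneg_nonpos) auto
  then have "smooth_step (real (Suc n) * (\<tau> - a)) = 0" for n by (rule smooth_step_eq_0)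
  with False show ?thesis by (simp del: of_nat_Suc)
qed

lemma pulse_integral: "integrable lborel pulse" "(LINT x|lborel. pulse x) = 1"
proof -
  have i: "integrable lborel (\<lambda>x. indicator {0..1} x *\<^sub>R pulse x)"
    by (intro borel_integrable_compact continuous_on_pulse compact_Icc)
  moreover have eq: "(\<lambda>x. indicator {0..1} x *\<^sub>R pulse x) = pulse"
  proof
    fix x show "indicator {0..1} x *\<^sub>R pulse x = pulse x"
      using pulse_eq_0[of x] by (cases "x \<in> {0..1}") auto
  qed
  ultimately show "integrable lborel pulse" by simp
  have "(LINT x:{0..1}|lborel. pulse x) = integral {0..1} pulse"
    using i by (intro set_borel_integral_eq_integral) (simp add: set_integrable_def)
  moreover have "integral {0..1} pulse = 1"
    unfolding pulse_def using pulse_normalization by simp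
  ultimately show "(LINT x|lborel. pulse x) = 1" by (simp only: set_lebesgue_integral_def eq)
qed

text \<open>The rescaled pulse is an approximate identity concentrated just to the right of a.
  Substituting \<tau> = a + \<sigma>/(n+1) leaves the fixed weight pulse(\<sigma>) of mass one and
  an argument that tends to a.\<close>

lemma pulse_average_tendsto:
  assumes G: "continuous_on {0..T} G" and a: "0 \<le> a" "a < T"
  shows "(\<lambda>n. LINT \<tau>|lborel. real (Suc n) * pulse (real (Suc n) * (\<tau> - a)) * (indicator {0..T} \<tau> * G \<tau>)) \<longlonglongrightarrow> G a"
proof -
  define h where "h \<tau> = indicator {0..T} \<tau> * G \<tau>" for \<tau>
  have hm[measurable]: "h \<in> borel_measurable borel"
    using borel_measurable_continuous_on_indicator[OF _ G] unfolding h_def by simp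
  have "bounded (G ` {0..T})" by (intro compact_imp_bounded compact_continuous_image G compact_Icc)
  then obtain B where B: "B > 0" "\<And>y. y \<in> G ` {0..T} \<Longrightarrow> norm y \<le> B" unfolding bounded_pos by blast
  have hb: "\<bar>h \<tau>\<bar> \<le> B" for \<tau> using B(2)[of "G \<tau>"] B(1) by (cases "\<tau> \<in> {0..T}") (auto simp: h_def)
  have pm[measurable]: "pulse \<in> borel_measurable borel"
    by (intro borel_measurable_continuous_onI continuous_on_pulse)
  have eq: "(LINT \<tau>|lborel. real (Suc n) * pulse (real (Suc n) * (\<tau> - a)) * h \<tau>)
      = (LINT \<sigma>|lborel. pulse \<sigma> * h (a + (1 / real (Suc n)) * \<sigma>))" for n
  proof -
    let ?c = "1 / real (Suc n)"
    have "(LINT \<tau>|lborel. real (Suc n) * pulse (real (Suc n) * (\<tau> - a)) * h \<tau>)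
        = \<bar>?c\<bar> *\<^sub>R (LINT \<sigma>|lborel. real (Suc n) * pulse (real (Suc n) * ((a + ?c * \<sigma>) - a)) * h (a + ?c * \<sigma>))"
      by (rule lborel_integral_real_affine) simp
    also have "\<dots> = ?c * (LINT \<sigma>|lborel. real (Suc n) * (pulse \<sigma> * h (a + ?c * \<sigma>)))"
    proof -
      have "real (Suc n) * ((a + ?c * \<sigma>) - a) = \<sigma>" for \<sigma> by simp
      moreover have "\<bar>?c\<bar> = ?c" by simp
      ultimately show ?thesis by (simp only: real_scaleR_def mult.assoc)
    qed
    also have "\<dots> = ?c * (real (Suc n) * (LINT \<sigma>|lborel. pulse \<sigma> * h (a + ?c * \<sigma>)))"
      by (simp only: integral_mult_right_zero)
    also have "\<dots> = (LINT \<sigma>|lborel. pulse \<sigma> * h (a + ?c * \<sigma>))" by simp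
    finally show ?thesis .
  qed
  have "(\<lambda>n. LINT \<sigma>|lborel. pulse \<sigma> * h (a + (1 / real (Suc n)) * \<sigma>)) \<longlonglongrightarrow> (LINT \<sigma>|lborel. pulse \<sigma> * G a)"
  proof (rule integral_dominated_convergence[where w="\<lambda>\<sigma>. B * pulse \<sigma>"])
    show "(\<lambda>\<sigma>. pulse \<sigma> * G a) \<in> borel_measurable lborel" by measurable
    show "(\<lambda>\<sigma>. pulse \<sigma> * h (a + (1 / real (Suc n)) * \<sigma>)) \<in> borel_measurable lborel" for n by measurable
    show "integrable lborel (\<lambda>\<sigma>. B * pulse \<sigma>)" using pulse_integral by simp
    show "AE \<sigma> in lborel. norm (pulse \<sigma> * h (a + (1 / real (Suc n)) * \<sigma>)) \<le> B * pulse \<sigma>" for n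
    proof (intro AE_I2)
      fix \<sigma>
      have "pulse \<sigma> * \<bar>h (a + (1 / real (Suc n)) * \<sigma>)\<bar> \<le> pulse \<sigma> * B"
        by (intro mult_left_mono hb pulse_nonneg)
      then show "norm (pulse \<sigma> * h (a + (1 / real (Suc n)) * \<sigma>)) \<le> B * pulse \<sigma>"
        using pulse_nonneg[of \<sigma>] by (simp add: abs_mult mult.commute)
    qed
    show "AE \<sigma> in lborel. (\<lambda>n. pulse \<sigma> * h (a + (1 / real (Suc n)) * \<sigma>)) \<longlonglongrightarrow> pulse \<sigma> * G a"
    proof (intro AE_I2)
      fix \<sigma>
      show "(\<lambda>n. pulse \<sigma> * h (a + (1 / real (Suc n)) * \<sigma>)) \<longlonglongrightarrow> pulse \<sigma> * G a"
      proof (cases "0 < \<sigma>")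
        case True
        have c0: "(\<lambda>n. 1 / real (Suc n)) \<longlonglongrightarrow> 0" using LIMSEQ_inverse_real_of_nat by (simp add: inverse_eq_divide)
        have lim: "(\<lambda>n. a + (1 / real (Suc n)) * \<sigma>) \<longlonglongrightarrow> a"
          using tendsto_add[OF tendsto_const[of a] tendsto_mult[OF c0 tendsto_const[of \<sigma>]]] by simp
        then have ev: "eventually (\<lambda>n. a + (1 / real (Suc n)) * \<sigma> < T) sequentially" using a(2) by (rule order_tendstoD)
        have ev': "eventually (\<lambda>n. a + (1 / real (Suc n)) * \<sigma> \<in> {0..T}) sequentially"
          using ev by eventually_elim (use a True in auto)
        have "(\<lambda>n. G (a + (1 / real (Suc n)) * \<sigma>)) \<longlonglongrightarrow> G a"
          by (rule continuous_on_tendsto_compose[OF G lim _ ev']) (use a in auto)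
        then have "(\<lambda>n. h (a + (1 / real (Suc n)) * \<sigma>)) \<longlonglongrightarrow> G a"
          by (rule Lim_transform_eventually) (use ev' in eventually_elim, simp add: h_def)
        then show ?thesis by (intro tendsto_mult tendsto_const)
      qed (simp add: pulse_eq_0)
    qed
  qed
  then show ?thesis unfolding eq[unfolded h_def] h_def using pulse_integral by simp
qed

text \<open>The hats tend to the indicator of (s,t], while integrating G against their derivatives
  tends to G s - G t; this gives the identity for 0 < s \<le> t < T. The test functions do not reach
  the end points, which are included by continuity of G.\<close>

lemma weak_derivative_primitive:
  assumes G: "continuous_on {0..T} G" and H: "integrable lborel H" and H0: "\<And>\<tau>. \<tau> \<notin> {0<..<T} \<Longrightarrow> H \<tau> = 0"
    and weak: "\<And>s t n. 0 < s \<Longrightarrow> s \<le> t \<Longrightarrow> t + 1 / real (Suc n) < T \<Longrightarrow>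
      (LINT \<tau>|lborel. deriv (hat s t n) \<tau> * (indicator {0..T} \<tau> * G \<tau>)) + (LINT \<tau>|lborel. hat s t n \<tau> * H \<tau>) = 0"
    and st: "0 \<le> s" "s \<le> t" "t \<le> T"
  shows "G t - G s = integral {s..t} H"
proof -
  have Hi: "H absolutely_integrable_on S" if "S \<in> sets borel" for S
  proof -
    have "set_integrable lborel S H" unfolding set_integrable_def using H that by (intro integrable_mult_indicator) auto
    then show ?thesis unfolding set_integrable_def
      by (subst integrable_completion) (use H that in \<open>auto intro!: borel_measurable_scaleR borel_measurable_indicator\<close>)
  qed
  have inner: "G t - G s = integral {s..t} H" if st: "0 < s" "s \<le> t" "t < T" for s t
  proof -
    define h where "h \<tau> = indicator {0..T} \<tau> * G \<tau>" for \<tau>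
    have hi: "integrable lborel h"
      using borel_integrable_compact[OF compact_Icc G] unfolding h_def by simp
    have pm[measurable]: "pulse \<in> borel_measurable borel"
      by (intro borel_measurable_continuous_onI continuous_on_pulse)
    obtain M where M: "M > 0" "\<And>s. pulse s \<le> M" using pulse_bounded by blast
    have pi: "integrable lborel (\<lambda>\<tau>. real (Suc n) * pulse (real (Suc n) * (\<tau> - a)) * h \<tau>)" for n a
    proof -
      have "integrable lborel (\<lambda>\<tau>. (real (Suc n) * pulse (real (Suc n) * (\<tau> - a))) *\<^sub>R h \<tau>)"
      proof (rule integrable_bounded_scaleR[OF hi])
        show "\<bar>real (Suc n) * pulse (real (Suc n) * (\<tau> - a))\<bar> \<le> real (Suc n) * M" for \<tau>
          unfolding abs_mult using M(2) pulse_nonneg by (intro mult_mono) auto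
      qed measurable
      then show ?thesis by simp
    qed
    have dh: "deriv (hat s t n) \<tau> = real (Suc n) * pulse (real (Suc n) * (\<tau> - s)) - real (Suc n) * pulse (real (Suc n) * (\<tau> - t))" for n \<tau>
      by (rule DERIV_imp_deriv[OF hat_DERIV])
    have split: "(LINT \<tau>|lborel. deriv (hat s t n) \<tau> * h \<tau>)
        = (LINT \<tau>|lborel. real (Suc n) * pulse (real (Suc n) * (\<tau> - s)) * h \<tau>)
        - (LINT \<tau>|lborel. real (Suc n) * pulse (real (Suc n) * (\<tau> - t)) * h \<tau>)" for n
      unfolding dh left_diff_distrib by (rule Bochner_Integration.integral_diff[OF pi pi])
    have l1: "(\<lambda>n. LINT \<tau>|lborel. deriv (hat s t n) \<tau> * h \<tau>) \<longlonglongrightarrow> G s - G t"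
      unfolding split
      by (intro tendsto_diff pulse_average_tendsto[OF G, folded h_def]) (use st in auto)
    have l2: "(\<lambda>n. LINT \<tau>|lborel. hat s t n \<tau> * H \<tau>) \<longlonglongrightarrow> (LINT \<tau>|lborel. indicator {s<..t} \<tau> * H \<tau>)"
    proof (rule integral_dominated_convergence[where w="\<lambda>\<tau>. \<bar>H \<tau>\<bar>"])
      note [measurable] = borel_measurable_integrable[OF H] elementary_borel[OF hat_elementary]
      show "(\<lambda>\<tau>. indicator {s<..t} \<tau> * H \<tau>) \<in> borel_measurable lborel" by measurable
      show "(\<lambda>\<tau>. hat s t n \<tau> * H \<tau>) \<in> borel_measurable lborel" for n by measurable
      show "integrable lborel (\<lambda>\<tau>. \<bar>H \<tau>\<bar>)" using H by simp
      show "AE \<tau> in lborel. norm (hat s t n \<tau> * H \<tau>) \<le> \<bar>H \<tau>\<bar>" for n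
        using hat_abs_le by (intro AE_I2) (simp add: abs_mult mult_left_le_one_le)
      show "AE \<tau> in lborel. (\<lambda>n. hat s t n \<tau> * H \<tau>) \<longlonglongrightarrow> indicator {s<..t} \<tau> * H \<tau>"
      proof (intro AE_I2 tendsto_mult tendsto_const)
        fix \<tau>
        have "(\<lambda>n. hat s t n \<tau>) \<longlonglongrightarrow> indicator {s<..} \<tau> - indicator {t<..} \<tau>"
          unfolding hat_def by (intro tendsto_diff smooth_step_scaled_tendsto)
        moreover have "indicator {s<..} \<tau> - indicator {t<..} \<tau> = (indicator {s<..t} \<tau> :: real)"
          using st by (auto simp: indicator_def)
        ultimately show "(\<lambda>n. hat s t n \<tau>) \<longlonglongrightarrow> indicator {s<..t} \<tau>" by simp
      qed
    qed
    obtain N where N: "1 / (T - t) < real N" using reals_Archimedean2 by blast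
    have "eventually (\<lambda>n. (LINT \<tau>|lborel. deriv (hat s t n) \<tau> * h \<tau>) + (LINT \<tau>|lborel. hat s t n \<tau> * H \<tau>) = 0) sequentially"
      unfolding eventually_sequentially
    proof (intro exI[of _ N] allI impI)
      fix n assume "n \<ge> N"
      then have "1 / (T - t) < real (Suc n)" using N by linarith
      then have "1 / real (Suc n) < T - t" using st by (simp add: field_simps)
      then show "(LINT \<tau>|lborel. deriv (hat s t n) \<tau> * h \<tau>) + (LINT \<tau>|lborel. hat s t n \<tau> * H \<tau>) = 0"
        unfolding h_def by (intro weak st) linarith
    qed
    then have "(\<lambda>n. (LINT \<tau>|lborel. deriv (hat s t n) \<tau> * h \<tau>) + (LINT \<tau>|lborel. hat s t n \<tau> * H \<tau>)) \<longlonglongrightarrow> 0"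
      by (rule tendsto_eventually)
    from LIMSEQ_unique[OF this tendsto_add[OF l1 l2]]
    have "G t - G s = (LINT \<tau>|lborel. indicator {s<..t} \<tau> * H \<tau>)" by simp
    also have "\<dots> = (LINT \<tau>|lborel. indicator {s..t} \<tau> *\<^sub>R H \<tau>)"
    proof (rule integral_cong_AE)
      note [measurable] = borel_measurable_integrable[OF H]
      show "(\<lambda>\<tau>. indicator {s<..t} \<tau> * H \<tau>) \<in> borel_measurable lborel" "(\<lambda>\<tau>. indicator {s..t} \<tau> *\<^sub>R H \<tau>) \<in> borel_measurable lborel"
        by measurable
      have "AE \<tau> in lborel. \<tau> \<noteq> s" by (rule AE_lborel_singleton)
      then show "AE \<tau> in lborel. indicator {s<..t} \<tau> * H \<tau> = indicator {s..t} \<tau> *\<^sub>R H \<tau>"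
        by eventually_elim (auto simp: indicator_def)
    qed
    also have "\<dots> = integral {s..t} H"
    proof -
      have "set_integrable lborel {s..t} H" unfolding set_integrable_def using H by (intro integrable_mult_indicator) auto
      from set_borel_integral_eq_integral(2)[OF this] show ?thesis by (simp add: set_lebesgue_integral_def)
    qed
    finally show ?thesis .
  qed
  have Hint: "H integrable_on {0..T}" using Hi[of "{0..T}"] by (simp add: absolutely_integrable_on_def)
  show ?thesis
  proof (cases "T = 0 \<or> s = t")
    case True
    then have "s = t" using st by auto
    then show ?thesis by simp
  next
    case False
    \<comment> \<open>G minus this primitive of H is constant on the open interval and continuous on
      the closed one, hence constant on it.\<close>
    define P where "P x = integral {0..x} H" for x
    have Pc: "continuous_on {0..T} P" unfolding P_def by (rule indefinite_integral_continuous_1[OF Hint])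
    have PP: "P y - P x = integral {x..y} H" if "0 \<le> x" "x \<le> y" "y \<le> T" for x y
    proof -
      have "integral {0..x} H + integral {x..y} H = integral {0..y} H"
        by (rule Henstock_Kurzweil_Integration.integral_combine[OF that(1,2)])
          (rule integrable_on_subinterval[OF Hint], use that in auto)
      then show ?thesis by (simp add: P_def)
    qed
    define k where "k x = G x - P x" for x
    have kc: "continuous_on {0..T} k" unfolding k_def by (intro continuous_intros G Pc)
    have T: "T > 0" using False st by auto
    have mid: "k x = k (T/2)" if "x \<in> {0<..<T}" for x
    proof (cases "x \<le> T/2")
      case True
      then show ?thesis using inner[of x "T/2"] PP[of x "T/2"] that T by (simp add: k_def)
    next
      case False
      then show ?thesis using inner[of "T/2" x] PP[of "T/2" x] that T by (simp add: k_def)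
    qed
    have "k x = k (T/2)" if x: "x \<in> {0..T}" for x
    proof (rule continuous_constant_on_closure[where S="{0<..<T}" and f=k])
      show "continuous_on (closure {0<..<T}) k" using kc T by simp
      show "x \<in> closure {0<..<T}" using x T by simp
    qed (rule mid)
    from this[of t] this[of s] have "k t = k s" using st by simp
    with PP[OF st] show ?thesis unfolding k_def by linarith
  qed
qed

section \<open>Time slices of functions on the cylinder\<close>

lemma AE_time_slices:
  assumes "AE z in (lborel :: ('a::euclidean_space \<times> real) measure). P z"
  shows "AE \<tau> in lborel. AE y in lborel. P (y, \<tau>)"
proof -
  have "AE z in (lborel :: 'a measure) \<Otimes>\<^sub>M (lborel :: real measure). P z"
    by (subst lborel_prod) (rule assms)
  \<comment> \<open>A measurable null set around the exceptional points makes the order of the two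
    almost-everywhere quantifiers exchangeable.\<close>
  then obtain N where N: "N \<in> null_sets ((lborel :: 'a measure) \<Otimes>\<^sub>M (lborel :: real measure))"
    "{z \<in> space (lborel \<Otimes>\<^sub>M lborel). \<not> P z} \<subseteq> N"
    unfolding eventually_ae_filter by blast
  have Nm: "{z \<in> space ((lborel :: 'a measure) \<Otimes>\<^sub>M (lborel :: real measure)). (fst z, snd z) \<notin> N} \<in> sets (lborel \<Otimes>\<^sub>M lborel)"
  proof -
    have "{z \<in> space ((lborel :: 'a measure) \<Otimes>\<^sub>M (lborel :: real measure)). (fst z, snd z) \<notin> N}
        = space (lborel \<Otimes>\<^sub>M lborel) - N" by auto
    moreover have "space ((lborel :: 'a measure) \<Otimes>\<^sub>M (lborel :: real measure)) - N \<in> sets (lborel \<Otimes>\<^sub>M lborel)"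
      by (rule sets.Diff[OF sets.top null_setsD2[OF N(1)]])
    ultimately show ?thesis by (simp only:)
  qed
  have "AE z in (lborel :: 'a measure) \<Otimes>\<^sub>M (lborel :: real measure). z \<notin> N" using N(1) by (rule AE_not_in)
  then have "AE y in (lborel :: 'a measure). AE \<tau> in (lborel :: real measure). (y, \<tau>) \<notin> N" by (rule lborel_pair.AE_pair)
  then have "AE \<tau> in (lborel :: real measure). AE y in (lborel :: 'a measure). (y, \<tau>) \<notin> N"
    using lborel_pair.AE_commute[of "\<lambda>y \<tau>. (y, \<tau>) \<notin> N"] Nm by simp
  then show ?thesis
  proof eventually_elim
    case (elim \<tau>)
    then show ?case
      by eventually_elim (use N(2) in \<open>auto simp: space_pair_measure\<close>)
  qed
qed

lemma bounded_continuous_Lp: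
  fixes d :: "'a::euclidean_space \<Rightarrow> real"
  assumes \<Omega>: "open \<Omega>" "bounded \<Omega>" and d: "continuous_on \<Omega> d" "\<And>x. x \<in> \<Omega> \<Longrightarrow> \<bar>d x\<bar> \<le> B"
  shows "p > 0 \<Longrightarrow> d \<in> Lp \<Omega> p" and "locally_integrable_on \<Omega> d" and "borel_rep \<Omega> d (extend_by_zero \<Omega> d)"
proof -
  have dm: "d \<in> borel_measurable (lebesgue_on \<Omega>)"
    using \<Omega>(1) by (intro continuous_imp_measurable_on_sets_lebesgue[OF d(1)]) simp
  interpret finite_measure "lebesgue_on \<Omega>"
    by (intro finite_measure_lebesgue_on lmeasurable_open \<Omega>)
  have "integrable (lebesgue_on \<Omega>) (\<lambda>x. norm (d x) powr p)" if p: "p > 0" for p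
  proof (rule integrable_const_bound)
    show "AE x in lebesgue_on \<Omega>. norm (norm (d x) powr p) \<le> B powr p"
      using d(2) p by (intro AE_I2) (auto intro: powr_mono2)
    show "(\<lambda>x. norm (d x) powr p) \<in> borel_measurable (lebesgue_on \<Omega>)" using dm by measurable
  qed
  with dm show "d \<in> Lp \<Omega> p" if "p > 0" using that by (simp add: Lp_def)
  have "integrable (lebesgue_on \<Omega>) d"
    by (rule integrable_const_bound[of _ B]) (use d(2) dm in auto)
  then have si: "set_integrable lebesgue \<Omega> d"
    using \<Omega>(1) integrable_restrict_space[of \<Omega> lebesgue d] by (simp add: set_integrable_def)
  then show "locally_integrable_on \<Omega> d"
    unfolding locally_integrable_on_def
  proof (intro allI impI)
    fix K assume K: "compact K \<and> K \<subseteq> \<Omega>"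
    have "K \<in> sets lebesgue" using K borel_compact[of K] by (intro sets_completionI_sets) simp
    with K show "set_integrable lebesgue K d" by (intro set_integrable_subset[OF si]) auto
  qed
  show "borel_rep \<Omega> d (extend_by_zero \<Omega> d)"
    unfolding borel_rep_def using dm borel_measurable_extend_by_zero[OF \<Omega>(1) d(1)]
    by (auto simp: extend_by_zero_def)
qed

text \<open>Continuity into W^{1,q} enters through the L^q term of the norm, which by Young's bound
  and the finite measure of \<Omega> controls the L^1 norm; the mollifier is bounded, so the
  convolution at a fixed x is continuous in time.\<close>

lemma conv_time_continuous:
  fixes \<Omega> :: "'a::euclidean_space set" and \<rho> :: "'a \<times> real \<Rightarrow> real"
  assumes \<Omega>: "open \<Omega>" "bounded \<Omega>" and e: "e > 0" and q: "q > 1"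
    and C: "\<rho> \<in> C_time T (Sobolev \<Omega> 1 q) (Sobolev_norm \<Omega> 1 q)"
    and cont: "\<And>t. t \<in> {0..T} \<Longrightarrow> continuous_on \<Omega> (at_time \<rho> t)"
    and bd: "\<And>t x. t \<in> {0..T} \<Longrightarrow> x \<in> \<Omega> \<Longrightarrow> \<bar>\<rho> (x, t)\<bar> \<le> M"
  shows "continuous_on {0..T} (\<lambda>t. conv e (extend_by_zero \<Omega> (at_time \<rho> t)) x)"
  unfolding continuous_on_iff
proof (intro ballI allI impI)
  fix t \<epsilon> :: real assume t: "t \<in> {0..T}" and \<epsilon>: "\<epsilon> > 0"
  let ?r = "\<lambda>t. extend_by_zero \<Omega> (at_time \<rho> t)"
  have at: "\<bar>at_time \<rho> s y\<bar> \<le> M" if "s \<in> {0..T}" "y \<in> \<Omega>" for s y using bd[OF that] by (simp add: at_time_def)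
  have ri: "integrable lborel (?r s)" if s: "s \<in> {0..T}" for s
  proof (rule integrable_bounded_compact_support[OF _ \<Omega>(2)])
    show "?r s \<in> borel_measurable borel" by (rule borel_measurable_extend_by_zero[OF \<Omega>(1) cont[OF s]])
    show "norm (?r s y) \<le> \<bar>M\<bar>" for y using at[OF s, of y] by (auto simp: extend_by_zero_def)
  qed (use \<Omega>(1) in \<open>auto simp: extend_by_zero_def\<close>)
  obtain B where B: "B > 0" "\<And>x::'a. \<bar>moll e x\<bar> \<le> B" using moll_bounded[OF e, where 'a='a] by blast
  define V where "V = measure lborel \<Omega>"
  have V0: "V \<ge> 0" by (simp add: V_def)
  \<comment> \<open>With the level equal to the bound on the norm, Young's inequality gives l V + l
    = l (V + 1); times the bound B of the kernel this is \<epsilon>/2.\<close>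
  define l where "l = \<epsilon> / (2 * B * (V + 1))"
  have l: "l > 0" using \<epsilon> B V0 by (simp add: l_def)
  have "((\<lambda>s. Sobolev_norm \<Omega> 1 q (\<lambda>x. \<rho> (x, s) - \<rho> (x, t))) \<longlongrightarrow> 0) (at t within {0..T})"
    using C t unfolding C_time_def by blast
  from tendstoD[OF this l]
  obtain d where d: "d > 0" "\<And>s. s \<in> {0..T} \<Longrightarrow> s \<noteq> t \<Longrightarrow> dist s t < d \<Longrightarrow> dist (Sobolev_norm \<Omega> 1 q (\<lambda>x. \<rho> (x, s) - \<rho> (x, t))) 0 < l"
    unfolding eventually_at by blast
  have "dist (conv e (?r s) x) (conv e (?r t) x) < \<epsilon>" if s: "s \<in> {0..T}" "dist s t < d" for s
  proof (cases "s = t")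
    case True
    then show ?thesis using \<epsilon> by simp
  next
    case False
    define D where "D x = \<rho> (x, s) - \<rho> (x, t)" for x
    have Dc: "continuous_on \<Omega> D"
      using continuous_on_diff[OF cont[OF s(1)] cont[OF t]] by (simp add: D_def[abs_def] at_time_def)
    have Db: "\<bar>D x\<bar> \<le> 2 * M" if "x \<in> \<Omega>" for x using bd[OF s(1) that] bd[OF t that] by (simp add: D_def)
    have N: "Sobolev_norm \<Omega> 1 q D < l" using d(2)[OF s(1) False s(2)] by (simp add: D_def[abs_def])
    have N0: "Sobolev_norm \<Omega> 1 q D \<ge> 0" by (simp add: Sobolev_norm_def)
    have q0: "q > 0" using q by simp
    have Lp1: "D \<in> Lp \<Omega> q" by (rule bounded_continuous_Lp(1)[OF \<Omega> Dc _ q0]) (rule Db)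
    have Lp2: "locally_integrable_on \<Omega> D" by (rule bounded_continuous_Lp(2)[OF \<Omega> Dc]) (rule Db)
    have Lp3: "borel_rep \<Omega> D (extend_by_zero \<Omega> D)" by (rule bounded_continuous_Lp(3)[OF \<Omega> Dc]) (rule Db)
    have wd: "has_weak_deriv \<Omega> [] D D" using Lp2 by (simp add: has_weak_deriv_def)
    then have "has_weak_deriv \<Omega> [] D (wderiv \<Omega> [] D)"
      by (intro wderiv_has_weak_deriv) (auto simp: weakly_differentiable_def)
    note w = this
    have ae: "AE x in lebesgue_on \<Omega>. D x = wderiv \<Omega> [] D x"
      using has_weak_deriv_unique[OF \<Omega>(1) wd w] \<Omega>(1) by (simp add: AE_restrict_space_iff)
    have wm: "wderiv \<Omega> [] D \<in> borel_measurable (lebesgue_on \<Omega>)"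
      using w by (intro locally_integrable_measurable[OF \<Omega>(1)]) (simp add: has_weak_deriv_def)
    have nil: "[] \<in> multi_indices 1" by (simp add: multi_indices_def)
    let ?E = "extend_by_zero \<Omega> D"
    have Eq: "integrable lborel (\<lambda>x. norm (?E x) powr q)" "(LINT x|lborel. norm (?E x) powr q) \<le> l powr q"
    proof -
      show "integrable lborel (\<lambda>x. norm (?E x) powr q)" by (rule borel_rep_powr(1)[OF Lp3 \<Omega>(1) q0 Lp1])
      have "(LINT x|lborel. norm (?E x) powr q) = (LINT x|lebesgue_on \<Omega>. norm (wderiv \<Omega> [] D x) powr q)"
        using borel_rep_powr(2)[OF Lp3 \<Omega>(1) q0 Lp1] Lp_cong_AE(2)[OF Lp1 wm ae] by simp
      also have "\<dots> \<le> Sobolev_norm \<Omega> 1 q D powr q" by (rule Sobolev_norm_ge[OF nil q0])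
      also have "\<dots> \<le> l powr q" using N N0 q0 by (intro powr_mono2) auto
      finally show "(LINT x|lborel. norm (?E x) powr q) \<le> l powr q" .
    qed
    have Em: "?E \<in> borel_measurable borel" by (rule borel_measurable_extend_by_zero[OF \<Omega>(1) Dc])
    have Ei: "integrable lborel ?E"
      by (rule integrable_of_powr[OF \<Omega> Em _ Eq(1) q]) (simp add: extend_by_zero_def)
    have \<Omega>i: "integrable lborel (indicator \<Omega> :: 'a \<Rightarrow> real)"
      using emeasure_bounded_finite[OF \<Omega>(2)] \<Omega>(1) by simp
    have "(LINT x|lborel. norm (?E x)) \<le> (LINT x|lborel. l * indicator \<Omega> x + l powr (1 - q) * norm (?E x) powr q)"
    proof (rule integral_mono)
      show "norm (?E x) \<le> l * indicator \<Omega> x + l powr (1 - q) * norm (?E x) powr q" for x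
        using powr_Young[of "norm (?E x)" l q] l q by (cases "x \<in> \<Omega>") (auto simp: extend_by_zero_def)
    qed (use Ei Eq(1) \<Omega>i in auto)
    also have "\<dots> = l * V + l powr (1 - q) * (LINT x|lborel. norm (?E x) powr q)"
      using Eq(1) \<Omega>i \<Omega>(1) by (simp add: V_def)
    also have "\<dots> \<le> l * V + l powr (1 - q) * l powr q"
      by (intro add_left_mono mult_left_mono Eq(2)) simp
    also have "l powr (1 - q) * l powr q = l" using l by (simp flip: powr_add)
    finally have E1: "(LINT x|lborel. norm (?E x)) \<le> l * (V + 1)" by (simp add: algebra_simps)
    have "conv e (?r s) x - conv e (?r t) x = (LINT y|lborel. moll e (x - y) *\<^sub>R ?r s y - moll e (x - y) *\<^sub>R ?r t y)"
      unfolding conv_def by (rule Bochner_Integration.integral_diff[symmetric]; intro integrable_conv(1)[OF e] ri s(1) t)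
    also have "\<dots> = (LINT y|lborel. moll e (x - y) *\<^sub>R ?E y)"
      by (intro Bochner_Integration.integral_cong refl) (auto simp: extend_by_zero_def at_time_def D_def algebra_simps)
    also have "norm \<dots> \<le> (LINT y|lborel. B * norm (?E y))"
      by (rule Bochner_Integration.integral_norm_bound_integral[OF integrable_conv(1)[OF e Ei]])
        (use Ei B in \<open>auto simp: abs_mult intro!: mult_right_mono\<close>)
    also have "\<dots> \<le> B * (l * (V + 1))" using mult_left_mono[OF E1, of B] B(1) by simp
    also have "\<dots> < \<epsilon>" using \<epsilon> B(1) V0 by (simp add: l_def)
    finally show ?thesis by (simp add: dist_norm)
  qed
  with d(1) show "\<exists>d>0. \<forall>s\<in>{0..T}. dist s t < d \<longrightarrow> dist (conv e (?r s) x) (conv e (?r t) x) < \<epsilon>" by blast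
qed

lemma borel_measurable_deriv_hat: "deriv (hat s t n) \<in> borel_measurable borel"
proof -
  have [measurable]: "pulse \<in> borel_measurable borel"
    by (intro borel_measurable_continuous_onI continuous_on_pulse)
  have "deriv (hat s t n) = (\<lambda>\<tau>. real (Suc n) * pulse (real (Suc n) * (\<tau> - s)) - real (Suc n) * pulse (real (Suc n) * (\<tau> - t)))"
    by (rule ext) (rule DERIV_imp_deriv[OF hat_DERIV])
  then show ?thesis by (simp only:) measurable
qed

lemma conv_cong_AE: "AE y in lborel. f y = g y \<Longrightarrow> f \<in> borel_measurable borel \<Longrightarrow> g \<in> borel_measurable borel \<Longrightarrow> conv e f x = conv e g x"
  unfolding conv_def by (intro integral_cong_AE) (auto elim: eventually_mono)

text \<open>The time factor extracts increments in time, the space factor evaluates the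
  mollification at x. The minus sign in the space derivative comes from the reflected argument of
  the kernel.\<close>

lemma product_test_function:
  fixes x :: "real^3"
  assumes e: "e > 0" and x: "cball x e \<subseteq> \<Omega>" and st: "0 < s" "s \<le> t" "t + 1 / real (Suc n) < T"
  defines "\<Phi> \<equiv> \<lambda>z. hat s t n (snd z) * moll e (x - fst z)"
  shows "test_function (cylinder \<Omega> T) \<Phi>"
    and "iter_deriv [(0, 1)] \<Phi> z = deriv (hat s t n) (snd z) * moll e (x - fst z)"
    and "iter_deriv [spt i] \<Phi> z = - (hat s t n (snd z) * mgrad e (x - fst z) $ i)"
proof -
  show "test_function (cylinder \<Omega> T) \<Phi>"
  proof (rule test_functionI[where K="cball x e \<times> {s..t + 1 / real (Suc n)}"])
    show "\<Phi> \<in> elementary"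
      unfolding \<Phi>_def by (intro elementary.mult elementary_snd[OF hat_elementary] elementary_fst[OF elementary_translate[OF moll_elementary]])
    show c: "compact (cball x e \<times> {s..t + 1 / real (Suc n)})" by (intro compact_Times compact_cball compact_Icc)
    show "closure {z. \<Phi> z \<noteq> 0} \<subseteq> cball x e \<times> {s..t + 1 / real (Suc n)}"
    proof (rule closure_minimal)
      show "{z. \<Phi> z \<noteq> 0} \<subseteq> cball x e \<times> {s..t + 1 / real (Suc n)}"
      proof
        fix z assume "z \<in> {z. \<Phi> z \<noteq> 0}"
        then have 1: "hat s t n (snd z) \<noteq> 0" "moll e (x - fst z) \<noteq> 0" by (auto simp: \<Phi>_def)
        have "snd z \<in> {s..t + 1 / real (Suc n)}" using hat_support[OF st(2), of "snd z" n] 1(1) by force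
        moreover have "fst z \<in> cball x e" using moll_eq_0[OF e, of "x - fst z"] 1(2) by (force simp: dist_norm)
        ultimately show "z \<in> cball x e \<times> {s..t + 1 / real (Suc n)}" by (simp add: mem_Times_iff)
      qed
      show "closed (cball x e \<times> {s..t + 1 / real (Suc n)})" using c by (rule compact_imp_closed)
    qed
    show "cball x e \<times> {s..t + 1 / real (Suc n)} \<subseteq> cylinder \<Omega> T"
      using x st unfolding cylinder_def by (intro Sigma_mono) auto
  qed
  have hd: "((\<lambda>z. hat s t n (snd z)) has_derivative (\<lambda>k. deriv (hat s t n) (snd z) * snd k)) (at z)"
  proof -
    have "(hat s t n has_real_derivative deriv (hat s t n) (snd z)) (at (snd z))"
      by (rule DERIV_deriv_iff_real_differentiable[THEN iffD2]) (use hat_DERIV real_differentiable_def in blast)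
    from has_derivative_compose[OF has_derivative_snd[OF has_derivative_ident] this[unfolded has_field_derivative_def]]
    show ?thesis .
  qed
  have md: "((\<lambda>z::(real^3) \<times> real. moll e (x - fst z)) has_derivative (\<lambda>k. - (mgrad e (x - fst z) \<bullet> fst k))) (at z)"
    using has_derivative_compose[OF has_derivative_fst[OF has_derivative_ident] moll_translate_has_derivative[OF e]] .
  have "(\<Phi> has_derivative (\<lambda>k. hat s t n (snd z) * - (mgrad e (x - fst z) \<bullet> fst k) + deriv (hat s t n) (snd z) * snd k * moll e (x - fst z))) (at z)"
    unfolding \<Phi>_def by (rule has_derivative_mult[OF hd md])
  from frechet_derivative_at[OF this, symmetric]
  have fd: "frechet_derivative \<Phi> (at z) = (\<lambda>k. hat s t n (snd z) * - (mgrad e (x - fst z) \<bullet> fst k) + deriv (hat s t n) (snd z) * snd k * moll e (x - fst z))" .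
  show "iter_deriv [(0, 1)] \<Phi> z = deriv (hat s t n) (snd z) * moll e (x - fst z)" by (simp add: fd)
  show "iter_deriv [spt i] \<Phi> z = - (hat s t n (snd z) * mgrad e (x - fst z) $ i)" by (simp add: fd spt_def inner_axis)
qed

text \<open>Here \<open>\<rho>'\<close> and \<open>u'\<close> are Borel representatives on the cylinder, so that Fubini's theorem applies.\<close>

lemma conv_density_evolution:
  fixes \<rho> :: "(real^3) \<times> real \<Rightarrow> real" and u H :: "(real^3) \<times> real \<Rightarrow> real^3" and x :: "real^3"
  assumes \<Omega>: "open \<Omega>" "bounded \<Omega>" and eq: "MHD_equations (cylinder \<Omega> T) \<gamma> \<mu> lam \<rho> u H"
    and \<rho>': "borel_rep (cylinder \<Omega> T) \<rho> \<rho>'" and u': "borel_rep (cylinder \<Omega> T) u u'"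
    and cont: "\<And>t. t \<in> {0..T} \<Longrightarrow> continuous_on \<Omega> (at_time \<rho> t)"
    and G: "continuous_on {0..T} (\<lambda>t. conv e (extend_by_zero \<Omega> (at_time \<rho> t)) x)"
    and e: "e > 0" and x: "cball x e \<subseteq> \<Omega>"
    and Hi: "integrable lborel (\<lambda>\<tau>. flux e (\<lambda>y. \<rho>' (y, \<tau>)) (\<lambda>y. u' (y, \<tau>)) x)"
    and st: "0 \<le> s" "s \<le> t" "t \<le> T"
  shows "conv e (extend_by_zero \<Omega> (at_time \<rho> t)) x - conv e (extend_by_zero \<Omega> (at_time \<rho> s)) x
     = integral {s..t} (\<lambda>\<tau>. - flux e (\<lambda>y. \<rho>' (y, \<tau>)) (\<lambda>y. u' (y, \<tau>)) x)"
proof (rule weak_derivative_primitive[OF G _ _ _ st])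
  let ?Q = "cylinder \<Omega> T"
  have Q: "open ?Q" by (rule open_cylinder[OF \<Omega>(1)])
  have r: "\<rho> \<in> borel_measurable (lebesgue_on ?Q)" "\<rho>' \<in> borel_measurable borel" "AE z in lborel. z \<in> ?Q \<longrightarrow> \<rho>' z = \<rho> z" "\<And>z. z \<notin> ?Q \<Longrightarrow> \<rho>' z = 0"
    using \<rho>' by (auto simp: borel_rep_def)
  have ur: "u \<in> borel_measurable (lebesgue_on ?Q)" "u' \<in> borel_measurable borel" "AE z in lborel. z \<in> ?Q \<longrightarrow> u' z = u z" "\<And>z. z \<notin> ?Q \<Longrightarrow> u' z = 0"
    using u' by (auto simp: borel_rep_def)
  have rm[measurable]: "(\<lambda>z. \<rho>' z) \<in> borel_measurable ((borel :: (real^3) measure) \<Otimes>\<^sub>M (borel :: real measure))"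
    using r(2) by (simp add: borel_prod)
  show "integrable lborel (\<lambda>\<tau>. - flux e (\<lambda>y. \<rho>' (y, \<tau>)) (\<lambda>y. u' (y, \<tau>)) x)" using Hi by simp
  show "- flux e (\<lambda>y. \<rho>' (y, \<tau>)) (\<lambda>y. u' (y, \<tau>)) x = 0" if "\<tau> \<notin> {0<..<T}" for \<tau>
  proof -
    have "\<rho>' (y, \<tau>) = 0" for y using that by (intro r(4)) (auto simp: cylinder_def)
    then show ?thesis by (simp add: flux_def)
  qed
  fix s t :: real and n :: nat
  assume st: "0 < s" "s \<le> t" "t + 1 / real (Suc n) < T"
  define \<Phi> where "\<Phi> = (\<lambda>z::(real^3) \<times> real. hat s t n (snd z) * moll e (x - fst z))"
  note \<Phi> = product_test_function[OF e x st, folded \<Phi>_def]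
  have D0: "iter_deriv [(0, 1)] \<Phi> \<in> borel_measurable borel" and Di: "iter_deriv [spt i] \<Phi> \<in> borel_measurable borel" for i
    by (intro test_function_borel[OF test_function_iter_deriv[OF \<Phi>(1)]] time_Basis spt_Basis)+
  define p where "p i z = (\<rho> z *\<^sub>R u z) $ i" for i z
  define p' where "p' i z = (\<rho>' z *\<^sub>R u' z) $ i" for i z
  have prep: "borel_rep ?Q (p i) (p' i)" for i
    unfolding borel_rep_def
  proof (intro conjI)
    have c: "(\<lambda>v::real^3. v $ i) \<in> borel_measurable borel" by (intro borel_measurable_continuous_onI continuous_intros)
    show "p i \<in> borel_measurable (lebesgue_on ?Q)" unfolding p_def
      by (rule measurable_compose[OF _ c]) (use r(1) ur(1) in measurable)
    show "p' i \<in> borel_measurable borel" unfolding p'_def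
      by (rule measurable_compose[OF _ c]) (use r(2) ur(2) in measurable)
    show "AE z in lborel. z \<in> ?Q \<longrightarrow> p' i z = p i z"
      using r(3) ur(3) by eventually_elim (simp add: p_def p'_def)
    show "\<forall>z. z \<notin> ?Q \<longrightarrow> p' i z = 0" using r(4) by (simp add: p'_def)
  qed
  have loc: "weakly_differentiable ?Q [(0, 1)] \<rho>" "weakly_differentiable ?Q [spt i] (\<lambda>z. \<rho> z *\<^sub>R u z)" for i
    using eq unfolding MHD_equations_def derivatives_exist_def by blast+
  have lr: "locally_integrable_on ?Q \<rho>" using loc(1) by (auto simp: weakly_differentiable_def has_weak_deriv_def)
  have lp: "locally_integrable_on ?Q (\<lambda>z. \<rho> z *\<^sub>R u z)" using loc(2) by (auto simp: weakly_differentiable_def has_weak_deriv_def)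
  have I0: "integrable lborel (\<lambda>z. iter_deriv [(0, 1)] \<Phi> z *\<^sub>R \<rho>' z)"
    using borel_rep_set_integral(2)[OF \<rho>' Q D0] test_function_set_integrable[OF test_function_iter_deriv[OF \<Phi>(1) time_Basis] lr] by blast
  have Ii: "integrable lborel (\<lambda>z. iter_deriv [spt i] \<Phi> z *\<^sub>R p' i z)" for i
  proof -
    have "set_integrable lebesgue ?Q (\<lambda>z. iter_deriv [spt i] \<Phi> z *\<^sub>R (\<rho> z *\<^sub>R u z))"
      by (rule test_function_set_integrable[OF test_function_iter_deriv[OF \<Phi>(1) spt_Basis] lp])
    from set_integral_vec_nth(2)[OF this, of i]
    have "set_integrable lebesgue ?Q (\<lambda>z. iter_deriv [spt i] \<Phi> z *\<^sub>R p i z)" by (simp only: p_def vector_scaleR_component)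
    then show ?thesis using borel_rep_set_integral(2)[OF prep Q Di] by blast
  qed
  have "(LINT z|lborel. iter_deriv [(0, 1)] \<Phi> z *\<^sub>R \<rho>' z) + (\<Sum>i\<in>UNIV. LINT z|lborel. iter_deriv [spt i] \<Phi> z *\<^sub>R p' i z) = 0"
    using continuity_equation_test[OF Q eq \<Phi>(1)]
    unfolding borel_rep_set_integral(1)[OF \<rho>' Q D0] borel_rep_set_integral(1)[OF prep[unfolded p_def[abs_def]] Q Di] by simp
  moreover have "(LINT z|lborel. iter_deriv [(0, 1)] \<Phi> z *\<^sub>R \<rho>' z)
      = (LINT \<tau>|lborel. deriv (hat s t n) \<tau> * (indicator {0..T} \<tau> * conv e (extend_by_zero \<Omega> (at_time \<rho> \<tau>)) x))"
  proof -
    have "(LINT z|lborel. iter_deriv [(0, 1)] \<Phi> z *\<^sub>R \<rho>' z) = (LINT \<tau>|lborel. LINT y|lborel. iter_deriv [(0, 1)] \<Phi> (y, \<tau>) *\<^sub>R \<rho>' (y, \<tau>))"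
      using lborel_pair.integral_snd[of "\<lambda>y \<tau>. iter_deriv [(0, 1)] \<Phi> (y, \<tau>) *\<^sub>R \<rho>' (y, \<tau>)"] I0
      by (simp add: lborel_prod case_prod_beta' del: iter_deriv.simps)
    also have "\<dots> = (LINT \<tau>|lborel. deriv (hat s t n) \<tau> * conv e (\<lambda>y. \<rho>' (y, \<tau>)) x)"
      unfolding \<Phi>(2) conv_def by (simp add: mult.assoc)
    also have "\<dots> = (LINT \<tau>|lborel. deriv (hat s t n) \<tau> * (indicator {0..T} \<tau> * conv e (extend_by_zero \<Omega> (at_time \<rho> \<tau>)) x))"
    proof (rule integral_cong_AE)
      have [measurable]: "deriv (hat s t n) \<in> borel_measurable borel"
        by (rule borel_measurable_deriv_hat)
      show "(\<lambda>\<tau>. deriv (hat s t n) \<tau> * conv e (\<lambda>y. \<rho>' (y, \<tau>)) x) \<in> borel_measurable lborel"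
        unfolding conv_def by measurable
      show "(\<lambda>\<tau>. deriv (hat s t n) \<tau> * (indicator {0..T} \<tau> * conv e (extend_by_zero \<Omega> (at_time \<rho> \<tau>)) x)) \<in> borel_measurable lborel"
      proof -
        have "(\<lambda>\<tau>. indicator {0..T} \<tau> * conv e (extend_by_zero \<Omega> (at_time \<rho> \<tau>)) x) \<in> borel_measurable lborel"
          using borel_measurable_continuous_on_indicator[OF _ G] by simp
        then show ?thesis by (rule borel_measurable_times[rotated]) measurable
      qed
      have a1: "AE \<tau> in lborel. AE y in lborel. (y, \<tau>) \<in> ?Q \<longrightarrow> \<rho>' (y, \<tau>) = \<rho> (y, \<tau>)"
        using r(3) by (rule AE_time_slices)
      \<comment> \<open>The indicator covers the closed interval whereas \<rho>' vanishes outside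
        the open one; the two end points are discarded as null sets.\<close>
      have a2: "AE \<tau> in lborel. \<tau> \<noteq> 0" "AE \<tau> in lborel. \<tau> \<noteq> T" by (rule AE_lborel_singleton)+
      show "AE \<tau> in lborel. deriv (hat s t n) \<tau> * conv e (\<lambda>y. \<rho>' (y, \<tau>)) x
          = deriv (hat s t n) \<tau> * (indicator {0..T} \<tau> * conv e (extend_by_zero \<Omega> (at_time \<rho> \<tau>)) x)"
        using a1 a2
      proof eventually_elim
        case (elim \<tau>)
        show ?case
        proof (cases "\<tau> \<in> {0<..<T}")
          case True
          have "conv e (\<lambda>y. \<rho>' (y, \<tau>)) x = conv e (extend_by_zero \<Omega> (at_time \<rho> \<tau>)) x"
          proof (rule conv_cong_AE)
            show "AE y in lborel. \<rho>' (y, \<tau>) = extend_by_zero \<Omega> (at_time \<rho> \<tau>) y"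
              using elim(1)
            proof eventually_elim
              case (elim y)
              then show ?case using True r(4)[of "(y, \<tau>)"] by (auto simp: extend_by_zero_def at_time_def cylinder_def)
            qed
            show "(\<lambda>y. \<rho>' (y, \<tau>)) \<in> borel_measurable borel" by measurable
            show "extend_by_zero \<Omega> (at_time \<rho> \<tau>) \<in> borel_measurable borel"
              by (rule borel_measurable_extend_by_zero[OF \<Omega>(1) cont]) (use True in auto)
          qed
          then show ?thesis using True by simp
        next
          case False
          then have "\<rho>' (y, \<tau>) = 0" for y by (intro r(4)) (auto simp: cylinder_def)
          moreover have "\<tau> \<notin> {0..T}" using False elim(2,3) by auto
          ultimately show ?thesis by (simp add: conv_def)
        qed
      qed
    qed
    finally show ?thesis .
  qed
  moreover have "(\<Sum>i\<in>UNIV. LINT z|lborel. iter_deriv [spt i] \<Phi> z *\<^sub>R p' i z)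
      = (LINT \<tau>|lborel. hat s t n \<tau> * - flux e (\<lambda>y. \<rho>' (y, \<tau>)) (\<lambda>y. u' (y, \<tau>)) x)"
  proof -
    \<comment> \<open>The three space derivatives of the test function, paired with the components
      of \<rho>' u', add up to the inner product with the kernel gradient, which is the integrand of
      \<open>flux\<close> with a minus sign.\<close>
    have pt: "(\<Sum>i\<in>UNIV. iter_deriv [spt i] \<Phi> z *\<^sub>R p' i z)
        = - (hat s t n (snd z) * (\<rho>' z * (u' z \<bullet> mgrad e (x - fst z))))" for z
      unfolding \<Phi>(3) p'_def by (simp add: inner_vec_def sum_distrib_left sum_negf mult_ac)
    have "(\<Sum>i\<in>UNIV. LINT z|lborel. iter_deriv [spt i] \<Phi> z *\<^sub>R p' i z)
        = (LINT z|lborel. (\<Sum>i\<in>UNIV. iter_deriv [spt i] \<Phi> z *\<^sub>R p' i z))"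
      by (rule Bochner_Integration.integral_sum[symmetric]) (rule Ii)
    also have "\<dots> = (LINT z|lborel. - (hat s t n (snd z) * (\<rho>' z * (u' z \<bullet> mgrad e (x - fst z)))))"
      unfolding pt ..
    also have "\<dots> = (LINT \<tau>|lborel. LINT y|lborel. - (hat s t n \<tau> * (\<rho>' (y, \<tau>) * (u' (y, \<tau>) \<bullet> mgrad e (x - y)))))"
    proof -
      have "integrable lborel (\<lambda>z. \<Sum>i\<in>UNIV. iter_deriv [spt i] \<Phi> z *\<^sub>R p' i z)"
        by (rule Bochner_Integration.integrable_sum) (rule Ii)
      then have "integrable lborel (\<lambda>z. - (hat s t n (snd z) * (\<rho>' z * (u' z \<bullet> mgrad e (x - fst z)))))"
        unfolding pt .
      then show ?thesis
        using lborel_pair.integral_snd[of "\<lambda>y \<tau>. - (hat s t n \<tau> * (\<rho>' (y, \<tau>) * (u' (y, \<tau>) \<bullet> mgrad e (x - y))))"]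
        by (simp add: lborel_prod case_prod_beta')
    qed
    also have "\<dots> = (LINT \<tau>|lborel. hat s t n \<tau> * - flux e (\<lambda>y. \<rho>' (y, \<tau>)) (\<lambda>y. u' (y, \<tau>)) x)"
      unfolding flux_def by simp
    finally show ?thesis .
  qed
  ultimately show "(LINT \<tau>|lborel. deriv (hat s t n) \<tau> * (indicator {0..T} \<tau> * conv e (extend_by_zero \<Omega> (at_time \<rho> \<tau>)) x))
      + (LINT \<tau>|lborel. hat s t n \<tau> * - flux e (\<lambda>y. \<rho>' (y, \<tau>)) (\<lambda>y. u' (y, \<tau>)) x) = 0" by (simp only:)
qed

section \<open>Comparison along the flow\<close>

text \<open>The set where f exceeds M is open, and a nonempty open set is not null.\<close>

lemma continuous_AE_le:
  fixes f :: "'a::euclidean_space \<Rightarrow> real"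
  assumes \<Omega>: "open \<Omega>" and f: "continuous_on \<Omega> f" and ae: "AE x in lebesgue_on \<Omega>. f x \<le> M" and x: "x \<in> \<Omega>"
  shows "f x \<le> M"
proof (rule ccontr)
  assume n: "\<not> f x \<le> M"
  define S where "S = {x \<in> \<Omega>. M < f x}"
  have S: "open S"
  proof -
    have "open (\<Omega> \<inter> f -` {M<..})" using \<Omega> f by (simp add: continuous_on_open_vimage Int_commute)
    moreover have "S = \<Omega> \<inter> f -` {M<..}" by (auto simp: S_def)
    ultimately show ?thesis by simp
  qed
  have "AE x in lebesgue. x \<in> \<Omega> \<longrightarrow> f x \<le> M" using ae \<Omega> by (simp add: AE_restrict_space_iff)
  then have "AE x in lebesgue. x \<notin> S" by eventually_elim (auto simp: S_def)
  then have "S \<in> null_sets lebesgue" using S by (subst AE_iff_null_sets) auto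
  then have "negligible S" by (simp add: negligible_iff_null_sets)
  moreover have "S \<noteq> {}" using n x by (auto simp: S_def)
  ultimately show False using open_not_negligible[OF S] by blast
qed

lemma conv_ge:
  fixes f :: "'a::euclidean_space \<Rightarrow> real"
  assumes e: "e > 0" and f: "integrable lborel f" and le: "\<And>y. y \<in> cball x e \<Longrightarrow> c \<le> f y"
  shows "c \<le> conv e f x"
proof -
  have im: "integrable lborel (\<lambda>y. moll e (x - y))" and m1: "(LINT y|lborel. moll e (x - y)) = 1"
    using integrable_moll[OF e, where 'a='a] integral_moll[OF e, where 'a='a]
    by (simp_all add: integral_reflect)
  have "c = (LINT y|lborel. moll e (x - y) * c)" using m1 by simp
  also have "\<dots> \<le> (LINT y|lborel. moll e (x - y) *\<^sub>R f y)"
  proof (rule integral_mono[OF _ integrable_conv(1)[OF e f]])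
    show "integrable lborel (\<lambda>y. moll e (x - y) * c)" using im by simp
    fix y
    show "moll e (x - y) * c \<le> moll e (x - y) *\<^sub>R f y"
    proof (cases "y \<in> cball x e")
      case True
      then show ?thesis using le[OF True] moll_nonneg[of e "x - y"] by (simp add: mult_left_mono)
    next
      case False
      then have "moll e (x - y) = 0" by (intro moll_eq_0[OF e]) (simp add: dist_norm)
      then show ?thesis by simp
    qed
  qed
  finally show ?thesis by (simp only: conv_def)
qed

text \<open>Uniform continuity is taken on a compact neighbourhood of K inside \<Omega>, since the
  balls around points of K leave K. One half of \<delta> is the difference between the values at y
  and x, the other the distance of the convolution from the value at x.\<close>

lemma conv_uniform_approx:
  fixes \<rho> :: "'a::euclidean_space \<Rightarrow> real"
  assumes \<Omega>: "open \<Omega>" and \<rho>: "continuous_on \<Omega> \<rho>" and i: "integrable lborel (extend_by_zero \<Omega> \<rho>)"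
    and K: "compact K" "K \<subseteq> \<Omega>" and \<delta>: "\<delta> > 0"
  obtains e0 where "e0 > 0" "\<And>e x y. 0 < e \<Longrightarrow> e \<le> e0 \<Longrightarrow> x \<in> K \<Longrightarrow> y \<in> cball x e \<Longrightarrow>
      cball x e \<subseteq> \<Omega> \<and> \<bar>\<rho> y - conv e (extend_by_zero \<Omega> \<rho>) x\<bar> \<le> \<delta>"
proof -
  obtain d0 where d0: "d0 > 0" "(\<Union>x\<in>K. cball x d0) \<subseteq> \<Omega>"
    using compact_subset_open_imp_cball_epsilon_subset[OF K(1) \<Omega> K(2)] by blast
  define K' where "K' = {a + b |a b. a \<in> K \<and> b \<in> cball (0::'a) d0}"
  have K': "compact K'" unfolding K'_def by (intro compact_sums K(1) compact_cball)
  have sub: "cball x d0 \<subseteq> K'" if x: "x \<in> K" for x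
  proof
    fix y assume "y \<in> cball x d0"
    then have "y - x \<in> cball 0 d0" by (simp add: dist_norm norm_minus_commute)
    moreover have "y = x + (y - x)" by simp
    ultimately show "y \<in> K'" unfolding K'_def using x by blast
  qed
  have "K' \<subseteq> \<Omega>"
  proof
    fix z assume "z \<in> K'"
    then obtain a b where ab: "a \<in> K" "b \<in> cball 0 d0" "z = a + b" unfolding K'_def by blast
    then have "z \<in> cball a d0" by (simp add: dist_norm)
    with ab(1) d0(2) show "z \<in> \<Omega>" by blast
  qed
  then have "uniformly_continuous_on K' \<rho>"
    by (intro compact_uniformly_continuous K' continuous_on_subset[OF \<rho>])
  moreover have "\<delta> / 2 > 0" using \<delta> by simp
  ultimately obtain d1 where d1: "d1 > 0" "\<And>x y. x \<in> K' \<Longrightarrow> y \<in> K' \<Longrightarrow> dist y x < d1 \<Longrightarrow> dist (\<rho> y) (\<rho> x) < \<delta> / 2"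
    unfolding uniformly_continuous_on_def by meson
  have "cball x e \<subseteq> \<Omega> \<and> \<bar>\<rho> y - conv e (extend_by_zero \<Omega> \<rho>) x\<bar> \<le> \<delta>"
    if e: "0 < e" "e \<le> min d0 (d1/2)" and x: "x \<in> K" and y: "y \<in> cball x e" for e x y
  proof -
    have ce: "cball x e \<subseteq> cball x d0" using e by (intro subset_cball) simp
    then have inc: "cball x e \<subseteq> \<Omega>" using d0(2) x by blast
    have near: "\<bar>\<rho> z - \<rho> x\<bar> \<le> \<delta> / 2" if z: "z \<in> cball x e" for z
    proof -
      have "dist z x < d1" using z e d1(1) by (simp add: dist_commute)
      moreover have "x \<in> K'" "z \<in> K'" using sub[OF x] ce z d0(1) by auto
      ultimately show ?thesis using d1(2)[of x z] by (simp add: dist_real_def)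
    qed
    have "norm (conv e (extend_by_zero \<Omega> \<rho>) x - \<rho> x) \<le> \<delta> / 2"
      by (rule conv_approx[OF e(1) i]) (use near inc in \<open>auto simp: extend_by_zero_def intro!: AE_I2\<close>)
    then have "\<bar>\<rho> y - conv e (extend_by_zero \<Omega> \<rho>) x\<bar> \<le> \<delta>"
      unfolding real_norm_def using near[OF y] by linarith
    with inc show ?thesis by simp
  qed
  then show ?thesis using d0(1) d1(1) by (intro that[of "min d0 (d1/2)"]) auto
qed

lemma integrable_lebesgue_of_lborel:
  fixes f :: "'a::euclidean_space \<Rightarrow> 'b::euclidean_space"
  shows "integrable lborel f \<Longrightarrow> integrable lebesgue f"
  by (subst integrable_completion) (auto dest: borel_measurable_integrable)

lemma flux_cong_AE:
  assumes "AE y in lborel. r y = r' y" "AE y in lborel. V y = V' y"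
    "r \<in> borel_measurable borel" "r' \<in> borel_measurable borel" "V \<in> borel_measurable borel" "V' \<in> borel_measurable borel"
  shows "flux e r V x = flux e r' V' x"
  unfolding flux_def
proof (rule integral_cong_AE)
  note [measurable] = assms(3-6)
  show "(\<lambda>y. r y * (V y \<bullet> mgrad e (x - y))) \<in> borel_measurable lborel" "(\<lambda>y. r' y * (V' y \<bullet> mgrad e (x - y))) \<in> borel_measurable lborel"
    by measurable
  show "AE y in lborel. r y * (V y \<bullet> mgrad e (x - y)) = r' y * (V' y \<bullet> mgrad e (x - y))"
    using assms(1,2) by eventually_elim simp
qed

text \<open>The comparison sees the solution only through this interface: a bounded density,
  continuous in space and bounded below at time T, and for almost every time a tangential Lipschitz
  field whose constant is integrable in time. The Borel functions \<rho>' and u' stand beside \<rho>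
  because Fubini's theorem is applied to the former, while values at a fixed time, such as 0 and T,
  belong to the latter.\<close>

locale transported_density =
  fixes \<Omega> :: "(real^3) set" and T M c C1 :: real and \<rho> \<rho>' :: "(real^3) \<times> real \<Rightarrow> real"
    and u' :: "(real^3) \<times> real \<Rightarrow> real^3" and L :: "real \<Rightarrow> real"
  assumes \<Omega>: "smooth_bounded_domain \<Omega>" and T: "T > 0" and M: "M \<ge> 0" and c: "c > 0"
    and cont: "\<And>t. t \<in> {0..T} \<Longrightarrow> continuous_on \<Omega> (at_time \<rho> t)"
    and nonneg: "\<And>t x. t \<in> {0..T} \<Longrightarrow> x \<in> \<Omega> \<Longrightarrow> 0 \<le> \<rho> (x, t)"
    and le_M: "\<And>t x. t \<in> {0..T} \<Longrightarrow> x \<in> \<Omega> \<Longrightarrow> \<rho> (x, t) \<le> M"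
    and final: "\<And>x. x \<in> \<Omega> \<Longrightarrow> c \<le> \<rho> (x, T)"
    and rho_borel: "\<rho>' \<in> borel_measurable borel" and u_borel: "u' \<in> borel_measurable borel"
    and rho_zero: "\<And>y \<tau>. y \<notin> \<Omega> \<or> \<tau> \<notin> {0<..<T} \<Longrightarrow> \<rho>' (y, \<tau>) = 0"
    and u_zero: "\<And>y \<tau>. y \<notin> \<Omega> \<or> \<tau> \<notin> {0<..<T} \<Longrightarrow> u' (y, \<tau>) = 0"
    and L: "integrable lborel L" "\<And>\<tau>. L \<tau> \<ge> 0"
    and good: "AE \<tau> in lborel. \<tau> \<in> {0<..<T} \<longrightarrow> (AE y in lborel. \<rho>' (y, \<tau>) = extend_by_zero \<Omega> (at_time \<rho> \<tau>) y) \<and>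
        (\<exists>v. tangential_Lipschitz_field \<Omega> (L \<tau>) v \<and> (AE y in lborel. u' (y, \<tau>) = extend_by_zero \<Omega> v y))"
    and time_cont: "\<And>e x. e > 0 \<Longrightarrow> continuous_on {0..T} (\<lambda>t. conv e (extend_by_zero \<Omega> (at_time \<rho> t)) x)"
    and evolution: "\<And>e x s t. e > 0 \<Longrightarrow> cball x e \<subseteq> \<Omega> \<Longrightarrow>
        integrable lborel (\<lambda>\<tau>. flux e (\<lambda>y. \<rho>' (y, \<tau>)) (\<lambda>y. u' (y, \<tau>)) x) \<Longrightarrow> 0 \<le> s \<Longrightarrow> s \<le> t \<Longrightarrow> t \<le> T \<Longrightarrow>
        conv e (extend_by_zero \<Omega> (at_time \<rho> t)) x - conv e (extend_by_zero \<Omega> (at_time \<rho> s)) x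
          = integral {s..t} (\<lambda>\<tau>. - flux e (\<lambda>y. \<rho>' (y, \<tau>)) (\<lambda>y. u' (y, \<tau>)) x)"
    and C1: "C1 > 0" "\<And>e. e > 0 \<Longrightarrow> integrable lborel (\<lambda>z::real^3. norm z * norm (mgrad e z))"
      "\<And>e. e > 0 \<Longrightarrow> (LINT z|lborel. norm z * norm (mgrad e (z :: real^3))) \<le> C1"
begin

abbreviation r :: "real \<Rightarrow> real^3 \<Rightarrow> real" where "r t \<equiv> extend_by_zero \<Omega> (at_time \<rho> t)"
abbreviation r' :: "real \<Rightarrow> real^3 \<Rightarrow> real" where "r' \<tau> \<equiv> (\<lambda>y. \<rho>' (y, \<tau>))"
abbreviation V' :: "real \<Rightarrow> real^3 \<Rightarrow> real^3" where "V' \<tau> \<equiv> (\<lambda>y. u' (y, \<tau>))"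

text \<open>On \<open>[0,T]\<close>, \<open>lower\<close> solves \<open>m' = rate m\<close> with \<open>m(T) = c\<close>; it is extended by zero so that all time
  integrals can be taken over the real line.\<close>

definition rate :: "real \<Rightarrow> real" where "rate \<tau> = (C1 + real DIM(real^3)) * L \<tau>"
definition accumulated :: "real \<Rightarrow> real" where "accumulated t = integral {0..t} rate"
definition lower :: "real \<Rightarrow> real" where
  "lower t = (if t \<in> {0..T} then c * exp (accumulated t - accumulated T) else 0)"

text \<open>At a good time the slices of the Borel representatives agree almost everywhere with the
  density and with one tangential Lipschitz field v. The spatial estimates are made there; the
  remaining times in (0,T) form a null set.\<close>

definition is_good :: "real \<Rightarrow> (real^3 \<Rightarrow> real^3) \<Rightarrow> bool" where
  "is_good \<tau> v \<longleftrightarrow> \<tau> \<in> {0<..<T} \<and> (AE y in lborel. r' \<tau> y = r \<tau> y) \<and>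
     tangential_Lipschitz_field \<Omega> (L \<tau>) v \<and> (AE y in lborel. V' \<tau> y = extend_by_zero \<Omega> v y)"

lemma open_domain: "open \<Omega>" and bounded_domain: "bounded \<Omega>"
  using \<Omega> by (auto simp: smooth_bounded_domain_def)

lemma domain_borel: "\<Omega> \<in> sets borel"
  using open_domain by simp

lemma AE_good: "AE \<tau> in lborel. \<tau> \<notin> {0<..<T} \<or> (\<exists>v. is_good \<tau> v)"
  using good by eventually_elim (auto simp: is_good_def)

lemma slice_measurable [measurable]: "r' \<tau> \<in> borel_measurable borel" "V' \<tau> \<in> borel_measurable borel"
  using rho_borel u_borel by measurable

lemma r_borel: "t \<in> {0..T} \<Longrightarrow> r t \<in> borel_measurable borel"
  by (rule borel_measurable_extend_by_zero[OF open_domain cont])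

lemma r_bounds: "t \<in> {0..T} \<Longrightarrow> 0 \<le> r t x" "t \<in> {0..T} \<Longrightarrow> r t x \<le> M"
  using nonneg le_M M by (auto simp: extend_by_zero_def at_time_def)

lemma r_integrable: assumes t: "t \<in> {0..T}" shows "integrable lborel (r t)"
proof (rule integrable_bounded_compact_support[OF r_borel[OF t] bounded_domain domain_borel])
  show "norm (r t x) \<le> M" for x using r_bounds[OF t, of x] by simp
qed (simp add: extend_by_zero_def)

lemma conv_r_bounds:
  assumes e: "e > 0" and t: "t \<in> {0..T}"
  shows "0 \<le> conv e (r t) x" and "conv e (r t) x \<le> M"
proof -
  show "0 \<le> conv e (r t) x" by (rule conv_ge[OF e r_integrable[OF t]]) (rule r_bounds(1)[OF t])
  have "norm (conv e (r t) x - 0) \<le> M"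
    by (rule conv_approx[OF e r_integrable[OF t]]) (use r_bounds[OF t] in \<open>auto intro!: AE_I2\<close>)
  then show "conv e (r t) x \<le> M" by simp
qed

lemma rate_absolutely_integrable: "rate absolutely_integrable_on {0..T}"
proof -
  have "integrable lborel rate" unfolding rate_def using L(1) by simp
  then have "integrable lebesgue rate" by (rule integrable_lebesgue_of_lborel)
  then show ?thesis unfolding set_integrable_def by (intro integrable_mult_indicator) auto
qed

lemma rate_nonneg: "rate \<tau> \<ge> 0"
  unfolding rate_def using C1(1) L(2) by simp

lemma rate_integrable_on: "rate integrable_on {0..T}"
  using rate_absolutely_integrable by (simp add: absolutely_integrable_on_def)

lemma accumulated_diff:
  assumes "0 \<le> s" "s \<le> t" "t \<le> T" shows "accumulated t - accumulated s = integral {s..t} rate"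
proof -
  have "integral {0..s} rate + integral {s..t} rate = integral {0..t} rate"
    by (rule Henstock_Kurzweil_Integration.integral_combine[OF assms(1,2)])
      (rule integrable_on_subinterval[OF rate_integrable_on], use assms in auto)
  then show ?thesis by (simp add: accumulated_def)
qed

lemma accumulated_mono: assumes "0 \<le> s" "s \<le> t" "t \<le> T" shows "accumulated s \<le> accumulated t"
proof -
  have "integral {s..t} rate \<ge> 0"
    by (rule integral_nonneg[OF integrable_on_subinterval[OF rate_integrable_on]]) (use assms rate_nonneg in auto)
  then show ?thesis using accumulated_diff[OF assms] by simp
qed

lemma accumulated_continuous: "continuous_on {0..T} accumulated"
  unfolding accumulated_def[abs_def] by (rule indefinite_integral_continuous_1[OF rate_integrable_on])

lemma lower_bounds: "0 \<le> lower t" "lower t \<le> c" "t \<in> {0..T} \<Longrightarrow> lower t > 0" "lower T = c"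
  using c T accumulated_mono[of t T] by (auto simp: lower_def)

lemma lower_continuous: "continuous_on {0..T} lower"
proof -
  have "continuous_on {0..T} (\<lambda>t. c * exp (accumulated t - accumulated T))"
    by (intro continuous_intros accumulated_continuous)
  then show ?thesis by (rule continuous_on_cong[THEN iffD1, OF refl _, rotated]) (simp add: lower_def)
qed

lemma lower_borel [measurable]: "lower \<in> borel_measurable borel"
proof -
  have "(\<lambda>t. indicator {0..T} t *\<^sub>R lower t) \<in> borel_measurable borel"
    by (rule borel_measurable_continuous_on_indicator[OF _ lower_continuous]) simp
  moreover have "(\<lambda>t. indicator {0..T} t *\<^sub>R lower t) = lower" by (auto simp: lower_def fun_eq_iff)
  ultimately show ?thesis by simp
qed

lemma rate_borel [measurable]: "rate \<in> borel_measurable borel"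
  unfolding rate_def using borel_measurable_integrable[OF L(1)] by measurable

lemma rate_lower_absolutely_integrable: "(\<lambda>\<tau>. rate \<tau> * lower \<tau>) absolutely_integrable_on {0..T}"
  using absolutely_integrable_continuous_mult[OF lower_continuous rate_absolutely_integrable]
  by (simp add: mult.commute)

text \<open>The rate is merely integrable, so the exponential is differentiated through the chain
  inequality: its tangent lines lie below it, and F serves as its own derivative. The direction of
  the inequality is the one \<open>convex_chain_inequality\<close> requires of the increments of
  \<open>lower\<close> minus the mollified density.\<close>

lemma lower_increment:
  assumes st: "0 \<le> s" "s \<le> t" "t \<le> T"
  shows "integral {s..t} (\<lambda>\<tau>. rate \<tau> * lower \<tau>) \<le> lower t - lower s"
proof -
  define F where "F x = c * exp (x - accumulated T)" for x
  have "integral {s..t} (\<lambda>\<tau>. F (accumulated \<tau>) * rate \<tau>) \<le> F (accumulated t) - F (accumulated s)"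
  proof (rule convex_chain_inequality[where w=accumulated and g=rate and F=F and F'=F and a=s and b=t])
    show "s \<le> t" by (rule st(2))
    show "continuous_on {s..t} accumulated" by (rule continuous_on_subset[OF accumulated_continuous]) (use st in auto)
    show "rate absolutely_integrable_on {s..t}"
      by (rule set_integrable_subset[OF rate_absolutely_integrable]) (use st in auto)
    show "integral {s'..t'} rate \<le> accumulated t' - accumulated s'" if "s \<le> s'" "s' \<le> t'" "t' \<le> t" for s' t'
      using accumulated_diff[of s' t'] that st by simp
    show "F x * (y - x) \<le> F y - F x" for x y
    proof -
      have "F x * (1 + (y - x)) \<le> F x * exp (y - x)"
        unfolding F_def using c by (intro mult_left_mono exp_ge_add_one_self) simp
      also have "F x * exp (y - x) = F y" by (simp add: F_def flip: exp_add)
      finally show ?thesis by (simp add: algebra_simps)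
    qed
    show "continuous_on UNIV F" unfolding F_def by (intro continuous_intros)
    show "F x \<ge> 0" for x unfolding F_def using c by simp
  qed
  moreover have "integral {s..t} (\<lambda>\<tau>. F (accumulated \<tau>) * rate \<tau>) = integral {s..t} (\<lambda>\<tau>. rate \<tau> * lower \<tau>)"
    by (rule integral_cong) (use st in \<open>auto simp: F_def lower_def\<close>)
  ultimately show ?thesis using st by (simp add: F_def lower_def)
qed

lemma good_conv: "is_good \<tau> v \<Longrightarrow> conv e (r' \<tau>) x = conv e (r \<tau>) x"
  by (rule conv_cong_AE) (auto simp: is_good_def intro: r_borel)

lemma good_field_borel: "is_good \<tau> v \<Longrightarrow> extend_by_zero \<Omega> v \<in> borel_measurable borel"
  by (rule borel_measurable_extend_by_zero[OF open_domain])
    (auto simp: is_good_def tangential_Lipschitz_field_def intro: continuous_on_subset[OF _ closure_subset])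

lemma good_flux: "is_good \<tau> v \<Longrightarrow> flux e (r' \<tau>) (V' \<tau>) x = flux e (r \<tau>) (extend_by_zero \<Omega> v) x"
  by (rule flux_cong_AE) (auto simp: is_good_def intro: r_borel good_field_borel)

lemma outside_zero:
  assumes "\<tau> \<notin> {0<..<T}" shows "conv e (r' \<tau>) x = 0" "flux e (r' \<tau>) (V' \<tau>) x = 0"
proof -
  have "r' \<tau> y = 0" for y using assms by (intro rho_zero) simp
  then show "conv e (r' \<tau>) x = 0" "flux e (r' \<tau>) (V' \<tau>) x = 0" by (simp_all add: conv_def flux_def)
qed

text \<open>The bound is uniform in x, so one null set of times serves all points; D L is the
  majorant behind the integrability of the flux in time and the exchange of space and time
  integrals.\<close>

lemma flux_bound:
  assumes e: "e > 0"
  obtains D where "D \<ge> 0" "AE \<tau> in lborel. \<forall>x. \<bar>flux e (r' \<tau>) (V' \<tau>) x\<bar> \<le> D * L \<tau>"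
proof -
  obtain B where B: "B > 0" "\<And>x::real^3. norm (mgrad e x) \<le> B" using mgrad_bounded[OF e] by blast
  define D where "D = M * B * measure lborel \<Omega>"
  have "D \<ge> 0" unfolding D_def using M B by simp
  moreover have "AE \<tau> in lborel. \<forall>x. \<bar>flux e (r' \<tau>) (V' \<tau>) x\<bar> \<le> D * L \<tau>"
    using AE_good
  proof eventually_elim
    case (elim \<tau>)
    show ?case
    proof
      fix x
      show "\<bar>flux e (r' \<tau>) (V' \<tau>) x\<bar> \<le> D * L \<tau>"
      proof (cases "\<tau> \<in> {0<..<T}")
        case False
        then show ?thesis using outside_zero(2)[OF False] L(2)[of \<tau>] \<open>D \<ge> 0\<close> by simp
      next
        case True
        with elim obtain v where v: "is_good \<tau> v" by blast
        have t: "\<tau> \<in> {0..T}" using True by simp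
        note [measurable] = r_borel[OF t] good_field_borel[OF v]
        have vb: "norm (extend_by_zero \<Omega> v y) \<le> L \<tau>" for y
          using v L(2)[of \<tau>] by (auto simp: is_good_def tangential_Lipschitz_field_def extend_by_zero_def)
        have b: "norm (r \<tau> y * (extend_by_zero \<Omega> v y \<bullet> mgrad e (x - y))) \<le> (M * (L \<tau> * B)) * indicator \<Omega> y" for y
        proof (cases "y \<in> \<Omega>")
          case True
          have "\<bar>extend_by_zero \<Omega> v y \<bullet> mgrad e (x - y)\<bar> \<le> norm (extend_by_zero \<Omega> v y) * norm (mgrad e (x - y))"
            by (rule Cauchy_Schwarz_ineq2)
          also have "\<dots> \<le> L \<tau> * B" by (intro mult_mono vb B(2) L(2) norm_ge_zero)
          finally have "\<bar>r \<tau> y\<bar> * \<bar>extend_by_zero \<Omega> v y \<bullet> mgrad e (x - y)\<bar> \<le> M * (L \<tau> * B)"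
            using r_bounds[OF t, of y] M by (intro mult_mono) auto
          with True show ?thesis by (simp add: abs_mult)
        qed (simp add: extend_by_zero_def)
        have i: "integrable lborel (\<lambda>y. (M * (L \<tau> * B)) * indicator \<Omega> y)"
          using emeasure_bounded_finite[OF bounded_domain] domain_borel by simp
        have "norm (flux e (r \<tau>) (extend_by_zero \<Omega> v) x) \<le> (LINT y|lborel. (M * (L \<tau> * B)) * indicator \<Omega> y)"
          unfolding flux_def by (rule integrable_dominated(2)[OF i _ b]) measurable
        also have "\<dots> = D * L \<tau>" using domain_borel by (simp add: D_def)
        finally show ?thesis unfolding good_flux[OF v] by simp
      qed
    qed
  qed
  ultimately show ?thesis by (rule that)
qed

lemma flux_measurable [measurable]: "(\<lambda>p. flux e (r' (fst p)) (V' (fst p)) (snd p)) \<in> borel_measurable (borel \<Otimes>\<^sub>M borel)"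
  unfolding flux_def using rho_borel u_borel by measurable

lemma conv_measurable [measurable]: "(\<lambda>p. conv e (r' (fst p)) (snd p)) \<in> borel_measurable (borel \<Otimes>\<^sub>M borel)"
  unfolding conv_def using rho_borel by measurable

lemma flux_time_integrable:
  assumes e: "e > 0" shows "integrable lborel (\<lambda>\<tau>. flux e (r' \<tau>) (V' \<tau>) x)"
proof -
  obtain D where D: "D \<ge> 0" "AE \<tau> in lborel. \<forall>x. \<bar>flux e (r' \<tau>) (V' \<tau>) x\<bar> \<le> D * L \<tau>"
    using flux_bound[OF e] by blast
  show ?thesis
  proof (rule Bochner_Integration.integrable_bound[where f="\<lambda>\<tau>. D * L \<tau>"])
    show "(\<lambda>\<tau>. flux e (r' \<tau>) (V' \<tau>) x) \<in> borel_measurable lborel"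
      unfolding flux_def using rho_borel u_borel by measurable
    show "AE \<tau> in lborel. norm (flux e (r' \<tau>) (V' \<tau>) x) \<le> norm (D * L \<tau>)"
      using D(2) by eventually_elim (use D(1) L(2) in simp)
  qed (use L(1) in simp)
qed

text \<open>Formally the time derivative of the squared positive part of \<open>lower\<close> minus
  the mollified density at x; its integral in x against \<kappa> is \<open>defect\<close>.\<close>

definition work :: "real \<Rightarrow> real \<Rightarrow> real^3 \<Rightarrow> real" where
  "work e \<tau> x = 2 * max 0 (lower \<tau> - conv e (r' \<tau>) x) * (rate \<tau> * lower \<tau> + flux e (r' \<tau>) (V' \<tau>) x)"

text \<open>The chain inequality with the squared positive part is applied on [0,T]. At T the
  mollified density averages values that are at least c = lower T, so the positive part vanishes
  there and only the contribution of time 0 remains.\<close>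

lemma pointwise_comparison:
  assumes e: "e > 0" and x: "cball x e \<subseteq> \<Omega>"
  shows "(max 0 (lower 0 - conv e (r 0) x))\<^sup>2 \<le> - (LINT \<tau>|lborel. work e \<tau> x)"
proof -
  define w where "w t = lower t - conv e (r t) x" for t
  define F where "F \<tau> = flux e (r' \<tau>) (V' \<tau>) x" for \<tau>
  define g where "g \<tau> = rate \<tau> * lower \<tau> + F \<tau>" for \<tau>
  have Fi: "integrable lborel F" unfolding F_def by (rule flux_time_integrable[OF e])
  have Fai: "F absolutely_integrable_on {0..T}"
    unfolding set_integrable_def using integrable_lebesgue_of_lborel[OF Fi] by (intro integrable_mult_indicator) auto
  have gai: "g absolutely_integrable_on {0..T}"
    unfolding g_def by (rule set_integral_add(1)[OF rate_lower_absolutely_integrable Fai])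
  have wc: "continuous_on {0..T} w" unfolding w_def by (intro continuous_on_diff lower_continuous time_cont e)
  have "integral {0..T} (\<lambda>\<tau>. 2 * max 0 (w \<tau>) * g \<tau>) \<le> (max 0 (w T))\<^sup>2 - (max 0 (w 0))\<^sup>2"
  proof (rule convex_chain_inequality[where w=w and g=g and F="\<lambda>s. (max 0 s)\<^sup>2" and F'="\<lambda>s. 2 * max 0 s" and a=0 and b=T, OF _ wc gai])
    show "0 \<le> T" using T by simp
    fix s t assume st: "0 \<le> s" "s \<le> t" "t \<le> T"
    have i1: "(\<lambda>\<tau>. rate \<tau> * lower \<tau>) integrable_on {s..t}"
      by (rule integrable_on_subinterval[of _ "{0..T}"]) (use rate_lower_absolutely_integrable st in \<open>auto simp: absolutely_integrable_on_def\<close>)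
    have i2: "F integrable_on {s..t}"
      by (rule integrable_on_subinterval[of _ "{0..T}"]) (use Fai st in \<open>auto simp: absolutely_integrable_on_def\<close>)
    have "integral {s..t} g = integral {s..t} (\<lambda>\<tau>. rate \<tau> * lower \<tau>) + integral {s..t} F"
      unfolding g_def by (rule Henstock_Kurzweil_Integration.integral_add[OF i1 i2])
    moreover have "conv e (r t) x - conv e (r s) x = - integral {s..t} F"
      using evolution[OF e x flux_time_integrable[OF e] st] by (simp add: F_def[abs_def])
    ultimately show "integral {s..t} g \<le> w t - w s"
      using lower_increment[OF st] unfolding w_def by linarith
  next
    show "2 * max 0 x * (y - x) \<le> (max 0 y)\<^sup>2 - (max 0 x)\<^sup>2" for x y :: real by (rule max_0_power2_convex)
    show "continuous_on UNIV (\<lambda>x::real. 2 * max 0 x)" by (intro continuous_intros)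
  qed simp
  moreover have "w T \<le> 0"
  proof -
    have "c \<le> conv e (r T) x"
    proof (rule conv_ge[OF e r_integrable])
      show "c \<le> r T y" if "y \<in> cball x e" for y using that x final[of y] by (auto simp: extend_by_zero_def at_time_def)
    qed (use T in simp)
    then show ?thesis using lower_bounds(4) by (simp add: w_def)
  qed
  moreover have "(LINT \<tau>|lborel. work e \<tau> x) = integral {0..T} (\<lambda>\<tau>. 2 * max 0 (w \<tau>) * g \<tau>)"
  proof -
    have km: "(\<lambda>\<tau>. work e \<tau> x) \<in> borel_measurable lborel"
      unfolding work_def conv_def flux_def using rho_borel u_borel by measurable
    have ai: "(\<lambda>\<tau>. 2 * max 0 (w \<tau>) * g \<tau>) absolutely_integrable_on {0..T}"
      by (rule absolutely_integrable_continuous_mult[OF _ gai]) (intro continuous_intros wc)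
    have "(LINT \<tau>|lborel. work e \<tau> x) = (LINT \<tau>|lebesgue. work e \<tau> x)" by (rule integral_completion[OF km, symmetric])
    also have "\<dots> = (LINT \<tau>|lebesgue. indicator {0..T} \<tau> *\<^sub>R (2 * max 0 (w \<tau>) * g \<tau>))"
    proof (rule integral_cong_AE[OF measurable_completion[OF km]])
      show "(\<lambda>\<tau>. indicator {0..T} \<tau> *\<^sub>R (2 * max 0 (w \<tau>) * g \<tau>)) \<in> borel_measurable lebesgue"
        using ai unfolding set_integrable_def by (rule borel_measurable_integrable)
      have "AE \<tau> in lborel. \<tau> \<noteq> 0" "AE \<tau> in lborel. \<tau> \<noteq> T" by (rule AE_lborel_singleton)+
      with AE_good have "AE \<tau> in lborel. work e \<tau> x = indicator {0..T} \<tau> *\<^sub>R (2 * max 0 (w \<tau>) * g \<tau>)"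
      proof eventually_elim
        case (elim \<tau>)
        show ?case
        proof (cases "\<tau> \<in> {0<..<T}")
          case True
          with elim obtain v where v: "is_good \<tau> v" by blast
          show ?thesis using True good_conv[OF v] by (simp add: work_def w_def g_def F_def)
        next
          case False
          then have "\<tau> \<notin> {0..T}" using elim by auto
          then have "lower \<tau> = 0" "indicator {0..T} \<tau> = (0::real)" unfolding lower_def by (simp_all del: atLeastAtMost_iff)
          then show ?thesis using outside_zero[OF False] by (simp add: work_def)
        qed
      qed
      then show "AE \<tau> in lebesgue. work e \<tau> x = indicator {0..T} \<tau> *\<^sub>R (2 * max 0 (w \<tau>) * g \<tau>)" by (rule AE_completion)
    qed
    also have "\<dots> = integral {0..T} (\<lambda>\<tau>. 2 * max 0 (w \<tau>) * g \<tau>)"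
      using set_lebesgue_integral_eq_integral(2)[OF ai] by (simp add: set_lebesgue_integral_def)
    finally show ?thesis .
  qed
  ultimately show ?thesis by (simp add: w_def max_absorb1)
qed

end

section \<open>Integration in space and removal of mollifier and cutoff\<close>

context transported_density
begin

lemma integrable_indicator_domain: "integrable lborel (\<lambda>x. a * indicator \<Omega> x :: real)"
  using emeasure_bounded_finite[OF bounded_domain] domain_borel by simp

text \<open>The pointwise inequality is weighted by \<kappa> and integrated in x; Fubini's theorem
  exchanges time and space so that the estimate at a fixed time becomes applicable. The weight lives
  on K because the comparison at x needs the ball of radius e around x inside \<Omega>.\<close>

lemma work_time_integrated:
  fixes \<kappa> :: "real^3 \<Rightarrow> real"
  assumes e: "e > 0" and K: "K \<subseteq> \<Omega>" "\<And>x. x \<in> K \<Longrightarrow> cball x e \<subseteq> \<Omega>"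
    and \<kappa>[measurable]: "\<kappa> \<in> borel_measurable borel"
    and \<kappa>01: "\<And>x. 0 \<le> \<kappa> x" "\<And>x. \<kappa> x \<le> 1" "\<And>x. x \<notin> K \<Longrightarrow> \<kappa> x = 0"
  shows "integrable lborel (\<lambda>\<tau>. defect e (r' \<tau>) (V' \<tau>) \<kappa> (lower \<tau>) (rate \<tau>))"
    and "(LINT x|lborel. \<kappa> x * (max 0 (lower 0 - conv e (r 0) x))\<^sup>2)
           \<le> - (LINT \<tau>|lborel. defect e (r' \<tau>) (V' \<tau>) \<kappa> (lower \<tau>) (rate \<tau>))"
proof -
  obtain D where D: "D \<ge> 0" "AE \<tau> in lborel. \<forall>x. \<bar>flux e (r' \<tau>) (V' \<tau>) x\<bar> \<le> D * L \<tau>"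
    using flux_bound[OF e] by blast
  define f where "f \<tau> x = \<kappa> x * work e \<tau> x" for \<tau> x
  \<comment> \<open>The positive part is at most c, \<open>rate\<close> times \<open>lower\<close>
    at most (C1 + 3) L c, and the flux at most D L; the factor 2 is that of
    \<open>work\<close>.\<close>
  define E where "E = 2 * c * ((C1 + real DIM(real^3)) * c + D)"
  have E: "E \<ge> 0" unfolding E_def using c C1(1) D(1) by (intro mult_nonneg_nonneg add_nonneg_nonneg) auto
  have fm[measurable]: "case_prod f \<in> borel_measurable (borel \<Otimes>\<^sub>M borel)"
    unfolding f_def work_def case_prod_beta' by measurable
  have fm1: "f \<tau> \<in> borel_measurable borel" for \<tau>
    unfolding f_def work_def conv_def flux_def using rho_borel u_borel by measurable
  have zero: "f \<tau> x = 0" if "x \<notin> \<Omega>" for \<tau> x using \<kappa>01(3)[of x] K(1) that by (auto simp: f_def)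
  have bound: "AE \<tau> in lborel. \<forall>x. norm (f \<tau> x) \<le> (E * L \<tau>) * indicator \<Omega> x"
    using D(2) AE_good AE_lborel_singleton[of 0] AE_lborel_singleton[of T]
  proof eventually_elim
    case (elim \<tau>)
    show ?case
    proof
      fix x
      have "conv e (r' \<tau>) x \<ge> 0"
      proof (cases "\<tau> \<in> {0<..<T}")
        case True
        then obtain v where v: "is_good \<tau> v" using elim(2) by blast
        show ?thesis using conv_r_bounds(1)[OF e, of \<tau> x] True by (simp add: good_conv[OF v])
      qed (simp add: outside_zero)
      then have "\<bar>max 0 (lower \<tau> - conv e (r' \<tau>) x)\<bar> \<le> c" using lower_bounds(1,2)[of \<tau>] by auto
      moreover have "\<bar>rate \<tau> * lower \<tau> + flux e (r' \<tau>) (V' \<tau>) x\<bar> \<le> rate \<tau> * c + D * L \<tau>"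
      proof -
        have "\<bar>rate \<tau> * lower \<tau>\<bar> \<le> rate \<tau> * c"
          using mult_left_mono[OF lower_bounds(2)[of \<tau>] rate_nonneg[of \<tau>]] lower_bounds(1)[of \<tau>] rate_nonneg[of \<tau>] by simp
        then show ?thesis
          using elim(1)[rule_format, of x] abs_triangle_ineq[of "rate \<tau> * lower \<tau>" "flux e (r' \<tau>) (V' \<tau>) x"] by linarith
      qed
      ultimately have "\<bar>max 0 (lower \<tau> - conv e (r' \<tau>) x)\<bar> * \<bar>rate \<tau> * lower \<tau> + flux e (r' \<tau>) (V' \<tau>) x\<bar> \<le> c * (rate \<tau> * c + D * L \<tau>)"
        using c by (intro mult_mono) auto
      then have w: "\<bar>work e \<tau> x\<bar> \<le> E * L \<tau>"
        unfolding work_def abs_mult E_def rate_def by (simp add: algebra_simps)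
      have "\<bar>\<kappa> x\<bar> * \<bar>work e \<tau> x\<bar> \<le> 1 * (E * L \<tau>)"
        using \<kappa>01(1,2)[of x] w by (intro mult_mono) auto
      then show "norm (f \<tau> x) \<le> (E * L \<tau>) * indicator \<Omega> x"
        using zero[of x \<tau>] by (cases "x \<in> \<Omega>") (simp add: f_def abs_mult, simp)
    qed
  qed
  have fi: "integrable (lborel \<Otimes>\<^sub>M lborel) (case_prod f)"
  proof (rule lborel_pair.Fubini_integrable)
    show "case_prod f \<in> borel_measurable (lborel \<Otimes>\<^sub>M lborel)" using fm by (simp cong: measurable_cong_sets)
    show "AE \<tau> in lborel. integrable lborel (\<lambda>x. case_prod f (\<tau>, x))"
      using bound
    proof eventually_elim
      case (elim \<tau>)
      show ?case
        unfolding prod.case by (rule integrable_dominated(1)[OF integrable_indicator_domain fm1]) (use elim in blast)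
    qed
    show "integrable lborel (\<lambda>\<tau>. LINT x|lborel. norm (case_prod f (\<tau>, x)))"
    proof (rule Bochner_Integration.integrable_bound[where f="\<lambda>\<tau>. (E * measure lborel \<Omega>) * L \<tau>"])
      show "(\<lambda>\<tau>. LINT x|lborel. norm (case_prod f (\<tau>, x))) \<in> borel_measurable lborel" by measurable
      show "AE \<tau> in lborel. norm (LINT x|lborel. norm (case_prod f (\<tau>, x))) \<le> norm ((E * measure lborel \<Omega>) * L \<tau>)"
        using bound
      proof eventually_elim
        case (elim \<tau>)
        have "norm (LINT x|lborel. norm (f \<tau> x)) \<le> (LINT x|lborel. (E * L \<tau>) * indicator \<Omega> x)"
          by (rule integrable_dominated(2)[OF integrable_indicator_domain]) (use elim fm1 in auto)
        also have "\<dots> = (E * measure lborel \<Omega>) * L \<tau>" using domain_borel by simp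
        finally show ?case by simp
      qed
    qed (use L(1) in simp)
  qed
  have df: "(LINT x|lborel. f \<tau> x) = defect e (r' \<tau>) (V' \<tau>) \<kappa> (lower \<tau>) (rate \<tau>)" for \<tau>
    by (simp add: defect_def work_def f_def)
  show "integrable lborel (\<lambda>\<tau>. defect e (r' \<tau>) (V' \<tau>) \<kappa> (lower \<tau>) (rate \<tau>))"
    using lborel_pair.integrable_fst[OF fi] by (simp add: df)
  have 0: "0 \<in> {0..T}" using T by simp
  have [measurable]: "r 0 \<in> borel_measurable borel" by (rule r_borel[OF 0])
  have "(LINT x|lborel. \<kappa> x * (max 0 (lower 0 - conv e (r 0) x))\<^sup>2) \<le> (LINT x|lborel. - (LINT \<tau>|lborel. f \<tau> x))"
  proof (rule integral_mono)
    show "integrable lborel (\<lambda>x. - (LINT \<tau>|lborel. f \<tau> x))" using lborel_pair.integrable_snd[OF fi] by simp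
    show "integrable lborel (\<lambda>x. \<kappa> x * (max 0 (lower 0 - conv e (r 0) x))\<^sup>2)"
    proof (rule integrable_bounded_compact_support[OF _ bounded_domain domain_borel])
      show "(\<lambda>x. \<kappa> x * (max 0 (lower 0 - conv e (r 0) x))\<^sup>2) \<in> borel_measurable borel"
        unfolding conv_def by measurable
      show "norm (\<kappa> x * (max 0 (lower 0 - conv e (r 0) x))\<^sup>2) \<le> 1 * c\<^sup>2" for x
        unfolding real_norm_def abs_mult
        using \<kappa>01(1,2)[of x] conv_r_bounds(1)[OF e 0, of x] lower_bounds(1,2)[of 0]
        by (intro mult_mono) (auto intro!: power_mono)
    qed (use \<kappa>01(3) K(1) in auto)
    fix x
    show "\<kappa> x * (max 0 (lower 0 - conv e (r 0) x))\<^sup>2 \<le> - (LINT \<tau>|lborel. f \<tau> x)"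
    proof (cases "x \<in> K")
      case True
      have "\<kappa> x * (max 0 (lower 0 - conv e (r 0) x))\<^sup>2 \<le> \<kappa> x * - (LINT \<tau>|lborel. work e \<tau> x)"
        by (intro mult_left_mono pointwise_comparison[OF e K(2)[OF True]] \<kappa>01(1))
      then show ?thesis by (simp add: f_def)
    qed (simp add: f_def \<kappa>01(3))
  qed
  also have "\<dots> = - (LINT \<tau>|lborel. LINT x|lborel. f \<tau> x)"
    using lborel_pair.Fubini_integral[OF fi] by simp
  finally show "(LINT x|lborel. \<kappa> x * (max 0 (lower 0 - conv e (r 0) x))\<^sup>2)
           \<le> - (LINT \<tau>|lborel. defect e (r' \<tau>) (V' \<tau>) \<kappa> (lower \<tau>) (rate \<tau>))" by (simp add: df)
qed

lemma defect_outside: assumes "\<tau> \<notin> {0..T}" shows "defect e (r' \<tau>) (V' \<tau>) \<kappa> (lower \<tau>) (rate \<tau>) = 0"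
proof -
  have "lower \<tau> = 0" using assms unfolding lower_def by (simp del: atLeastAtMost_iff)
  moreover have "\<tau> \<notin> {0<..<T}" using assms by auto
  ultimately show ?thesis using outside_zero by (simp add: defect_def)
qed

text \<open>Transfers the slice estimate from the continuous density and the field v to the Borel
  slices, and replaces \<open>lower \<tau>\<close> by its upper bound c, so that the time dependence
  left is that of L and of the boundary term.\<close>

lemma good_slice_estimate:
  assumes v: "is_good \<tau> v"
    and \<kappa>: "\<And>x. 0 \<le> \<kappa> x" "\<And>x. \<kappa> x \<le> 1" "\<And>x. (\<kappa> has_derivative (\<lambda>h. g x \<bullet> h)) (at x)" "continuous_on UNIV g"
    and K: "compact K" "K \<subseteq> \<Omega>" "\<And>x. x \<notin> K \<Longrightarrow> \<kappa> x = 0 \<and> g x = 0"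
    and e: "e > 0" "\<And>x. x \<in> K \<Longrightarrow> cball x e \<subseteq> \<Omega>"
    and osc: "\<And>x y. x \<in> K \<Longrightarrow> y \<in> cball x e \<Longrightarrow> \<bar>\<rho> (y, \<tau>) - conv e (r \<tau>) x\<bar> \<le> \<omega>" "\<omega> \<ge> 0"
  shows "- defect e (r' \<tau>) (V' \<tau>) \<kappa> (lower \<tau>) (rate \<tau>) - c\<^sup>2 * (LINT x|lborel. \<bar>V' \<tau> x \<bullet> g x\<bar>)
    \<le> 2 * c * (C1 * L \<tau> * \<omega>) * measure lborel K"
proof -
  have t: "\<tau> \<in> {0..T}" using v by (auto simp: is_good_def)
  let ?m = "lower \<tau>"
  let ?I = "LINT x|lborel. \<bar>V' \<tau> x \<bullet> g x\<bar>"
  note [measurable] = good_field_borel[OF v] borel_measurable_continuous_onI[OF \<kappa>(4)]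
  have tl: "tangential_Lipschitz_field \<Omega> (L \<tau>) v" using v by (simp add: is_good_def)
  have I: "(LINT x|lborel. \<bar>extend_by_zero \<Omega> v x \<bullet> g x\<bar>) = ?I"
  proof (rule integral_cong_AE)
    have "AE y in lborel. V' \<tau> y = extend_by_zero \<Omega> v y" using v by (simp add: is_good_def)
    then show "AE x in lborel. \<bar>extend_by_zero \<Omega> v x \<bullet> g x\<bar> = \<bar>V' \<tau> x \<bullet> g x\<bar>" by eventually_elim simp
  qed measurable
  have "defect e (r' \<tau>) (V' \<tau>) \<kappa> ?m (rate \<tau>) = defect e (r \<tau>) (extend_by_zero \<Omega> v) \<kappa> ?m ((C1 + DIM(real^3)) * L \<tau>)"
    unfolding defect_def good_conv[OF v] good_flux[OF v] rate_def ..
  moreover have "- defect e (r \<tau>) (extend_by_zero \<Omega> v) \<kappa> ?m ((C1 + DIM(real^3)) * L \<tau>)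
      \<le> 2 * ?m * (C1 * L \<tau> * \<omega>) * measure lborel K + ?m\<^sup>2 * (LINT x|lborel. \<bar>extend_by_zero \<Omega> v x \<bullet> g x\<bar>)"
  proof (rule slice_estimate[OF open_domain bounded_domain cont[OF t] _ _ M _ _ _ L(2) \<kappa> K e C1(2)[OF e(1)] C1(3)[OF e(1)] lower_bounds(1) _ osc(2)])
    show "continuous_on \<Omega> v" using tl by (auto simp: tangential_Lipschitz_field_def intro: continuous_on_subset[OF _ closure_subset])
  qed (use tl nonneg[OF t] le_M[OF t] osc(1) in \<open>auto simp: tangential_Lipschitz_field_def at_time_def\<close>)
  moreover have "2 * ?m * (C1 * L \<tau> * \<omega>) * measure lborel K \<le> 2 * c * (C1 * L \<tau> * \<omega>) * measure lborel K"
    using lower_bounds(2)[of \<tau>] C1(1) L(2)[of \<tau>] osc(2) by (intro mult_right_mono) auto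
  moreover have "?m\<^sup>2 * ?I \<le> c\<^sup>2 * ?I"
    by (intro mult_right_mono power_mono lower_bounds Bochner_Integration.integral_nonneg) simp
  ultimately show ?thesis unfolding I by linarith
qed

lemma tendsto_inverse_Suc: "(\<lambda>k. e1 / real (Suc k)) \<longlonglongrightarrow> 0"
  using tendsto_mult[OF tendsto_const[of e1] LIMSEQ_inverse_real_of_nat] by (simp add: divide_inverse)

text \<open>The cutoff is fixed while the radius tends to zero. What the negative defect exceeds the
  boundary term by is bounded by a multiple of the oscillation of the density around its
  mollification; this oscillation is at most M throughout and tends to zero at each good time, so
  dominated convergence in time applies.\<close>

lemma cutoff_inequality:
  assumes \<kappa>: "\<And>x. 0 \<le> \<kappa> x" "\<And>x. \<kappa> x \<le> 1" "\<And>x. (\<kappa> has_derivative (\<lambda>h. g x \<bullet> h)) (at x)" "continuous_on UNIV g"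
    and K: "compact K" "K \<subseteq> \<Omega>" "\<And>x. x \<notin> K \<Longrightarrow> \<kappa> x = 0 \<and> g x = 0"
    and I: "integrable lborel (\<lambda>\<tau>. LINT x|lborel. \<bar>V' \<tau> x \<bullet> g x\<bar>)"
  shows "(LINT x|lborel. \<kappa> x * (max 0 (lower 0 - r 0 x))\<^sup>2) \<le> c\<^sup>2 * (LINT \<tau>|lborel. LINT x|lborel. \<bar>V' \<tau> x \<bullet> g x\<bar>)"
proof -
  obtain e1 where e1: "e1 > 0" "(\<Union>x\<in>K. cball x e1) \<subseteq> \<Omega>"
    using compact_subset_open_imp_cball_epsilon_subset[OF K(1) open_domain K(2)] by blast
  define e where "e k = e1 / real (Suc k)" for k
  have e: "e k > 0" for k using e1(1) by (simp add: e_def)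
  have eK: "cball x (e k) \<subseteq> \<Omega>" if "x \<in> K" for k x
  proof -
    have "e k \<le> e1" using e1(1) by (simp add: e_def divide_le_eq)
    then have "cball x (e k) \<subseteq> cball x e1" by (rule subset_cball)
    then show ?thesis using e1(2) that by blast
  qed
  have etends: "e \<longlonglongrightarrow> 0" unfolding e_def by (rule tendsto_inverse_Suc)
  have small: "eventually (\<lambda>k. e k \<le> d) sequentially" if "d > 0" for d
    using order_tendstoD(2)[OF etends that] by eventually_elim simp
  have [measurable]: "\<kappa> \<in> borel_measurable borel"
    by (intro borel_measurable_continuous_onI continuous_at_imp_continuous_on ballI has_derivative_continuous[OF \<kappa>(3)])
  define I where "I \<tau> = (LINT x|lborel. \<bar>V' \<tau> x \<bullet> g x\<bar>)" for \<tau>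
  define J where "J k \<tau> = defect (e k) (r' \<tau>) (V' \<tau>) \<kappa> (lower \<tau>) (rate \<tau>)" for k \<tau>
  \<comment> \<open>The defect has no definite sign; the positive part of the excess is squeezed
    between 0 and a multiple of the oscillation, so its integrals converge to 0.\<close>
  define N where "N k \<tau> = max 0 (- J k \<tau> - c\<^sup>2 * I \<tau>)" for k \<tau>
  have Ii: "integrable lborel I" using I by (simp add: I_def[abs_def])
  have Inn: "I \<tau> \<ge> 0" for \<tau> unfolding I_def by (intro Bochner_Integration.integral_nonneg) simp
  have \<kappa>0: "\<kappa> x = 0" if "x \<notin> K" for x using K(3)[OF that] by simp
  note w = work_time_integrated[OF e K(2) eK _ \<kappa>(1,2) \<kappa>0]
  have Ji: "integrable lborel (J k)" for k unfolding J_def[abs_def] by (rule w(1)) simp_all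
  have step: "(LINT x|lborel. \<kappa> x * (max 0 (lower 0 - conv (e k) (r 0) x))\<^sup>2) \<le> - (LINT \<tau>|lborel. J k \<tau>)" for k
    unfolding J_def by (rule w(2)) simp_all
  have Ni: "integrable lborel (N k)" for k unfolding N_def[abs_def] using Ji[of k] Ii by simp
  have est: "N k \<tau> \<le> 2 * c * (C1 * L \<tau> * \<omega>) * measure lborel K"
    if v: "is_good \<tau> v" and o: "\<And>x y. x \<in> K \<Longrightarrow> y \<in> cball x (e k) \<Longrightarrow> \<bar>\<rho> (y, \<tau>) - conv (e k) (r \<tau>) x\<bar> \<le> \<omega>" and o0: "\<omega> \<ge> 0"
    for k \<tau> v \<omega>
  proof -
    have "- J k \<tau> - c\<^sup>2 * I \<tau> \<le> 2 * c * (C1 * L \<tau> * \<omega>) * measure lborel K"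
      unfolding J_def I_def by (rule good_slice_estimate[OF v \<kappa> K e]) (use eK o o0 in auto)
    moreover have "0 \<le> 2 * c * (C1 * L \<tau> * \<omega>) * measure lborel K"
      using c C1(1) L(2)[of \<tau>] o0 by (intro mult_nonneg_nonneg) auto
    ultimately show ?thesis by (simp add: N_def)
  qed
  have Nout: "N k \<tau> = 0" if "\<tau> \<notin> {0..T}" for k \<tau>
    using defect_outside[OF that] Inn[of \<tau>] by (simp add: N_def J_def)
  have "(\<lambda>k. LINT \<tau>|lborel. N k \<tau>) \<longlonglongrightarrow> (LINT \<tau>|(lborel :: real measure). (0::real))"
  proof (rule integral_dominated_convergence[where w="\<lambda>\<tau>. 2 * c * (C1 * L \<tau> * M) * measure lborel K"])
    show "N k \<in> borel_measurable lborel" for k using Ni by (rule borel_measurable_integrable)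
    show "integrable lborel (\<lambda>\<tau>. 2 * c * (C1 * L \<tau> * M) * measure lborel K)" using L(1) by simp
    show "AE \<tau> in lborel. norm (N k \<tau>) \<le> 2 * c * (C1 * L \<tau> * M) * measure lborel K" for k
      using AE_good AE_lborel_singleton[of 0] AE_lborel_singleton[of T]
    proof eventually_elim
      case (elim \<tau>)
      show ?case
      proof (cases "\<tau> \<in> {0<..<T}")
        case True
        then obtain v where v: "is_good \<tau> v" using elim by blast
        have t: "\<tau> \<in> {0..T}" using True by simp
        \<comment> \<open>Density and mollification both lie in [0,M], so M bounds the oscillation
          for every radius; this yields the dominating function.\<close>
        have "N k \<tau> \<le> 2 * c * (C1 * L \<tau> * M) * measure lborel K"
        proof (rule est[OF v _ M])
          fix x y assume "x \<in> K" "y \<in> cball x (e k)"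
          then have y: "y \<in> \<Omega>" using eK by blast
          show "\<bar>\<rho> (y, \<tau>) - conv (e k) (r \<tau>) x\<bar> \<le> M"
            using nonneg[OF t y] le_M[OF t y] conv_r_bounds[OF e t, of k x] by linarith
        qed
        then show ?thesis by (simp add: N_def)
      next
        case False
        then have "\<tau> \<notin> {0..T}" using elim by auto
        then show ?thesis using Nout c C1(1) L(2)[of \<tau>] M by simp
      qed
    qed
    show "AE \<tau> in lborel. (\<lambda>k. N k \<tau>) \<longlonglongrightarrow> 0"
      using AE_good AE_lborel_singleton[of 0] AE_lborel_singleton[of T]
    proof eventually_elim
      case (elim \<tau>)
      show ?case
      proof (cases "\<tau> \<in> {0<..<T}")
        case True
        then obtain v where v: "is_good \<tau> v" using elim by blast
        have t: "\<tau> \<in> {0..T}" using True by simp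
        define A where "A = 2 * c * (C1 * L \<tau>) * measure lborel K"
        have A: "A \<ge> 0" unfolding A_def using c C1(1) L(2)[of \<tau>] by simp
        show ?thesis
        proof (rule tendstoI)
          fix \<epsilon> :: real assume \<epsilon>: "\<epsilon> > 0"
          \<comment> \<open>The summand 1 allows for A = 0 and makes A \<delta> < \<epsilon>
            strict.\<close>
          define \<delta> where "\<delta> = \<epsilon> / (A + 1)"
          have \<delta>: "\<delta> > 0" using \<epsilon> A by (simp add: \<delta>_def)
          have A\<delta>: "A * \<delta> < \<epsilon>" using \<epsilon> A by (simp add: \<delta>_def divide_less_eq algebra_simps)
          obtain e0 where e0: "e0 > 0" "\<And>d x y. 0 < d \<Longrightarrow> d \<le> e0 \<Longrightarrow> x \<in> K \<Longrightarrow> y \<in> cball x d \<Longrightarrow>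
              cball x d \<subseteq> \<Omega> \<and> \<bar>at_time \<rho> \<tau> y - conv d (r \<tau>) x\<bar> \<le> \<delta>"
            using conv_uniform_approx[OF open_domain cont[OF t] r_integrable[OF t] K(1,2) \<delta>] by blast
          show "\<forall>\<^sub>F k in sequentially. dist (N k \<tau>) 0 < \<epsilon>"
            using small[OF e0(1)]
          proof eventually_elim
            case (elim k)
            have "N k \<tau> \<le> 2 * c * (C1 * L \<tau> * \<delta>) * measure lborel K"
            proof (rule est[OF v])
              show "\<bar>\<rho> (y, \<tau>) - conv (e k) (r \<tau>) x\<bar> \<le> \<delta>" if "x \<in> K" "y \<in> cball x (e k)" for x y
                using e0(2)[OF e elim that] by (simp add: at_time_def)
            qed (use \<delta> in simp)
            also have "\<dots> = A * \<delta>" by (simp add: A_def)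
            finally show ?case using A\<delta> by (simp add: N_def)
          qed
        qed
      next
        case False
        then have "\<tau> \<notin> {0..T}" using elim by auto
        then show ?thesis using Nout by simp
      qed
    qed
  qed simp
  then have Nlim: "(\<lambda>k. LINT \<tau>|lborel. N k \<tau>) \<longlonglongrightarrow> 0" by simp
  have 0: "0 \<in> {0..T}" using T by simp
  have [measurable]: "r 0 \<in> borel_measurable borel" by (rule r_borel[OF 0])
  have "(\<lambda>k. LINT x|lborel. \<kappa> x * (max 0 (lower 0 - conv (e k) (r 0) x))\<^sup>2) \<longlonglongrightarrow> (LINT x|lborel. \<kappa> x * (max 0 (lower 0 - r 0 x))\<^sup>2)"
  proof (rule integral_dominated_convergence[where w="\<lambda>x. c\<^sup>2 * indicator \<Omega> x"])
    show "(\<lambda>x. \<kappa> x * (max 0 (lower 0 - r 0 x))\<^sup>2) \<in> borel_measurable lborel" by measurable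
    show "(\<lambda>x. \<kappa> x * (max 0 (lower 0 - conv (e k) (r 0) x))\<^sup>2) \<in> borel_measurable lborel" for k
      unfolding conv_def by measurable
    show "AE x in lborel. norm (\<kappa> x * (max 0 (lower 0 - conv (e k) (r 0) x))\<^sup>2) \<le> c\<^sup>2 * indicator \<Omega> x" for k
    proof (rule AE_I2)
      fix x
      have "\<bar>\<kappa> x\<bar> * \<bar>(max 0 (lower 0 - conv (e k) (r 0) x))\<^sup>2\<bar> \<le> 1 * c\<^sup>2"
        using \<kappa>(1,2)[of x] conv_r_bounds(1)[OF e 0, of k x] lower_bounds(1,2)[of 0]
        by (intro mult_mono) (auto intro!: power_mono)
      then show "norm (\<kappa> x * (max 0 (lower 0 - conv (e k) (r 0) x))\<^sup>2) \<le> c\<^sup>2 * indicator \<Omega> x"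
        using \<kappa>0[of x] K(2) by (cases "x \<in> K") (auto simp: abs_mult)
    qed
    show "AE x in lborel. (\<lambda>k. \<kappa> x * (max 0 (lower 0 - conv (e k) (r 0) x))\<^sup>2) \<longlonglongrightarrow> \<kappa> x * (max 0 (lower 0 - r 0 x))\<^sup>2"
    proof (rule AE_I2)
      fix x
      show "(\<lambda>k. \<kappa> x * (max 0 (lower 0 - conv (e k) (r 0) x))\<^sup>2) \<longlonglongrightarrow> \<kappa> x * (max 0 (lower 0 - r 0 x))\<^sup>2"
      proof (cases "x \<in> K")
        case True
        have "(\<lambda>k. conv (e k) (r 0) x) \<longlonglongrightarrow> r 0 x"
        proof (rule tendstoI)
          fix \<epsilon> :: real assume \<epsilon>: "\<epsilon> > 0"
          then have "\<epsilon> / 2 > 0" by simp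
          then obtain e0 where e0: "e0 > 0" "\<And>d x y. 0 < d \<Longrightarrow> d \<le> e0 \<Longrightarrow> x \<in> K \<Longrightarrow> y \<in> cball x d \<Longrightarrow>
              cball x d \<subseteq> \<Omega> \<and> \<bar>at_time \<rho> 0 y - conv d (r 0) x\<bar> \<le> \<epsilon> / 2"
            using conv_uniform_approx[OF open_domain cont[OF 0] r_integrable[OF 0] K(1,2)] by blast
          show "\<forall>\<^sub>F k in sequentially. dist (conv (e k) (r 0) x) (r 0 x) < \<epsilon>"
            using small[OF e0(1)]
          proof eventually_elim
            case (elim k)
            have "x \<in> cball x (e k)" using e[of k] by simp
            then have "\<bar>at_time \<rho> 0 x - conv (e k) (r 0) x\<bar> \<le> \<epsilon> / 2" using e0(2)[OF e elim True] by blast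
            moreover have "r 0 x = at_time \<rho> 0 x" using True K(2) by (auto simp: extend_by_zero_def)
            ultimately show ?case using \<epsilon> unfolding dist_real_def by linarith
          qed
        qed
        then show ?thesis by (intro tendsto_intros)
      qed (simp add: \<kappa>0)
    qed
  qed (rule integrable_indicator_domain)
  moreover have "(LINT x|lborel. \<kappa> x * (max 0 (lower 0 - conv (e k) (r 0) x))\<^sup>2) \<le> (LINT \<tau>|lborel. N k \<tau>) + c\<^sup>2 * (LINT \<tau>|lborel. I \<tau>)" for k
  proof -
    have "- (LINT \<tau>|lborel. J k \<tau>) = (LINT \<tau>|lborel. - J k \<tau>)" by simp
    also have "\<dots> \<le> (LINT \<tau>|lborel. N k \<tau> + c\<^sup>2 * I \<tau>)"
      by (rule integral_mono) (use Ji Ni Ii in \<open>auto simp: N_def\<close>)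
    also have "\<dots> = (LINT \<tau>|lborel. N k \<tau>) + c\<^sup>2 * (LINT \<tau>|lborel. I \<tau>)" using Ni Ii by simp
    finally show ?thesis using step[of k] by linarith
  qed
  moreover have "(\<lambda>k. (LINT \<tau>|lborel. N k \<tau>) + c\<^sup>2 * (LINT \<tau>|lborel. I \<tau>)) \<longlonglongrightarrow> 0 + c\<^sup>2 * (LINT \<tau>|lborel. I \<tau>)"
    by (intro tendsto_add Nlim tendsto_const)
  ultimately have "(LINT x|lborel. \<kappa> x * (max 0 (lower 0 - r 0 x))\<^sup>2) \<le> 0 + c\<^sup>2 * (LINT \<tau>|lborel. I \<tau>)"
    by (intro LIMSEQ_le) auto
  then show ?thesis by (simp add: I_def)
qed

text \<open>At each point of \<Omega> the gradient g n is eventually zero, and tangency gives |V . g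
  n| \<le> C L, so dominated convergence in x at each good time, and then in time, makes the
  boundary term vanish. The squared positive part of \<open>lower 0\<close> minus the initial
  density then has integral zero, and continuity of the density extends the inequality from almost
  every point to every point.\<close>

lemma initial_lower_bound:
  assumes x: "x \<in> \<Omega>" shows "lower 0 \<le> \<rho> (x, 0)"
proof -
  obtain \<kappa> g C where "cutoff_sequence \<Omega> \<kappa> g C" using cutoff_sequence_exists[OF \<Omega>] by blast
  then have C: "C \<ge> 0" and \<kappa>: "\<And>n x. 0 \<le> \<kappa> n x" "\<And>n x. \<kappa> n x \<le> 1" "\<And>n x. (\<kappa> n has_derivative (\<lambda>v. g n x \<bullet> v)) (at x)"
    and g: "\<And>n. continuous_on UNIV (g n)"
    and K: "\<And>n. \<exists>K. compact K \<and> K \<subseteq> \<Omega> \<and> (\<forall>x. x \<notin> K \<longrightarrow> \<kappa> n x = 0 \<and> g n x = 0)"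
    and tan: "\<And>n K v x. tangential_Lipschitz_field \<Omega> K v \<Longrightarrow> x \<in> \<Omega> \<Longrightarrow> \<bar>v x \<bullet> g n x\<bar> \<le> C * K"
    and ev: "\<And>x. x \<in> \<Omega> \<Longrightarrow> eventually (\<lambda>n. \<kappa> n x = 1 \<and> g n x = 0) sequentially"
    unfolding cutoff_sequence_def by blast+
  have [measurable]: "g n \<in> borel_measurable borel" "\<kappa> n \<in> borel_measurable borel" for n
    by (intro borel_measurable_continuous_onI g continuous_at_imp_continuous_on ballI has_derivative_continuous[OF \<kappa>(3)])+
  define I where "I n \<tau> = (LINT x|lborel. \<bar>V' \<tau> x \<bullet> g n x\<bar>)" for n \<tau>
  have out: "I n \<tau> = 0" if "\<tau> \<notin> {0<..<T}" for n \<tau>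
    using u_zero that by (simp add: I_def)
  have Im: "I n \<in> borel_measurable lborel" for n
    unfolding I_def using u_borel by measurable
  have slice: "AE x in lborel. \<bar>V' \<tau> x \<bullet> g n x\<bar> \<le> (C * L \<tau>) * indicator \<Omega> x" if v: "is_good \<tau> v" for n \<tau> v
  proof -
    have "AE y in lborel. V' \<tau> y = extend_by_zero \<Omega> v y" using v by (simp add: is_good_def)
    then show ?thesis
    proof eventually_elim
      case (elim y)
      then show ?case using tan[of "L \<tau>" v y n] v by (auto simp: is_good_def extend_by_zero_def)
    qed
  qed
  have Ib: "AE \<tau> in lborel. norm (I n \<tau>) \<le> (C * measure lborel \<Omega>) * L \<tau>" for n
    using AE_good
  proof eventually_elim
    case (elim \<tau>)
    show ?case
    proof (cases "\<tau> \<in> {0<..<T}")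
      case True
      then obtain v where v: "is_good \<tau> v" using elim by blast
      have i: "integrable lborel (\<lambda>x. \<bar>V' \<tau> x \<bullet> g n x\<bar>)"
        by (rule Bochner_Integration.integrable_bound[OF integrable_indicator_domain[of "C * L \<tau>"]])
          (measurable, use slice[OF v, of n] in eventually_elim, auto)
      have "I n \<tau> \<le> (LINT x|lborel. (C * L \<tau>) * indicator \<Omega> x)"
        unfolding I_def by (rule integral_mono_AE[OF i integrable_indicator_domain slice[OF v]])
      also have "\<dots> = (C * measure lborel \<Omega>) * L \<tau>" using domain_borel by simp
      finally show ?thesis by (simp add: I_def)
    next
      case False
      then show ?thesis using out C L(2)[of \<tau>] by simp
    qed
  qed
  have Ii: "integrable lborel (I n)" for n
  proof (rule Bochner_Integration.integrable_bound[OF _ Im])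
    show "integrable lborel (\<lambda>\<tau>. (C * measure lborel \<Omega>) * L \<tau>)" using L(1) by simp
    show "AE \<tau> in lborel. norm (I n \<tau>) \<le> norm ((C * measure lborel \<Omega>) * L \<tau>)"
      using Ib[of n] by eventually_elim simp
  qed
  have "(\<lambda>n. LINT \<tau>|lborel. I n \<tau>) \<longlonglongrightarrow> (LINT \<tau>|(lborel :: real measure). (0::real))"
  proof (rule integral_dominated_convergence[OF _ Im _ _ Ib])
    show "integrable lborel (\<lambda>\<tau>. (C * measure lborel \<Omega>) * L \<tau>)" using L(1) by simp
    show "AE \<tau> in lborel. (\<lambda>n. I n \<tau>) \<longlonglongrightarrow> 0"
      using AE_good
    proof eventually_elim
      case (elim \<tau>)
      show ?case
      proof (cases "\<tau> \<in> {0<..<T}")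
        case True
        then obtain v where v: "is_good \<tau> v" using elim by blast
        have "(\<lambda>n. LINT x|lborel. \<bar>V' \<tau> x \<bullet> g n x\<bar>) \<longlonglongrightarrow> (LINT x|(lborel :: (real^3) measure). (0::real))"
        proof (rule integral_dominated_convergence[where w="\<lambda>x. (C * L \<tau>) * indicator \<Omega> x"])
          show "AE x in lborel. norm \<bar>V' \<tau> x \<bullet> g n x\<bar> \<le> (C * L \<tau>) * indicator \<Omega> x" for n
            using slice[OF v, of n] by simp
          show "AE x in lborel. (\<lambda>n. \<bar>V' \<tau> x \<bullet> g n x\<bar>) \<longlonglongrightarrow> 0"
          proof (rule AE_I2)
            fix x
            show "(\<lambda>n. \<bar>V' \<tau> x \<bullet> g n x\<bar>) \<longlonglongrightarrow> 0"
            proof (cases "x \<in> \<Omega>")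
              case True
              have "eventually (\<lambda>n. \<bar>V' \<tau> x \<bullet> g n x\<bar> = 0) sequentially" using ev[OF True] by eventually_elim simp
              then show ?thesis by (rule tendsto_eventually)
            next
              case False
              then show ?thesis using u_zero by simp
            qed
          qed
        qed (measurable, rule integrable_indicator_domain)
        then show ?thesis by (simp add: I_def)
      next
        case False
        then show ?thesis using out by simp
      qed
    qed
  qed simp
  then have Ilim: "(\<lambda>n. LINT \<tau>|lborel. I n \<tau>) \<longlonglongrightarrow> 0" by simp
  have 0: "0 \<in> {0..T}" using T by simp
  have [measurable]: "r 0 \<in> borel_measurable borel" by (rule r_borel[OF 0])
  note [measurable] = domain_borel
  let ?f = "\<lambda>x. (max 0 (lower 0 - r 0 x))\<^sup>2"
  have fb: "\<bar>?f x\<bar> \<le> c\<^sup>2" for x using r_bounds(1)[OF 0, of x] lower_bounds(1,2)[of 0] by (auto intro!: power_mono)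
  have bound: "(LINT x|lborel. \<kappa> n x * ?f x) \<le> c\<^sup>2 * (LINT \<tau>|lborel. I n \<tau>)" for n
  proof -
    obtain K where K: "compact K" "K \<subseteq> \<Omega>" "\<And>x. x \<notin> K \<Longrightarrow> \<kappa> n x = 0 \<and> g n x = 0" using K[of n] by blast
    show ?thesis
      using cutoff_inequality[OF \<kappa>[of n] g K] Ii[of n] by (simp add: I_def[abs_def])
  qed
  have "(\<lambda>n. LINT x|lborel. \<kappa> n x * ?f x) \<longlonglongrightarrow> (LINT x|lborel. indicator \<Omega> x * ?f x)"
  proof (rule integral_dominated_convergence[where w="\<lambda>x. c\<^sup>2 * indicator \<Omega> x"])
    have \<kappa>out: "\<kappa> n x = 0" if "x \<notin> \<Omega>" for n x using K[of n] that by blast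
    show "AE x in lborel. norm (\<kappa> n x * ?f x) \<le> c\<^sup>2 * indicator \<Omega> x" for n
    proof (rule AE_I2)
      fix x
      have "\<bar>\<kappa> n x\<bar> * \<bar>?f x\<bar> \<le> 1 * c\<^sup>2" using \<kappa>(1,2)[of n x] fb[of x] by (intro mult_mono) auto
      then show "norm (\<kappa> n x * ?f x) \<le> c\<^sup>2 * indicator \<Omega> x" using \<kappa>out[of x n] by (cases "x \<in> \<Omega>") (auto simp: abs_mult)
    qed
    show "AE x in lborel. (\<lambda>n. \<kappa> n x * ?f x) \<longlonglongrightarrow> indicator \<Omega> x * ?f x"
    proof (rule AE_I2)
      fix x
      show "(\<lambda>n. \<kappa> n x * ?f x) \<longlonglongrightarrow> indicator \<Omega> x * ?f x"
      proof (cases "x \<in> \<Omega>")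
        case True
        have "eventually (\<lambda>n. \<kappa> n x * ?f x = indicator \<Omega> x * ?f x) sequentially"
          using ev[OF True] by eventually_elim (use True in simp)
        then show ?thesis by (rule tendsto_eventually)
      qed (simp add: \<kappa>out)
    qed
  qed (measurable, rule integrable_indicator_domain)
  moreover have "(\<lambda>n. c\<^sup>2 * (LINT \<tau>|lborel. I n \<tau>)) \<longlonglongrightarrow> c\<^sup>2 * 0" by (intro tendsto_mult Ilim tendsto_const)
  ultimately have le: "(LINT x|lborel. indicator \<Omega> x * ?f x) \<le> 0" using bound by (auto intro: LIMSEQ_le)
  have fi: "integrable lborel (\<lambda>x. indicator \<Omega> x * ?f x)"
  proof (rule integrable_dominated(1)[OF integrable_indicator_domain])
    show "norm (indicator \<Omega> x * ?f x) \<le> c\<^sup>2 * indicator \<Omega> x" for x using fb[of x] by (cases "x \<in> \<Omega>") auto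
  qed measurable
  have "(LINT x|lborel. indicator \<Omega> x * ?f x) \<ge> 0" by (intro Bochner_Integration.integral_nonneg) simp
  with le have "(LINT x|lborel. indicator \<Omega> x * ?f x) = 0" by simp
  then have "AE x in lborel. indicator \<Omega> x * ?f x = 0"
    using integral_nonneg_eq_0_iff_AE[OF fi] by simp
  then have "AE x in lborel. x \<in> \<Omega> \<longrightarrow> - \<rho> (x, 0) \<le> - lower 0"
    by eventually_elim (auto simp: extend_by_zero_def at_time_def max_def split: if_splits)
  then have "AE x in lebesgue. x \<in> \<Omega> \<longrightarrow> - \<rho> (x, 0) \<le> - lower 0" by (rule AE_completion)
  then have "AE x in lebesgue_on \<Omega>. - \<rho> (x, 0) \<le> - lower 0" using open_domain by (simp add: AE_restrict_space_iff)
  from continuous_AE_le[OF open_domain _ this x] show ?thesis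
    using continuous_on_minus[OF cont[OF 0]] by (simp add: at_time_def[abs_def])
qed

end

section \<open>Strong solutions\<close>

text \<open>The boundary condition speaks of a representative continuous on the closure. The Sobolev
  bounds hold for every representative continuous on \<Omega>, in particular for this one, so a
  single v carries both.\<close>

lemma normal_part_vanishes_tangential:
  assumes \<Omega>: "smooth_bounded_domain \<Omega>" and n: "normal_part_vanishes \<Omega> f"
    and C: "\<And>v. continuous_on \<Omega> v \<Longrightarrow> AE x in lebesgue_on \<Omega>. v x = f x \<Longrightarrow>
       (\<forall>x\<in>\<Omega>. norm (v x) \<le> K) \<and> (\<forall>x y. closed_segment x y \<subseteq> \<Omega> \<longrightarrow> norm (v x - v y) \<le> K * norm (x - y))"
    and K: "K \<ge> 0"
  obtains v where "tangential_Lipschitz_field \<Omega> K v" "AE x in lebesgue_on \<Omega>. v x = f x"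
proof -
  obtain v where v: "continuous_on (closure \<Omega>) v" "AE x in lebesgue_on \<Omega>. v x = f x"
      "\<forall>x\<in>frontier \<Omega>. v x \<bullet> outward_normal \<Omega> x = 0"
    using n unfolding normal_part_vanishes_def continuous_up_to_boundary_def by blast
  have "continuous_on \<Omega> v" by (rule continuous_on_subset[OF v(1) closure_subset])
  from C[OF this v(2)] show ?thesis
    using that[of v] v K by (simp add: tangential_Lipschitz_field_def)
qed

text \<open>N \<le> N^2 + 1 trades square integrability for an integrable majorant on the bounded
  interval, and L is Borel on the whole line as the comparison requires. The 2 in its definition
  collects the 1 just used and the 1 in N + 1.\<close>

lemma integrable_borel_majorant:
  fixes N :: "real \<Rightarrow> real"
  assumes N: "integrable (lebesgue_on {a<..<b}) (\<lambda>t. (N t)\<^sup>2)" "\<And>t. N t \<ge> 0"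
  obtains L where "integrable lborel L" "\<And>\<tau>. L \<tau> \<ge> 0" "AE \<tau> in lborel. \<tau> \<in> {a<..<b} \<longrightarrow> N \<tau> + 1 \<le> L \<tau>"
proof -
  let ?U = "{a<..<b}"
  have fin: "emeasure lborel ?U < \<infinity>" by (rule emeasure_bounded_finite) simp
  have m: "(\<lambda>t. (N t)\<^sup>2) \<in> borel_measurable (lebesgue_on ?U)" using N(1) by (rule borel_measurable_integrable)
  obtain f' where f': "borel_rep ?U (\<lambda>t. (N t)\<^sup>2) f'" using borel_rep_exists[OF _ m] by auto
  have i: "integrable lborel f'"
  proof -
    have "set_integrable lebesgue ?U (\<lambda>t. (1::real) *\<^sub>R (N t)\<^sup>2)"
      using N(1) by (simp add: set_integrable_def integrable_restrict_space)
    then have "integrable lborel (\<lambda>t. (1::real) *\<^sub>R f' t)"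
      using borel_rep_set_integral(2)[OF f', of "\<lambda>_. 1"] by simp
    then show ?thesis by simp
  qed
  define L where "L \<tau> = \<bar>f' \<tau>\<bar> + 2 * indicator ?U \<tau>" for \<tau>
  show ?thesis
  proof (rule that)
    show "integrable lborel L" unfolding L_def using i fin by simp
    show "L \<tau> \<ge> 0" for \<tau> by (simp add: L_def)
    have "AE \<tau> in lborel. \<tau> \<in> ?U \<longrightarrow> f' \<tau> = (N \<tau>)\<^sup>2" using f' by (simp add: borel_rep_def)
    then show "AE \<tau> in lborel. \<tau> \<in> ?U \<longrightarrow> N \<tau> + 1 \<le> L \<tau>"
    proof eventually_elim
      case (elim \<tau>)
      have "N \<tau> \<le> (N \<tau>)\<^sup>2 + 1"
        using power2_diff[of "N \<tau>" 1] zero_le_power2[of "N \<tau> - 1"] N(2)[of \<tau>] by simp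
      then show ?case using elim by (auto simp: L_def)
    qed
  qed
qed

text \<open>The embedding constant times the W^{2,q} norm of u at time \<tau>, plus a constant, is
  the Lipschitz constant of the field; its integrability in time comes from u being square
  integrable in time with values in W^{2,q}. The normal boundary condition supplies tangency. With
  these, \<open>transported_density\<close> is instantiated and \<open>lower 0\<close> is the bound
  sought.\<close>

lemma strong_solution_initial_density_positive:
  assumes \<Omega>: "smooth_bounded_domain \<Omega>" and T: "T > 0" and S: "strong_solution \<Omega> \<gamma> \<mu> lam \<rho>\<^sub>0 u\<^sub>0 H\<^sub>0 T \<rho> u H"
    and M: "M \<ge> 0" "\<And>t x. t \<in> {0..T} \<Longrightarrow> x \<in> \<Omega> \<Longrightarrow> \<rho> (x, t) \<le> M"
    and c: "c > 0" "\<And>x. x \<in> \<Omega> \<Longrightarrow> c \<le> \<rho> (x, T)"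
  obtains m where "m > 0" "\<And>x. x \<in> \<Omega> \<Longrightarrow> m \<le> \<rho> (x, 0)"
proof -
  let ?Q = "cylinder \<Omega> T"
  have o: "open \<Omega>" "bounded \<Omega>" using \<Omega> by (auto simp: smooth_bounded_domain_def)
  have oQ: "open ?Q" unfolding cylinder_def using o(1) by (intro open_Times) auto
  obtain q where q: "3 < q" and reg: "strong_regularity \<Omega> T q \<rho> u H"
    and eq: "MHD_equations ?Q \<gamma> \<mu> lam \<rho> u H" and bc: "boundary_conditions \<Omega> T u H"
    using S unfolding strong_solution_def by blast
  have cont: "continuous_on \<Omega> (at_time \<rho> t)" and nonneg: "x \<in> \<Omega> \<Longrightarrow> 0 \<le> \<rho> (x, t)" if "t \<in> {0..T}" for t x
    using reg that unfolding strong_regularity_def by blast+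
  have rhoC: "\<rho> \<in> C_time T (Sobolev \<Omega> 1 q) (Sobolev_norm \<Omega> 1 q)"
    and u2: "u \<in> L2_time T (Sobolev \<Omega> 2 q) (Sobolev_norm \<Omega> 2 q)"
    using reg unfolding strong_regularity_def by blast+
  have "weakly_differentiable ?Q [(0, 1)] \<rho>" "\<forall>i. weakly_differentiable ?Q [spt i] u"
    using eq unfolding MHD_equations_def derivatives_exist_def by blast+
  then have li: "locally_integrable_on ?Q \<rho>" "locally_integrable_on ?Q u"
    unfolding weakly_differentiable_def has_weak_deriv_def by blast+
  obtain \<rho>' where \<rho>': "borel_rep ?Q \<rho> \<rho>'" using borel_rep_exists[OF oQ locally_integrable_measurable[OF oQ li(1)]] by blast
  obtain u' where u': "borel_rep ?Q u u'" using borel_rep_exists[OF oQ locally_integrable_measurable[OF oQ li(2)]] by blast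
  have q3: "q > DIM(real^3)" using q by simp
  obtain C0 where C0: "C0 > 0"
    "\<And>(f :: real^3 \<Rightarrow> real^3) v. f \<in> Sobolev \<Omega> 2 q \<Longrightarrow> continuous_on \<Omega> v \<Longrightarrow> AE x in lebesgue_on \<Omega>. v x = f x \<Longrightarrow>
       (\<forall>x\<in>\<Omega>. norm (v x) \<le> C0 * (Sobolev_norm \<Omega> 2 q f + 1)) \<and>
       (\<forall>x y. closed_segment x y \<subseteq> \<Omega> \<longrightarrow> norm (v x - v y) \<le> C0 * (Sobolev_norm \<Omega> 2 q f + 1) * norm (x - y))"
    by (rule Sobolev_embedding_Lipschitz[OF o smooth_bounded_domain_cone[OF \<Omega>] q3]) (rule that)
  define N where "N \<tau> = Sobolev_norm \<Omega> 2 q (at_time u \<tau>)" for \<tau>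
  have N0: "N \<tau> \<ge> 0" for \<tau> by (simp add: N_def Sobolev_norm_def)
  have N2: "integrable (lebesgue_on {0<..<T}) (\<lambda>t. (N t)\<^sup>2)" using u2 by (simp add: L2_time_def N_def)
  obtain L0 where L0: "integrable lborel L0" "\<And>\<tau>. L0 \<tau> \<ge> 0" "AE \<tau> in lborel. \<tau> \<in> {0<..<T} \<longrightarrow> N \<tau> + 1 \<le> L0 \<tau>"
    by (rule integrable_borel_majorant[OF N2 N0]) (rule that)
  define L where "L \<tau> = C0 * L0 \<tau>" for \<tau>
  obtain C1 where C1: "C1 > 0" "\<And>e. e > 0 \<Longrightarrow> integrable lborel (\<lambda>z::real^3. norm z * norm (mgrad e z))"
      "\<And>e. e > 0 \<Longrightarrow> (LINT z|lborel. norm z * norm (mgrad e (z :: real^3))) \<le> C1"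
    by (rule mgrad_first_moment_bound[where 'a="real^3"]) (rule that)
  have time_cont: "continuous_on {0..T} (\<lambda>t. conv e (extend_by_zero \<Omega> (at_time \<rho> t)) x)" if e: "e > 0" for e x
  proof (rule conv_time_continuous[OF o e _ rhoC cont])
    show "q > 1" using q by simp
    show "\<bar>\<rho> (x, t)\<bar> \<le> M" if "t \<in> {0..T}" "x \<in> \<Omega>" for t x using nonneg[OF that] M(2)[OF that] by simp
  qed
  have "AE \<tau> in lebesgue_on {0<..<T}. at_time u \<tau> \<in> Sobolev \<Omega> 2 q"
    using u2 unfolding L2_time_def strongly_measurable_def by (auto elim: eventually_mono)
  then have S: "AE \<tau> in lebesgue. \<tau> \<in> {0<..<T} \<longrightarrow> at_time u \<tau> \<in> Sobolev \<Omega> 2 q"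
    by (simp add: AE_restrict_space_iff)
  have "AE z in lborel. z \<in> ?Q \<longrightarrow> \<rho>' z = \<rho> z" using \<rho>' by (simp add: borel_rep_def)
  note s1 = AE_time_slices[OF this]
  have "AE z in lborel. z \<in> ?Q \<longrightarrow> u' z = u z" using u' by (simp add: borel_rep_def)
  note s2 = AE_time_slices[OF this]
  have good: "AE \<tau> in lebesgue. \<tau> \<in> {0<..<T} \<longrightarrow> (AE y in lborel. \<rho>' (y, \<tau>) = extend_by_zero \<Omega> (at_time \<rho> \<tau>) y) \<and>
        (\<exists>v. tangential_Lipschitz_field \<Omega> (L \<tau>) v \<and> (AE y in lborel. u' (y, \<tau>) = extend_by_zero \<Omega> v y))"
    using S AE_completion[OF s1] AE_completion[OF s2] AE_completion[OF L0(3)]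
  proof eventually_elim
    case (elim \<tau>)
    show ?case
    proof
      assume \<tau>: "\<tau> \<in> {0<..<T}"
      have zero: "\<rho>' (y, \<tau>) = 0" "u' (y, \<tau>) = 0" if "y \<notin> \<Omega>" for y
        using \<rho>' u' that by (auto simp: borel_rep_def cylinder_def)
      have "AE y in lborel. \<rho>' (y, \<tau>) = extend_by_zero \<Omega> (at_time \<rho> \<tau>) y"
        using elim(2) by eventually_elim (use \<tau> zero in \<open>auto simp: extend_by_zero_def at_time_def cylinder_def\<close>)
      moreover have "\<exists>v. tangential_Lipschitz_field \<Omega> (L \<tau>) v \<and> (AE y in lborel. u' (y, \<tau>) = extend_by_zero \<Omega> v y)"
      proof -
        have n: "normal_part_vanishes \<Omega> (at_time u \<tau>)" using bc \<tau> by (simp add: boundary_conditions_def)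
        have K: "C0 * (Sobolev_norm \<Omega> 2 q (at_time u \<tau>) + 1) \<le> L \<tau>"
          unfolding L_def using elim(4) \<tau> C0(1) by (intro mult_left_mono) (auto simp: N_def)
        have b: "(\<forall>x\<in>\<Omega>. norm (v x) \<le> L \<tau>) \<and> (\<forall>x y. closed_segment x y \<subseteq> \<Omega> \<longrightarrow> norm (v x - v y) \<le> L \<tau> * norm (x - y))"
          if v: "continuous_on \<Omega> v" "AE x in lebesgue_on \<Omega>. v x = at_time u \<tau> x" for v
        proof -
          have "at_time u \<tau> \<in> Sobolev \<Omega> 2 q" using elim(1) \<tau> by blast
          from C0(2)[OF this v] show ?thesis
            using K by (meson mult_right_mono norm_ge_zero order_trans)
        qed
        have L\<tau>: "L \<tau> \<ge> 0" unfolding L_def using C0(1) L0(2) by simp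
        obtain v where v: "tangential_Lipschitz_field \<Omega> (L \<tau>) v" "AE x in lebesgue_on \<Omega>. v x = at_time u \<tau> x"
          by (rule normal_part_vanishes_tangential[OF \<Omega> n b L\<tau>])
        have "AE x in lebesgue. x \<in> \<Omega> \<longrightarrow> v x = u (x, \<tau>)" using v(2) o(1) by (simp add: AE_restrict_space_iff at_time_def)
        then have "AE y in lebesgue. u' (y, \<tau>) = extend_by_zero \<Omega> v y"
          using AE_completion[OF elim(3)]
          by eventually_elim (use \<tau> zero in \<open>auto simp: extend_by_zero_def cylinder_def\<close>)
        then have "AE y in lborel. u' (y, \<tau>) = extend_by_zero \<Omega> v y" by (simp add: AE_completion_iff)
        with v(1) show ?thesis by blast
      qed
      ultimately show "(AE y in lborel. \<rho>' (y, \<tau>) = extend_by_zero \<Omega> (at_time \<rho> \<tau>) y) \<and>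
        (\<exists>v. tangential_Lipschitz_field \<Omega> (L \<tau>) v \<and> (AE y in lborel. u' (y, \<tau>) = extend_by_zero \<Omega> v y))" ..
    qed
  qed
  interpret transported_density \<Omega> T M c C1 \<rho> \<rho>' u' L
  proof
    show "integrable lborel L" unfolding L_def using L0(1) by simp
    show "L \<tau> \<ge> 0" for \<tau> unfolding L_def using C0(1) L0(2) by simp
    show "\<rho>' \<in> borel_measurable borel" "u' \<in> borel_measurable borel" using \<rho>' u' by (auto simp: borel_rep_def)
    show "\<rho>' (y, \<tau>) = 0" "u' (y, \<tau>) = 0" if "y \<notin> \<Omega> \<or> \<tau> \<notin> {0<..<T}" for y \<tau>
      using \<rho>' u' that by (auto simp: borel_rep_def cylinder_def)
    show "AE \<tau> in lborel. \<tau> \<in> {0<..<T} \<longrightarrow> (AE y in lborel. \<rho>' (y, \<tau>) = extend_by_zero \<Omega> (at_time \<rho> \<tau>) y) \<and>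
        (\<exists>v. tangential_Lipschitz_field \<Omega> (L \<tau>) v \<and> (AE y in lborel. u' (y, \<tau>) = extend_by_zero \<Omega> v y))"
      using good by (simp add: AE_completion_iff)
    show "conv e (extend_by_zero \<Omega> (at_time \<rho> t)) x - conv e (extend_by_zero \<Omega> (at_time \<rho> s)) x
          = integral {s..t} (\<lambda>\<tau>. - flux e (\<lambda>y. \<rho>' (y, \<tau>)) (\<lambda>y. u' (y, \<tau>)) x)"
      if "e > 0" "cball x e \<subseteq> \<Omega>" "integrable lborel (\<lambda>\<tau>. flux e (\<lambda>y. \<rho>' (y, \<tau>)) (\<lambda>y. u' (y, \<tau>)) x)" "0 \<le> s" "s \<le> t" "t \<le> T" for e x s t
      by (rule conv_density_evolution[OF o eq \<rho>' u' cont time_cont[OF that(1)] that])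
  qed (fact \<Omega> T M c cont nonneg time_cont C1)+
  show ?thesis
    using that[of "lower 0"] initial_lower_bound lower_bounds(3)[of 0] T by simp
qed

text \<open>The essential supremum is an almost everywhere bound, which continuity makes
  pointwise.\<close>

lemma continuous_le_esssup:
  fixes f :: "'a::euclidean_space \<Rightarrow> real"
  assumes \<Omega>: "open \<Omega>" and f: "continuous_on \<Omega> f"
    and b: "esssup (lebesgue_on \<Omega>) (\<lambda>x. ereal \<bar>f x\<bar>) \<le> ereal M" and x: "x \<in> \<Omega>"
  shows "f x \<le> M"
proof (rule continuous_AE_le[OF \<Omega> f _ x])
  from esssup_AE[of "\<lambda>x. ereal \<bar>f x\<bar>" "lebesgue_on \<Omega>"] show "AE x in lebesgue_on \<Omega>. f x \<le> M"
  proof eventually_elim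
    case (elim x)
    then have "ereal \<bar>f x\<bar> \<le> ereal M" using b by (rule order_trans)
    then show ?case by simp
  qed
qed

theorem corollary1p1:
  fixes \<Omega> :: "(real^3) set"
    and \<gamma> \<mu> lam \<rho>_hat :: real
    and \<rho>\<^sub>0 :: "real^3 \<Rightarrow> real" and u\<^sub>0 H\<^sub>0 :: "real^3 \<Rightarrow> real^3"
    and \<rho> :: "(real^3) \<times> real \<Rightarrow> real" and u H :: "(real^3) \<times> real \<Rightarrow> real^3"
  assumes "smooth_bounded_domain \<Omega>" and "simply_connected \<Omega>"
    and "\<gamma> > 1" and "\<mu> > 0" and "2 * \<mu> + 3 * lam \<ge> 0"
    and "\<forall>x\<in>\<Omega>. \<rho>\<^sub>0 x \<ge> 0"
    and "admissible_data \<Omega> \<rho>\<^sub>0 u\<^sub>0 H\<^sub>0"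
    and "global_strong_solution \<Omega> \<gamma> \<mu> lam \<rho>\<^sub>0 u\<^sub>0 H\<^sub>0 \<rho> u H"
    and "\<rho>_hat > 0"
    and "(SUP t\<in>{0..}. esssup (lebesgue_on \<Omega>) (\<lambda>x. ereal \<bar>\<rho> (x, t)\<bar>)) \<le> ereal \<rho>_hat"
    and "(INF x\<in>\<Omega>. \<rho>\<^sub>0 x) = 0"
  shows "\<forall>t\<ge>0. (INF x\<in>\<Omega>. \<rho> (x, t)) = 0"
proof (intro allI impI)
  fix t :: real assume t: "t \<ge> 0"
  have o: "open \<Omega>" "\<Omega> \<noteq> {}" using assms(1) by (auto simp: smooth_bounded_domain_def)
  have sol: "strong_solution \<Omega> \<gamma> \<mu> lam \<rho>\<^sub>0 u\<^sub>0 H\<^sub>0 T \<rho> u H" if "T > 0" for T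
    using assms(8) that by (simp add: global_strong_solution_def)
  have init: "\<rho> (x, 0) = \<rho>\<^sub>0 x" if "x \<in> \<Omega>" for x
    using sol[of 1] that by (simp add: strong_solution_def initial_conditions_def)
  show "(INF x\<in>\<Omega>. \<rho> (x, t)) = 0"
  \<comment> \<open>Time 0 is treated separately because the solution is considered on [0,t], which
    requires t > 0.\<close>
  proof (cases "t = 0")
    case True
    have "(INF x\<in>\<Omega>. \<rho> (x, t)) = (INF x\<in>\<Omega>. \<rho>\<^sub>0 x)" by (rule INF_cong) (simp_all add: True init)
    then show ?thesis using assms(11) by simp
  next
    case False
    with t have T: "t > 0" by simp
    have reg: "continuous_on \<Omega> (at_time \<rho> s)" "x \<in> \<Omega> \<Longrightarrow> 0 \<le> \<rho> (x, s)" if "s \<in> {0..t}" for s x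
      using sol[OF T] that unfolding strong_solution_def strong_regularity_def by blast+
    have le: "\<rho> (x, s) \<le> \<rho>_hat" if s: "s \<in> {0..t}" and x: "x \<in> \<Omega>" for s x
    proof -
      have "esssup (lebesgue_on \<Omega>) (\<lambda>x. ereal \<bar>at_time \<rho> s x\<bar>)
          \<le> (SUP t\<in>{0..}. esssup (lebesgue_on \<Omega>) (\<lambda>x. ereal \<bar>\<rho> (x, t)\<bar>))"
        unfolding at_time_def by (rule SUP_upper) (use s in simp)
      also note assms(10)
      finally show ?thesis using continuous_le_esssup[OF o(1) reg(1)[OF s] _ x] by (simp add: at_time_def)
    qed
    have tt: "t \<in> {0..t}" using t by simp
    define c where "c = (INF x\<in>\<Omega>. \<rho> (x, t))"
    have cle: "c \<le> \<rho> (x, t)" if "x \<in> \<Omega>" for x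
      unfolding c_def by (rule cINF_lower[OF bdd_belowI2 that]) (rule reg(2)[OF tt])
    have c0: "c \<ge> 0" unfolding c_def by (rule cINF_greatest[OF o(2)]) (rule reg(2)[OF tt])
    \<comment> \<open>A positive infimum at time t is the final lower bound from which a positive
      lower bound at time 0 follows, against the vanishing infimum of the initial density.\<close>
    have "\<not> c > 0"
    proof
      assume c: "c > 0"
      have h: "\<rho>_hat \<ge> 0" using assms(9) by simp
      obtain m where m: "m > 0" "\<And>x. x \<in> \<Omega> \<Longrightarrow> m \<le> \<rho> (x, 0)"
        by (rule strong_solution_initial_density_positive[OF assms(1) T sol[OF T] h _ c]) (rule le cle that; assumption)+
      have "m \<le> (INF x\<in>\<Omega>. \<rho>\<^sub>0 x)" by (rule cINF_greatest[OF o(2)]) (use m(2) init in force)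
      with m(1) assms(11) show False by simp
    qed
    with c0 show ?thesis by (simp add: c_def)
  qed
qed

end
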